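(* Let $G=(V,E)$ be a directed graph with $n=|V|$ and $m=|E|$, with edge weights $w:E\to\mathbb{R}$, and let $s\in V$ be a source. In the comparison-based model, the single-source bottleneck path problem on $(G,w,s)$ can be solved by a randomized algorithm that runs in $O(m\sqrt{\log n})$ time with high probability (i.e., with probability $1-n^{-\omega(1)}$).
   Context: The capacity of a path traversing edges $e_1,\dots,e_l$ is $\min_{1\le i\le l} w(e_i)$. For $u,v\in V$, $b(u,v)$ is the maximum capacity over all paths from $u$ to $v$. The single-source bottleneck path (SSBP) problem asks: given $(G,w,s)$, output $b(s,t)$ for every $t\in V$. In the comparison-based model, edge weights may only be accessed via comparisons. *)

theory Defs
  imports "HOL-Probability.Probability" "Graph_Theory.Graph_Theory"
begin

section \<open>Bottleneck paths\<close>

text \<open>The capacity of the empty path is \<open>\<infinity>\<close>, and the bottleneck value of an unreachable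
  vertex is \<open>-\<infinity>\<close>. In a finite graph only finitely many capacities occur, so the supremum
  is a maximum whenever there is a path.\<close>

definition capacity :: "('a \<times> 'a \<Rightarrow> real) \<Rightarrow> ('a \<times> 'a) list \<Rightarrow> ereal" where
  "capacity w p = (INF e\<in>set p. ereal (w e))"

definition bottleneck :: "'a pair_pre_digraph \<Rightarrow> ('a \<times> 'a \<Rightarrow> real) \<Rightarrow> 'a \<Rightarrow> 'a \<Rightarrow> ereal" where
  "bottleneck G w u v = (SUP p\<in>{p. pre_digraph.awalk (with_proj G) u p v}. capacity w p)"


section \<open>A randomized word RAM with comparison access to the weights\<close>

text \<open>The machine sees the edges as a read-only list of pairs of vertex numbers. The weights
  enter the input only as the comparison relation \<open>in_wle\<close> on positions in that list, so no
  behaviour of a program can depend on them in any other way.\<close>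

record input =
  in_n :: nat
  in_edges :: "(nat \<times> nat) list"
  in_src :: nat
  in_wle :: "nat \<Rightarrow> nat \<Rightarrow> bool"

definition ssbp_input ::
    "nat pair_pre_digraph \<Rightarrow> (nat \<times> nat) list \<Rightarrow> (nat \<times> nat \<Rightarrow> real) \<Rightarrow> nat \<Rightarrow> input" where
  "ssbp_input G es w s =
     \<lparr>in_n = card (pverts G), in_edges = es, in_src = s,
      in_wle = (\<lambda>i j. i < length es \<and> j < length es \<and> w (es ! i) \<le> w (es ! j))\<rparr>"

text \<open>Machine words hold the numbers below \<open>(n + m + 2)\<^sup>\<kappa>\<close>, that is, about
  \<open>\<kappa> log (n + m + 2)\<close> bits; addition and multiplication wrap around.\<close>

definition word_bound :: "nat \<Rightarrow> input \<Rightarrow> nat" where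
  "word_bound \<kappa> I = (in_n I + length (in_edges I) + 2) ^ \<kappa>"

record state =
  regs :: "nat \<Rightarrow> nat"
  mem :: "nat \<Rightarrow> nat"

datatype exp =
    Const nat
  | Reg nat
  | Mem exp
  | NumVerts
  | NumEdges
  | Src
  | EdgeTail exp
  | EdgeHead exp
  | Plus exp exp
  | Monus exp exp
  | Times exp exp
  | Quot exp exp

primrec eval_exp :: "nat \<Rightarrow> input \<Rightarrow> state \<Rightarrow> exp \<Rightarrow> nat" where
  "eval_exp \<kappa> I \<sigma> (Const k) = k mod word_bound \<kappa> I"
| "eval_exp \<kappa> I \<sigma> (Reg r) = regs \<sigma> r"
| "eval_exp \<kappa> I \<sigma> (Mem a) = mem \<sigma> (eval_exp \<kappa> I \<sigma> a)"
| "eval_exp \<kappa> I \<sigma> NumVerts = in_n I"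
| "eval_exp \<kappa> I \<sigma> NumEdges = length (in_edges I)"
| "eval_exp \<kappa> I \<sigma> Src = in_src I"
| "eval_exp \<kappa> I \<sigma> (EdgeTail a) =
     (let i = eval_exp \<kappa> I \<sigma> a in if i < length (in_edges I) then fst (in_edges I ! i) else 0)"
| "eval_exp \<kappa> I \<sigma> (EdgeHead a) =
     (let i = eval_exp \<kappa> I \<sigma> a in if i < length (in_edges I) then snd (in_edges I ! i) else 0)"
| "eval_exp \<kappa> I \<sigma> (Plus a b) = (eval_exp \<kappa> I \<sigma> a + eval_exp \<kappa> I \<sigma> b) mod word_bound \<kappa> I"
| "eval_exp \<kappa> I \<sigma> (Monus a b) = eval_exp \<kappa> I \<sigma> a - eval_exp \<kappa> I \<sigma> b"
| "eval_exp \<kappa> I \<sigma> (Times a b) = (eval_exp \<kappa> I \<sigma> a * eval_exp \<kappa> I \<sigma> b) mod word_bound \<kappa> I"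
| "eval_exp \<kappa> I \<sigma> (Quot a b) = eval_exp \<kappa> I \<sigma> a div eval_exp \<kappa> I \<sigma> b"

datatype test =
    Leq exp exp
  | WeightLeq exp exp
  | Neg test
  | Conj test test

primrec eval_test :: "nat \<Rightarrow> input \<Rightarrow> state \<Rightarrow> test \<Rightarrow> bool" where
  "eval_test \<kappa> I \<sigma> (Leq a b) \<longleftrightarrow> eval_exp \<kappa> I \<sigma> a \<le> eval_exp \<kappa> I \<sigma> b"
| "eval_test \<kappa> I \<sigma> (WeightLeq a b) \<longleftrightarrow> in_wle I (eval_exp \<kappa> I \<sigma> a) (eval_exp \<kappa> I \<sigma> b)"
| "eval_test \<kappa> I \<sigma> (Neg t) \<longleftrightarrow> \<not> eval_test \<kappa> I \<sigma> t"
| "eval_test \<kappa> I \<sigma> (Conj t u) \<longleftrightarrow> eval_test \<kappa> I \<sigma> t \<and> eval_test \<kappa> I \<sigma> u"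

text \<open>\<open>Random r a\<close> puts a uniformly random number below the value of \<open>a\<close> into register \<open>r\<close>.\<close>

datatype com =
    Skip
  | Assign nat exp
  | Store exp exp
  | Random nat exp
  | Seq com com
  | If test com com
  | While test com

text \<open>Every transition costs one unit of time. The expressions and tests in a fixed program have
  constant size, so charging one unit for evaluating one of them, weight comparisons included,
  affects only the constant factor.\<close>

fun step :: "nat \<Rightarrow> input \<Rightarrow> com \<times> state \<Rightarrow> (com \<times> state) pmf" where
  "step \<kappa> I (Skip, \<sigma>) = return_pmf (Skip, \<sigma>)"
| "step \<kappa> I (Assign r a, \<sigma>) =
     return_pmf (Skip, \<sigma>\<lparr>regs := (regs \<sigma>)(r := eval_exp \<kappa> I \<sigma> a)\<rparr>)"
| "step \<kappa> I (Store a b, \<sigma>) =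
     return_pmf (Skip, \<sigma>\<lparr>mem := (mem \<sigma>)(eval_exp \<kappa> I \<sigma> a := eval_exp \<kappa> I \<sigma> b)\<rparr>)"
| "step \<kappa> I (Random r a, \<sigma>) =
     map_pmf (\<lambda>k. (Skip, \<sigma>\<lparr>regs := (regs \<sigma>)(r := k)\<rparr>))
       (pmf_of_set {..<max 1 (eval_exp \<kappa> I \<sigma> a)})"
| "step \<kappa> I (Seq c d, \<sigma>) =
     (if c = Skip then return_pmf (d, \<sigma>)
      else map_pmf (\<lambda>(c', \<sigma>'). (Seq c' d, \<sigma>')) (step \<kappa> I (c, \<sigma>)))"
| "step \<kappa> I (If t c d, \<sigma>) = return_pmf (if eval_test \<kappa> I \<sigma> t then c else d, \<sigma>)"
| "step \<kappa> I (While t c, \<sigma>) = return_pmf (If t (Seq c (While t c)) Skip, \<sigma>)"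

primrec steps :: "nat \<Rightarrow> input \<Rightarrow> nat \<Rightarrow> com \<times> state \<Rightarrow> (com \<times> state) pmf" where
  "steps \<kappa> I 0 x = return_pmf x"
| "steps \<kappa> I (Suc k) x = bind_pmf (step \<kappa> I x) (steps \<kappa> I k)"

definition run :: "com \<Rightarrow> nat \<Rightarrow> input \<Rightarrow> nat \<Rightarrow> (com \<times> state) pmf" where
  "run prog \<kappa> I k = steps \<kappa> I k (prog, \<lparr>regs = (\<lambda>_. 0), mem = (\<lambda>_. 0)\<rparr>)"

definition halted :: "com \<times> state \<Rightarrow> bool" where
  "halted x \<longleftrightarrow> fst x = Skip"

definition prob_halted :: "com \<Rightarrow> nat \<Rightarrow> input \<Rightarrow> nat \<Rightarrow> real" where
  "prob_halted prog \<kappa> I k = measure_pmf.prob (run prog \<kappa> I k) {x. halted x}"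


section \<open>Solving the single-source bottleneck path problem\<close>

text \<open>Weights cannot be stored in memory, so an output weight is named by an edge carrying it:
  \<open>0\<close> stands for \<open>-\<infinity>\<close>, \<open>i + 1\<close> with \<open>i < m\<close> for the weight of the \<open>i\<close>-th edge, and anything
  larger for \<open>\<infinity>\<close>. The answer for vertex \<open>t\<close> is read off memory cell \<open>t\<close>.\<close>

definition output_value :: "(nat \<times> nat) list \<Rightarrow> (nat \<times> nat \<Rightarrow> real) \<Rightarrow> nat \<Rightarrow> ereal" where
  "output_value es w x =
     (if x = 0 then -\<infinity> else if x \<le> length es then ereal (w (es ! (x - 1))) else \<infinity>)"

definition ssbp_output_correct ::
    "nat pair_pre_digraph \<Rightarrow> (nat \<times> nat) list \<Rightarrow> (nat \<times> nat \<Rightarrow> real) \<Rightarrow> nat \<Rightarrow> state \<Rightarrow> bool" where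
  "ssbp_output_correct G es w s \<sigma> \<longleftrightarrow>
     (\<forall>t\<in>pverts G. output_value es w (mem \<sigma> t) = bottleneck G w s t)"

text \<open>The vertices are numbered from \<open>0\<close>; the edges are listed in an arbitrary order.\<close>

definition ssbp_instance ::
    "nat pair_pre_digraph \<Rightarrow> (nat \<times> nat) list \<Rightarrow> nat \<Rightarrow> bool" where
  "ssbp_instance G es s \<longleftrightarrow>
     pair_fin_digraph G \<and> pverts G = {..<card (pverts G)} \<and>
     distinct es \<and> set es = parcs G \<and> s \<in> pverts G"

text \<open>Zero-error algorithms: termination is almost sure and the output is never wrong; only the
  running time is random.\<close>

definition solves_ssbp :: "com \<Rightarrow> nat \<Rightarrow> bool" where
  "solves_ssbp prog \<kappa> \<longleftrightarrow>
     (\<forall>G es w s. ssbp_instance G es s \<longrightarrow>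
        (\<lambda>k. prob_halted prog \<kappa> (ssbp_input G es w s) k) \<longlonglongrightarrow> 1 \<and>
        (\<forall>k. \<forall>x\<in>set_pmf (run prog \<kappa> (ssbp_input G es w s) k).
           halted x \<longrightarrow> ssbp_output_correct G es w s (snd x)))"

end

theory Submission
  imports Defs "HOL-Real_Asymp.Real_Asymp"
begin

text \<open>Every vertex \<open>v\<close> keeps an interval \<open>[lo v, hi v)\<close> of edge ranks that contains its bottleneck
  value. An edge is alive if both ends have the same interval and its rank exceeds \<open>lo\<close>; all other
  edges are either useless or act as sources with a known capacity. One level samples every edge
  with probability \<open>1 / q\<close> and, in each weak component of the alive graph, sorts the sampled
  edges into thresholds and runs a bucketed Dijkstra search over the \<open>p\<close> thresholds, which replaces
  each interval by its subinterval between two consecutive thresholds. A binary search over the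
  thresholds, of cost \<open>log p\<close>, is needed only for an edge that afterwards is dead: the sources are
  visited in depth-first order, with the bucket of the previous one as guess, so a wrong guess is paid
  for by an edge whose ends are separated. Hence all binary searches together cost
  \<open>O(m log p)\<close>, and each level costs only \<open>O(m)\<close> besides.

  With \<open>r\<close> about \<open>sqrt (log n)\<close> and \<open>D = 2 ^ r\<close> the sampling rates \<open>1 / q\<close> run through the powers
  \<open>D ^ R, \<dots>, D, 1\<close> of \<open>D\<close>. Outside an event of probability \<open>poly n * 2 ^ (- D)\<close> every
  component has at most \<open>3 D\<^sup>2\<close> thresholds, so \<open>log p = O(r)\<close>, and there are \<open>O(r)\<close> levels. At the last
  level all edges are sampled, so the result is always correct.\<close>

section \<open>Probabilistic Hoare triples, and a deterministic calculus for programs without random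
  draws\<close>

section \<open>Hoare logic with time credits\<close>

text \<open>The choice of \<open>r\<close> balances two costs. A level costs \<open>O(m)\<close>,
  and about \<open>log n / r\<close> levels lead from a sparse sample to all edges; a binary search
  among \<open>2 ^ O(r)\<close> thresholds costs \<open>O(r)\<close>, and a potential allows only
  \<open>2 m\<close> payments for dying edges over all levels. With \<open>D = 2 ^ r\<close> the
  failure bound \<open>2 ^ (- D)\<close> then beats every power of \<open>n\<close>. Two obstacles
  shape the proof. The sample of a level determines the next intervals, so the failure events cannot
  be stated about those intervals; they quantify over all windows of ranks in the components known
  before the draw, of which there are only polynomially many. And the machine cannot compute ranks:
  intervals are stored as edge codes, ranks occur only in the proof, and every use of them is
  realized by weight comparisons, with ties broken by the position in the list. Since the output
  must never be wrong and termination must be certain, the loop over the levels is analysed for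
  abstract failure events and instantiated twice: once with events that cannot occur and a coarse
  time bound, once with the events that give the fast bound.\<close>

definition failing :: "(state \<Rightarrow> bool) \<Rightarrow> (com \<times> state) set" where
  "failing Q = {x. \<not> (fst x = Skip \<and> Q (snd x))}"

lemma failing_mono: "(\<And>\<sigma>. Q \<sigma> \<Longrightarrow> Q' \<sigma>) \<Longrightarrow> failing Q' \<subseteq> failing Q"
  by (auto simp: failing_def)

lemma steps_Skip [simp]: "steps \<kappa> I k (Skip, \<sigma>) = return_pmf (Skip, \<sigma>)"
  by (induction k) (simp_all add: bind_return_pmf)

lemma steps_add: "steps \<kappa> I (a + b) x = bind_pmf (steps \<kappa> I a x) (steps \<kappa> I b)"
proof (induction a arbitrary: x)
  case (Suc a)
  then have "steps \<kappa> I (a + b) = (\<lambda>x. bind_pmf (steps \<kappa> I a x) (steps \<kappa> I b))" by blast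
  then show ?case by (simp add: bind_assoc_pmf)
qed (simp add: bind_return_pmf)

lemma emeasure_pmf_le_1: "emeasure (measure_pmf p) A \<le> 1"
  using measure_pmf.emeasure_space_1[of p] emeasure_space[of "measure_pmf p" A]
  by simp

text \<open>A halted configuration never moves again, so a run that has succeeded after
  \<open>a\<close> steps still counts as successful later. This makes all time bounds
  monotone.\<close>

lemma failing_antimono_steps:
  "emeasure (steps \<kappa> I (a + b) x) (failing Q) \<le> emeasure (steps \<kappa> I a x) (failing Q)"
proof -
  have "emeasure (steps \<kappa> I b y) (failing Q) \<le> indicator (failing Q) y" for y
  proof (cases "y \<in> failing Q")
    case True
    then show ?thesis by (simp add: emeasure_pmf_le_1)
  next
    case False
    then obtain \<sigma> where "y = (Skip, \<sigma>)" "Q \<sigma>"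
      by (cases y) (auto simp: failing_def)
    then show ?thesis by (simp add: failing_def)
  qed
  then have "emeasure (steps \<kappa> I (a + b) x) (failing Q)
      \<le> (\<integral>\<^sup>+y. indicator (failing Q) y \<partial>steps \<kappa> I a x)"
    unfolding steps_add emeasure_bind_pmf by (intro nn_integral_mono)
  then show ?thesis by simp
qed

text \<open>The additional step is the one that discards the finished \<open>Skip\<close>. If
  \<open>c\<close> halts early, the time left over goes to \<open>d\<close> and is absorbed by
  \<open>failing_antimono_steps\<close>; a run of \<open>c\<close> that has not halted by time
  \<open>a\<close> is counted as a certain failure.\<close>

lemma failing_Seq:
  "emeasure (steps \<kappa> I (Suc (a + b)) (Seq c d, \<sigma>)) (failing Q) \<le>
     (\<integral>\<^sup>+y. (if fst y = Skip then emeasure (steps \<kappa> I b (d, snd y)) (failing Q) else 1)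
        \<partial>steps \<kappa> I a (c, \<sigma>))"
proof (induction a arbitrary: c \<sigma>)
  case 0
  show ?case
    by (cases "c = Skip") (simp_all add: bind_return_pmf emeasure_pmf_le_1 del: emeasure_bind_pmf)
next
  case (Suc a)
  show ?case
  proof (cases "c = Skip")
    case True
    then show ?thesis
      using failing_antimono_steps[of \<kappa> I b "Suc a" "(d, \<sigma>)" Q]
      by (simp add: bind_return_pmf add.commute)
  next
    case False
    have "emeasure (steps \<kappa> I (Suc (Suc a + b)) (Seq c d, \<sigma>)) (failing Q) =
        (\<integral>\<^sup>+x. emeasure (steps \<kappa> I (Suc (a + b)) (Seq (fst x) d, snd x)) (failing Q)
           \<partial>step \<kappa> I (c, \<sigma>))"
      using False by (subst steps.simps(2)) (simp add: case_prod_unfold del: steps.simps(2))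
    also have "\<dots> \<le> (\<integral>\<^sup>+x. (\<integral>\<^sup>+y. (if fst y = Skip then emeasure (steps \<kappa> I b (d, snd y)) (failing Q) else 1)
        \<partial>steps \<kappa> I a (fst x, snd x)) \<partial>step \<kappa> I (c, \<sigma>))"
      by (intro nn_integral_mono Suc.IH)
    finally show ?thesis
      by simp
  qed
qed

text \<open>A triple for one start state: being too slow and giving a wrong result are one and the
  same failure. The bound 0 is meaningful for random programs as well and says that no sequence of
  draws fails.\<close>

definition tri :: "nat \<Rightarrow> input \<Rightarrow> com \<Rightarrow> state \<Rightarrow> nat \<Rightarrow> ennreal \<Rightarrow> (state \<Rightarrow> bool) \<Rightarrow> bool" where
  "tri \<kappa> I c \<sigma> t \<epsilon> Q \<longleftrightarrow> emeasure (steps \<kappa> I t (c, \<sigma>)) (failing Q) \<le> \<epsilon>"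

lemma tri_mono:
  assumes "tri \<kappa> I c \<sigma> t \<epsilon> Q" "t \<le> t'" "\<epsilon> \<le> \<epsilon>'" "\<And>\<sigma>. Q \<sigma> \<Longrightarrow> Q' \<sigma>"
  shows "tri \<kappa> I c \<sigma> t' \<epsilon>' Q'"
proof -
  obtain k where k: "t' = t + k" using assms(2) le_Suc_ex by blast
  have "emeasure (steps \<kappa> I t' (c, \<sigma>)) (failing Q') \<le> emeasure (steps \<kappa> I t' (c, \<sigma>)) (failing Q)"
    by (intro emeasure_mono failing_mono assms(4)) auto
  also have "\<dots> \<le> emeasure (steps \<kappa> I t (c, \<sigma>)) (failing Q)"
    unfolding k by (rule failing_antimono_steps)
  finally show ?thesis using assms(1,3) unfolding tri_def by (meson order_trans)
qed

text \<open>Failure probabilities add because the bound for \<open>d\<close> is uniform over all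
  states that satisfy \<open>P\<close>.\<close>

lemma tri_Seq:
  assumes "tri \<kappa> I c \<sigma> a \<epsilon>1 P" "\<And>\<sigma>'. P \<sigma>' \<Longrightarrow> tri \<kappa> I d \<sigma>' b \<epsilon>2 Q"
  shows "tri \<kappa> I (Seq c d) \<sigma> (a + b + 1) (\<epsilon>1 + \<epsilon>2) Q"
proof -
  have "emeasure (steps \<kappa> I (Suc (a + b)) (Seq c d, \<sigma>)) (failing Q) \<le>
     (\<integral>\<^sup>+y. (if fst y = Skip then emeasure (steps \<kappa> I b (d, snd y)) (failing Q) else 1)
        \<partial>steps \<kappa> I a (c, \<sigma>))"
    by (rule failing_Seq)
  also have "\<dots> \<le> (\<integral>\<^sup>+y. indicator (failing P) y + \<epsilon>2 \<partial>steps \<kappa> I a (c, \<sigma>))"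
  proof (intro nn_integral_mono)
    fix y :: "com \<times> state"
    show "(if fst y = Skip then emeasure (steps \<kappa> I b (d, snd y)) (failing Q) else 1)
       \<le> indicator (failing P) y + \<epsilon>2"
    proof (cases "y \<in> failing P")
      case True
      have "emeasure (steps \<kappa> I b (d, snd y)) (failing Q) \<le> 1"
        by (rule emeasure_pmf_le_1)
      also have "1 \<le> 1 + \<epsilon>2" by simp
      finally show ?thesis using True by simp
    next
      case False
      then show ?thesis using assms(2)[of "snd y"] by (auto simp: failing_def tri_def)
    qed
  qed
  also have "\<dots> = emeasure (steps \<kappa> I a (c, \<sigma>)) (failing P) + \<epsilon>2"
    using measure_pmf.emeasure_space_1[of "steps \<kappa> I a (c, \<sigma>)"]
    by (subst nn_integral_add) auto
  also have "\<dots> \<le> \<epsilon>1 + \<epsilon>2"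
    using assms(1) by (auto simp: tri_def add_right_mono)
  finally show ?thesis by (simp add: tri_def)
qed

lemma tri_Skip: "Q \<sigma> \<Longrightarrow> tri \<kappa> I Skip \<sigma> t \<epsilon> Q"
  by (simp add: tri_def failing_def)

lemma tri_step_det:
  assumes "step \<kappa> I (c, \<sigma>) = return_pmf (c', \<sigma>')" "tri \<kappa> I c' \<sigma>' t \<epsilon> Q"
  shows "tri \<kappa> I c \<sigma> (Suc t) \<epsilon> Q"
  using assms by (simp add: tri_def bind_return_pmf)

lemma tri_While_true:
  assumes "eval_test \<kappa> I \<sigma> b" "tri \<kappa> I (Seq c (While b c)) \<sigma> t \<epsilon> Q"
  shows "tri \<kappa> I (While b c) \<sigma> (t + 2) \<epsilon> Q"
proof -
  have "tri \<kappa> I (If b (Seq c (While b c)) Skip) \<sigma> (Suc t) \<epsilon> Q"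
    using assms by (intro tri_step_det[where c' = "Seq c (While b c)" and \<sigma>' = \<sigma>]) auto
  then show ?thesis
    using tri_step_det[of \<kappa> I "While b c" \<sigma> "If b (Seq c (While b c)) Skip" \<sigma> "Suc t" \<epsilon> Q]
    by simp
qed

lemma tri_While_false:
  assumes "\<not> eval_test \<kappa> I \<sigma> b" "Q \<sigma>"
  shows "tri \<kappa> I (While b c) \<sigma> 2 \<epsilon> Q"
proof -
  have "tri \<kappa> I (If b (Seq c (While b c)) Skip) \<sigma> (Suc 0) \<epsilon> Q"
    using assms by (intro tri_step_det[where c' = Skip and \<sigma>' = \<sigma>]) (auto intro: tri_Skip)
  then show ?thesis
    using tri_step_det[of \<kappa> I "While b c" \<sigma> "If b (Seq c (While b c)) Skip" \<sigma> "Suc 0" \<epsilon> Q]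
    by (simp add: numeral_2_eq_2)
qed

text \<open>A big-step semantics without a rule for \<open>Random\<close>, so that the large parts
  of the program that draw nothing are verified without probabilities. The step counts are exact:
  the 3 for a loop round consists of the unfolding to \<open>If\<close>, the branch, and the removal
  of the finished body.\<close>

inductive exec :: "nat \<Rightarrow> input \<Rightarrow> com \<Rightarrow> state \<Rightarrow> nat \<Rightarrow> state \<Rightarrow> bool" for \<kappa> I where
  "exec \<kappa> I Skip \<sigma> 0 \<sigma>"
| "exec \<kappa> I (Assign r a) \<sigma> 1 (\<sigma>\<lparr>regs := (regs \<sigma>)(r := eval_exp \<kappa> I \<sigma> a)\<rparr>)"
| "exec \<kappa> I (Store a b) \<sigma> 1 (\<sigma>\<lparr>mem := (mem \<sigma>)(eval_exp \<kappa> I \<sigma> a := eval_exp \<kappa> I \<sigma> b)\<rparr>)"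
| "exec \<kappa> I c \<sigma> k \<sigma>1 \<Longrightarrow> exec \<kappa> I d \<sigma>1 l \<sigma>2 \<Longrightarrow> exec \<kappa> I (Seq c d) \<sigma> (k + l + 1) \<sigma>2"
| "exec \<kappa> I (if eval_test \<kappa> I \<sigma> b then c else d) \<sigma> k \<sigma>1 \<Longrightarrow> exec \<kappa> I (If b c d) \<sigma> (Suc k) \<sigma>1"
| "\<not> eval_test \<kappa> I \<sigma> b \<Longrightarrow> exec \<kappa> I (While b c) \<sigma> 2 \<sigma>"
| "eval_test \<kappa> I \<sigma> b \<Longrightarrow> exec \<kappa> I c \<sigma> k \<sigma>1 \<Longrightarrow> exec \<kappa> I (While b c) \<sigma>1 l \<sigma>2 \<Longrightarrow>
     exec \<kappa> I (While b c) \<sigma> (k + l + 3) \<sigma>2"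

inductive_cases exec_SkipE: "exec \<kappa> I Skip \<sigma> k \<sigma>'"
inductive_cases exec_AssignE: "exec \<kappa> I (Assign r a) \<sigma> k \<sigma>'"
inductive_cases exec_StoreE: "exec \<kappa> I (Store a b) \<sigma> k \<sigma>'"
inductive_cases exec_SeqE: "exec \<kappa> I (Seq c d) \<sigma> k \<sigma>'"
inductive_cases exec_IfE: "exec \<kappa> I (If b c d) \<sigma> k \<sigma>'"

lemma exec_imp_tri: "exec \<kappa> I c \<sigma> k \<sigma>' \<Longrightarrow> Q \<sigma>' \<Longrightarrow> tri \<kappa> I c \<sigma> k 0 Q"
proof (induction arbitrary: Q rule: exec.induct)
  case (1 \<sigma>)
  then show ?case by (rule tri_Skip)
next
  case (2 r a \<sigma>)
  then show ?case using tri_step_det[OF _ tri_Skip, of _ _ _ _ _ Q 0] by (simp add: numeral_eq_Suc)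
next
  case (3 a b \<sigma>)
  then show ?case using tri_step_det[OF _ tri_Skip, of _ _ _ _ _ Q 0] by (simp add: numeral_eq_Suc)
next
  case (4 c \<sigma> k \<sigma>1 d l \<sigma>2)
  have "tri \<kappa> I c \<sigma> k 0 (\<lambda>\<sigma>'. \<sigma>' = \<sigma>1)" using 4 by simp
  then show ?case using tri_Seq[of \<kappa> I c \<sigma> k 0 "\<lambda>\<sigma>'. \<sigma>' = \<sigma>1" d l 0 Q] 4 by simp
next
  case (5 \<sigma> b c d k \<sigma>1)
  then have "tri \<kappa> I (if eval_test \<kappa> I \<sigma> b then c else d) \<sigma> k 0 Q" by simp
  then show ?case by (rule tri_step_det[rotated]) simp
next
  case (6 \<sigma> b c)
  then show ?case by (auto intro: tri_While_false)
next
  case (7 \<sigma> b c k \<sigma>1 l \<sigma>2)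
  have "tri \<kappa> I c \<sigma> k 0 (\<lambda>\<sigma>'. \<sigma>' = \<sigma>1)" using 7 by simp
  then have "tri \<kappa> I (Seq c (While b c)) \<sigma> (k + l + 1) 0 Q"
    using tri_Seq[of \<kappa> I c \<sigma> k 0 "\<lambda>\<sigma>'. \<sigma>' = \<sigma>1" "While b c" l 0 Q] 7 by simp
  from tri_While_true[OF 7(1) this] show ?case by (simp add: numeral_3_eq_3)
qed

text \<open>\<open>t\<close> is the time available before, and the second argument of \<open>Q\<close> the time left over.\<close>

definition ok :: "nat \<Rightarrow> input \<Rightarrow> com \<Rightarrow> state \<Rightarrow> nat \<Rightarrow> (state \<Rightarrow> nat \<Rightarrow> bool) \<Rightarrow> bool" where
  "ok \<kappa> I c \<sigma> t Q \<longleftrightarrow> (\<exists>k \<sigma>'. exec \<kappa> I c \<sigma> k \<sigma>' \<and> k \<le> t \<and> Q \<sigma>' (t - k))"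

lemma ok_imp_tri: "ok \<kappa> I c \<sigma> t (\<lambda>\<sigma>' _. Q \<sigma>') \<Longrightarrow> tri \<kappa> I c \<sigma> t 0 Q"
  unfolding ok_def by (auto intro: tri_mono exec_imp_tri)

lemma okI: "exec \<kappa> I c \<sigma> k \<sigma>' \<Longrightarrow> k \<le> t \<Longrightarrow> Q \<sigma>' (t - k) \<Longrightarrow> ok \<kappa> I c \<sigma> t Q"
  unfolding ok_def by blast

lemma okE:
  assumes "ok \<kappa> I c \<sigma> t Q"
  obtains k \<sigma>' where "exec \<kappa> I c \<sigma> k \<sigma>'" "k \<le> t" "Q \<sigma>' (t - k)"
  using assms unfolding ok_def by blast

text \<open>This rule and the following ones are equivalences, so that the simplifier computes the
  weakest precondition of straight-line code by rewriting.\<close>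

lemma ok_Skip [simp]: "ok \<kappa> I Skip \<sigma> t Q \<longleftrightarrow> Q \<sigma> t"
proof
  show "Q \<sigma> t" if "ok \<kappa> I Skip \<sigma> t Q"
    using that by (elim okE exec_SkipE) simp
  show "ok \<kappa> I Skip \<sigma> t Q" if "Q \<sigma> t"
    using that by (intro okI[OF exec.intros(1)]) auto
qed

lemma ok_Assign:
  "ok \<kappa> I (Assign r a) \<sigma> t Q \<longleftrightarrow>
     1 \<le> t \<and> Q (\<sigma>\<lparr>regs := (regs \<sigma>)(r := eval_exp \<kappa> I \<sigma> a)\<rparr>) (t - 1)" (is "?l \<longleftrightarrow> ?r")
proof
  show ?r if ?l
    using that by (elim okE exec_AssignE) simp
  show ?l if ?r
    using that by (intro okI[OF exec.intros(2)]) auto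
qed

lemma ok_Store:
  "ok \<kappa> I (Store a b) \<sigma> t Q \<longleftrightarrow>
     1 \<le> t \<and> Q (\<sigma>\<lparr>mem := (mem \<sigma>)(eval_exp \<kappa> I \<sigma> a := eval_exp \<kappa> I \<sigma> b)\<rparr>) (t - 1)" (is "?l \<longleftrightarrow> ?r")
proof
  show ?r if ?l
    using that by (elim okE exec_StoreE) simp
  show ?l if ?r
    using that by (intro okI[OF exec.intros(3)]) auto
qed

lemma ok_Seq:
  "ok \<kappa> I (Seq c d) \<sigma> t Q \<longleftrightarrow>
     1 \<le> t \<and> ok \<kappa> I c \<sigma> (t - 1) (\<lambda>\<sigma>' t'. ok \<kappa> I d \<sigma>' t' Q)" (is "?l \<longleftrightarrow> ?r")
proof
  assume ?l
  then obtain k0 \<sigma>2 where 0: "exec \<kappa> I (Seq c d) \<sigma> k0 \<sigma>2" "k0 \<le> t" "Q \<sigma>2 (t - k0)" by (rule okE)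
  from 0(1) obtain k l \<sigma>1 where *: "exec \<kappa> I c \<sigma> k \<sigma>1" "exec \<kappa> I d \<sigma>1 l \<sigma>2" and k0: "k0 = Suc (k + l)"
    by (rule exec_SeqE)
  note * = * 0(2,3)[unfolded k0]
  have "t - 1 - k - l = t - (k + l + 1)" by simp
  then have "ok \<kappa> I d \<sigma>1 (t - 1 - k) Q"
    using * by (intro okI[OF *(2)]) auto
  then show ?r using * by (intro conjI okI[OF *(1)]) auto
next
  assume ?r
  then obtain k \<sigma>1 l \<sigma>2 where *: "1 \<le> t" "exec \<kappa> I c \<sigma> k \<sigma>1" "k \<le> t - 1" "exec \<kappa> I d \<sigma>1 l \<sigma>2"
    "l \<le> t - 1 - k" "Q \<sigma>2 (t - 1 - k - l)" by (elim okE conjE) metis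
  moreover have "t - 1 - k - l = t - (k + l + 1)" by simp
  ultimately show ?l by (intro okI[OF exec.intros(4)[OF *(2,4)]]) auto
qed

lemma ok_If:
  "ok \<kappa> I (If b c d) \<sigma> t Q \<longleftrightarrow>
     1 \<le> t \<and> (if eval_test \<kappa> I \<sigma> b then ok \<kappa> I c \<sigma> (t - 1) Q else ok \<kappa> I d \<sigma> (t - 1) Q)" (is "?l \<longleftrightarrow> ?r")
proof
  assume ?l
  then obtain k \<sigma>1 where *: "exec \<kappa> I (if eval_test \<kappa> I \<sigma> b then c else d) \<sigma> k \<sigma>1" "Suc k \<le> t"
    "Q \<sigma>1 (t - Suc k)" by (elim okE exec_IfE) metis
  have "ok \<kappa> I (if eval_test \<kappa> I \<sigma> b then c else d) \<sigma> (t - 1) Q"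
    by (rule okI[OF *(1), where Q = Q]) (use *(2,3) in simp_all)
  then show ?r using *(2) by (simp split: if_splits)
next
  assume ?r
  then have "1 \<le> t" "ok \<kappa> I (if eval_test \<kappa> I \<sigma> b then c else d) \<sigma> (t - 1) Q" by auto
  then obtain k \<sigma>1 where *: "1 \<le> t" "exec \<kappa> I (if eval_test \<kappa> I \<sigma> b then c else d) \<sigma> k \<sigma>1" "k \<le> t - 1"
    "Q \<sigma>1 (t - 1 - k)" by (elim okE) metis
  show ?l by (rule okI[OF exec.intros(5)[OF *(2)], where Q = Q]) (use * in simp_all)
qed

text \<open>Surplus time is passed through: \<open>u + t' = v + t\<close> says that exactly the
  extra \<open>t' - t\<close> credits reappear at the end.\<close>

lemma ok_mono:
  assumes "ok \<kappa> I c \<sigma> t P" "t \<le> t'" "\<And>\<sigma>' u v. P \<sigma>' u \<Longrightarrow> u + t' = v + t \<Longrightarrow> Q \<sigma>' v"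
  shows "ok \<kappa> I c \<sigma> t' Q"
proof -
  obtain k \<sigma>' where *: "exec \<kappa> I c \<sigma> k \<sigma>'" "k \<le> t" "P \<sigma>' (t - k)"
    using assms(1) by (rule okE)
  have "Q \<sigma>' (t' - k)" by (rule assms(3)[OF *(3)]) (use *(2) assms(2) in simp)
  then show ?thesis using * assms(2) by (intro okI[OF *(1)]) auto
qed

text \<open>The available time is the variant: a round spends at least 3 credits, so the induction
  runs over \<open>t\<close>, and termination follows from the invariant supplying these
  credits.\<close>

lemma ok_While:
  assumes "Inv \<sigma> t"
    and body: "\<And>\<sigma> t. Inv \<sigma> t \<Longrightarrow> eval_test \<kappa> I \<sigma> b \<Longrightarrow> 3 \<le> t \<and> ok \<kappa> I c \<sigma> (t - 3) Inv"
    and exit: "\<And>\<sigma> t. Inv \<sigma> t \<Longrightarrow> \<not> eval_test \<kappa> I \<sigma> b \<Longrightarrow> 2 \<le> t \<and> Q \<sigma> (t - 2)"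
  shows "ok \<kappa> I (While b c) \<sigma> t Q"
  using assms(1)
proof (induction t arbitrary: \<sigma> rule: less_induct)
  case (less t)
  show ?case
  proof (cases "eval_test \<kappa> I \<sigma> b")
    case False
    then show ?thesis
      using exit[OF less.prems] by (auto intro: okI[OF exec.intros(6)])
  next
    case True
    then obtain k \<sigma>1 where 1: "3 \<le> t" "exec \<kappa> I c \<sigma> k \<sigma>1" "k \<le> t - 3" "Inv \<sigma>1 (t - 3 - k)"
      using body[OF less.prems] unfolding ok_def by auto
    then have "ok \<kappa> I (While b c) \<sigma>1 (t - 3 - k) Q"
      by (intro less.IH) auto
    then obtain l \<sigma>2 where 2: "exec \<kappa> I (While b c) \<sigma>1 l \<sigma>2" "l \<le> t - 3 - k" "Q \<sigma>2 (t - 3 - k - l)"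
      unfolding ok_def by auto
    have "t - 3 - k - l = t - (k + l + 3)" by simp
    then show ?thesis unfolding ok_def
      using exec.intros(7)[OF True 1(2) 2(1)] 1 2
      by (intro exI[of _ "k + l + 3"] exI[of _ \<sigma>2]) auto
  qed
qed

section \<open>Reachability by heavy edges, alive components, and the refinement of intervals by a
  sample\<close>

section \<open>Intervals around the bottleneck values\<close>

text \<open>Separates the combinatorics from the machine and the weights. All that is left of the
  weights is an injective rank, in which the sentinel codes 0 and \<open>Suc m\<close> bracket the
  edges.\<close>

locale net =
  fixes m :: nat and T H :: "nat \<Rightarrow> nat" and s :: nat and rk :: "nat \<Rightarrow> nat"
  assumes rk_0 [simp]: "rk 0 = 0" and rk_top [simp]: "rk (Suc m) = Suc m"
    and rk_inj: "inj_on rk {..Suc m}"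
    and rk_edge: "c \<in> {1..m} \<Longrightarrow> 1 \<le> rk c \<and> rk c \<le> m"
begin

definition reach :: "nat \<Rightarrow> nat \<Rightarrow> bool" where
  "reach t v \<longleftrightarrow> (s, v) \<in> {(T c, H c) | c. c \<in> {1..m} \<and> t \<le> rk c}\<^sup>*"

text \<open>The max-min value of a path in threshold form, so that no minimum along a path is ever
  taken. An unreachable vertex gets 0, and only \<open>s\<close>, by the empty path, gets
  \<open>Suc m\<close>.\<close>

definition B :: "nat \<Rightarrow> nat" where
  "B v = Max (insert 0 {t \<in> {1..Suc m}. reach t v})"

definition VV :: "nat set" where "VV = T ` {1..m} \<union> H ` {1..m}"

lemma rk_le: "c \<le> Suc m \<Longrightarrow> rk c \<le> Suc m"
  using rk_edge[of c] by (cases "c = 0 \<or> c = Suc m") auto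

lemma rk_eq_iff: "c \<le> Suc m \<Longrightarrow> d \<le> Suc m \<Longrightarrow> rk c = rk d \<longleftrightarrow> c = d"
  using rk_inj by (auto simp: inj_on_def)

lemma reach_antimono: "reach t v \<Longrightarrow> t' \<le> t \<Longrightarrow> reach t' v"
  unfolding reach_def by (erule rtrancl_mono[THEN subsetD, rotated]) auto

lemma B_le: "B v \<le> Suc m"
  unfolding B_def by (subst Max_le_iff) auto

lemma le_B_iff: "1 \<le> t \<Longrightarrow> t \<le> B v \<longleftrightarrow> t \<le> Suc m \<and> reach t v"
  unfolding B_def by (subst Max_ge_iff) (auto intro: reach_antimono)

lemma B_s [simp]: "B s = Suc m"
  using le_B_iff[of "Suc m" s] B_le[of s] by (auto simp: reach_def)

lemma B_edge: "c \<in> {1..m} \<Longrightarrow> min (B (T c)) (rk c) \<le> B (H c)"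
proof -
  assume c: "c \<in> {1..m}"
  define t where "t = min (B (T c)) (rk c)"
  show ?thesis
  proof (cases "t = 0")
    case False
    then have "reach t (T c)" "t \<le> rk c" "t \<le> Suc m" using le_B_iff[of t "T c"] by (auto simp: t_def)
    then have "reach t (H c)"
      using c unfolding reach_def by - (rule rtrancl_into_rtrancl[of s "T c"], assumption, blast)
    then show ?thesis using le_B_iff[of t "H c"] False \<open>t \<le> Suc m\<close> by (simp add: t_def)
  qed (simp add: t_def)
qed

lemma B_top: "B v = Suc m \<Longrightarrow> v = s"
proof -
  assume "B v = Suc m"
  then have "reach (Suc m) v" using le_B_iff[of "Suc m" v] by simp
  moreover have "{(T c, H c) | c. c \<in> {1..m} \<and> Suc m \<le> rk c} = {}"
    using rk_edge by force
  ultimately have "(s, v) \<in> {}\<^sup>*" unfolding reach_def by (simp only:)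
  then show ?thesis by simp
qed

lemma B_notin_VV: "v \<notin> VV \<Longrightarrow> v \<noteq> s \<Longrightarrow> B v = 0"
proof (rule ccontr)
  assume v: "v \<notin> VV" "v \<noteq> s" and "B v \<noteq> 0"
  then have "reach 1 v" using le_B_iff[of 1 v] by simp
  then show False using v unfolding reach_def
    by (cases rule: rtranclE) (auto simp: VV_def)
qed

text \<open>Only the lower ends are compared; \<open>alive_hi\<close> shows that under
  \<open>good\<close> the upper ends then agree as well. The scans of the program test accordingly
  little.\<close>

definition alive :: "(nat \<Rightarrow> nat) \<Rightarrow> nat \<Rightarrow> bool" where
  "alive lo c \<longleftrightarrow> c \<in> {1..m} \<and> lo (T c) = lo (H c) \<and> rk (lo (H c)) < rk c"

text \<open>The last clause makes the intervals at the two ends of an edge that still matters equal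
  or disjoint, which is what allows an edge to be classified by comparing stored codes. The source
  has an empty interval with both ends \<open>Suc m\<close>, hence the exception for
  \<open>s\<close> in the upper bound.\<close>

definition good :: "(nat \<Rightarrow> nat) \<Rightarrow> (nat \<Rightarrow> nat) \<Rightarrow> bool" where
  "good lo hi \<longleftrightarrow> (\<forall>v. lo v \<le> Suc m \<and> hi v \<le> Suc m \<and> rk (lo v) \<le> B v) \<and>
     (\<forall>v\<in>VV. v \<noteq> s \<longrightarrow> B v < rk (hi v)) \<and> lo s = Suc m \<and> hi s = Suc m \<and>
     (\<forall>c\<in>{1..m}. rk (lo (H c)) < rk c \<longrightarrow>
        lo (T c) = lo (H c) \<and> hi (T c) = hi (H c) \<or>
        rk (hi (H c)) \<le> rk (lo (T c)) \<or> rk (hi (T c)) \<le> rk (lo (H c)))"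

definition cc :: "(nat \<Rightarrow> nat) \<Rightarrow> nat \<Rightarrow> nat set" where
  "cc lo v = {u. (v, u) \<in> ({(T c, H c) | c. alive lo c} \<union> {(H c, T c) | c. alive lo c})\<^sup>*}"

text \<open>The tail is already known to reach rank \<open>rk c\<close>, so such an edge contributes
  exactly its own rank to its head, whatever the true value at the tail.\<close>

definition src :: "(nat \<Rightarrow> nat) \<Rightarrow> nat \<Rightarrow> bool" where
  "src lo c \<longleftrightarrow> c \<in> {1..m} \<and> rk (lo (H c)) < rk c \<and> rk c \<le> rk (lo (T c))"

definition irk :: "nat \<Rightarrow> nat" where "irk = inv_into {..Suc m} rk"

definition hh :: "(nat \<Rightarrow> nat) \<Rightarrow> nat \<Rightarrow> nat" where
  "hh lo v = irk (Max (insert 0 (rk ` {c. src lo c \<and> H c = v})))"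

text \<open>The thresholds of the component of \<open>v\<close>. Source edges into the component
  have to be included beside alive ones, since a bottleneck value inside may be the rank of
  either.\<close>

definition keys :: "nat set \<Rightarrow> (nat \<Rightarrow> nat) \<Rightarrow> (nat \<Rightarrow> nat) \<Rightarrow> nat \<Rightarrow> nat set" where
  "keys S lo hi v = {c \<in> {1..m}. c \<in> S \<and> H c \<in> cc lo v \<and> rk (lo v) < rk c \<and> rk c < rk (hi v)}"

text \<open>Stated through \<open>B\<close>, which the program does not know. The bucket search
  arrives at the same codes, as \<open>nlo_ix\<close> and \<open>nhi_ix\<close> show by way of
  bucket numbers.\<close>

definition nlo :: "nat set \<Rightarrow> (nat \<Rightarrow> nat) \<Rightarrow> (nat \<Rightarrow> nat) \<Rightarrow> nat \<Rightarrow> nat" where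
  "nlo S lo hi v = irk (Max (insert (rk (lo v)) (rk ` {c \<in> keys S lo hi v. rk c \<le> B v})))"

definition nhi :: "nat set \<Rightarrow> (nat \<Rightarrow> nat) \<Rightarrow> (nat \<Rightarrow> nat) \<Rightarrow> nat \<Rightarrow> nat" where
  "nhi S lo hi v = irk (Min (insert (rk (hi v)) (rk ` {c \<in> keys S lo hi v. B v < rk c})))"

lemma irk_rk [simp]: "c \<le> Suc m \<Longrightarrow> irk (rk c) = c"
  unfolding irk_def using rk_inj by (simp add: inv_into_f_f)

lemma rk_irk_image: "x \<in> rk ` A \<Longrightarrow> A \<subseteq> {..Suc m} \<Longrightarrow> rk (irk x) = x \<and> irk x \<in> A"
  by auto

lemma src_le: "src lo c \<Longrightarrow> c \<le> Suc m" by (auto simp: src_def)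

lemma finite_src [simp]: "finite {c. src lo c \<and> P c}"
  by (rule finite_subset[of _ "{1..m}"]) (auto simp: src_def)

lemma hh_cases:
  obtains (none) "hh lo v = 0" "\<And>c. src lo c \<Longrightarrow> H c \<noteq> v"
  | (some) "src lo (hh lo v)" "H (hh lo v) = v" "\<And>c. src lo c \<Longrightarrow> H c = v \<Longrightarrow> rk c \<le> rk (hh lo v)"
proof (cases "{c. src lo c \<and> H c = v} = {}")
  case True
  have "hh lo v = 0" unfolding hh_def True using irk_rk[of 0] by simp
  then show ?thesis using True none by auto
next
  case False
  let ?A = "insert 0 {c. src lo c \<and> H c = v}"
  let ?M = "Max (insert 0 (rk ` {c. src lo c \<and> H c = v}))"
  have M: "?M \<in> insert 0 (rk ` {c. src lo c \<and> H c = v})" by (intro Max_in) auto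
  have pos: "0 < rk c" if "src lo c" for c using rk_edge[of c] that by (auto simp: src_def)
  from False obtain c where c: "src lo c" "H c = v" by auto
  then have "rk c \<le> ?M" by (intro Max_ge) auto
  with pos[OF c(1)] M obtain d where d: "src lo d" "H d = v" "?M = rk d" by auto
  then have "hh lo v = d" unfolding hh_def using src_le[OF d(1)] by simp
  moreover have "rk c \<le> rk d" if "src lo c" "H c = v" for c
    unfolding d(3)[symmetric] using that by (intro Max_ge) auto
  ultimately show ?thesis using d some by blast
qed

lemma hh_le: "hh lo v \<le> m"
  by (cases rule: hh_cases[of lo v]) (auto simp: src_def)

lemma hh_eqI:
  assumes "src lo c" "H c = v" "\<And>d. src lo d \<Longrightarrow> H d = v \<Longrightarrow> rk d \<le> rk c"
  shows "hh lo v = c"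
proof (cases rule: hh_cases[of lo v])
  case some
  then have "rk (hh lo v) = rk c" using assms by (metis le_antisym)
  then show ?thesis using rk_eq_iff src_le assms(1) some(1) by blast
qed (use assms in auto)

lemma hh_eq_0: "(\<And>d. src lo d \<Longrightarrow> H d \<noteq> v) \<Longrightarrow> hh lo v = 0"
  by (cases rule: hh_cases[of lo v]) auto

lemma goodD:
  assumes "good lo hi"
  shows "lo v \<le> Suc m" "hi v \<le> Suc m" "rk (lo v) \<le> B v" "v \<in> VV \<Longrightarrow> v \<noteq> s \<Longrightarrow> B v < rk (hi v)"
    "lo s = Suc m" "hi s = Suc m"
    "c \<in> {1..m} \<Longrightarrow> rk (lo (H c)) < rk c \<Longrightarrow>
        lo (T c) = lo (H c) \<and> hi (T c) = hi (H c) \<or>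
        rk (hi (H c)) \<le> rk (lo (T c)) \<or> rk (hi (T c)) \<le> rk (lo (H c))"
  using assms unfolding good_def by blast+

lemma VV_edge: "c \<in> {1..m} \<Longrightarrow> T c \<in> VV" "c \<in> {1..m} \<Longrightarrow> H c \<in> VV"
  by (auto simp: VV_def)

lemma lo_lt_top:
  assumes "good lo hi" "v \<noteq> s" shows "rk (lo v) < Suc m"
proof -
  have "B v \<noteq> Suc m" using B_top assms(2) by blast
  then show ?thesis using goodD(3)[OF assms(1), of v] B_le[of v] by linarith
qed

lemma edge_not_s:
  assumes "good lo hi" "c \<in> {1..m}" "rk (lo (H c)) < rk c" shows "H c \<noteq> s"
  using goodD(5)[OF assms(1)] assms(3) rk_edge[OF assms(2)] by (cases "H c = s") simp_all

text \<open>Neither end is \<open>s\<close>, whose lower end no edge exceeds in rank. The intervals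
  at both ends contain the bottleneck values and hence are nonempty, so with a common lower end they
  cannot be disjoint.\<close>

lemma alive_hi:
  assumes g: "good lo hi" and a: "alive lo c"
  shows "hi (T c) = hi (H c)" "T c \<noteq> s" "H c \<noteq> s"
proof -
  have c: "c \<in> {1..m}" "lo (T c) = lo (H c)" "rk (lo (H c)) < rk c" using a by (auto simp: alive_def)
  show ns: "H c \<noteq> s" using edge_not_s[OF g c(1,3)] .
  show nt: "T c \<noteq> s"
    using lo_lt_top[OF g ns] goodD(5)[OF g] c(2) by (metis rk_top less_irrefl)
  show "hi (T c) = hi (H c)"
    using goodD(7)[OF g c(1,3)] goodD(3,4)[OF g, of "H c"] goodD(3,4)[OF g, of "T c"] VV_edge[OF c(1)] ns nt c(2)
    by auto
qed

lemma cc_refl [simp]: "v \<in> cc lo v" by (simp add: cc_def)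

lemma cc_alive:
  assumes "alive lo c" shows "T c \<in> cc lo v \<longleftrightarrow> H c \<in> cc lo v"
  unfolding cc_def using assms by (auto intro: rtrancl_into_rtrancl)

lemma cc_induct [consumes 1, case_names base head tail]:
  assumes "u \<in> cc lo v" "P v" "\<And>c. alive lo c \<Longrightarrow> T c \<in> cc lo v \<Longrightarrow> P (T c) \<Longrightarrow> P (H c)"
    "\<And>c. alive lo c \<Longrightarrow> H c \<in> cc lo v \<Longrightarrow> P (H c) \<Longrightarrow> P (T c)"
  shows "P u"
proof -
  have "(v, u) \<in> ({(T c, H c) | c. alive lo c} \<union> {(H c, T c) | c. alive lo c})\<^sup>*"
    using assms(1) by (simp add: cc_def)
  then show ?thesis
  proof (induction rule: rtrancl_induct)
    case (step y z)
    then have "y \<in> cc lo v" by (simp add: cc_def)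
    then show ?case using step assms(3,4) by auto
  qed (rule assms(2))
qed

lemma cc_lo: "u \<in> cc lo v \<Longrightarrow> lo u = lo v"
  by (induction rule: cc_induct) (auto simp: alive_def)

lemma cc_hi: "good lo hi \<Longrightarrow> u \<in> cc lo v \<Longrightarrow> hi u = hi v"
  by (rotate_tac 1, induction rule: cc_induct) (auto simp: alive_hi)

lemma cc_trans: "x \<in> cc lo y \<Longrightarrow> y \<in> cc lo z \<Longrightarrow> x \<in> cc lo z"
  unfolding cc_def by (auto intro: rtrancl_trans)

lemma cc_sym: "u \<in> cc lo v \<Longrightarrow> v \<in> cc lo u"
proof (induction rule: cc_induct)
  case (head c)
  have "T c \<in> cc lo (H c)" using cc_alive[OF head(1), of "H c"] by simp
  then show ?case using head(3) cc_trans by blast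
next
  case (tail c)
  have "H c \<in> cc lo (T c)" using cc_alive[OF tail(1), of "T c"] by simp
  then show ?case using tail(3) cc_trans by blast
qed simp

lemma cc_eq: "u \<in> cc lo v \<Longrightarrow> cc lo u = cc lo v"
  using cc_trans cc_sym by blast

lemma cc_subset_VV: "cc lo v \<subseteq> insert v VV"
proof
  fix u assume "u \<in> cc lo v"
  then show "u \<in> insert v VV"
    by (induction rule: cc_induct) (auto simp: VV_edge alive_def)
qed

text \<open>A component receives its bottleneck values from its source edges alone, since every other
  edge entering it is too light to matter.\<close>

lemma comp_induct:
  assumes g: "good lo hi" and v: "v \<in> cc lo v0" "rk (lo v0) < t" "t \<le> B v"
    and base: "\<And>u. u \<in> cc lo v0 \<Longrightarrow> hh lo u \<noteq> 0 \<Longrightarrow> t \<le> rk (hh lo u) \<Longrightarrow> P u"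
    and step: "\<And>c. alive lo c \<Longrightarrow> T c \<in> cc lo v0 \<Longrightarrow> H c \<in> cc lo v0 \<Longrightarrow> t \<le> rk c \<Longrightarrow> t \<le> B (T c) \<Longrightarrow> P (T c) \<Longrightarrow> P (H c)"
  shows "P v"
proof -
  have tm: "1 \<le> t" "t \<le> Suc m" using v(2,3) B_le[of v] by linarith+
  have ns: "s \<notin> cc lo v0"
    using cc_lo[of s lo v0] goodD(5)[OF g] v(2) tm by (metis rk_top leD)
  have "reach t v" using le_B_iff[OF tm(1)] v(3) by blast
  then have "v \<in> cc lo v0 \<longrightarrow> P v" unfolding reach_def
  proof (induction rule: rtrancl_induct)
    case base
    then show ?case using ns by blast
  next
    case (step x u)
    then obtain c where c: "c \<in> {1..m}" "t \<le> rk c" "x = T c" "u = H c" by auto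
    have tx: "t \<le> B x" using step(1) le_B_iff[OF tm(1)] tm(2) by (auto simp: reach_def)
    show ?case
    proof
      assume u: "u \<in> cc lo v0"
      then have lou: "lo u = lo v0" "u \<noteq> s" using cc_lo ns by auto
      then have lt: "rk (lo (H c)) < rk c" using v(2) c by simp
      consider "lo x = lo u" "hi x = hi u" | "rk (hi u) \<le> rk (lo x)" | "rk (hi x) \<le> rk (lo u)"
        using goodD(7)[OF g c(1) lt] c by auto
      then show "P u"
      proof cases
        case 1
        then have "alive lo c" using c lt by (simp add: alive_def)
        moreover from this have "x \<in> cc lo v0" using u cc_alive c by auto
        ultimately show ?thesis using assms(6)[of c] c tx u step.IH by simp
      next
        \<comment> \<open>The tail lies above the head. Its value exceeds the value at the head, so
          in \<open>B_edge\<close> the minimum must be the rank of \<open>c\<close>; this makes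
          \<open>c\<close> a source edge.\<close>
        case 2
        have "B u < rk (hi u)" using goodD(4)[OF g] VV_edge[OF c(1)] c lou by simp
        moreover have "rk (lo x) \<le> B x" using goodD(3)[OF g] .
        moreover have "min (B x) (rk c) \<le> B u" using B_edge[OF c(1)] c by simp
        ultimately have "rk c \<le> rk (lo x)" using 2 by linarith
        then have "src lo c" using c lt by (simp add: src_def)
        then have "hh lo u \<noteq> 0 \<and> rk c \<le> rk (hh lo u)"
          using c by (cases rule: hh_cases[of lo u]) (auto simp: src_def)
        then show ?thesis using base[OF u] c(2) by auto
      next
        \<comment> \<open>The tail lies below the head, so its value would be less than
          \<open>t\<close>. The source, for which no strict upper bound is available, is excluded
          because its upper end \<open>Suc m\<close> is too large for this case.\<close>
        case 3
        have "x = s" using goodD(4)[OF g, of x] VV_edge[OF c(1)] c tx lou 3 v(2) by force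
        then have False using goodD(6)[OF g] 3 lou(1) v(2) tm by simp
        then show ?thesis ..
      qed
    qed
  qed
  then show ?thesis using v(1) by blast
qed

lemma hh_le_B:
  assumes "good lo hi" "hh lo v \<noteq> 0"
  shows "rk (hh lo v) \<le> B v" "rk (lo v) < rk (hh lo v)" "hh lo v \<in> {1..m}" "H (hh lo v) = v" "v \<in> VV" "v \<noteq> s"
proof -
  have *: "src lo (hh lo v)" "H (hh lo v) = v" using assms(2) by (cases rule: hh_cases[of lo v]; simp)+
  then show "rk (lo v) < rk (hh lo v)" "hh lo v \<in> {1..m}" "H (hh lo v) = v" by (auto simp: src_def)
  then show "v \<in> VV" using VV_edge by metis
  have "rk (hh lo v) \<le> B (T (hh lo v))" using * goodD(3)[OF assms(1), of "T (hh lo v)"] by (auto simp: src_def)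
  then show "rk (hh lo v) \<le> B v" using B_edge[of "hh lo v"] * by (auto simp: src_def)
  show "v \<noteq> s" using edge_not_s[OF assms(1), of "hh lo v"] * by (auto simp: src_def)
qed

lemma keys_fin [simp]: "finite (keys S lo hi v)" "finite {c \<in> keys S lo hi v. P c}"
  by (auto simp: keys_def)

lemma nlo_props:
  assumes g: "good lo hi"
  shows "nlo S lo hi v \<in> insert (lo v) (keys S lo hi v)" "rk (nlo S lo hi v) \<le> B v"
    "\<And>c. c \<in> keys S lo hi v \<Longrightarrow> rk c \<le> B v \<Longrightarrow> rk c \<le> rk (nlo S lo hi v)"
    "rk (lo v) \<le> rk (nlo S lo hi v)" "nlo S lo hi v \<le> Suc m"
proof -
  let ?A = "insert (lo v) {c \<in> keys S lo hi v. rk c \<le> B v}"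
  have A: "?A \<subseteq> {..Suc m}" using goodD(1)[OF g] by (auto simp: keys_def)
  have 1: "nlo S lo hi v = irk (Max (rk ` ?A))" by (simp add: nlo_def)
  have "Max (rk ` ?A) \<in> rk ` ?A" by (intro Max_in) auto
  from rk_irk_image[OF this A] have 2: "rk (nlo S lo hi v) = Max (rk ` ?A)" "nlo S lo hi v \<in> ?A" by (auto simp: 1)
  show "nlo S lo hi v \<in> insert (lo v) (keys S lo hi v)" "rk (nlo S lo hi v) \<le> B v" "nlo S lo hi v \<le> Suc m"
    using 2(2) goodD(3)[OF g] A by auto
  show "rk c \<le> rk (nlo S lo hi v)" if "c \<in> keys S lo hi v" "rk c \<le> B v" for c
    unfolding 2(1) using that by (intro Max_ge) auto
  show "rk (lo v) \<le> rk (nlo S lo hi v)" unfolding 2(1) by (intro Max_ge) auto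
qed

lemma nhi_props:
  assumes g: "good lo hi"
  shows "nhi S lo hi v \<in> insert (hi v) (keys S lo hi v)" "v \<in> VV \<Longrightarrow> v \<noteq> s \<Longrightarrow> B v < rk (nhi S lo hi v)"
    "\<And>c. c \<in> keys S lo hi v \<Longrightarrow> B v < rk c \<Longrightarrow> rk (nhi S lo hi v) \<le> rk c"
    "rk (nhi S lo hi v) \<le> rk (hi v)" "nhi S lo hi v \<le> Suc m"
proof -
  let ?A = "insert (hi v) {c \<in> keys S lo hi v. B v < rk c}"
  have A: "?A \<subseteq> {..Suc m}" using goodD(2)[OF g] by (auto simp: keys_def)
  have 1: "nhi S lo hi v = irk (Min (rk ` ?A))" by (simp add: nhi_def)
  have "Min (rk ` ?A) \<in> rk ` ?A" by (intro Min_in) auto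
  from rk_irk_image[OF this A] have 2: "rk (nhi S lo hi v) = Min (rk ` ?A)" "nhi S lo hi v \<in> ?A" by (auto simp: 1)
  show "nhi S lo hi v \<in> insert (hi v) (keys S lo hi v)" "nhi S lo hi v \<le> Suc m"
    using 2(2) A by auto
  show "v \<in> VV \<Longrightarrow> v \<noteq> s \<Longrightarrow> B v < rk (nhi S lo hi v)" using 2(2) goodD(4)[OF g] by auto
  show "rk (nhi S lo hi v) \<le> rk c" if "c \<in> keys S lo hi v" "B v < rk c" for c
    unfolding 2(1) using that by (intro Min_le) auto
  show "rk (nhi S lo hi v) \<le> rk (hi v)" unfolding 2(1) by (intro Min_le) auto
qed

lemma keys_cc: "good lo hi \<Longrightarrow> u \<in> cc lo v \<Longrightarrow> keys S lo hi u = keys S lo hi v"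
  unfolding keys_def using cc_eq[of u lo v] cc_lo[of u lo v] cc_hi[of lo hi u v] by simp

text \<open>Both vertices see the same thresholds, so their new intervals are cells of one partition
  of the old interval. The cells coincide unless the new lower end at \<open>v\<close> separates the
  two values.\<close>

lemma n_split:
  assumes g: "good lo hi" and u: "u \<in> cc lo v" "u \<in> VV" "v \<in> VV" "u \<noteq> s" "v \<noteq> s" and le: "B u \<le> B v"
  shows "nlo S lo hi u = nlo S lo hi v \<and> nhi S lo hi u = nhi S lo hi v \<or>
    rk (nhi S lo hi u) \<le> rk (nlo S lo hi v)"
proof (cases "rk (nlo S lo hi v) \<le> B u")
  case False
  have "nlo S lo hi v \<in> keys S lo hi u"
    using nlo_props(1)[OF g, of S v] cc_lo[OF u(1)] goodD(3)[OF g, of u] False keys_cc[OF g u(1)] by auto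
  then show ?thesis using nhi_props(3)[OF g, of "nlo S lo hi v" S u] False by simp
next
  case True
  note K = keys_cc[OF g u(1), of S] and L = cc_lo[OF u(1)] and Hi = cc_hi[OF g u(1)]
  have lv: "nlo S lo hi v = lo v \<or> nlo S lo hi v \<in> keys S lo hi v"
    and lu: "nlo S lo hi u = lo v \<or> nlo S lo hi u \<in> keys S lo hi v"
    using nlo_props(1)[OF g, of S v] nlo_props(1)[OF g, of S u] unfolding K L insert_iff .
  have hv: "nhi S lo hi v = hi v \<or> nhi S lo hi v \<in> keys S lo hi v"
    using nhi_props(1)[OF g, of S v] unfolding insert_iff .
  have l2: "rk (lo v) \<le> rk (nlo S lo hi u)" "rk (lo v) \<le> rk (nlo S lo hi v)"
    and h2: "rk (nhi S lo hi u) \<le> rk (hi v)"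
    using nlo_props(4)[OF g, of u S] nlo_props(4)[OF g, of v S] nhi_props(4)[OF g, of S u] unfolding L Hi .
  have "rk (nlo S lo hi u) = rk (nlo S lo hi v)"
  proof (rule antisym)
    show "rk (nlo S lo hi v) \<le> rk (nlo S lo hi u)"
      using lv
    proof
      assume "nlo S lo hi v \<in> keys S lo hi v"
      then show ?thesis using nlo_props(3)[OF g, of "nlo S lo hi v" S u] True unfolding K by blast
    qed (use l2 in simp)
    show "rk (nlo S lo hi u) \<le> rk (nlo S lo hi v)"
      using lu
    proof
      assume "nlo S lo hi u \<in> keys S lo hi v"
      moreover have "rk (nlo S lo hi u) \<le> B v" using nlo_props(2)[OF g, of S u] le by simp
      ultimately show ?thesis using nlo_props(3)[OF g, of "nlo S lo hi u" S v] by blast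
    qed (use l2 in simp)
  qed
  moreover have "rk (nhi S lo hi u) = rk (nhi S lo hi v)"
  proof (rule antisym)
    have Bv: "B v < rk (nhi S lo hi v)" using nhi_props(2)[OF g] u by simp
    show "rk (nhi S lo hi u) \<le> rk (nhi S lo hi v)"
      using hv
    proof
      assume "nhi S lo hi v \<in> keys S lo hi v"
      moreover have "B u < rk (nhi S lo hi v)" using Bv le by simp
      ultimately show ?thesis using nhi_props(3)[OF g, of "nhi S lo hi v" S u] unfolding K by blast
    qed (use h2 in simp)
    have 1: "B u < rk (nhi S lo hi u)" using nhi_props(2)[OF g] u by simp
    have bv: "B v < rk (nhi S lo hi u)"
    proof (rule ccontr)
      assume *: "\<not> ?thesis"
      then have "nhi S lo hi u \<noteq> hi v" using goodD(4)[OF g, of v] u by auto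
      then have "nhi S lo hi u \<in> keys S lo hi v" using nhi_props(1)[OF g, of S u] Hi K by auto
      then have "rk (nhi S lo hi u) \<le> rk (nlo S lo hi v)" using nlo_props(3)[OF g, of "nhi S lo hi u" S v] * by simp
      then show False using 1 True by simp
    qed
    consider "nhi S lo hi u = hi v" | "nhi S lo hi u \<in> keys S lo hi v"
      using nhi_props(1)[OF g, of S u] unfolding Hi K insert_iff by blast
    then show "rk (nhi S lo hi v) \<le> rk (nhi S lo hi u)"
      using bv nhi_props(3)[OF g, of "nhi S lo hi u" S v] nhi_props(4)[OF g, of S v] by cases simp_all
  qed
  ultimately show ?thesis using rk_eq_iff nlo_props(5)[OF g] nhi_props(5)[OF g] by blast
qed

definition refined :: "nat set \<Rightarrow> (nat \<Rightarrow> nat) \<Rightarrow> (nat \<Rightarrow> nat) \<Rightarrow> (nat \<Rightarrow> nat) \<Rightarrow> (nat \<Rightarrow> nat) \<Rightarrow> bool" where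
  "refined S lo hi lo' hi' \<longleftrightarrow> (\<forall>v\<in>VV. lo' v = nlo S lo hi v \<and> hi' v = nhi S lo hi v) \<and>
     (\<forall>v. v \<notin> VV \<longrightarrow> lo' v = lo v \<and> hi' v = hi v)"

text \<open>Disjoint intervals stay disjoint because intervals only shrink. Equal ones at the ends
  of an edge belong to one component, where \<open>n_split\<close> applies in the order of the two
  bottleneck values.\<close>

lemma good_refined:
  assumes g: "good lo hi" and r: "refined S lo hi lo' hi'"
  shows "good lo' hi'"
proof -
  have ks: "keys S lo hi s = {}"
    using goodD(5)[OF g] rk_edge by (fastforce simp: keys_def)
  have ls: "nlo S lo hi s = Suc m" "nhi S lo hi s = Suc m"
    using nlo_props(1)[OF g, of S s] nhi_props(1)[OF g, of S s] goodD(5,6)[OF g] ks by auto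
  have mono: "rk (lo v) \<le> rk (lo' v)" "rk (hi' v) \<le> rk (hi v)" for v
    using r nlo_props(4)[OF g] nhi_props(4)[OF g] by (cases "v \<in> VV"; auto simp: refined_def)+
  have 1: "lo' v \<le> Suc m \<and> hi' v \<le> Suc m \<and> rk (lo' v) \<le> B v" for v
    using r nlo_props[OF g] nhi_props[OF g] goodD[OF g] by (cases "v \<in> VV") (auto simp: refined_def)
  have 2: "B v < rk (hi' v)" if "v \<in> VV" "v \<noteq> s" for v
    using r nhi_props(2)[OF g] that by (auto simp: refined_def)
  have 3: "lo' s = Suc m" "hi' s = Suc m"
    using r goodD(5,6)[OF g] ls by (cases "s \<in> VV"; auto simp: refined_def)+
  have 4: "lo' (T c) = lo' (H c) \<and> hi' (T c) = hi' (H c) \<or>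
        rk (hi' (H c)) \<le> rk (lo' (T c)) \<or> rk (hi' (T c)) \<le> rk (lo' (H c))"
    if c: "c \<in> {1..m}" "rk (lo' (H c)) < rk c" for c
  proof -
    have lt: "rk (lo (H c)) < rk c" using mono c(2) by (meson le_less_trans)
    consider "lo (T c) = lo (H c)" | "rk (hi (H c)) \<le> rk (lo (T c))" | "rk (hi (T c)) \<le> rk (lo (H c))"
      using goodD(7)[OF g c(1) lt] by auto
    then show ?thesis
    proof cases
      case 1
      then have a: "alive lo c" using c lt by (simp add: alive_def)
      have cT: "T c \<in> cc lo (H c)" and cH: "H c \<in> cc lo (T c)"
        using cc_alive[OF a, of "H c"] cc_alive[OF a, of "T c"] by simp_all
      note v = VV_edge[OF c(1)] and ns = alive_hi(2,3)[OF g a]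
      have n: "lo' (T c) = nlo S lo hi (T c)" "lo' (H c) = nlo S lo hi (H c)"
        "hi' (T c) = nhi S lo hi (T c)" "hi' (H c) = nhi S lo hi (H c)"
        using r v by (simp_all add: refined_def)
      show ?thesis
      proof (cases "B (T c) \<le> B (H c)")
        case True
        then show ?thesis using n_split[OF g cT v ns True, of S] unfolding n by blast
      next
        case False
        then have "B (H c) \<le> B (T c)" by simp
        then show ?thesis using n_split[OF g cH v(2,1) ns(2,1), of S] unfolding n by metis
      qed
    qed (meson mono order_trans)+
  qed
  show ?thesis unfolding good_def using 1 2 3 4 by blast
qed

text \<open>Each new lower end lies in the old interval of its vertex, so vertices with disjoint old
  intervals cannot share a new lower end. Hence dead edges stay dead and components only
  split.\<close>

lemma alive_refined:
  assumes g: "good lo hi" and r: "refined S lo hi lo' hi'" and a: "alive lo' c"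
  shows "alive lo c"
proof -
  have g': "good lo' hi'" by (rule good_refined[OF g r])
  have c: "c \<in> {1..m}" "lo' (T c) = lo' (H c)" "rk (lo' (H c)) < rk c" using a by (auto simp: alive_def)
  have mono: "rk (lo v) \<le> rk (lo' v)" for v
    using r nlo_props(4)[OF g] by (cases "v \<in> VV") (auto simp: refined_def)
  have lt: "rk (lo (H c)) < rk c" using mono c(3) by (meson le_less_trans)
  note v = VV_edge[OF c(1)] and ns = alive_hi(2,3)[OF g' a]
  have "B (H c) < rk (hi (H c))" "B (T c) < rk (hi (T c))" using goodD(4)[OF g] v ns by auto
  moreover have "rk (lo' (T c)) \<le> B (T c)" "rk (lo' (H c)) \<le> B (H c)" using goodD(3)[OF g'] by auto
  ultimately have "lo (T c) = lo (H c)"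
    using goodD(7)[OF g c(1) lt] mono[of "T c"] mono[of "H c"] c(2) by auto
  then show ?thesis using c lt by (simp add: alive_def)
qed

lemma cc_refined:
  assumes "good lo hi" "refined S lo hi lo' hi'" shows "cc lo' v \<subseteq> cc lo v"
proof
  fix u assume "u \<in> cc lo' v"
  then show "u \<in> cc lo v"
    by (induction rule: cc_induct) (use alive_refined[OF assms] cc_alive cc_refl in blast)+
qed

text \<open>The budget for the binary searches of all levels together. An edge can be charged in two
  ways, by separation of its ends and by falling below the lower end at its head; each of them
  lowers one summand.\<close>

definition Psi :: "(nat \<Rightarrow> nat) \<Rightarrow> nat" where
  "Psi lo = card {c. alive lo c} + card {c \<in> {1..m}. rk (lo (H c)) < rk c}"

text \<open>The edges that die in a refinement: those whose ends are separated, and those that fall below the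
  new lower end at their head. The potential \<open>Psi\<close> pays for them.\<close>
definition D1 :: "nat set \<Rightarrow> (nat \<Rightarrow> nat) \<Rightarrow> (nat \<Rightarrow> nat) \<Rightarrow> nat set" where
  "D1 S lo hi = {c. alive lo c \<and> nlo S lo hi (T c) \<noteq> nlo S lo hi (H c)}"

definition D3 :: "nat set \<Rightarrow> (nat \<Rightarrow> nat) \<Rightarrow> (nat \<Rightarrow> nat) \<Rightarrow> nat set" where
  "D3 S lo hi = {c \<in> {1..m}. rk (lo (H c)) < rk c \<and> rk c \<le> rk (nlo S lo hi (H c))}"

lemma finite_alive [simp]: "finite {c. alive lo c}" "finite {c. alive lo c \<and> P c}"
  by (rule finite_subset[of _ "{1..m}"]; auto simp: alive_def)+

lemma Psi_refined:
  assumes g: "good lo hi" and r: "refined S lo hi lo' hi'"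
  shows "Psi lo' + card (D1 S lo hi) + card (D3 S lo hi) \<le> Psi lo"
proof -
  have mono: "rk (lo v) \<le> rk (lo' v)" for v
    using r nlo_props(4)[OF g] by (cases "v \<in> VV") (auto simp: refined_def)
  have "card {c. alive lo' c} + card (D1 S lo hi) = card ({c. alive lo' c} \<union> D1 S lo hi)"
    using r VV_edge by (intro card_Un_disjoint[symmetric]) (auto simp: D1_def alive_def refined_def)
  also have "\<dots> \<le> card {c. alive lo c}"
    using alive_refined[OF g r] by (intro card_mono) (auto simp: D1_def)
  finally have 1: "card {c. alive lo' c} + card (D1 S lo hi) \<le> card {c. alive lo c}" .
  have "card {c \<in> {1..m}. rk (lo' (H c)) < rk c} + card (D3 S lo hi) =
    card ({c \<in> {1..m}. rk (lo' (H c)) < rk c} \<union> D3 S lo hi)"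
    using r VV_edge(2) by (intro card_Un_disjoint[symmetric]) (auto simp: D3_def refined_def)
  also have "\<dots> \<le> card {c \<in> {1..m}. rk (lo (H c)) < rk c}"
    using mono by (intro card_mono) (auto simp: D3_def intro: le_less_trans)
  finally show ?thesis using 1 by (simp add: Psi_def)
qed

lemma Psi_le: "Psi lo \<le> 2 * m"
proof -
  have "card {c. alive lo c} \<le> card {1..m}" by (intro card_mono) (auto simp: alive_def)
  moreover have "card {c \<in> {1..m}. rk (lo (H c)) < rk c} \<le> card {1..m}" by (intro card_mono) auto
  ultimately show ?thesis by (simp add: Psi_def)
qed

text \<open>A bottleneck value above the lower end is the rank of some edge that enters the
  component. If all edges are thresholds, the new lower end therefore is the value itself.\<close>

lemma nlo_complete:
  assumes g: "good lo hi" and S: "{1..m} \<subseteq> S" and v: "v \<in> VV"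
  shows "rk (nlo S lo hi v) = B v"
proof (cases "B v = rk (lo v)")
  case True
  then show ?thesis using nlo_props(2)[OF g, of S v] nlo_props(4)[OF g, of v S] by (metis le_antisym)
next
  case False
  then have lt: "rk (lo v) < B v" using goodD(3)[OF g, of v] by simp
  then have ns: "v \<noteq> s" using goodD(5)[OF g] by (cases "v = s") auto
  have hi: "B v < rk (hi v)" using goodD(4)[OF g v ns] .
  \<comment> \<open>The second disjunct is false at \<open>v\<close> and only carries the induction:
    as long as no edge of rank exactly \<open>B v\<close> has been met, every vertex on the way has
    a value above \<open>B v\<close>.\<close>
  have "(\<exists>c\<in>{1..m}. H c \<in> cc lo v \<and> rk c = B v) \<or> Suc (B v) \<le> B v"
  proof (rule comp_induct[OF g _ lt, where v = v and P = "\<lambda>x. (\<exists>c\<in>{1..m}. H c \<in> cc lo v \<and> rk c = B v) \<or> Suc (B v) \<le> B x"])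
    fix u assume u: "u \<in> cc lo v" "hh lo u \<noteq> 0" "B v \<le> rk (hh lo u)"
    then show "(\<exists>c\<in>{1..m}. H c \<in> cc lo v \<and> rk c = B v) \<or> Suc (B v) \<le> B u"
      using hh_le_B[OF g u(2)] by (cases "B v = rk (hh lo u)") (metis, linarith)
  next
    fix c assume c: "alive lo c" "T c \<in> cc lo v" "H c \<in> cc lo v" "B v \<le> rk c"
      "(\<exists>c\<in>{1..m}. H c \<in> cc lo v \<and> rk c = B v) \<or> Suc (B v) \<le> B (T c)"
    then show "(\<exists>c\<in>{1..m}. H c \<in> cc lo v \<and> rk c = B v) \<or> Suc (B v) \<le> B (H c)"
      using B_edge[of c] by (cases "B v = rk c") (auto simp: alive_def)
  qed auto
  then obtain c where "c \<in> {1..m}" "H c \<in> cc lo v" "rk c = B v" by auto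
  then have "c \<in> keys S lo hi v" using lt hi S by (auto simp: keys_def)
  then have "rk c \<le> rk (nlo S lo hi v)" using nlo_props(3)[OF g, of c S v] \<open>rk c = B v\<close> by simp
  then show ?thesis using nlo_props(2)[OF g, of S v] \<open>rk c = B v\<close> by simp
qed

text \<open>The ends \<open>a\<close> and \<open>b\<close> are arbitrary because the next interval
  depends on the sample; a union bound has to run over all candidates fixed before the draw.\<close>

definition win :: "(nat \<Rightarrow> nat) \<Rightarrow> nat \<Rightarrow> nat \<Rightarrow> nat \<Rightarrow> nat set" where
  "win lo v a b = {c \<in> {1..m}. H c \<in> cc lo v \<and> a < rk c \<and> rk c < b}"

definition sz_le :: "(nat \<Rightarrow> nat) \<Rightarrow> (nat \<Rightarrow> nat) \<Rightarrow> nat \<Rightarrow> bool" where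
  "sz_le lo hi N \<longleftrightarrow> (\<forall>v\<in>VV. card (win lo v (rk (lo v)) (rk (hi v))) \<le> N)"

text \<open>A new interval has no sampled edge strictly inside, and its component lies in an old
  one. A window of more than \<open>N\<close> edges would have been hit.\<close>

lemma sz_refined:
  assumes g: "good lo hi" and r: "refined S lo hi lo' hi'"
    and hit: "\<And>v a b. v \<in> VV \<Longrightarrow> a \<le> Suc m \<Longrightarrow> b \<le> Suc m \<Longrightarrow> N < card (win lo v a b) \<Longrightarrow> win lo v a b \<inter> S \<noteq> {}"
  shows "sz_le lo' hi' N"
  unfolding sz_le_def
proof (rule ballI, rule ccontr)
  fix v assume v: "v \<in> VV" and "\<not> card (win lo' v (rk (lo' v)) (rk (hi' v))) \<le> N"
  moreover have "card (win lo' v (rk (lo' v)) (rk (hi' v))) \<le> card (win lo v (rk (lo' v)) (rk (hi' v)))"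
    using cc_refined[OF g r] by (intro card_mono) (auto simp: win_def)
  ultimately have "N < card (win lo v (rk (lo' v)) (rk (hi' v)))" by simp
  moreover have g': "good lo' hi'" by (rule good_refined[OF g r])
  moreover have "rk (lo' v) \<le> Suc m" "rk (hi' v) \<le> Suc m" using goodD(1,2)[OF g'] rk_le by auto
  ultimately obtain c where c: "c \<in> win lo v (rk (lo' v)) (rk (hi' v))" "c \<in> S"
    using hit[OF v, of "rk (lo' v)" "rk (hi' v)"] by auto
  have n: "lo' v = nlo S lo hi v" "hi' v = nhi S lo hi v" using r v by (auto simp: refined_def)
  have "c \<in> keys S lo hi v"
    using c nlo_props(4)[OF g, of v S] nhi_props(4)[OF g, of S v] by (auto simp: win_def keys_def n)
  then show False
    using nlo_props(3)[OF g, of c S v] nhi_props(3)[OF g, of c S v] c(1) unfolding win_def n by fastforce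
qed

end

section \<open>A search order whose colour changes are paid for by alive edges\<close>

section \<open>The search order of a component\<close>

text \<open>The colour of a vertex will be the bucket of its bottleneck value; a change of colour is
  a place where the guess taken over from the predecessor may be wrong.\<close>

fun bd :: "(nat \<Rightarrow> nat) \<Rightarrow> nat list \<Rightarrow> nat" where
  "bd col (x # y # xs) = (if col x = col y then 0 else 1) + bd col (y # xs)"
| "bd col xs = 0"

lemma bd_append: "bd col (xs @ [a] @ ys) = bd col (xs @ [a]) + bd col (a # ys)"
  by (induction col xs rule: bd.induct) auto

text \<open>Only the pairs around the insertion point change, and an element of the same colour as
  \<open>a\<close> adds nothing there.\<close>

lemma bd_insert: "bd col (xs @ [a] @ x # ys) \<le> bd col (xs @ [a] @ ys) + (if col a = col x then 0 else 2)"
  using bd_append[of col xs a "x # ys"] bd_append[of col xs a ys] by (cases ys) auto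

context net
begin

definition ismax :: "nat set \<Rightarrow> nat \<Rightarrow> bool" where
  "ismax A x \<longleftrightarrow> (A = {} \<and> x = 0) \<or> (x \<in> A \<and> (\<forall>c\<in>A. rk c \<le> rk x))"

definition key :: "nat set \<Rightarrow> (nat \<Rightarrow> nat) \<Rightarrow> (nat \<Rightarrow> nat) \<Rightarrow> nat \<Rightarrow> bool" where
  "key S lo hi c \<longleftrightarrow> c \<in> {1..m} \<and> c \<in> S \<and> rk (lo (H c)) < rk c \<and> rk c < rk (hi (H c))"

text \<open>\<open>os\<close> holds the vertices already popped, the last of them being scanned,
  \<open>ss\<close> the stack with its top first, and \<open>U0\<close> the vertices visited
  earlier. \<open>X1\<close> and \<open>X2\<close> are the out-edges and in-edges of the scanned
  vertex that are still pending. The last clause charges colour changes in \<open>os @ ss\<close> to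
  bichromatic alive edges. It quantifies over all colourings because the one that matters, the final
  buckets, involves thresholds that the search is still collecting.\<close>

definition srch :: "(nat \<Rightarrow> nat) \<Rightarrow> (nat \<Rightarrow> nat) \<Rightarrow> nat set \<Rightarrow> nat set \<Rightarrow> nat \<Rightarrow> nat set \<Rightarrow> nat set \<Rightarrow>
    nat list \<Rightarrow> nat list \<Rightarrow> nat set \<Rightarrow> (nat \<Rightarrow> nat) \<Rightarrow> nat \<Rightarrow> (nat \<Rightarrow> nat) \<Rightarrow> bool" where
  "srch lo hi S U0 r X1 X2 os ss Vs Tf p hf \<longleftrightarrow>
     distinct (os @ ss) \<and> set (os @ ss) \<subseteq> cc lo r \<and> Vs = U0 \<union> set (os @ ss) \<and> U0 \<inter> cc lo r = {} \<and> r \<in> set (os @ ss) \<and>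
     (\<forall>c. alive lo c \<and> T c \<in> set os \<and> c \<notin> X1 \<longrightarrow> H c \<in> set (os @ ss)) \<and>
     (\<forall>c. alive lo c \<and> H c \<in> set os \<and> c \<notin> X2 \<longrightarrow> T c \<in> set (os @ ss)) \<and>
     Tf ` {1..p} = {c. key S lo hi c \<and> H c \<in> set os \<and> c \<notin> X2} \<and> inj_on Tf {1..p} \<and>
     (\<forall>v\<in>set os. ismax {c. src lo c \<and> H c = v \<and> c \<notin> X2} (hf v)) \<and>
     (\<forall>col::nat \<Rightarrow> nat. bd col (os @ ss) \<le> 2 * card {c. alive lo c \<and> T c \<in> set (os @ ss) \<and> H c \<in> set (os @ ss) \<and> col (T c) \<noteq> col (H c)})"

lemma srchI:
  assumes "distinct (os @ ss)" "set (os @ ss) \<subseteq> cc lo r" "Vs = U0 \<union> set (os @ ss)" "U0 \<inter> cc lo r = {}" "r \<in> set (os @ ss)"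
    "\<And>c. alive lo c \<Longrightarrow> T c \<in> set os \<Longrightarrow> c \<notin> X1 \<Longrightarrow> H c \<in> set (os @ ss)"
    "\<And>c. alive lo c \<Longrightarrow> H c \<in> set os \<Longrightarrow> c \<notin> X2 \<Longrightarrow> T c \<in> set (os @ ss)"
    "Tf ` {1..p} = {c. key S lo hi c \<and> H c \<in> set os \<and> c \<notin> X2}" "inj_on Tf {1..p}"
    "\<And>v. v \<in> set os \<Longrightarrow> ismax {c. src lo c \<and> H c = v \<and> c \<notin> X2} (hf v)"
    "\<And>col::nat \<Rightarrow> nat. bd col (os @ ss) \<le> 2 * card {c. alive lo c \<and> T c \<in> set (os @ ss) \<and> H c \<in> set (os @ ss) \<and> col (T c) \<noteq> col (H c)}"
  shows "srch lo hi S U0 r X1 X2 os ss Vs Tf p hf"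
  unfolding srch_def by (intro conjI allI impI ballI; (elim conjE)?; rule assms; assumption?)

lemma srchD:
  assumes "srch lo hi S U0 r X1 X2 os ss Vs Tf p hf"
  shows "distinct (os @ ss)" "set (os @ ss) \<subseteq> cc lo r" "Vs = U0 \<union> set (os @ ss)" "U0 \<inter> cc lo r = {}" "r \<in> set (os @ ss)"
    "\<And>c. alive lo c \<Longrightarrow> T c \<in> set os \<Longrightarrow> c \<notin> X1 \<Longrightarrow> H c \<in> set (os @ ss)"
    "\<And>c. alive lo c \<Longrightarrow> H c \<in> set os \<Longrightarrow> c \<notin> X2 \<Longrightarrow> T c \<in> set (os @ ss)"
    "Tf ` {1..p} = {c. key S lo hi c \<and> H c \<in> set os \<and> c \<notin> X2}" "inj_on Tf {1..p}"
    "\<And>v. v \<in> set os \<Longrightarrow> ismax {c. src lo c \<and> H c = v \<and> c \<notin> X2} (hf v)"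
    "\<And>col::nat \<Rightarrow> nat. bd col (os @ ss) \<le> 2 * card {c. alive lo c \<and> T c \<in> set (os @ ss) \<and> H c \<in> set (os @ ss) \<and> col (T c) \<noteq> col (H c)}"
  using assms unfolding srch_def by (blast | elim conjE)+

lemma srch_init:
  "U0 \<inter> cc lo r = {} \<Longrightarrow> srch lo hi S U0 r {} {} [] [r] (insert r U0) Tf 0 hf"
  by (auto simp: srch_def)

text \<open>Popping moves the border between \<open>os\<close> and \<open>ss\<close> and leaves
  \<open>os @ ss\<close> unchanged, so the colour clause carries over. All edges at \<open>a\<close>
  become pending, which exempts them from the closure clauses for the moment.\<close>

lemma srch_pop:
  assumes "srch lo hi S U0 r {} {} os (a # ss) Vs Tf p hf"
  shows "srch lo hi S U0 r {c \<in> {1..m}. T c = a} {c \<in> {1..m}. H c = a} (os @ [a]) ss Vs Tf p (hf(a := 0))"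
proof -
  have 1: "{c. key S lo hi c \<and> H c \<in> set (os @ [a]) \<and> c \<notin> {c \<in> {1..m}. H c = a}} = {c. key S lo hi c \<and> H c \<in> set os \<and> c \<notin> {}}"
    using assms by (auto simp: srch_def key_def)
  have 2: "ismax {c. src lo c \<and> H c = v \<and> c \<notin> {c \<in> {1..m}. H c = a}} ((hf(a := 0)) v)" if "v \<in> set (os @ [a])" for v
  proof (cases "v = a")
    case True
    then show ?thesis by (auto simp: ismax_def src_def)
  next
    case False
    then have "{c. src lo c \<and> H c = v \<and> c \<notin> {c \<in> {1..m}. H c = a}} = {c. src lo c \<and> H c = v \<and> c \<notin> {}}" by auto
    then show ?thesis using assms that False by (auto simp: srch_def)
  qed
  show ?thesis using assms unfolding srch_def 1
    by (intro conjI allI ballI) (use 2 in \<open>auto simp: alive_def\<close>)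
qed

lemma srch_Vs: "srch lo hi S U0 r X1 X2 os ss Vs Tf p hf \<Longrightarrow> x \<in> Vs \<Longrightarrow> x \<in> cc lo r \<Longrightarrow> x \<in> set (os @ ss)"
  by (auto simp: srch_def)

lemma srch_cc:
  assumes "srch lo hi S U0 r X1 X2 (os @ [a]) ss Vs Tf p hf" "alive lo c" "{T c, H c} = {a, x}"
  shows "x \<in> cc lo r"
proof -
  have "a \<in> cc lo r" using assms(1) by (auto simp: srch_def)
  then show ?thesis using cc_alive[OF assms(2), of r] assms(3) by (auto simp: doubleton_eq_iff)
qed

text \<open>The new vertex lands on top of the stack and thus directly behind \<open>a\<close> in
  \<open>os @ ss\<close>. A difference of colours costs at most two changes and is charged to
  \<open>c\<close>, which enters the counted set only now, because its end \<open>x\<close> is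
  new.\<close>

lemma srch_push:
  assumes s: "srch lo hi S U0 r X1 X2 (os @ [a]) ss Vs Tf p hf" and c: "alive lo c" "{T c, H c} = {a, x}" and x: "x \<notin> Vs"
  shows "srch lo hi S U0 r X1 X2 (os @ [a]) (x # ss) (insert x Vs) Tf p hf"
proof -
  have xc: "x \<in> cc lo r" by (rule srch_cc[OF s c])
  have bdc: "bd col ((os @ [a]) @ x # ss) \<le> 2 * card {c. alive lo c \<and> T c \<in> set ((os @ [a]) @ x # ss) \<and> H c \<in> set ((os @ [a]) @ x # ss) \<and> col (T c) \<noteq> col (H c)}" (is "_ \<le> 2 * card ?B") for col
  proof -
    let ?A = "{c. alive lo c \<and> T c \<in> set ((os @ [a]) @ ss) \<and> H c \<in> set ((os @ [a]) @ ss) \<and> col (T c) \<noteq> col (H c)}"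
    have bs: "bd col ((os @ [a]) @ ss) \<le> 2 * card ?A" using s by (simp add: srch_def)
    have "bd col ((os @ [a]) @ x # ss) \<le> bd col ((os @ [a]) @ ss) + (if col a = col x then 0 else 2)"
      using bd_insert[of col os a x ss] by simp
    moreover have "card ?A + (if col a = col x then 0 else 1) \<le> card ?B"
    proof (cases "col a = col x")
      case True
      then show ?thesis by (auto intro!: card_mono)
    next
      case False
      have xA: "x \<notin> set ((os @ [a]) @ ss)" using s x by (auto simp: srch_def)
      then have "c \<notin> ?A" using c(2) by (auto simp: doubleton_eq_iff)
      moreover have "insert c ?A \<subseteq> ?B" using c False by (auto simp: doubleton_eq_iff)
      then have "card (insert c ?A) \<le> card ?B" by (rule card_mono[rotated]) simp
      ultimately show ?thesis using False by simp
    qed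
    ultimately show ?thesis using bs by (auto split: if_splits)
  qed
  have xA: "x \<notin> set ((os @ [a]) @ ss)" using s x by (auto simp: srch_def)
  show ?thesis using s xc xA bdc unfolding srch_def by (intro conjI allI) auto
qed

lemma srch_X1:
  assumes s: "srch lo hi S U0 r X1 X2 os ss Vs Tf p hf" and c: "alive lo c \<Longrightarrow> T c \<in> set os \<Longrightarrow> H c \<in> Vs"
  shows "srch lo hi S U0 r (X1 - {c}) X2 os ss Vs Tf p hf"
proof -
  have "H c \<in> set (os @ ss)" if "alive lo c" "T c \<in> set os"
    using srch_Vs[OF s c[OF that]] cc_alive[OF that(1), of r] s that by (auto simp: srch_def)
  then show ?thesis using s unfolding srch_def by (intro conjI allI) auto
qed

text \<open>Finishing an in-edge has three effects: the tail of an alive edge must be marked by now,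
  a source edge may become the best one of its head, and a sampled edge in the interval joins the
  thresholds.\<close>

lemma srch_X2:
  assumes s: "srch lo hi S U0 r X1 X2 os ss Vs Tf p hf"
    and c: "c \<in> X2" "c \<in> {1..m}" "H c = a" "a \<in> set os" "alive lo c \<Longrightarrow> T c \<in> Vs"
    and hf': "hf' = (if src lo c \<and> rk (hf a) < rk c then hf(a := c) else hf)"
    and T': "Tf' = (if key S lo hi c then Tf(p + 1 := c) else Tf)" "p' = (if key S lo hi c then p + 1 else p)"
  shows "srch lo hi S U0 r X1 (X2 - {c}) os ss Vs Tf' p' hf'"
proof -
  have 1: "T c \<in> set (os @ ss)" if "alive lo c"
    using srch_Vs[OF s c(5)[OF that]] cc_alive[OF that(1), of r] s that c by (auto simp: srch_def)
  have 2: "{d. key S lo hi d \<and> H d \<in> set os \<and> d \<notin> X2 - {c}} =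
     (if key S lo hi c then insert c {d. key S lo hi d \<and> H d \<in> set os \<and> d \<notin> X2} else {d. key S lo hi d \<and> H d \<in> set os \<and> d \<notin> X2})"
    using c by auto
  have img: "Tf ` {1..p} = {d. key S lo hi d \<and> H d \<in> set os \<and> d \<notin> X2}" and inj: "inj_on Tf {1..p}" using s by (auto simp: srch_def)
  have i: "{1..p + 1} = insert (p + 1) {1..p}" by auto
  have 3: "Tf' ` {1..p'} = {d. key S lo hi d \<and> H d \<in> set os \<and> d \<notin> X2 - {c}}"
  proof (cases "key S lo hi c")
    case True
    have "(Tf(p + 1 := c)) ` {1..p} = Tf ` {1..p}" by (intro image_cong) auto
    then have "(Tf(p + 1 := c)) ` {1..p + 1} = insert c (Tf ` {1..p})"
      unfolding i image_insert by (simp only: fun_upd_same)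
    then show ?thesis using True unfolding 2 T' img by (simp only: if_True)
  next
    case False
    then show ?thesis unfolding 2 T' by (simp only: if_False img)
  qed
  have 4: "inj_on Tf' {1..p'}"
  proof (cases "key S lo hi c")
    case True
    have 1: "c \<notin> Tf ` {1..p}" unfolding img using c(1) by blast
    have 2: "(Tf(p + 1 := c)) ` {1..p} = Tf ` {1..p}" by (intro image_cong) auto
    have 3: "inj_on (Tf(p + 1 := c)) {1..p}"
      using inj by (subst inj_on_cong[where g = Tf]) auto
    have 4: "{1..p} - {p + 1} = {1..p}" by auto
    have "inj_on (Tf(p + 1 := c)) {1..p + 1}"
      unfolding i inj_on_insert 4 2 fun_upd_same using 1 3 by blast
    then show ?thesis using True by (simp only: T' if_True)
  next
    case False
    then show ?thesis by (simp only: T' if_False inj)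
  qed
  have 5: "ismax {d. src lo d \<and> H d = v \<and> d \<notin> X2 - {c}} (hf' v)" if v: "v \<in> set os" for v
  proof -
    have old: "ismax {d. src lo d \<and> H d = v \<and> d \<notin> X2} (hf v)" using s v by (simp add: srch_def)
    show ?thesis
    proof (cases "v = a \<and> src lo c")
      case False
      then have "{d. src lo d \<and> H d = v \<and> d \<notin> X2 - {c}} = {d. src lo d \<and> H d = v \<and> d \<notin> X2}"
        using c by auto
      then show ?thesis using old False by (auto simp: hf')
    next
      case True
      then have e: "{d. src lo d \<and> H d = v \<and> d \<notin> X2 - {c}} = insert c {d. src lo d \<and> H d = v \<and> d \<notin> X2}"
        using c by auto
      have pos: "0 < rk c" using rk_edge[OF c(2)] by simp
      show ?thesis unfolding e hf' using old True pos by (auto simp: ismax_def)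
    qed
  qed
  have 6: "T d \<in> set (os @ ss)" if "alive lo d" "H d \<in> set os" "d \<notin> X2 - {c}" for d
  proof (cases "d = c")
    case False
    then show ?thesis using s that unfolding srch_def by blast
  qed (use 1 that in blast)
  show ?thesis
    by (rule srchI) (fact srchD[OF s] 3 4 5 6)+
qed

text \<open>With an empty stack and no pending edges, \<open>os\<close> is closed under alive edges
  in both directions and therefore is the whole component.\<close>

lemma srch_done:
  assumes g: "good lo hi" and s: "srch lo hi S U0 r {} {} os [] Vs Tf p hf"
  shows "set os = cc lo r" "distinct os" "Vs = U0 \<union> cc lo r" "Tf ` {1..p} = keys S lo hi r" "inj_on Tf {1..p}"
    "p = card (keys S lo hi r)" "\<And>v. v \<in> cc lo r \<Longrightarrow> hf v = hh lo v"
    "\<And>col::nat \<Rightarrow> nat. bd col os \<le> 2 * card {c. alive lo c \<and> T c \<in> cc lo r \<and> H c \<in> cc lo r \<and> col (T c) \<noteq> col (H c)}"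
proof -
  have "u \<in> set os" if "u \<in> cc lo r" for u
    using that by (induction rule: cc_induct) (use s in \<open>auto simp: srch_def\<close>)
  then show os: "set os = cc lo r" using s by (auto simp: srch_def)
  show "distinct os" "Vs = U0 \<union> cc lo r" "inj_on Tf {1..p}" using s os by (auto simp: srch_def)
  have lh: "lo v = lo r" "hi v = hi r" if "v \<in> cc lo r" for v using that cc_lo cc_hi[OF g] by blast+
  have "Tf ` {1..p} = {c. key S lo hi c \<and> H c \<in> cc lo r}"
    using s unfolding srch_def os by blast
  also have "\<dots> = keys S lo hi r"
    unfolding key_def keys_def by (intro Collect_cong) (metis lh)
  finally show img: "Tf ` {1..p} = keys S lo hi r" .
  show "p = card (keys S lo hi r)"
    using card_image[OF \<open>inj_on Tf {1..p}\<close>] img by simp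
  show "hf v = hh lo v" if "v \<in> cc lo r" for v
  proof -
    have *: "ismax {c. src lo c \<and> H c = v} (hf v)" using s os that by (auto simp: srch_def)
    then show ?thesis unfolding ismax_def
    proof (elim disjE conjE)
      assume "{c. src lo c \<and> H c = v} = {}" "hf v = 0"
      then show ?thesis using hh_eq_0[of lo v] by auto
    next
      assume "hf v \<in> {c. src lo c \<and> H c = v}" "\<forall>c\<in>{c. src lo c \<and> H c = v}. rk c \<le> rk (hf v)"
      then show ?thesis by (intro hh_eqI[symmetric]) auto
    qed
  qed
  show "bd col os \<le> 2 * card {c. alive lo c \<and> T c \<in> cc lo r \<and> H c \<in> cc lo r \<and> col (T c) \<noteq> col (H c)}" for col :: "nat \<Rightarrow> nat"
    using srchD(11)[OF s, of col] by (simp add: os)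
qed

lemma srch_bounds:
  assumes "srch lo hi S U0 r X1 X2 os ss Vs Tf p hf"
  shows "length os + length ss \<le> card (cc lo r)" "p \<le> m"
proof -
  have f: "finite (cc lo r)" by (rule finite_subset[OF cc_subset_VV]) (simp add: VV_def)
  have "length (os @ ss) = card (set (os @ ss))" using assms by (intro distinct_card[symmetric]) (simp add: srch_def)
  also have "\<dots> \<le> card (cc lo r)" using assms f by (intro card_mono) (auto simp: srch_def)
  finally show "length os + length ss \<le> card (cc lo r)" by simp
  have "inj_on Tf {1..p}" using assms by (simp add: srch_def)
  from card_image[OF this] have "p = card (Tf ` {1..p})" by simp
  also have "\<dots> \<le> card {1..m}" using assms by (intro card_mono) (auto simp: srch_def key_def)
  finally show "p \<le> m" by simp
qed

section \<open>Adjacency lists as chains of descending codes, ended by the code 0\<close>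

definition prv :: "(nat \<Rightarrow> nat) \<Rightarrow> nat \<Rightarrow> nat \<Rightarrow> nat" where
  "prv F c v = Max (insert 0 {d \<in> {1..m}. d < c \<and> F d = v})"

lemma prv_cases:
  obtains "prv F c v = 0" "{d \<in> {1..m}. d < c \<and> F d = v} = {}"
  | "prv F c v \<in> {1..m}" "prv F c v < c" "F (prv F c v) = v"
    "\<And>d. d \<in> {1..m} \<Longrightarrow> d < c \<Longrightarrow> F d = v \<Longrightarrow> d \<le> prv F c v"
proof (cases "{d \<in> {1..m}. d < c \<and> F d = v} = {}")
  case True
  then show ?thesis using that(1) unfolding prv_def True by simp
next
  case False
  let ?A = "{d \<in> {1..m}. d < c \<and> F d = v}"
  have e: "prv F c v = Max ?A" unfolding prv_def using False by (subst Max_insert) auto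
  have "prv F c v \<in> ?A" unfolding e using False by (intro Max_in) auto
  moreover have "d \<le> prv F c v" if "d \<in> ?A" for d unfolding e using that by (intro Max_ge) auto
  ultimately show ?thesis using that(2) by auto
qed

lemma prv_le: "prv F c v \<le> m" by (cases rule: prv_cases[of F c v]) auto

lemma prv_iff:
  assumes "1 \<le> d" "d \<le> m" "F d = v"
  shows "d \<le> prv F c v \<longleftrightarrow> d < c"
proof (cases rule: prv_cases[of F c v])
  case 1
  then have "d \<notin> {d \<in> {1..m}. d < c \<and> F d = v}" by blast
  then show ?thesis using assms 1(1) by simp
next
  case 2
  then show ?thesis using assms 2(4)[of d] by fastforce
qed

lemma prv_set: "{d. 1 \<le> d \<and> d \<le> prv F c v \<and> F d = v} = {d. 1 \<le> d \<and> d \<le> m \<and> d < c \<and> F d = v}"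
  using prv_iff[of _ F v c] prv_le[of F c v] by (intro Collect_cong) (metis le_trans)

text \<open>The pending edges at code \<open>c\<close> are those of code at most \<open>c\<close> in
  the list; removing \<open>c\<close> leaves exactly those up to its successor in the chain.\<close>

lemma prv_step:
  assumes "c \<le> m" "F c = v"
  shows "{d. 1 \<le> d \<and> d \<le> c \<and> F d = v} - {c} = {d. 1 \<le> d \<and> d \<le> prv F c v \<and> F d = v}"
proof -
  have "x \<le> c \<and> x \<noteq> c \<longleftrightarrow> x \<le> m \<and> x < c" for x using assms(1) by linarith
  then show ?thesis unfolding prv_set by blast
qed

lemma prv_top: "{d. 1 \<le> d \<and> d \<le> prv F (Suc m) v \<and> F d = v} = {d \<in> {1..m}. F d = v}"
proof -
  have "x \<le> m \<and> x < Suc m \<longleftrightarrow> x \<le> m" for x by linarith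
  then show ?thesis unfolding prv_set atLeastAtMost_iff by blast
qed

lemma prv_valid: "prv F c v = 0 \<or> prv F c v \<in> {1..m} \<and> F (prv F c v) = v"
  by (cases rule: prv_cases[of F c v]) auto

end

section \<open>Buckets between consecutive thresholds, wrong guesses, and the invariant of the
  bucket search\<close>

section \<open>Threshold tables and the bucket search\<close>

text \<open>The number of binary searches that the placement of the sources performs; the guess
  \<open>g\<close> survives vertices without a source edge.\<close>

fun fails :: "(nat \<Rightarrow> nat) \<Rightarrow> (nat \<Rightarrow> nat) \<Rightarrow> nat \<Rightarrow> nat list \<Rightarrow> nat" where
  "fails hf loc g [] = 0"
| "fails hf loc g (v # vs) = (if hf v = 0 then fails hf loc g vs
     else (if loc v = g then 0 else 1) + fails hf loc (loc v) vs)"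

text \<open>\<open>fi\<close> gives the final buckets, and \<open>u\<close> is a reference vertex
  whose final bucket stands in for the guess. If every source landed in its final bucket, the
  failures would be changes of \<open>fi\<close>; a vertex with \<open>loc v \<noteq> fi v\<close>
  can spoil two comparisons, its own and the next one.\<close>

lemma fails_bound:
  assumes "distinct vs"
  shows "fails hf loc g vs \<le> (if g = fi u then 0 else 1) + bd fi (u # vs) + 2 * card {v \<in> set vs. hf v \<noteq> 0 \<and> loc v \<noteq> fi v}"
  using assms
proof (induction vs arbitrary: g u)
  case Nil
  then show ?case by simp
next
  case (Cons v vs)
  let ?c = "card {x \<in> set vs. hf x \<noteq> 0 \<and> loc x \<noteq> fi x}"
  have c: "card {x \<in> set (v # vs). hf x \<noteq> 0 \<and> loc x \<noteq> fi x} = (if hf v \<noteq> 0 \<and> loc v \<noteq> fi v then 1 else 0) + ?c"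
  proof (cases "hf v \<noteq> 0 \<and> loc v \<noteq> fi v")
    case True
    then have "{x \<in> set (v # vs). hf x \<noteq> 0 \<and> loc x \<noteq> fi x} = insert v {x \<in> set vs. hf x \<noteq> 0 \<and> loc x \<noteq> fi x}" by auto
    then show ?thesis using Cons.prems True by simp
  next
    case False
    then have "{x \<in> set (v # vs). hf x \<noteq> 0 \<and> loc x \<noteq> fi x} = {x \<in> set vs. hf x \<noteq> 0 \<and> loc x \<noteq> fi x}" by auto
    then show ?thesis using False by simp
  qed
  show ?case
    using Cons.IH[of g v] Cons.IH[of "loc v" v] Cons.prems unfolding c by (auto split: if_splits)
qed

lemma fails_0: "(\<And>v. v \<in> set vs \<Longrightarrow> hf v \<noteq> 0 \<Longrightarrow> loc v = g) \<Longrightarrow> fails hf loc g vs = 0"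
  by (induction vs) auto

context net
begin

text \<open>The old interval ends serve as sentinels at 0 and \<open>p + 1\<close>. Thus the buckets
  0 to \<open>p\<close> partition the interval, and a binary search always starts with a valid
  bracket.\<close>

definition tabl :: "(nat \<Rightarrow> nat) \<Rightarrow> (nat \<Rightarrow> nat) \<Rightarrow> nat set \<Rightarrow> nat \<Rightarrow> nat \<Rightarrow> (nat \<Rightarrow> nat) \<Rightarrow> bool" where
  "tabl lo hi S r p Tf \<longleftrightarrow> Tf ` {1..p} = keys S lo hi r \<and> Tf 0 = lo r \<and> Tf (p + 1) = hi r \<and>
     (\<forall>i j. i \<le> j \<and> j \<le> p + 1 \<longrightarrow> rk (Tf i) \<le> rk (Tf j))"

definition ix :: "nat \<Rightarrow> (nat \<Rightarrow> nat) \<Rightarrow> nat \<Rightarrow> nat" where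
  "ix p Tf r = Max (insert 0 {i. i \<le> p \<and> rk (Tf i) \<le> r})"

lemma ix_le: "ix p Tf r \<le> p"
  unfolding ix_def by (subst Max_le_iff) auto

lemma ix_ge: "i \<le> p \<Longrightarrow> rk (Tf i) \<le> r \<Longrightarrow> i \<le> ix p Tf r"
  unfolding ix_def by (intro Max_ge) auto

lemma ix_val: "rk (Tf 0) \<le> r \<Longrightarrow> rk (Tf (ix p Tf r)) \<le> r"
proof -
  assume 0: "rk (Tf 0) \<le> r"
  have "ix p Tf r \<in> insert 0 {i. i \<le> p \<and> rk (Tf i) \<le> r}" unfolding ix_def by (intro Max_in) auto
  then show ?thesis using 0 by auto
qed

lemma ix_mono: "r \<le> r' \<Longrightarrow> ix p Tf r \<le> ix p Tf r'"
  unfolding ix_def by (intro Max_mono) auto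

context
  fixes lo hi S r p Tf
  assumes g: "good lo hi" and tb: "tabl lo hi S r p Tf"
begin

lemma tb_mono: "i \<le> j \<Longrightarrow> j \<le> p + 1 \<Longrightarrow> rk (Tf i) \<le> rk (Tf j)"
  using tb unfolding tabl_def by blast

lemma tb_key: "1 \<le> i \<Longrightarrow> i \<le> p \<Longrightarrow> Tf i \<in> keys S lo hi r"
proof -
  assume "1 \<le> i" "i \<le> p"
  then have "Tf i \<in> Tf ` {1..p}" by simp
  then show ?thesis using tb by (simp add: tabl_def)
qed

lemma tb_0: "Tf 0 = lo r" and tb_top: "Tf (p + 1) = hi r"
  using tb by (auto simp: tabl_def)

lemma tb_code: "i \<le> p + 1 \<Longrightarrow> Tf i \<le> Suc m"
  using tb_key[of i] tb_0 tb_top goodD(1,2)[OF g] by (cases "i = 0"; cases "i = p + 1") (auto simp: keys_def)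

lemma tb_gt: "1 \<le> i \<Longrightarrow> i \<le> p \<Longrightarrow> rk (lo r) < rk (Tf i)"
  using tb_key[of i] by (simp add: keys_def)

lemma ix_unique:
  assumes "i \<le> p" "rk (Tf i) \<le> x" "x < rk (Tf (i + 1))" shows "ix p Tf x = i"
proof (rule antisym)
  show "i \<le> ix p Tf x" by (rule ix_ge[where Tf = Tf, OF assms(1,2)])
  show "ix p Tf x \<le> i"
  proof (rule ccontr)
    assume *: "\<not> ix p Tf x \<le> i"
    then have "rk (Tf (i + 1)) \<le> rk (Tf (ix p Tf x))" using tb_mono[of "i + 1" "ix p Tf x"] ix_le[of p Tf x] by simp
    moreover have "rk (Tf 0) \<le> x" using tb_mono[of 0 i] assms by simp
    ultimately show False using ix_val[of Tf x p] assms(3) by simp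
  qed
qed

lemma ix_next:
  assumes "x < rk (hi r)" shows "x < rk (Tf (ix p Tf x + 1))"
proof (rule ccontr)
  assume *: "\<not> ?thesis"
  show False
  proof (cases "ix p Tf x = p")
    case True
    then show ?thesis using * assms tb_top by simp
  next
    case False
    then have "ix p Tf x + 1 \<le> ix p Tf x" using ix_le[of p Tf x] * by (intro ix_ge) auto
    then show ?thesis by simp
  qed
qed

lemma nlo_ix: "v \<in> cc lo r \<Longrightarrow> nlo S lo hi v = Tf (ix p Tf (B v))"
proof -
  assume v: "v \<in> cc lo r"
  note K = keys_cc[OF g v, of S] and L = cc_lo[OF v]
  let ?i = "ix p Tf (B v)"
  have 0: "rk (Tf 0) \<le> B v" using tb_0 L goodD(3)[OF g, of v] by simp
  have "rk (nlo S lo hi v) = rk (Tf ?i)"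
  proof (rule antisym)
    have "nlo S lo hi v \<in> insert (Tf 0) (Tf ` {1..p})"
      using nlo_props(1)[OF g, of S v] tb unfolding K L tabl_def by simp
    then obtain j where j: "j \<le> p" "nlo S lo hi v = Tf j" by auto
    then have "j \<le> ?i" using nlo_props(2)[OF g, of S v] by (intro ix_ge) auto
    then show "rk (nlo S lo hi v) \<le> rk (Tf ?i)" using j tb_mono[of j ?i] ix_le[of p Tf "B v"] by simp
    show "rk (Tf ?i) \<le> rk (nlo S lo hi v)"
    proof (cases "?i = 0")
      case True
      then show ?thesis using nlo_props(4)[OF g, of v S] tb_0 L by simp
    next
      case False
      then have "Tf ?i \<in> keys S lo hi v" using tb_key[of ?i] ix_le[of p Tf "B v"] K by simp
      then show ?thesis using nlo_props(3)[OF g] ix_val[where Tf = Tf, of "B v" p, OF 0] by blast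
    qed
  qed
  then show ?thesis using rk_eq_iff[OF nlo_props(5)[OF g] tb_code] ix_le[of p Tf "B v"] by simp
qed

lemma nhi_ix: "v \<in> cc lo r \<Longrightarrow> v \<in> VV \<or> p = 0 \<Longrightarrow> nhi S lo hi v = Tf (ix p Tf (B v) + 1)"
proof -
  assume v: "v \<in> cc lo r" and vv: "v \<in> VV \<or> p = 0"
  note K = keys_cc[OF g v, of S] and Hi = cc_hi[OF g v]
  let ?i = "ix p Tf (B v)"
  have il: "?i \<le> p" by (rule ix_le)
  have ks: "keys S lo hi s = {}" using goodD(5)[OF g] rk_edge by (fastforce simp: keys_def)
  have 0: "rk (Tf 0) \<le> B v" using tb_0 cc_lo[OF v] goodD(3)[OF g, of v] by simp
  have "rk (nhi S lo hi v) = rk (Tf (?i + 1))"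
  proof (rule antisym)
    show "rk (nhi S lo hi v) \<le> rk (Tf (?i + 1))"
    proof (cases "?i = p")
      case True
      then show ?thesis using nhi_props(4)[OF g, of S v] tb_top Hi by simp
    next
      case False
      then have "Tf (?i + 1) \<in> keys S lo hi v" using tb_key[of "?i + 1"] il K by simp
      moreover have "B v < rk (Tf (?i + 1))"
      proof (rule ccontr)
        assume "\<not> B v < rk (Tf (?i + 1))"
        then have "?i + 1 \<le> ?i" using False il by (intro ix_ge) auto
        then show False by simp
      qed
      ultimately show ?thesis using nhi_props(3)[OF g] by blast
    qed
    have "nhi S lo hi v = hi r \<or> nhi S lo hi v \<in> keys S lo hi v"
      using nhi_props(1)[OF g, of S v] unfolding Hi insert_iff .
    then show "rk (Tf (?i + 1)) \<le> rk (nhi S lo hi v)"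
    proof
      assume "nhi S lo hi v = hi r"
      then show ?thesis using tb_mono[of "?i + 1" "p + 1"] tb_top il by simp
    next
      assume k: "nhi S lo hi v \<in> keys S lo hi v"
      then have ns: "v \<noteq> s" using ks by auto
      have "nhi S lo hi v \<in> Tf ` {1..p}" using k tb unfolding K tabl_def by simp
      then obtain j where j: "1 \<le> j" "j \<le> p" "nhi S lo hi v = Tf j" by auto
      then have "v \<in> VV" using vv by auto
      then have lt: "B v < rk (Tf j)" using nhi_props(2)[OF g _ ns, of S] j by simp
      have "?i < j"
      proof (rule ccontr)
        assume "\<not> ?i < j"
        then have "rk (Tf j) \<le> rk (Tf ?i)" using tb_mono[of j ?i] il by simp
        then show False using ix_val[where Tf = Tf, of "B v" p, OF 0] lt by simp
      qed
      then show ?thesis using tb_mono[of "?i + 1" j] j by simp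
    qed
  qed
  then show ?thesis using rk_eq_iff[OF nhi_props(5)[OF g] tb_code] il by simp
qed

text \<open>The search proceeds from bucket \<open>p\<close> downwards. The value
  \<open>fin v = 0\<close> means unsettled and at the same time is the right answer for bucket 0, so
  the search may stop before that bucket. The lists hold edge codes that stand for their heads, and
  stale entries with settled heads may remain. \<open>X\<close> contains the edges out of the vertex
  just settled that are still to be relaxed; for all other edges out of settled vertices, and for
  all sources, an entry is guaranteed, and the last clause makes every entry sound.\<close>

definition djk :: "nat set \<Rightarrow> nat \<Rightarrow> (nat \<Rightarrow> nat) \<Rightarrow> (nat \<Rightarrow> nat list) \<Rightarrow> bool" where
  "djk X i fin \<ll> \<longleftrightarrow> i \<le> p \<and>
     (\<forall>v\<in>cc lo r. fin v \<noteq> 0 \<longrightarrow> fin v = ix p Tf (B v) \<and> i \<le> fin v) \<and>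
     (\<forall>v\<in>cc lo r. i < ix p Tf (B v) \<longrightarrow> fin v \<noteq> 0) \<and>
     (\<forall>u\<in>cc lo r. hh lo u \<noteq> 0 \<longrightarrow> fin u = 0 \<longrightarrow> u \<in> H ` set (\<ll> (ix p Tf (rk (hh lo u)))) \<or> ix p Tf (rk (hh lo u)) = 0) \<and>
     (\<forall>c. alive lo c \<longrightarrow> T c \<in> cc lo r \<longrightarrow> fin (T c) \<noteq> 0 \<longrightarrow> c \<notin> X \<longrightarrow> fin (H c) = 0 \<longrightarrow>
        H c \<in> H ` set (\<ll> (min (fin (T c)) (ix p Tf (rk c)))) \<or> ix p Tf (rk c) = 0) \<and>
     (\<forall>j c. 1 \<le> j \<longrightarrow> c \<in> set (\<ll> j) \<longrightarrow> j \<le> i \<and> c \<in> {1..m} \<and> H c \<in> cc lo r \<and> j \<le> ix p Tf (B (H c)))"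

lemma djkI:
  assumes "i \<le> p" "\<And>v. v \<in> cc lo r \<Longrightarrow> fin v \<noteq> 0 \<Longrightarrow> fin v = ix p Tf (B v) \<and> i \<le> fin v"
    "\<And>v. v \<in> cc lo r \<Longrightarrow> i < ix p Tf (B v) \<Longrightarrow> fin v \<noteq> 0"
    "\<And>u. u \<in> cc lo r \<Longrightarrow> hh lo u \<noteq> 0 \<Longrightarrow> fin u = 0 \<Longrightarrow> ix p Tf (rk (hh lo u)) \<noteq> 0 \<Longrightarrow> u \<in> H ` set (\<ll> (ix p Tf (rk (hh lo u))))"
    "\<And>c. alive lo c \<Longrightarrow> T c \<in> cc lo r \<Longrightarrow> fin (T c) \<noteq> 0 \<Longrightarrow> c \<notin> X \<Longrightarrow> fin (H c) = 0 \<Longrightarrow> ix p Tf (rk c) \<noteq> 0 \<Longrightarrow>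
        H c \<in> H ` set (\<ll> (min (fin (T c)) (ix p Tf (rk c))))"
    "\<And>j c. 1 \<le> j \<Longrightarrow> c \<in> set (\<ll> j) \<Longrightarrow> j \<le> i \<and> c \<in> {1..m} \<and> H c \<in> cc lo r \<and> j \<le> ix p Tf (B (H c))"
  shows "djk X i fin \<ll>"
  unfolding djk_def using assms by blast

lemma djkD:
  assumes "djk X i fin \<ll>"
  shows "i \<le> p" "\<And>v. v \<in> cc lo r \<Longrightarrow> fin v \<noteq> 0 \<Longrightarrow> fin v = ix p Tf (B v) \<and> i \<le> fin v"
    "\<And>v. v \<in> cc lo r \<Longrightarrow> i < ix p Tf (B v) \<Longrightarrow> fin v \<noteq> 0"
    "\<And>u. u \<in> cc lo r \<Longrightarrow> hh lo u \<noteq> 0 \<Longrightarrow> fin u = 0 \<Longrightarrow> ix p Tf (rk (hh lo u)) \<noteq> 0 \<Longrightarrow> u \<in> H ` set (\<ll> (ix p Tf (rk (hh lo u))))"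
    "\<And>c. alive lo c \<Longrightarrow> T c \<in> cc lo r \<Longrightarrow> fin (T c) \<noteq> 0 \<Longrightarrow> c \<notin> X \<Longrightarrow> fin (H c) = 0 \<Longrightarrow> ix p Tf (rk c) \<noteq> 0 \<Longrightarrow>
        H c \<in> H ` set (\<ll> (min (fin (T c)) (ix p Tf (rk c))))"
    "\<And>j c. 1 \<le> j \<Longrightarrow> c \<in> set (\<ll> j) \<Longrightarrow> j \<le> i \<and> c \<in> {1..m} \<and> H c \<in> cc lo r \<and> j \<le> ix p Tf (B (H c))"
proof -
  have A: "i \<le> p"
    "(\<forall>v\<in>cc lo r. fin v \<noteq> 0 \<longrightarrow> fin v = ix p Tf (B v) \<and> i \<le> fin v)"
    "(\<forall>v\<in>cc lo r. i < ix p Tf (B v) \<longrightarrow> fin v \<noteq> 0)"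
    "(\<forall>u\<in>cc lo r. hh lo u \<noteq> 0 \<longrightarrow> fin u = 0 \<longrightarrow> u \<in> H ` set (\<ll> (ix p Tf (rk (hh lo u)))) \<or> ix p Tf (rk (hh lo u)) = 0)"
    "(\<forall>c. alive lo c \<longrightarrow> T c \<in> cc lo r \<longrightarrow> fin (T c) \<noteq> 0 \<longrightarrow> c \<notin> X \<longrightarrow> fin (H c) = 0 \<longrightarrow>
        H c \<in> H ` set (\<ll> (min (fin (T c)) (ix p Tf (rk c)))) \<or> ix p Tf (rk c) = 0)"
    "(\<forall>j c. 1 \<le> j \<longrightarrow> c \<in> set (\<ll> j) \<longrightarrow> j \<le> i \<and> c \<in> {1..m} \<and> H c \<in> cc lo r \<and> j \<le> ix p Tf (B (H c)))"
    using assms unfolding djk_def by - (elim conjE, assumption)+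
  show "i \<le> p" using A(1) by metis
  show "\<And>v. v \<in> cc lo r \<Longrightarrow> fin v \<noteq> 0 \<Longrightarrow> fin v = ix p Tf (B v) \<and> i \<le> fin v" using A(2) by metis
  show "\<And>v. v \<in> cc lo r \<Longrightarrow> i < ix p Tf (B v) \<Longrightarrow> fin v \<noteq> 0" using A(3) by metis
  show "\<And>u. u \<in> cc lo r \<Longrightarrow> hh lo u \<noteq> 0 \<Longrightarrow> fin u = 0 \<Longrightarrow> ix p Tf (rk (hh lo u)) \<noteq> 0 \<Longrightarrow> u \<in> H ` set (\<ll> (ix p Tf (rk (hh lo u))))" using A(4) by metis
  show "\<And>c. alive lo c \<Longrightarrow> T c \<in> cc lo r \<Longrightarrow> fin (T c) \<noteq> 0 \<Longrightarrow> c \<notin> X \<Longrightarrow> fin (H c) = 0 \<Longrightarrow> ix p Tf (rk c) \<noteq> 0 \<Longrightarrow>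
        H c \<in> H ` set (\<ll> (min (fin (T c)) (ix p Tf (rk c))))" using A(5) by metis
  show "\<And>j c. 1 \<le> j \<Longrightarrow> c \<in> set (\<ll> j) \<Longrightarrow> j \<le> i \<and> c \<in> {1..m} \<and> H c \<in> cc lo r \<and> j \<le> ix p Tf (B (H c))" using A(6) by metis
qed

text \<open>A vertex of value at least \<open>rk (Tf i)\<close> is reached within the component from
  a source of that capacity over alive edges of that rank. Along this chain an unsettled vertex
  would have an entry in bucket \<open>i\<close> or above, but all of these buckets are
  empty.\<close>

lemma djk_dec:
  assumes d: "djk {} i fin \<ll>" and i: "1 \<le> i" and e: "\<ll> i = []"
  shows "djk {} (i - 1) fin \<ll>"
proof -
  note D = djkD[OF d]
  let ?t = "rk (Tf i)"
  have settled: "fin v \<noteq> 0" if v: "v \<in> cc lo r" "i \<le> ix p Tf (B v)" for v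
  proof (rule comp_induct[OF g v(1), where t = ?t and P = "\<lambda>x. fin x \<noteq> 0"])
    show "rk (lo r) < ?t" using tb_gt[OF i D(1)] .
    have "?t \<le> rk (Tf (ix p Tf (B v)))" using tb_mono[OF v(2)] ix_le[of p Tf "B v"] by simp
    also have "\<dots> \<le> B v" using tb_0 cc_lo[OF v(1)] goodD(3)[OF g, of v] ix_val[of Tf "B v" p] by simp
    finally show "?t \<le> B v" .
  next
    fix u assume u: "u \<in> cc lo r" "hh lo u \<noteq> 0" "?t \<le> rk (hh lo u)"
    have j: "i \<le> ix p Tf (rk (hh lo u))" by (rule ix_ge[where Tf = Tf, OF D(1) u(3)])
    show "fin u \<noteq> 0"
    proof
      assume "fin u = 0"
      then have "u \<in> H ` set (\<ll> (ix p Tf (rk (hh lo u))))" using D(4)[OF u(1,2)] j i by simp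
      then obtain c where "c \<in> set (\<ll> (ix p Tf (rk (hh lo u))))" by auto
      then show False using D(6)[of "ix p Tf (rk (hh lo u))" c] j i e by (cases "ix p Tf (rk (hh lo u)) = i") auto
    qed
  next
    fix c assume c: "alive lo c" "T c \<in> cc lo r" "?t \<le> rk c" "?t \<le> B (T c)" "fin (T c) \<noteq> 0"
    have j: "i \<le> ix p Tf (rk c)" "i \<le> fin (T c)" using ix_ge[where Tf = Tf, OF D(1) c(3)] D(2)[OF c(2,5)] by auto
    show "fin (H c) \<noteq> 0"
    proof
      assume "fin (H c) = 0"
      then have "H c \<in> H ` set (\<ll> (min (fin (T c)) (ix p Tf (rk c))))" using D(5)[OF c(1,2,5)] j i by simp
      then obtain x where "x \<in> set (\<ll> (min (fin (T c)) (ix p Tf (rk c))))" by auto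
      then show False using D(6)[of "min (fin (T c)) (ix p Tf (rk c))" x] j i e by (cases "min (fin (T c)) (ix p Tf (rk c)) = i") auto
    qed
  qed
  show ?thesis
  proof (rule djkI)
    show "j \<le> i - 1 \<and> c \<in> {1..m} \<and> H c \<in> cc lo r \<and> j \<le> ix p Tf (B (H c))" if "1 \<le> j" "c \<in> set (\<ll> j)" for j c
      using D(6)[OF that] that e by (cases "j = i") auto
    show "fin v = ix p Tf (B v) \<and> i - 1 \<le> fin v" if "v \<in> cc lo r" "fin v \<noteq> 0" for v
      using D(2)[OF that] by auto
    show "fin v \<noteq> 0" if "v \<in> cc lo r" "i - 1 < ix p Tf (B v)" for v
      using settled[OF that(1)] that(2) by simp
    show "i - 1 \<le> p" using D(1) by simp
  qed (fact D)+
qed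

lemma djk_skip:
  assumes d: "djk {} i fin \<ll>" and i: "1 \<le> i" and e: "\<ll> i = c # cs" "fin (H c) \<noteq> 0"
  shows "djk {} i fin (\<ll>(i := cs))"
proof (rule djkI)
  note D = djkD[OF d]
  have sub: "x \<in> H ` set ((\<ll>(i := cs)) j)" if "x \<in> H ` set (\<ll> j)" "fin x = 0" for x j
    using that e by (cases "j = i") auto
  show "u \<in> H ` set ((\<ll>(i := cs)) (ix p Tf (rk (hh lo u))))"
    if "u \<in> cc lo r" "hh lo u \<noteq> 0" "fin u = 0" "ix p Tf (rk (hh lo u)) \<noteq> 0" for u
    using sub[OF D(4)[OF that] that(3)] .
  show "H c \<in> H ` set ((\<ll>(i := cs)) (min (fin (T c)) (ix p Tf (rk c))))"
    if "alive lo c" "T c \<in> cc lo r" "fin (T c) \<noteq> 0" "c \<notin> {}" "fin (H c) = 0" "ix p Tf (rk c) \<noteq> 0" for c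
    using sub[OF D(5)[OF that] that(5)] .
  show "j \<le> i \<and> c \<in> {1..m} \<and> H c \<in> cc lo r \<and> j \<le> ix p Tf (B (H c))" if "1 \<le> j" "c \<in> set ((\<ll>(i := cs)) j)" for j c
    using D(6)[of j c] that e by (cases "j = i") auto
qed (fact djkD[OF d])+

text \<open>The Dijkstra argument: an entry guarantees at least bucket \<open>i\<close>, and every
  vertex of a higher bucket is settled already, so the head belongs to bucket \<open>i\<close>
  exactly.\<close>

lemma djk_settle:
  assumes d: "djk {} i fin \<ll>" and i: "1 \<le> i" and e: "\<ll> i = c # cs" "fin (H c) = 0"
  shows "djk {x \<in> {1..m}. T x = H c} i (fin(H c := i)) (\<ll>(i := cs))" "H c \<in> cc lo r" "ix p Tf (B (H c)) = i" "c \<in> {1..m}"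
proof -
  note D = djkD[OF d]
  have c: "c \<in> {1..m}" "H c \<in> cc lo r" "i \<le> ix p Tf (B (H c))" using D(6)[OF i, of c] e by auto
  then show "H c \<in> cc lo r" "c \<in> {1..m}" by auto
  show fi: "ix p Tf (B (H c)) = i" using D(3)[of "H c"] c e(2) by (metis le_neq_implies_less)
  have sub: "x \<in> H ` set ((\<ll>(i := cs)) j)" if "x \<in> H ` set (\<ll> j)" "x \<noteq> H c" for x j
    using that e by (cases "j = i") auto
  show "djk {x \<in> {1..m}. T x = H c} i (fin(H c := i)) (\<ll>(i := cs))"
  proof (rule djkI)
    show "i \<le> p" by (rule D(1))
    show "(fin(H c := i)) v = ix p Tf (B v) \<and> i \<le> (fin(H c := i)) v" if "v \<in> cc lo r" "(fin(H c := i)) v \<noteq> 0" for v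
      using D(2)[of v] that fi by (cases "v = H c") auto
    show "(fin(H c := i)) v \<noteq> 0" if "v \<in> cc lo r" "i < ix p Tf (B v)" for v
      using D(3)[OF that] i by auto
    show "u \<in> H ` set ((\<ll>(i := cs)) (ix p Tf (rk (hh lo u))))"
      if "u \<in> cc lo r" "hh lo u \<noteq> 0" "(fin(H c := i)) u = 0" "ix p Tf (rk (hh lo u)) \<noteq> 0" for u
    proof (rule sub)
      have "u \<noteq> H c" "fin u = 0" using that(3) i by (auto split: if_splits)
      then show "u \<noteq> H c" "u \<in> H ` set (\<ll> (ix p Tf (rk (hh lo u))))" using D(4)[OF that(1,2) _ that(4)] by auto
    qed
    show "H x \<in> H ` set ((\<ll>(i := cs)) (min ((fin(H c := i)) (T x)) (ix p Tf (rk x))))"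
      if "alive lo x" "T x \<in> cc lo r" "(fin(H c := i)) (T x) \<noteq> 0" "x \<notin> {x \<in> {1..m}. T x = H c}" "(fin(H c := i)) (H x) = 0" "ix p Tf (rk x) \<noteq> 0" for x
    proof (rule sub)
      have "x \<in> {1..m}" using that(1) by (simp add: alive_def)
      then have t: "T x \<noteq> H c" using that(4) by simp
      have h: "H x \<noteq> H c" "fin (H x) = 0" using that(5) i by (auto split: if_splits)
      then show "H x \<noteq> H c" "H x \<in> H ` set (\<ll> (min ((fin(H c := i)) (T x)) (ix p Tf (rk x))))"
        using D(5)[OF that(1,2) _ _ h(2) that(6)] that(3) t by auto
    qed
    show "j \<le> i \<and> x \<in> {1..m} \<and> H x \<in> cc lo r \<and> j \<le> ix p Tf (B (H x))" if "1 \<le> j" "x \<in> set ((\<ll>(i := cs)) j)" for j x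
      using D(6)[of j x] that e by (cases "j = i") auto
  qed
qed

lemma djk_edge_skip:
  assumes d: "djk X i fin \<ll>" and c: "alive lo c \<Longrightarrow> fin (H c) \<noteq> 0"
  shows "djk (X - {c}) i fin \<ll>"
proof (rule djkI)
  note D = djkD[OF d]
  show "H x \<in> H ` set (\<ll> (min (fin (T x)) (ix p Tf (rk x))))"
    if "alive lo x" "T x \<in> cc lo r" "fin (T x) \<noteq> 0" "x \<notin> X - {c}" "fin (H x) = 0" "ix p Tf (rk x) \<noteq> 0" for x
    using D(5)[OF that(1,2,3) _ that(5,6)] c that by (cases "x = c") auto
qed (fact djkD[OF d])+

text \<open>The new entry is sound because both the value of the tail and the rank of
  \<open>c\<close> reach the threshold \<open>Tf gg\<close>.\<close>

lemma djk_relax: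
  assumes d: "djk X i fin \<ll>" and i: "1 \<le> i" and c: "alive lo c" "T c \<in> cc lo r" "fin (T c) = i" "fin (H c) = 0"
    and gg: "gg = min i (ix p Tf (rk c))"
  shows "djk (X - {c}) i fin (\<ll>(gg := c # \<ll> gg))"
proof (rule djkI)
  note D = djkD[OF d]
  have sub: "x \<in> H ` set ((\<ll>(gg := c # \<ll> gg)) j)" if "x \<in> H ` set (\<ll> j)" for x j
    using that by auto
  show "u \<in> H ` set ((\<ll>(gg := c # \<ll> gg)) (ix p Tf (rk (hh lo u))))"
    if "u \<in> cc lo r" "hh lo u \<noteq> 0" "fin u = 0" "ix p Tf (rk (hh lo u)) \<noteq> 0" for u
    using sub[OF D(4)[OF that]] .
  show "H x \<in> H ` set ((\<ll>(gg := c # \<ll> gg)) (min (fin (T x)) (ix p Tf (rk x))))"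
    if "alive lo x" "T x \<in> cc lo r" "fin (T x) \<noteq> 0" "x \<notin> X - {c}" "fin (H x) = 0" "ix p Tf (rk x) \<noteq> 0" for x
  proof (cases "x = c")
    case True
    then show ?thesis using c(3) gg by simp
  next
    case False
    then show ?thesis using sub[OF D(5)[OF that(1,2,3) _ that(5,6)]] that(4) by simp
  qed
  have Hc: "H c \<in> cc lo r" using cc_alive[OF c(1)] c(2) by blast
  have cm: "c \<in> {1..m}" using c(1) by (simp add: alive_def)
  have fi: "ix p Tf (B (T c)) = i" using D(2)[OF c(2)] c(3) i by simp
  have lt: "rk (Tf 0) \<le> rk c" using c(1) tb_0 cc_lo[OF Hc] by (simp add: alive_def)
  have "rk (Tf gg) \<le> B (H c)"
  proof -
    have "rk (Tf gg) \<le> rk (Tf i)" using tb_mono[of gg i] D(1) gg by simp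
    also have "\<dots> \<le> B (T c)"
      using ix_val[of Tf "B (T c)" p] fi tb_0 cc_lo[OF c(2)] goodD(3)[OF g, of "T c"] by simp
    finally have 1: "rk (Tf gg) \<le> B (T c)" .
    have "rk (Tf gg) \<le> rk (Tf (ix p Tf (rk c)))" using tb_mono[of gg "ix p Tf (rk c)"] ix_le[of p Tf "rk c"] gg by simp
    also have "\<dots> \<le> rk c" using ix_val[of Tf "rk c" p] lt by simp
    finally show ?thesis using 1 B_edge[OF cm] by simp
  qed
  then have "gg \<le> ix p Tf (B (H c))" using ix_ge[of gg p Tf "B (H c)"] D(1) gg by simp
  then show "j \<le> i \<and> x \<in> {1..m} \<and> H x \<in> cc lo r \<and> j \<le> ix p Tf (B (H x))" if "1 \<le> j" "x \<in> set ((\<ll>(gg := c # \<ll> gg)) j)" for j x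
    using D(6)[of j x] that Hc cm gg by (cases "j = gg"; cases "x = c") auto
qed (fact djkD[OF d])+

lemma djk_done:
  assumes d: "djk {} 0 fin \<ll>" and v: "v \<in> cc lo r"
  shows "fin v = ix p Tf (B v)"
  using djkD(2)[OF d v] djkD(3)[OF d v] by fastforce

text \<open>Relaxation searches only for edges too light for the current bucket. Either the head
  ends in a lower bucket and the edge is cut, or it ends in bucket \<open>i\<close> and the edge
  falls below the new lower end there; the potential pays in both cases.\<close>

lemma djk_located:
  assumes d: "djk X i fin \<ll>" and i: "1 \<le> i" and c: "alive lo c" "T c \<in> cc lo r" "fin (T c) = i" "fin (H c) = 0" "rk c < rk (Tf i)"
  shows "c \<in> D1 S lo hi \<union> D3 S lo hi"
proof -
  note D = djkD[OF d]
  have Hc: "H c \<in> cc lo r" using cc_alive[OF c(1)] c(2) by blast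
  have fi: "ix p Tf (B (T c)) = i" using D(2)[OF c(2)] c(3) i by simp
  have le: "ix p Tf (B (H c)) \<le> i" using D(3)[OF Hc] c(4) by (meson not_less)
  have n: "nlo S lo hi (T c) = Tf i" "nlo S lo hi (H c) = Tf (ix p Tf (B (H c)))"
    using nlo_ix[OF c(2)] nlo_ix[OF Hc] fi by simp_all
  show ?thesis
  proof (cases "ix p Tf (B (H c)) = i")
    case True
    then have "c \<in> D3 S lo hi" using c n by (simp add: D3_def alive_def)
    then show ?thesis ..
  next
    case False
    have "Tf i \<noteq> Tf (ix p Tf (B (H c)))"
    proof
      assume "Tf i = Tf (ix p Tf (B (H c)))"
      then have "rk (Tf i) \<le> B (H c)"
        using ix_val[of Tf "B (H c)" p] tb_0 cc_lo[OF Hc] goodD(3)[OF g, of "H c"] by simp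
      then show False using ix_ge[where Tf = Tf, OF D(1)] le False by (metis le_antisym)
    qed
    then have "c \<in> D1 S lo hi" using c(1) n by (simp add: D1_def)
    then show ?thesis ..
  qed
qed

text \<open>Colour changes are charged to edges whose ends are separated. A source placed below the
  final bucket of its head is the best source edge there and falls below the new lower end. The
  summand \<open>p\<close> absorbs the first guess, which can be wrong only if there is a threshold
  at all.\<close>

lemma fails_le:
  assumes d: "distinct os" and os: "set os = cc lo r"
    and b: "bd (\<lambda>v. ix p Tf (B v)) os \<le> 2 * card {c. alive lo c \<and> T c \<in> cc lo r \<and> H c \<in> cc lo r \<and> ix p Tf (B (T c)) \<noteq> ix p Tf (B (H c))}"
  shows "fails (hh lo) (\<lambda>v. ix p Tf (rk (hh lo v))) 0 os \<le>
     p + 2 * card {c \<in> D1 S lo hi. T c \<in> cc lo r} + 2 * card {c \<in> D3 S lo hi. H c \<in> cc lo r}"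
proof (cases "p = 0 \<or> os = []")
  case True
  then have "fails (hh lo) (\<lambda>v. ix p Tf (rk (hh lo v))) 0 os = 0"
    using ix_le[of p Tf] by (intro fails_0) auto
  then show ?thesis by simp
next
  case False
  let ?fi = "\<lambda>v. ix p Tf (B v)" and ?loc = "\<lambda>v. ix p Tf (rk (hh lo v))"
  obtain u us where us: "os = u # us" using False by (cases os) auto
  have "fails (hh lo) ?loc 0 os \<le> (if 0 = ?fi u then 0 else 1) + bd ?fi (u # os) + 2 * card {v \<in> set os. hh lo v \<noteq> 0 \<and> ?loc v \<noteq> ?fi v}"
    by (rule fails_bound[OF d])
  also have "bd ?fi (u # os) = bd ?fi os" by (simp add: us)
  finally have 1: "fails (hh lo) ?loc 0 os \<le> 1 + bd ?fi os + 2 * card {v \<in> set os. hh lo v \<noteq> 0 \<and> ?loc v \<noteq> ?fi v}"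
    by (auto split: if_splits)
  have fD: "finite (D1 S lo hi)" "finite (D3 S lo hi)" unfolding D1_def D3_def by simp_all
  have "card {c. alive lo c \<and> T c \<in> cc lo r \<and> H c \<in> cc lo r \<and> ?fi (T c) \<noteq> ?fi (H c)} \<le> card {c \<in> D1 S lo hi. T c \<in> cc lo r}"
  proof (rule card_mono)
    show "{c. alive lo c \<and> T c \<in> cc lo r \<and> H c \<in> cc lo r \<and> ?fi (T c) \<noteq> ?fi (H c)} \<subseteq> {c \<in> D1 S lo hi. T c \<in> cc lo r}"
    proof (intro subsetI, elim CollectE conjE)
      fix c assume c: "alive lo c" "T c \<in> cc lo r" "H c \<in> cc lo r" "?fi (T c) \<noteq> ?fi (H c)"
      have *: "?fi v = ix p Tf (rk (nlo S lo hi v))" if "v \<in> cc lo r" for v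
      proof (rule antisym)
        show "?fi v \<le> ix p Tf (rk (nlo S lo hi v))" unfolding nlo_ix[OF that] by (intro ix_ge ix_le order_refl)
        show "ix p Tf (rk (nlo S lo hi v)) \<le> ?fi v" by (intro ix_mono nlo_props(2)[OF g])
      qed
      have "nlo S lo hi (T c) \<noteq> nlo S lo hi (H c)" using *[OF c(2)] *[OF c(3)] c(4) by metis
      then show "c \<in> {c \<in> D1 S lo hi. T c \<in> cc lo r}" using c by (simp add: D1_def)
    qed
  qed (use fD in simp)
  moreover have "card {v \<in> set os. hh lo v \<noteq> 0 \<and> ?loc v \<noteq> ?fi v} \<le> card {c \<in> D3 S lo hi. H c \<in> cc lo r}"
  proof (rule card_inj_on_le[where f = "hh lo"])
    show "inj_on (hh lo) {v \<in> set os. hh lo v \<noteq> 0 \<and> ?loc v \<noteq> ?fi v}"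
      using hh_le_B(4)[OF g] by (intro inj_onI, elim CollectE conjE) metis
    show "hh lo ` {v \<in> set os. hh lo v \<noteq> 0 \<and> ?loc v \<noteq> ?fi v} \<subseteq> {c \<in> D3 S lo hi. H c \<in> cc lo r}"
    proof (rule image_subsetI, elim CollectE conjE)
      fix v assume v: "v \<in> set os" "hh lo v \<noteq> 0" "?loc v \<noteq> ?fi v"
      note h = hh_le_B[OF g v(2)]
      have vc: "v \<in> cc lo r" using v(1) os by simp
      have "?loc v \<le> ?fi v" by (intro ix_mono h(1))
      then have lt: "?loc v < ?fi v" using v(3) by simp
      have "B v < rk (hi r)" using goodD(4)[OF g h(5,6)] cc_hi[OF g vc] by simp
      then have "rk (hh lo v) < rk (Tf (?loc v + 1))" using h(1) by (intro ix_next) simp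
      also have "\<dots> \<le> rk (Tf (?fi v))" using tb_mono[of "?loc v + 1" "?fi v"] lt ix_le[of p Tf "B v"] by simp
      finally have "rk (hh lo v) \<le> rk (nlo S lo hi v)" using nlo_ix[OF vc] by simp
      then show "hh lo v \<in> {c \<in> D3 S lo hi. H c \<in> cc lo r}" using h vc by (simp add: D3_def)
    qed
  qed (use fD in simp)
  ultimately show ?thesis using 1 b False by linarith
qed

end

lemma tablI:
  assumes g: "good lo hi" and im: "Tf ` {1..p} = keys S lo hi r" and e: "Tf 0 = lo r" "Tf (p + 1) = hi r"
    and s: "\<And>i j. 1 \<le> i \<Longrightarrow> i \<le> j \<Longrightarrow> j \<le> p \<Longrightarrow> rk (Tf i) \<le> rk (Tf j)" and lh: "rk (lo r) \<le> rk (hi r)"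
  shows "tabl lo hi S r p Tf"
proof -
  have k: "rk (lo r) < rk (Tf i) \<and> rk (Tf i) < rk (hi r)" if "1 \<le> i" "i \<le> p" for i
  proof -
    have "Tf i \<in> keys S lo hi r" unfolding im[symmetric] using that by simp
    then show ?thesis by (simp add: keys_def)
  qed
  have "rk (Tf i) \<le> rk (Tf j)" if "i \<le> j" "j \<le> p + 1" for i j
  proof -
    consider "i = j" | "i = 0" "j = p + 1" | "i = 0" "1 \<le> j" "j \<le> p" | "1 \<le> i" "i \<le> p" "j = p + 1" | "1 \<le> i" "i \<le> j" "j \<le> p"
      using \<open>i \<le> j\<close> \<open>j \<le> p + 1\<close> by linarith
    then show ?thesis by cases (use e k s lh in \<open>auto intro: less_imp_le\<close>)
  qed
  then show ?thesis unfolding tabl_def using im e by blast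
qed

lemma good_lh: "good lo hi \<Longrightarrow> v \<in> VV \<Longrightarrow> rk (lo v) \<le> rk (hi v)"
  using goodD(3,4)[of lo hi v] goodD(5,6)[of lo hi] by (cases "v = s") (auto intro: less_imp_le le_less_trans)

end

section \<open>Derived expressions and tests, the ranks of an instance, and arrays in the
  memory\<close>

section \<open>The machine\<close>

abbreviation seq_com (infixr ";;" 60) where "c ;; d \<equiv> Seq c d"
abbreviation assign_com (infix "::=" 61) where "r ::= e \<equiv> Assign r e"
abbreviation "V \<equiv> Reg"
abbreviation "N \<equiv> Const"

text \<open>Array \<open>k < 32\<close> occupies the memory cells \<open>n + 32 i + k\<close>, above the output cells.
  Edges are named by codes \<open>1, \<dots>, m\<close>; the codes \<open>0\<close> and \<open>m + 1\<close> stand for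
  \<open>-\<infinity>\<close> and \<open>\<infinity>\<close>.\<close>

definition arr :: "nat \<Rightarrow> exp \<Rightarrow> exp" where
  "arr k e = Mem (Plus NumVerts (Plus (Times (N 32) e) (N k)))"

definition put :: "nat \<Rightarrow> exp \<Rightarrow> exp \<Rightarrow> com" where
  "put k e v = Store (Plus NumVerts (Plus (Times (N 32) e) (N k))) v"

definition tl_exp :: "exp \<Rightarrow> exp" where "tl_exp e = EdgeTail (Monus e (N 1))"
definition hd_exp :: "exp \<Rightarrow> exp" where "hd_exp e = EdgeHead (Monus e (N 1))"

definition lt_test :: "exp \<Rightarrow> exp \<Rightarrow> test" where "lt_test a b = Neg (Leq b a)"
definition eq_test :: "exp \<Rightarrow> exp \<Rightarrow> test" where "eq_test a b = Conj (Leq a b) (Leq b a)"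
definition or_test :: "test \<Rightarrow> test \<Rightarrow> test" where "or_test a b = Neg (Conj (Neg a) (Neg b))"

text \<open>The sentinels are handled before any weight is compared, because
  \<open>WeightLeq\<close> is false for positions outside the edge list. Equal weights are ordered
  by code.\<close>

definition wle_test :: "exp \<Rightarrow> exp \<Rightarrow> test" where
  "wle_test a b = or_test (Leq a (N 0)) (or_test (lt_test NumEdges b)
     (Conj (Leq (N 1) b) (Conj (WeightLeq (Monus a (N 1)) (Monus b (N 1)))
        (or_test (Neg (WeightLeq (Monus b (N 1)) (Monus a (N 1)))) (Leq a b)))))"

definition wlt_test :: "exp \<Rightarrow> exp \<Rightarrow> test" where "wlt_test a b = Neg (wle_test b a)"

definition srg :: "nat \<Rightarrow> nat \<Rightarrow> state \<Rightarrow> state" where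
  "srg r v \<sigma> = \<sigma>\<lparr>regs := (regs \<sigma>)(r := v)\<rparr>"

locale inst =
  fixes G :: "nat pair_pre_digraph" and es :: "(nat \<times> nat) list" and w :: "nat \<times> nat \<Rightarrow> real" and s :: nat
  assumes inst: "ssbp_instance G es s"
begin

definition n :: nat where "n = card (pverts G)"
definition m :: nat where "m = length es"
definition I :: input where "I = ssbp_input G es w s"
definition T :: "nat \<Rightarrow> nat" where "T c = fst (es ! (c - 1))"
definition H :: "nat \<Rightarrow> nat" where "H c = snd (es ! (c - 1))"

text \<open>Breaking ties by code makes this a linear order on the edges, so that the position of an
  edge in it is an injective rank.\<close>

definition ele :: "nat \<Rightarrow> nat \<Rightarrow> bool" where
  "ele c d \<longleftrightarrow> w (es ! (c - 1)) < w (es ! (d - 1)) \<or> w (es ! (c - 1)) = w (es ! (d - 1)) \<and> c \<le> d"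

definition rk :: "nat \<Rightarrow> nat" where
  "rk c = (if c = 0 then 0 else if m < c then Suc m else card {d \<in> {1..m}. ele d c})"

lemma I_sel: "in_n I = n" "in_edges I = es" "in_src I = s"
  "in_wle I i j \<longleftrightarrow> i < m \<and> j < m \<and> w (es ! i) \<le> w (es ! j)"
  by (simp_all add: I_def ssbp_input_def n_def m_def)

lemma rk_mono_iff:
  assumes "c \<in> {1..m}" "d \<in> {1..m}"
  shows "rk c \<le> rk d \<longleftrightarrow> ele c d"
proof
  assume "ele c d"
  then have "{x \<in> {1..m}. ele x c} \<subseteq> {x \<in> {1..m}. ele x d}" by (auto simp: ele_def)
  then show "rk c \<le> rk d" using assms by (auto simp: rk_def intro!: card_mono)
next
  assume le: "rk c \<le> rk d"
  show "ele c d"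
  proof (rule ccontr)
    assume n: "\<not> ele c d"
    then have "{x \<in> {1..m}. ele x d} \<subset> {x \<in> {1..m}. ele x c}"
      using assms by (auto simp: ele_def)
    then have "card {x \<in> {1..m}. ele x d} < card {x \<in> {1..m}. ele x c}" by (intro psubset_card_mono) auto
    then show False using le assms by (auto simp: rk_def)
  qed
qed

lemma rk_bounds: "c \<in> {1..m} \<Longrightarrow> 1 \<le> rk c \<and> rk c \<le> m"
proof -
  assume c: "c \<in> {1..m}"
  have "card {c} \<le> card {d \<in> {1..m}. ele d c}" using c by (intro card_mono) (auto simp: ele_def)
  moreover have "card {d \<in> {1..m}. ele d c} \<le> card {1..m}" by (intro card_mono) auto
  ultimately show ?thesis using c by (simp add: rk_def)
qed

lemma rk_inj_on: "inj_on rk {..Suc m}"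
proof (rule inj_onI)
  fix x y assume *: "x \<in> {..Suc m}" "y \<in> {..Suc m}" "rk x = rk y"
  have e: "z = 0 \<or> z = Suc m \<or> z \<in> {1..m}" if "z \<in> {..Suc m}" for z using that by auto
  have 0: "rk 0 = 0" "rk (Suc m) = Suc m" by (simp_all add: rk_def)
  show "x = y"
  proof (cases "x \<in> {1..m} \<and> y \<in> {1..m}")
    case True
    then have "ele x y" "ele y x" using rk_mono_iff[of x y] rk_mono_iff[of y x] *(3) by auto
    then show ?thesis by (auto simp: ele_def)
  next
    case False
    then show ?thesis using e[OF *(1)] e[OF *(2)] rk_bounds[of x] rk_bounds[of y] 0 *(3)
      by (elim disjE) auto
  qed
qed

sublocale net m T H s rk
  by unfold_locales (use rk_inj_on rk_bounds in \<open>auto simp: rk_def\<close>)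

definition W :: nat where "W = n + m + 2"

lemma W_ge: "2 \<le> W" "n \<le> W" "m \<le> W" "1 \<le> n" "3 \<le> W"
proof -
  have "finite (pverts G)" "s \<in> pverts G"
    using inst unfolding ssbp_instance_def pair_fin_digraph_def pair_fin_digraph_axioms_def by auto
  then show "1 \<le> n" unfolding n_def by (metis One_nat_def Suc_leI card_gt_0_iff empty_iff)
  then show "2 \<le> W" "n \<le> W" "m \<le> W" "3 \<le> W" by (auto simp: W_def)
qed

lemma word_bound_I: "word_bound 10 I = W ^ 10"
  by (simp add: word_bound_def I_def ssbp_input_def W_def n_def m_def)

text \<open>Room for array addresses, at most \<open>n + 96 * W + 31\<close>, and for the sums
  formed by the program, without wrap-around. The factor \<open>3 ^ 9 = 19683\<close> comes from
  \<open>W \<ge> 3\<close>.\<close>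

lemma W_power: "128 * W + 64 < W ^ 10" "100 < W ^ 10"
proof -
  have "3 ^ 9 \<le> W ^ 9" using W_ge by (intro power_mono) auto
  then have "3 ^ 9 * W \<le> W ^ 9 * W" by (rule mult_right_mono) simp
  also have "W ^ 9 * W = W ^ 10" by (simp add: eval_nat_numeral)
  finally have "19683 * W \<le> W ^ 10" by simp
  then show "128 * W + 64 < W ^ 10" "100 < W ^ 10" using W_ge by linarith+
qed

lemma s_lt: "s < n"
  using inst by (auto simp: ssbp_instance_def n_def)

lemma edge_lt: "c \<in> {1..m} \<Longrightarrow> T c < n \<and> H c < n"
proof -
  assume "c \<in> {1..m}"
  then have "es ! (c - 1) \<in> set es" by (auto simp: m_def)
  then have "es ! (c - 1) \<in> parcs G" using inst by (simp add: ssbp_instance_def)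
  moreover have "pair_wf_digraph G" using inst by (simp add: ssbp_instance_def pair_fin_digraph_def)
  ultimately have "T c \<in> pverts G" "H c \<in> pverts G" unfolding T_def H_def
    by (cases "es ! (c - 1)"; auto simp: pair_wf_digraph_def)+
  moreover have "pverts G = {..<n}" using inst by (simp add: ssbp_instance_def n_def)
  ultimately show ?thesis by auto
qed

lemma VV_lt: "v \<in> VV \<Longrightarrow> v < n"
  using edge_lt by (auto simp: VV_def)

abbreviation rg :: "state \<Rightarrow> nat \<Rightarrow> nat" where "rg \<equiv> regs"
definition ar :: "state \<Rightarrow> nat \<Rightarrow> nat \<Rightarrow> nat" where "ar \<sigma> k i = mem \<sigma> (n + (32 * i + k))"
definition sar :: "nat \<Rightarrow> nat \<Rightarrow> nat \<Rightarrow> state \<Rightarrow> state" where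
  "sar k i v \<sigma> = \<sigma>\<lparr>mem := (mem \<sigma>)(n + (32 * i + k) := v)\<rparr>"
abbreviation ev :: "state \<Rightarrow> exp \<Rightarrow> nat" where "ev \<sigma> e \<equiv> eval_exp 10 I \<sigma> e"
abbreviation te :: "state \<Rightarrow> test \<Rightarrow> bool" where "te \<sigma> b \<equiv> eval_test 10 I \<sigma> b"
abbreviation okk :: "com \<Rightarrow> state \<Rightarrow> nat \<Rightarrow> (state \<Rightarrow> nat \<Rightarrow> bool) \<Rightarrow> bool" where "okk \<equiv> ok 10 I"

lemma rg_srg [simp]: "rg (srg r v \<sigma>) = (rg \<sigma>)(r := v)" by (simp add: srg_def)
lemma rg_sar [simp]: "rg (sar k i v \<sigma>) = rg \<sigma>" by (simp add: sar_def)
lemma ar_srg [simp]: "ar (srg r v \<sigma>) = ar \<sigma>" by (simp add: srg_def ar_def fun_eq_iff)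
lemma ar_sar: "k < 32 \<Longrightarrow> k' < 32 \<Longrightarrow> ar (sar k i v \<sigma>) k' = (if k' = k then (ar \<sigma> k)(i := v) else ar \<sigma> k')"
proof (rule ext)
  fix i' assume k: "k < 32" "k' < 32"
  have "i' = i \<and> k' = k" if e: "32 * i' + k' = 32 * i + k"
  proof -
    have "i' = i" using arg_cong[OF e, of "\<lambda>x. x div 32"] k by simp
    then show ?thesis using e by simp
  qed
  then have "32 * i' + k' = 32 * i + k \<longleftrightarrow> i' = i \<and> k' = k" by blast
  then show "ar (sar k i v \<sigma>) k' i' = (if k' = k then (ar \<sigma> k)(i := v) else ar \<sigma> k') i'"
    by (auto simp: ar_def sar_def)
qed
lemma mem_srg [simp]: "mem (srg r v \<sigma>) = mem \<sigma>" by (simp add: srg_def)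
lemma mem_sar: "t < n \<Longrightarrow> mem (sar k i v \<sigma>) t = mem \<sigma> t" by (simp add: sar_def)

text \<open>The output cells below \<open>n\<close> belong to every frame: they keep their initial 0
  until the output pass at the end.\<close>

definition frame :: "nat set \<Rightarrow> nat set \<Rightarrow> state \<Rightarrow> state \<Rightarrow> bool" where
  "frame R K \<sigma> \<sigma>' \<longleftrightarrow> (\<forall>r. r \<notin> R \<longrightarrow> rg \<sigma>' r = rg \<sigma> r) \<and> (\<forall>k<32. k \<notin> K \<longrightarrow> ar \<sigma>' k = ar \<sigma> k) \<and>
     (\<forall>t<n. mem \<sigma>' t = mem \<sigma> t)"

lemma frame_refl [simp]: "frame R K \<sigma> \<sigma>" by (simp add: frame_def)
lemma frame_trans: "frame R K \<sigma> \<sigma>' \<Longrightarrow> frame R K \<sigma>' \<sigma>'' \<Longrightarrow> frame R K \<sigma> \<sigma>''" by (simp add: frame_def)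
lemma frame_mono: "frame R K \<sigma> \<sigma>' \<Longrightarrow> R \<subseteq> R' \<Longrightarrow> K \<subseteq> K' \<Longrightarrow> frame R' K' \<sigma> \<sigma>'" by (auto simp: frame_def)
lemma frame_srg [simp]: "r \<in> R \<Longrightarrow> frame R K \<sigma> (srg r v \<sigma>') \<longleftrightarrow> frame R K \<sigma> \<sigma>'"
  by (auto simp: frame_def)
lemma frame_sar [simp]: "k \<in> K \<Longrightarrow> k < 32 \<Longrightarrow> frame R K \<sigma> (sar k i v \<sigma>') \<longleftrightarrow> frame R K \<sigma> \<sigma>'"
  by (auto simp: frame_def ar_sar mem_sar)
lemma ev_N: "k \<le> 100 \<Longrightarrow> ev \<sigma> (N k) = k" using W_power by (simp add: word_bound_I)
lemma ev_V: "ev \<sigma> (V r) = rg \<sigma> r" by simp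
lemma ev_NumVerts: "ev \<sigma> NumVerts = n" by (simp add: I_def ssbp_input_def n_def)
lemma ev_NumEdges: "ev \<sigma> NumEdges = m" by (simp add: I_sel m_def)
lemma ev_Src: "ev \<sigma> Src = s" by (simp add: I_sel)
lemma ev_Plus: "ev \<sigma> a + ev \<sigma> b \<le> 128 * W \<Longrightarrow> ev \<sigma> (Plus a b) = ev \<sigma> a + ev \<sigma> b"
  using W_power by (simp add: word_bound_I)
lemma ev_Monus: "ev \<sigma> (Monus a b) = ev \<sigma> a - ev \<sigma> b" by simp
lemma ev_Quot: "ev \<sigma> (Quot a b) = ev \<sigma> a div ev \<sigma> b" by simp
lemma ev_Times: "ev \<sigma> a * ev \<sigma> b < W ^ 10 \<Longrightarrow> ev \<sigma> (Times a b) = ev \<sigma> a * ev \<sigma> b"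
  by (simp add: word_bound_I)

lemma ev_addr:
  assumes "ev \<sigma> e \<le> 3 * W" "k < 32"
  shows "ev \<sigma> (Plus NumVerts (Plus (Times (N 32) e) (N k))) = n + (32 * ev \<sigma> e + k)"
proof -
  have *: "32 * ev \<sigma> e + k + n < W ^ 10" using assms W_power W_ge by linarith
  then show ?thesis using W_power assms(2) unfolding eval_exp.simps word_bound_I
    by (simp add: I_sel)
qed

lemma ev_arr: "ev \<sigma> e \<le> 3 * W \<Longrightarrow> k < 32 \<Longrightarrow> ev \<sigma> (arr k e) = ar \<sigma> k (ev \<sigma> e)"
  unfolding arr_def eval_exp.simps(3) ev_addr by (simp add: ar_def)

lemma ev_tl: "1 \<le> ev \<sigma> e \<Longrightarrow> ev \<sigma> e \<le> m \<Longrightarrow> ev \<sigma> (tl_exp e) = T (ev \<sigma> e)"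
  using ev_N[of 1 \<sigma>] by (auto simp: tl_exp_def T_def I_sel m_def Let_def simp del: eval_exp.simps(1))

lemma ev_hd: "1 \<le> ev \<sigma> e \<Longrightarrow> ev \<sigma> e \<le> m \<Longrightarrow> ev \<sigma> (hd_exp e) = H (ev \<sigma> e)"
  using ev_N[of 1 \<sigma>] by (auto simp: hd_exp_def H_def I_sel m_def Let_def simp del: eval_exp.simps(1))

lemma te_Leq: "te \<sigma> (Leq a b) \<longleftrightarrow> ev \<sigma> a \<le> ev \<sigma> b" by simp
lemma te_lt: "te \<sigma> (lt_test a b) \<longleftrightarrow> ev \<sigma> a < ev \<sigma> b" by (auto simp: lt_test_def)
lemma te_eq: "te \<sigma> (eq_test a b) \<longleftrightarrow> ev \<sigma> a = ev \<sigma> b" by (auto simp: eq_test_def)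
lemma te_or: "te \<sigma> (or_test a b) \<longleftrightarrow> te \<sigma> a \<or> te \<sigma> b" by (auto simp: or_test_def)
lemma te_Neg: "te \<sigma> (Neg a) \<longleftrightarrow> \<not> te \<sigma> a" by simp
lemma te_Conj: "te \<sigma> (Conj a b) \<longleftrightarrow> te \<sigma> a \<and> te \<sigma> b" by simp

lemma te_wle:
  assumes "ev \<sigma> a \<le> Suc m" "ev \<sigma> b \<le> Suc m"
  shows "te \<sigma> (wle_test a b) \<longleftrightarrow> rk (ev \<sigma> a) \<le> rk (ev \<sigma> b)"
proof -
  define x y where "x = ev \<sigma> a" and "y = ev \<sigma> b"
  have e: "te \<sigma> (wle_test a b) \<longleftrightarrow> x = 0 \<or> m < y \<or> 1 \<le> y \<and> in_wle I (x - 1) (y - 1) \<and>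
      (\<not> in_wle I (y - 1) (x - 1) \<or> x \<le> y)"
    unfolding wle_test_def te_or te_Conj te_lt te_Leq te_Neg eval_test.simps(2) ev_Monus ev_NumEdges
    using ev_N[of 0] ev_N[of 1] by (simp add: x_def y_def)
  note wI = I_sel(4)
  consider "x = 0" | "y = Suc m" | "x \<noteq> 0" "y = 0" | "x = Suc m" "y \<in> {1..m}" | "x \<in> {1..m}" "y \<in> {1..m}"
    using assms unfolding x_def[symmetric] y_def[symmetric] by (metis Suc_leI atLeastAtMost_iff le_SucE neq0_conv One_nat_def)
  then have "(x = 0 \<or> m < y \<or> 1 \<le> y \<and> in_wle I (x - 1) (y - 1) \<and>
      (\<not> in_wle I (y - 1) (x - 1) \<or> x \<le> y)) \<longleftrightarrow> rk x \<le> rk y"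
  proof cases
    case 2
    then show ?thesis using rk_le[of x] assms by (simp add: x_def)
  next
    case 3
    then show ?thesis using rk_eq_iff[of x 0] assms by (simp add: x_def)
  next
    case 4
    then show ?thesis using rk_edge[of y] by (auto simp: wI)
  next
    case 5
    then show ?thesis using rk_mono_iff[OF 5] by (auto simp: wI ele_def)
  qed simp
  then show ?thesis using e by (simp add: x_def y_def)
qed

lemma te_wlt:
  "ev \<sigma> a \<le> Suc m \<Longrightarrow> ev \<sigma> b \<le> Suc m \<Longrightarrow> te \<sigma> (wlt_test a b) \<longleftrightarrow> rk (ev \<sigma> a) < rk (ev \<sigma> b)"
  using te_wle[of \<sigma> b a] by (auto simp: wlt_test_def)

lemma okk_Assign: "okk (r ::= e) \<sigma> t Q \<longleftrightarrow> 1 \<le> t \<and> Q (srg r (ev \<sigma> e) \<sigma>) (t - 1)"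
  by (simp add: ok_Assign srg_def)

lemma okk_put:
  "ev \<sigma> e \<le> 3 * W \<Longrightarrow> k < 32 \<Longrightarrow> okk (put k e v) \<sigma> t Q \<longleftrightarrow> 1 \<le> t \<and> Q (sar k (ev \<sigma> e) (ev \<sigma> v) \<sigma>) (t - 1)"
  unfolding put_def ok_Store ev_addr sar_def ..

lemmas okk = ok_Seq ok_If okk_Assign okk_put
lemmas evs = ev_N ev_V ev_NumVerts ev_NumEdges ev_Src ev_Plus ev_Monus ev_Quot ev_Times ev_arr ev_tl ev_hd
lemmas tes = te_Leq te_lt te_eq te_or te_Neg te_Conj te_wle te_wlt

end

declare eval_exp.simps [simp del] eval_test.simps [simp del]

section \<open>Commands that search, sort, bucket and write back one component\<close>

section \<open>The program for one component\<close>

text \<open>Arrays: 0 to 3 adjacency lists (first and next edge by tail, then by head), 4 and 5 the interval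
  ends \<open>lo\<close> and \<open>hi\<close>, 6 and 7 their new values, 8 the random tape (an edge with entry 0 is sampled),
  9 visit stamps, 10 search order, 11 stack, 12 best source edge of a vertex, 13 thresholds, 14 merge
  buffer, 15 final bucket of a vertex (0 while it is not settled), 16 to 18 buckets as linked lists.
  Registers: 0 and 1 \<open>D\<close> and \<open>q\<close>, 2 stamp, 3 edge of the outer loop, 4 root of the component, 5 stack
  size, 6 component size, 7 number of thresholds, 12 and 13 the ends of the binary search for the key
  in register 14, 15 number of list cells in use, 16 current bucket.\<close>
definition locate_com :: com where
  "locate_com = 12 ::= N 0 ;;
     While (lt_test (Plus (V 12) (N 1)) (V 13))
      (21 ::= Quot (Plus (V 12) (V 13)) (N 2) ;;
       If (wle_test (arr 13 (V 21)) (V 14)) (12 ::= V 21) (13 ::= V 21))"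

definition insert_com :: com where
  "insert_com = 15 ::= Plus (V 15) (N 1) ;; put 18 (V 15) (V 14) ;;
     put 17 (V 15) (arr 16 (V 12)) ;; put 16 (V 12) (V 15)"

definition push_com :: com where
  "push_com = put 9 (V 10) (V 2) ;; put 11 (V 5) (V 10) ;; 5 ::= Plus (V 5) (N 1)"

definition out_scan :: com where
  "out_scan = While (Leq (N 1) (V 9))
     (10 ::= hd_exp (V 9) ;;
      If (Conj (eq_test (arr 4 (V 10)) (arr 4 (V 8)))
            (Conj (wlt_test (arr 4 (V 8)) (V 9)) (Neg (eq_test (arr 9 (V 10)) (V 2)))))
        push_com Skip ;;
      9 ::= arr 1 (V 9))"

definition in_push :: com where
  "in_push = If (Conj (eq_test (arr 4 (V 10)) (arr 4 (V 8))) (Neg (eq_test (arr 9 (V 10)) (V 2)))) push_com Skip"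

definition in_upd :: com where
  "in_upd = If (Conj (wle_test (V 9) (arr 4 (V 10))) (wlt_test (arr 12 (V 8)) (V 9))) (put 12 (V 8) (V 9)) Skip ;;
     If (Conj (wlt_test (V 9) (arr 5 (V 8))) (eq_test (arr 8 (V 9)) (N 0)))
       (7 ::= Plus (V 7) (N 1) ;; put 13 (V 7) (V 9)) Skip"

definition in_scan :: com where
  "in_scan = While (Leq (N 1) (V 9))
     (10 ::= tl_exp (V 9) ;;
      If (wlt_test (arr 4 (V 8)) (V 9)) (in_push ;; in_upd) Skip ;;
      9 ::= arr 3 (V 9))"

definition pop_com :: com where
  "pop_com = 5 ::= Monus (V 5) (N 1) ;; 8 ::= arr 11 (V 5) ;; put 10 (V 6) (V 8) ;;
     6 ::= Plus (V 6) (N 1) ;; put 12 (V 8) (N 0) ;; 9 ::= arr 0 (V 8)"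

definition root_com :: com where
  "root_com = put 9 (V 4) (V 2) ;; put 11 (N 0) (V 4) ;; 5 ::= N 1 ;; 6 ::= N 0 ;; 7 ::= N 0"

definition search_com :: com where
  "search_com = root_com ;;
     While (Leq (N 1) (V 5)) (pop_com ;; out_scan ;; 9 ::= arr 2 (V 8) ;; in_scan)"

definition merge_loop :: com where
  "merge_loop = While (lt_test (V 11) (V 22))
     (If (Conj (lt_test (V 19) (V 21)) (or_test (Leq (V 22) (V 20)) (wle_test (arr 13 (V 19)) (arr 13 (V 20)))))
        (put 14 (V 11) (arr 13 (V 19)) ;; 19 ::= Plus (V 19) (N 1))
        (put 14 (V 11) (arr 13 (V 20)) ;; 20 ::= Plus (V 20) (N 1)) ;;
      11 ::= Plus (V 11) (N 1))"

definition min_com :: "nat \<Rightarrow> exp \<Rightarrow> exp \<Rightarrow> com" where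
  "min_com r a b = If (Leq a b) (r ::= a) (r ::= b)"

definition pass_com :: com where
  "pass_com = 18 ::= N 1 ;; While (Leq (V 18) (V 7))
     (19 ::= V 18 ;; min_com 21 (Plus (V 18) (V 17)) (Plus (V 7) (N 1)) ;; 20 ::= V 21 ;;
      min_com 22 (Plus (V 18) (Plus (V 17) (V 17))) (Plus (V 7) (N 1)) ;;
      11 ::= V 18 ;; merge_loop ;; 18 ::= V 22)"

definition copy_com :: com where
  "copy_com = 11 ::= N 1 ;; While (Leq (V 11) (V 7)) (put 13 (V 11) (arr 14 (V 11)) ;; 11 ::= Plus (V 11) (N 1))"

definition sort_com :: com where
  "sort_com = 17 ::= N 1 ;; While (lt_test (V 17) (V 7)) (pass_com ;; copy_com ;; 17 ::= Plus (V 17) (V 17))"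

text \<open>Register 12 still holds the bucket of the previous source, and two comparisons confirm
  or refute it.\<close>

definition guess_com :: com where
  "guess_com = If (Conj (wle_test (arr 13 (V 12)) (V 14)) (wlt_test (V 14) (arr 13 (Plus (V 12) (N 1)))))
     Skip (13 ::= Plus (V 7) (N 1) ;; locate_com)"

definition place_loop :: com where
  "place_loop = While (lt_test (V 11) (V 6))
     (8 ::= arr 10 (V 11) ;; put 15 (V 8) (N 0) ;; 14 ::= arr 12 (V 8) ;; 11 ::= Plus (V 11) (N 1) ;;
      If (Leq (N 1) (V 14)) (guess_com ;; insert_com) Skip)"

definition ends_com :: com where
  "ends_com = put 13 (N 0) (arr 4 (V 4)) ;; put 13 (Plus (V 7) (N 1)) (arr 5 (V 4)) ;;
     12 ::= N 0 ;; 15 ::= N 0 ;; 11 ::= N 0"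

text \<open>The bucket of a relaxed edge is capped by that of its tail, so an edge at least as heavy
  as the current threshold needs one comparison, and only a lighter one is searched for.\<close>

definition cap_com :: com where
  "cap_com = If (wle_test (arr 13 (V 16)) (V 14)) (12 ::= V 16) (13 ::= V 16 ;; locate_com)"

definition relax_scan :: com where
  "relax_scan = While (Leq (N 1) (V 9))
     (10 ::= hd_exp (V 9) ;; 14 ::= V 9 ;; 9 ::= arr 1 (V 9) ;;
      If (Conj (eq_test (arr 4 (V 10)) (arr 4 (V 8)))
            (Conj (wlt_test (arr 4 (V 8)) (V 14)) (eq_test (arr 15 (V 10)) (N 0))))
        (cap_com ;; insert_com) Skip)"

text \<open>Relaxation may insert into the current bucket while it is being emptied, so the bucket
  is left only when its list is found empty. Entries with settled heads are dropped when they are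
  met.\<close>

definition settle_com :: com where
  "settle_com = 16 ::= V 7 ;; While (Leq (N 1) (V 16))
     (If (Leq (arr 16 (V 16)) (N 0)) (16 ::= Monus (V 16) (N 1))
       (23 ::= arr 16 (V 16) ;; put 16 (V 16) (arr 17 (V 23)) ;; 8 ::= hd_exp (arr 18 (V 23)) ;;
        If (Leq (arr 15 (V 8)) (N 0))
          (put 15 (V 8) (V 16) ;; 9 ::= arr 0 (V 8) ;; relax_scan) Skip))"

definition write_com :: com where
  "write_com = 11 ::= N 0 ;; While (lt_test (V 11) (V 6))
     (8 ::= arr 10 (V 11) ;; put 6 (V 8) (arr 13 (arr 15 (V 8))) ;;
      put 7 (V 8) (arr 13 (Plus (arr 15 (V 8)) (N 1))) ;; 11 ::= Plus (V 11) (N 1))"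

definition comp_com :: com where
  "comp_com = If (eq_test (arr 9 (V 4)) (V 2)) Skip
     (search_com ;; sort_com ;; ends_com ;; place_loop ;; settle_com ;; write_com)"

section \<open>Binary search, the adjacency scans, and the traversal of a component\<close>

section \<open>Verification of the search\<close>

declare One_nat_def [simp del]

context inst
begin

lemma le_diff_pos: "0 < a \<Longrightarrow> (a::nat) \<le> t - b \<longleftrightarrow> b + a \<le> t" by auto

lemmas vcg = okk evs tes le_diff_pos

lemma okk_While:
  assumes "Inv \<sigma> t"
    and "\<And>\<sigma> t. Inv \<sigma> t \<Longrightarrow> te \<sigma> b \<Longrightarrow> 3 \<le> t \<and> okk c \<sigma> (t - 3) Inv"
    and "\<And>\<sigma> t. Inv \<sigma> t \<Longrightarrow> \<not> te \<sigma> b \<Longrightarrow> 2 \<le> t \<and> Q \<sigma> (t - 2)"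
  shows "okk (While b c) \<sigma> t Q"
  using assms by (rule ok_While)

text \<open>The bracket is half open, so width 1 identifies the bucket. The invariant bounds the
  width by \<open>2 ^ L\<close>, and each halving spends 10 credits.\<close>

lemma okk_locate:
  assumes J: "1 \<le> rg \<sigma> 13" "rg \<sigma> 13 \<le> 2 * W" "rg \<sigma> 13 \<le> 2 ^ \<Lambda>"
    and codes: "\<And>i. i \<le> rg \<sigma> 13 \<Longrightarrow> ar \<sigma> 13 i \<le> Suc m" "rg \<sigma> 14 \<le> Suc m"
    and key: "rk (ar \<sigma> 13 0) \<le> rk (rg \<sigma> 14)" "rk (rg \<sigma> 14) < rk (ar \<sigma> 13 (rg \<sigma> 13))"
    and t: "10 * \<Lambda> + 10 \<le> t"
    and Q: "\<And>\<sigma>' u. frame {12, 13, 21} {} \<sigma> \<sigma>' \<Longrightarrow> rg \<sigma>' 12 < rg \<sigma> 13 \<Longrightarrow>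
        rk (ar \<sigma> 13 (rg \<sigma>' 12)) \<le> rk (rg \<sigma> 14) \<Longrightarrow> rk (rg \<sigma> 14) < rk (ar \<sigma> 13 (rg \<sigma>' 12 + 1)) \<Longrightarrow>
        t - (10 * \<Lambda> + 10) \<le> u \<Longrightarrow> Q \<sigma>' u"
  shows "okk locate_com \<sigma> t Q"
proof -
  define Inv where "Inv = (\<lambda>\<sigma>' u. frame {12, 13, 21} {} \<sigma> \<sigma>' \<and> rg \<sigma>' 12 < rg \<sigma>' 13 \<and> rg \<sigma>' 13 \<le> rg \<sigma> 13 \<and>
     rk (ar \<sigma> 13 (rg \<sigma>' 12)) \<le> rk (rg \<sigma> 14) \<and> rk (rg \<sigma> 14) < rk (ar \<sigma> 13 (rg \<sigma>' 13)) \<and>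
     (\<exists>L. rg \<sigma>' 13 - rg \<sigma>' 12 \<le> 2 ^ L \<and> 10 * L + 2 + (t - (10 * \<Lambda> + 10)) \<le> u))"
  have "okk (While (lt_test (Plus (V 12) (N 1)) (V 13))
      (21 ::= Quot (Plus (V 12) (V 13)) (N 2) ;;
       If (wle_test (arr 13 (V 21)) (V 14)) (12 ::= V 21) (13 ::= V 21))) (srg 12 0 \<sigma>) (t - 2) Q"
  proof (rule okk_While[where Inv = Inv])
    show "Inv (srg 12 0 \<sigma>) (t - 2)"
      unfolding Inv_def using J key t by (auto intro!: exI[of _ \<Lambda>])
  next
    fix \<sigma>' u assume inv: "Inv \<sigma>' u" and b: "te \<sigma>' (lt_test (Plus (V 12) (N 1)) (V 13))"
    obtain L where L: "rg \<sigma>' 13 - rg \<sigma>' 12 \<le> 2 ^ L" "10 * L + 2 + (t - (10 * \<Lambda> + 10)) \<le> u"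
      using inv by (auto simp: Inv_def)
    have fr: "frame {12, 13, 21} {} \<sigma> \<sigma>'" and r: "rg \<sigma>' 12 < rg \<sigma>' 13" "rg \<sigma>' 13 \<le> rg \<sigma> 13" using inv by (auto simp: Inv_def)
    have arr: "ar \<sigma>' 13 = ar \<sigma> 13" "rg \<sigma>' 14 = rg \<sigma> 14" using fr by (auto simp: frame_def)
    have lt: "rg \<sigma>' 12 + 1 < rg \<sigma>' 13" using b r J by (simp add: vcg)
    obtain L' where L': "L = Suc L'" using L lt by (cases L) auto
    define mid where "mid = (rg \<sigma>' 12 + rg \<sigma>' 13) div 2"
    have mid: "rg \<sigma>' 12 < mid" "mid < rg \<sigma>' 13" using lt by (auto simp: mid_def)
    have mid2: "mid - rg \<sigma>' 12 \<le> 2 ^ L'" "rg \<sigma>' 13 - mid \<le> 2 ^ L'"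
      using L(1) lt unfolding L' mid_def by auto
    have c: "ar \<sigma> 13 mid \<le> Suc m" using codes(1)[of mid] mid r by simp
    show "3 \<le> u \<and> okk (21 ::= Quot (Plus (V 12) (V 13)) (N 2) ;;
       If (wle_test (arr 13 (V 21)) (V 14)) (12 ::= V 21) (13 ::= V 21)) \<sigma>' (u - 3) Inv"
      using L L' r J c codes arr mid mid2 fr inv
      by (auto simp: vcg Inv_def mid_def[symmetric] not_le intro!: exI[of _ L'])
  next
    fix \<sigma>' u assume inv: "Inv \<sigma>' u" and b: "\<not> te \<sigma>' (lt_test (Plus (V 12) (N 1)) (V 13))"
    have fr: "frame {12, 13, 21} {} \<sigma> \<sigma>'" and r: "rg \<sigma>' 12 < rg \<sigma>' 13" "rg \<sigma>' 13 \<le> rg \<sigma> 13" using inv by (auto simp: Inv_def)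
    have "rg \<sigma>' 13 = rg \<sigma>' 12 + 1" using b r J by (simp add: vcg)
    then show "2 \<le> u \<and> Q \<sigma>' (u - 2)" using inv Q[of \<sigma>' "u - 2"] by (auto simp: Inv_def)
  qed
  then show ?thesis using t by (simp add: locate_com_def vcg)
qed

lemma okk_insert:
  assumes "rg \<sigma> 15 < 2 * W" "rg \<sigma> 12 \<le> 2 * W" "7 \<le> t"
    and "Q (sar 16 (rg \<sigma> 12) (rg \<sigma> 15 + 1) (sar 17 (rg \<sigma> 15 + 1) (ar \<sigma> 16 (rg \<sigma> 12))
       (sar 18 (rg \<sigma> 15 + 1) (rg \<sigma> 14) (srg 15 (rg \<sigma> 15 + 1) \<sigma>)))) (t - 7)"
  shows "okk insert_com \<sigma> t Q"
  using assms by (simp add: insert_com_def vcg ar_sar)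


definition adj :: "state \<Rightarrow> bool" where
  "adj \<sigma> \<longleftrightarrow> (\<forall>v<n. ar \<sigma> 0 v = prv T (Suc m) v \<and> ar \<sigma> 2 v = prv H (Suc m) v) \<and>
     (\<forall>c\<in>{1..m}. ar \<sigma> 1 c = prv T c (T c) \<and> ar \<sigma> 3 c = prv H c (H c))"

definition smp :: "state \<Rightarrow> nat set" where "smp \<sigma> = {c. ar \<sigma> 8 c = 0}"
definition ord :: "state \<Rightarrow> nat list" where "ord \<sigma> = map (ar \<sigma> 10) [0..<rg \<sigma> 6]"
text \<open>Reversed because the top of the stack has the largest index in the array, whereas
  \<open>srch\<close> has it at the front of the list.\<close>

definition stk :: "state \<Rightarrow> nat list" where "stk \<sigma> = rev (map (ar \<sigma> 11) [0..<rg \<sigma> 5])"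
definition vis :: "state \<Rightarrow> nat set" where "vis \<sigma> = {v. ar \<sigma> 9 v = rg \<sigma> 2}"

definition sst :: "state \<Rightarrow> nat set \<Rightarrow> nat \<Rightarrow> nat set \<Rightarrow> nat set \<Rightarrow> bool" where
  "sst \<sigma> U0 r X1 X2 \<longleftrightarrow> srch (ar \<sigma> 4) (ar \<sigma> 5) (smp \<sigma>) U0 r X1 X2 (ord \<sigma>) (stk \<sigma>) (vis \<sigma>) (ar \<sigma> 13) (rg \<sigma> 7) (ar \<sigma> 12)"

lemma state_srg [simp]:
  "smp (srg r v \<sigma>) = smp \<sigma>" "r \<noteq> 6 \<Longrightarrow> ord (srg r v \<sigma>) = ord \<sigma>" "r \<noteq> 5 \<Longrightarrow> stk (srg r v \<sigma>) = stk \<sigma>"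
  "r \<noteq> 2 \<Longrightarrow> vis (srg r v \<sigma>) = vis \<sigma>" "adj (srg r v \<sigma>) = adj \<sigma>"
  by (simp_all add: smp_def ord_def stk_def vis_def adj_def)

lemma sst_srg [simp]: "r \<notin> {2, 5, 6, 7} \<Longrightarrow> sst (srg r v \<sigma>) U0 q X1 X2 = sst \<sigma> U0 q X1 X2"
  by (simp add: sst_def)

lemma card_cc_le: "r < n \<Longrightarrow> card (cc lo r) \<le> n"
proof -
  assume "r < n"
  then have "cc lo r \<subseteq> {..<n}" using cc_subset_VV[of lo r] VV_lt by auto
  from card_mono[OF _ this] show ?thesis by simp
qed

lemma cc_lt: "r < n \<Longrightarrow> v \<in> cc lo r \<Longrightarrow> v < n"
  using cc_subset_VV[of lo r] VV_lt by auto

lemma sst_bounds: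
  assumes "sst \<sigma> U0 r X1 X2" "r < n"
  shows "rg \<sigma> 6 + rg \<sigma> 5 \<le> n" "rg \<sigma> 7 \<le> m"
proof -
  have s: "srch (ar \<sigma> 4) (ar \<sigma> 5) (smp \<sigma>) U0 r X1 X2 (ord \<sigma>) (stk \<sigma>) (vis \<sigma>) (ar \<sigma> 13) (rg \<sigma> 7) (ar \<sigma> 12)"
    using assms(1) by (simp add: sst_def)
  show "rg \<sigma> 7 \<le> m" by (rule srch_bounds(2)[OF s])
  have "rg \<sigma> 6 + rg \<sigma> 5 = length (ord \<sigma>) + length (stk \<sigma>)" by (simp add: ord_def stk_def)
  also have "\<dots> \<le> card (cc (ar \<sigma> 4) r)" by (rule srch_bounds(1)[OF s])
  also have "\<dots> \<le> n" by (rule card_cc_le[OF assms(2)])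
  finally show "rg \<sigma> 6 + rg \<sigma> 5 \<le> n" .
qed

definition pushed :: "state \<Rightarrow> state" where
  "pushed \<sigma> = srg 5 (rg \<sigma> 5 + 1) (sar 11 (rg \<sigma> 5) (rg \<sigma> 10) (sar 9 (rg \<sigma> 10) (rg \<sigma> 2) \<sigma>))"

lemma okk_push:
  "rg \<sigma> 10 < n \<Longrightarrow> rg \<sigma> 5 \<le> n \<Longrightarrow> okk push_com \<sigma> t Q \<longleftrightarrow> 5 \<le> t \<and> Q (pushed \<sigma>) (t - 5)"
  using W_ge by (auto simp: push_com_def vcg pushed_def)

lemma rg_pushed: "r \<noteq> 5 \<Longrightarrow> rg (pushed \<sigma>) r = rg \<sigma> r" by (simp add: pushed_def)

lemma ar_pushed: "k < 32 \<Longrightarrow> k \<noteq> 9 \<Longrightarrow> k \<noteq> 11 \<Longrightarrow> ar (pushed \<sigma>) k = ar \<sigma> k"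
  by (simp add: pushed_def ar_sar)

lemma frame_pushed: "5 \<in> R \<Longrightarrow> 9 \<in> K \<Longrightarrow> 11 \<in> K \<Longrightarrow> frame R K \<sigma>0 (pushed \<sigma>) \<longleftrightarrow> frame R K \<sigma>0 \<sigma>"
  by (simp add: pushed_def)

lemma sst_pushed:
  assumes s: "sst \<sigma> U0 r X1 X2" and o: "ord \<sigma> = os @ [a]" and c: "alive (ar \<sigma> 4) c" "{T c, H c} = {a, rg \<sigma> 10}"
    and x: "ar \<sigma> 9 (rg \<sigma> 10) \<noteq> rg \<sigma> 2"
  shows "sst (pushed \<sigma>) U0 r X1 X2" "ord (pushed \<sigma>) = os @ [a]" "vis (pushed \<sigma>) = insert (rg \<sigma> 10) (vis \<sigma>)"
proof -
  have o': "ord (pushed \<sigma>) = ord \<sigma>" by (simp add: pushed_def ord_def ar_sar)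
  then show "ord (pushed \<sigma>) = os @ [a]" using o by simp
  show v: "vis (pushed \<sigma>) = insert (rg \<sigma> 10) (vis \<sigma>)" by (auto simp: pushed_def vis_def ar_sar)
  have s': "stk (pushed \<sigma>) = rg \<sigma> 10 # stk \<sigma>" by (simp add: pushed_def stk_def ar_sar Suc_eq_plus1[symmetric] del: Suc_eq_plus1)
  have "smp (pushed \<sigma>) = smp \<sigma>" by (simp add: smp_def ar_pushed)
  moreover have "rg \<sigma> 10 \<notin> vis \<sigma>" using x by (simp add: vis_def)
  ultimately show "sst (pushed \<sigma>) U0 r X1 X2"
    using srch_push[OF s[unfolded sst_def o] c]
    unfolding sst_def o' o s' v by (simp add: ar_pushed rg_pushed)
qed

lemma good_codes:
  assumes "good (ar \<sigma> 4) (ar \<sigma> 5)" shows "ar \<sigma> 4 v \<le> Suc m" "ar \<sigma> 5 v \<le> Suc m"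
  using goodD[OF assms] by auto

lemma okk_out_scan:
  assumes g: "good (ar \<sigma> 4) (ar \<sigma> 5)" and ad: "adj \<sigma>" and r: "r < n"
    and o: "ord \<sigma> = os @ [rg \<sigma> 8]"
    and f: "rg \<sigma> 9 = prv T (Suc m) (rg \<sigma> 8)"
    and s: "sst \<sigma> U0 r {c \<in> {1..m}. T c = rg \<sigma> 8} X2"
    and t: "25 * card {c \<in> {1..m}. T c = rg \<sigma> 8} + 5 \<le> t"
    and Q: "\<And>\<sigma>' u. frame {5, 9, 10} {9, 11} \<sigma> \<sigma>' \<Longrightarrow> sst \<sigma>' U0 r {} X2 \<Longrightarrow>
        t - (25 * card {c \<in> {1..m}. T c = rg \<sigma> 8} + 5) \<le> u \<Longrightarrow> Q \<sigma>' u"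
  shows "okk out_scan \<sigma> t Q"
proof -
  define a where "a = rg \<sigma> 8"
  \<comment> \<open>The adjacency list is descending, so the edges pending at code \<open>f\<close>
    are those of code at most \<open>f\<close>; this set is the parameter \<open>X1\<close> of the
    search invariant.\<close>
  define X where "X f = {c. 1 \<le> c \<and> c \<le> f \<and> T c = a}" for f
  define K where "K = 25 * card {c \<in> {1..m}. T c = a} + 5"
  have fX: "finite (X f)" for f by (rule finite_subset[of _ "{..f}"]) (auto simp: X_def)
  have X0: "X (rg \<sigma> 9) = {c \<in> {1..m}. T c = a}" using prv_top[of T a] f by (simp add: X_def a_def)
  have an: "a < n"
  proof -
    have "a \<in> cc (ar \<sigma> 4) r" using srchD(2)[OF s[unfolded sst_def]] o by (auto simp: a_def)
    then show ?thesis by (rule cc_lt[OF r])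
  qed
  define Inv where "Inv = (\<lambda>\<sigma>' u. frame {5, 9, 10} {9, 11} \<sigma> \<sigma>' \<and> sst \<sigma>' U0 r (X (rg \<sigma>' 9)) X2 \<and> rg \<sigma>' 9 \<le> m \<and>
     (rg \<sigma>' 9 = 0 \<or> T (rg \<sigma>' 9) = a) \<and> 25 * card (X (rg \<sigma>' 9)) + 2 + (t - K) \<le> u)"
  show ?thesis unfolding out_scan_def
  proof (rule okk_While[where Inv = Inv])
    show "Inv \<sigma> t"
      unfolding Inv_def X0 using s t prv_le[of T "Suc m" a] prv_valid[of T "Suc m" a] f by (auto simp: a_def K_def)
  next
    fix \<sigma>' u assume inv: "Inv \<sigma>' u" and b: "te \<sigma>' (Leq (N 1) (V 9))"
    have fr: "frame {5, 9, 10} {9, 11} \<sigma> \<sigma>'" and s': "sst \<sigma>' U0 r (X (rg \<sigma>' 9)) X2" and u: "25 * card (X (rg \<sigma>' 9)) + 2 + (t - K) \<le> u"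
      using inv by (auto simp: Inv_def)
    have f': "1 \<le> rg \<sigma>' 9" "rg \<sigma>' 9 \<le> m" "T (rg \<sigma>' 9) = a" using inv b by (auto simp: Inv_def vcg)
    define c where "c = rg \<sigma>' 9"
    have e: "rg \<sigma>' 8 = a" "ar \<sigma>' 4 = ar \<sigma> 4" "ar \<sigma>' 1 = ar \<sigma> 1" "rg \<sigma>' 6 = rg \<sigma> 6" "ar \<sigma>' 10 = ar \<sigma> 10"
      using fr by (simp_all add: frame_def a_def)
    have o': "ord \<sigma>' = os @ [a]" using o e by (simp add: ord_def a_def)
    have cm: "c \<in> {1..m}" using f' by (simp add: c_def)
    have Hn: "H c < n" "c \<le> W" "a \<le> W" using edge_lt[OF cm] f' W_ge an by (auto simp: c_def)
    have nx: "ar \<sigma> 1 c = prv T c a" using ad cm f' by (auto simp: adj_def c_def)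
    have Xs: "X c - {c} = X (prv T c a)" using prv_step[of c T a] f' by (simp add: X_def c_def)
    have "c \<in> X c" using f' by (simp add: X_def c_def)
    then have cX: "card (X c) = card (X (prv T c a)) + 1"
      using fX[of c] Xs card_Suc_Diff1[of "X c" c] by simp
    have al: "alive (ar \<sigma> 4) c \<longleftrightarrow> ar \<sigma> 4 (H c) = ar \<sigma> 4 a \<and> rk (ar \<sigma> 4 a) < rk c"
      using f' cm by (auto simp: alive_def c_def)
    have bnd: "rg \<sigma>' 5 \<le> n" using sst_bounds[OF s' r] by simp
    have codes: "ar \<sigma> 4 v \<le> Suc m" for v using good_codes[OF g] by auto
    note pv = prv_le[of T c a] prv_valid[of T c a]
    define \<tau> where "\<tau> = srg 10 (H c) \<sigma>'"
    have tau: "rg \<tau> 10 = H c" "rg \<tau> 9 = c" "rg \<tau> 8 = a" "rg \<tau> 5 = rg \<sigma>' 5" "rg \<tau> 2 = rg \<sigma>' 2" "ar \<tau> = ar \<sigma>'"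
      "sst \<tau> U0 r (X c) X2" "ord \<tau> = os @ [a]" "frame {5, 9, 10} {9, 11} \<sigma> \<tau>" "vis \<tau> = vis \<sigma>'"
      using s' o' fr e by (simp_all add: \<tau>_def c_def)
    have A: "Inv (srg 9 (ar \<sigma> 1 c) (pushed \<tau>)) v" if "alive (ar \<sigma> 4) c" "ar \<sigma>' 9 (H c) \<noteq> rg \<sigma>' 2" "25 * card (X (prv T c a)) + 2 + (t - K) \<le> v" for v
    proof -
      have "sst (pushed \<tau>) U0 r (X c) X2" "vis (pushed \<tau>) = insert (H c) (vis \<sigma>')"
        using sst_pushed[OF tau(7,8), of c] that tau e f' by (auto simp: c_def)
      then have "sst (pushed \<tau>) U0 r (X c - {c}) X2"
        unfolding sst_def by (intro srch_X1) auto
      then show ?thesis unfolding Inv_def Xs nx using pv that(3) tau(9) by (auto simp: frame_pushed nx)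
    qed
    have B: "Inv (srg 9 (ar \<sigma> 1 c) \<tau>) v" if "alive (ar \<sigma> 4) c \<Longrightarrow> ar \<sigma>' 9 (H c) = rg \<sigma>' 2" "25 * card (X (prv T c a)) + 2 + (t - K) \<le> v" for v
    proof -
      have "sst \<tau> U0 r (X c - {c}) X2"
        using tau(7) unfolding sst_def by (rule srch_X1) (use that(1) tau e in \<open>simp add: vis_def\<close>)
      then show ?thesis unfolding Inv_def Xs nx using pv that(2) tau(9) by (auto simp: nx)
    qed
    show "3 \<le> u \<and> okk (10 ::= hd_exp (V 9) ;;
      If (Conj (eq_test (arr 4 (V 10)) (arr 4 (V 8)))
            (Conj (wlt_test (arr 4 (V 8)) (V 9)) (Neg (eq_test (arr 9 (V 10)) (V 2)))))
        push_com Skip ;;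
      9 ::= arr 1 (V 9)) \<sigma>' (u - 3) Inv"
      using A B Hn f' u[folded c_def] codes e bnd al W_ge cX nx
      by (auto simp: vcg c_def[symmetric] \<tau>_def[symmetric] tau okk_push rg_pushed ar_pushed)
  next
    fix \<sigma>' u assume inv: "Inv \<sigma>' u" and b: "\<not> te \<sigma>' (Leq (N 1) (V 9))"
    then have "rg \<sigma>' 9 = 0" by (simp add: vcg)
    then have "X (rg \<sigma>' 9) = {}" by (auto simp: X_def)
    then show "2 \<le> u \<and> Q \<sigma>' (u - 2)" using inv Q[of \<sigma>' "u - 2"] by (auto simp: Inv_def K_def a_def)
  qed
qed


text \<open>The two conditional updates as state transformers, so that later proofs meet one
  resulting state instead of four branches.\<close>

definition hupd :: "state \<Rightarrow> state" where
  "hupd \<sigma> = (if rk (rg \<sigma> 9) \<le> rk (ar \<sigma> 4 (rg \<sigma> 10)) \<and> rk (ar \<sigma> 12 (rg \<sigma> 8)) < rk (rg \<sigma> 9)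
     then sar 12 (rg \<sigma> 8) (rg \<sigma> 9) \<sigma> else \<sigma>)"

definition kupd :: "state \<Rightarrow> state" where
  "kupd \<sigma> = (if rk (rg \<sigma> 9) < rk (ar \<sigma> 5 (rg \<sigma> 8)) \<and> ar \<sigma> 8 (rg \<sigma> 9) = 0
     then sar 13 (rg \<sigma> 7 + 1) (rg \<sigma> 9) (srg 7 (rg \<sigma> 7 + 1) \<sigma>) else \<sigma>)"

lemma rg_hupd: "rg (hupd \<sigma>) = rg \<sigma>" by (simp add: hupd_def)
lemma ar_hupd: "k < 32 \<Longrightarrow> k \<noteq> 12 \<Longrightarrow> ar (hupd \<sigma>) k = ar \<sigma> k" by (simp add: hupd_def ar_sar)
lemma rg_kupd: "r \<noteq> 7 \<Longrightarrow> rg (kupd \<sigma>) r = rg \<sigma> r" by (simp add: kupd_def)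
lemma ar_kupd: "k < 32 \<Longrightarrow> k \<noteq> 13 \<Longrightarrow> ar (kupd \<sigma>) k = ar \<sigma> k" by (simp add: kupd_def ar_sar)

lemma okk_in_upd:
  assumes "rg \<sigma> 8 < n" "1 \<le> rg \<sigma> 9" "rg \<sigma> 9 \<le> m" "rg \<sigma> 10 < n" "rg \<sigma> 7 \<le> m"
    "\<And>v. ar \<sigma> 4 v \<le> Suc m" "\<And>v. ar \<sigma> 5 v \<le> Suc m" "ar \<sigma> 12 (rg \<sigma> 8) \<le> Suc m" "8 \<le> t"
    and Q: "\<And>u. t - 8 \<le> u \<Longrightarrow> Q (kupd (hupd \<sigma>)) u"
  shows "okk in_upd \<sigma> t Q"
proof -
  have b: "rg \<sigma> 8 \<le> 3 * W" "rg \<sigma> 9 \<le> 3 * W" "rg \<sigma> 10 \<le> 3 * W" "rg \<sigma> 7 + 1 \<le> 3 * W" "rg \<sigma> 7 + 1 \<le> 128 * W"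
    using assms(1-5) W_ge by auto
  have 1: "okk (If (Conj (wle_test (V 9) (arr 4 (V 10))) (wlt_test (arr 12 (V 8)) (V 9))) (put 12 (V 8) (V 9)) Skip) \<sigma> (t - 1)
      (\<lambda>\<sigma>' u. \<sigma>' = hupd \<sigma> \<and> t - 3 \<le> u)"
    using assms b by (auto simp: vcg hupd_def)
  have 2: "okk (If (Conj (wlt_test (V 9) (arr 5 (V 8))) (eq_test (arr 8 (V 9)) (N 0)))
       (7 ::= Plus (V 7) (N 1) ;; put 13 (V 7) (V 9)) Skip) (hupd \<sigma>) v Q" if "t - 3 \<le> v" for v
    using assms b that by (auto simp: vcg kupd_def rg_hupd ar_hupd intro!: Q)
  show ?thesis unfolding in_upd_def ok_Seq
    using assms(9) by (intro conjI ok_mono[OF 1]) (auto intro: 2)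
qed

lemma sst_upd:
  assumes s: "sst \<sigma> U0 r X1 X2" and c: "rg \<sigma> 9 \<in> X2" "rg \<sigma> 9 \<in> {1..m}" "H (rg \<sigma> 9) = rg \<sigma> 8" "rg \<sigma> 8 \<in> set (ord \<sigma>)"
    "T (rg \<sigma> 9) = rg \<sigma> 10" "rk (ar \<sigma> 4 (rg \<sigma> 8)) < rk (rg \<sigma> 9)"
    "alive (ar \<sigma> 4) (rg \<sigma> 9) \<Longrightarrow> rg \<sigma> 10 \<in> vis \<sigma>"
  shows "sst (kupd (hupd \<sigma>)) U0 r X1 (X2 - {rg \<sigma> 9})" "ord (kupd (hupd \<sigma>)) = ord \<sigma>" "vis (kupd (hupd \<sigma>)) = vis \<sigma>"
proof -
  let ?\<sigma> = "kupd (hupd \<sigma>)"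
  show o: "ord ?\<sigma> = ord \<sigma>" and v: "vis ?\<sigma> = vis \<sigma>"
    by (simp_all add: ord_def vis_def rg_kupd ar_kupd rg_hupd ar_hupd)
  have st: "stk ?\<sigma> = stk \<sigma>" "smp ?\<sigma> = smp \<sigma>" "ar ?\<sigma> 4 = ar \<sigma> 4" "ar ?\<sigma> 5 = ar \<sigma> 5"
    by (simp_all add: stk_def smp_def rg_kupd ar_kupd rg_hupd ar_hupd)
  have h: "ar ?\<sigma> 12 = (if src (ar \<sigma> 4) (rg \<sigma> 9) \<and> rk (ar \<sigma> 12 (rg \<sigma> 8)) < rk (rg \<sigma> 9) then (ar \<sigma> 12)(rg \<sigma> 8 := rg \<sigma> 9) else ar \<sigma> 12)"
    using c by (simp add: ar_kupd hupd_def src_def ar_sar)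
  have k: "key (smp \<sigma>) (ar \<sigma> 4) (ar \<sigma> 5) (rg \<sigma> 9) \<longleftrightarrow> rk (rg \<sigma> 9) < rk (ar \<sigma> 5 (rg \<sigma> 8)) \<and> ar \<sigma> 8 (rg \<sigma> 9) = 0"
    using c by (auto simp: key_def smp_def)
  have t: "ar ?\<sigma> 13 = (if key (smp \<sigma>) (ar \<sigma> 4) (ar \<sigma> 5) (rg \<sigma> 9) then (ar \<sigma> 13)(rg \<sigma> 7 + 1 := rg \<sigma> 9) else ar \<sigma> 13)"
    "rg ?\<sigma> 7 = (if key (smp \<sigma>) (ar \<sigma> 4) (ar \<sigma> 5) (rg \<sigma> 9) then rg \<sigma> 7 + 1 else rg \<sigma> 7)"
    unfolding k by (simp_all add: kupd_def rg_hupd ar_hupd ar_sar)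
  show "sst ?\<sigma> U0 r X1 (X2 - {rg \<sigma> 9})"
    unfolding sst_def o v st
    by (rule srch_X2[OF s[unfolded sst_def] c(1,2,3,4) _ h t]) (use c(5,7) in simp)
qed

lemma ismax_le: "ismax A x \<Longrightarrow> A \<subseteq> {..Suc m} \<Longrightarrow> x \<le> Suc m"
  by (auto simp: ismax_def)

lemma okk_in_scan:
  assumes g: "good (ar \<sigma> 4) (ar \<sigma> 5)" and ad: "adj \<sigma>" and r: "r < n"
    and o: "ord \<sigma> = os @ [rg \<sigma> 8]"
    and f: "rg \<sigma> 9 = prv H (Suc m) (rg \<sigma> 8)"
    and s: "sst \<sigma> U0 r X1 {c \<in> {1..m}. H c = rg \<sigma> 8}"
    and t: "30 * card {c \<in> {1..m}. H c = rg \<sigma> 8} + 5 \<le> t"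
    and Q: "\<And>\<sigma>' u. frame {5, 7, 9, 10} {9, 11, 12, 13} \<sigma> \<sigma>' \<Longrightarrow> sst \<sigma>' U0 r X1 {} \<Longrightarrow>
        t - (30 * card {c \<in> {1..m}. H c = rg \<sigma> 8} + 5) \<le> u \<Longrightarrow> Q \<sigma>' u"
  shows "okk in_scan \<sigma> t Q"
proof -
  define a where "a = rg \<sigma> 8"
  define X where "X f = {c. 1 \<le> c \<and> c \<le> f \<and> H c = a}" for f
  define K where "K = 30 * card {c \<in> {1..m}. H c = a} + 5"
  have fX: "finite (X f)" for f by (rule finite_subset[of _ "{..f}"]) (auto simp: X_def)
  have X0: "X (rg \<sigma> 9) = {c \<in> {1..m}. H c = a}" using prv_top[of H a] f by (simp add: X_def a_def)
  have an: "a < n"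
  proof -
    have "a \<in> cc (ar \<sigma> 4) r" using srchD(2)[OF s[unfolded sst_def]] o by (auto simp: a_def)
    then show ?thesis by (rule cc_lt[OF r])
  qed
  define Inv where "Inv = (\<lambda>\<sigma>' u. frame {5, 7, 9, 10} {9, 11, 12, 13} \<sigma> \<sigma>' \<and> sst \<sigma>' U0 r X1 (X (rg \<sigma>' 9)) \<and> rg \<sigma>' 9 \<le> m \<and>
     (rg \<sigma>' 9 = 0 \<or> H (rg \<sigma>' 9) = a) \<and> 30 * card (X (rg \<sigma>' 9)) + 2 + (t - K) \<le> u)"
  show ?thesis unfolding in_scan_def
  proof (rule okk_While[where Inv = Inv])
    show "Inv \<sigma> t"
      unfolding Inv_def X0 using s t prv_le[of H "Suc m" a] prv_valid[of H "Suc m" a] f by (auto simp: a_def K_def)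
  next
    fix \<sigma>' u assume inv: "Inv \<sigma>' u" and b: "te \<sigma>' (Leq (N 1) (V 9))"
    have fr: "frame {5, 7, 9, 10} {9, 11, 12, 13} \<sigma> \<sigma>'" and s': "sst \<sigma>' U0 r X1 (X (rg \<sigma>' 9))" and u: "30 * card (X (rg \<sigma>' 9)) + 2 + (t - K) \<le> u"
      using inv by (auto simp: Inv_def)
    have f': "1 \<le> rg \<sigma>' 9" "rg \<sigma>' 9 \<le> m" "H (rg \<sigma>' 9) = a" using inv b by (auto simp: Inv_def vcg)
    define c where "c = rg \<sigma>' 9"
    have e: "rg \<sigma>' 8 = a" "ar \<sigma>' 4 = ar \<sigma> 4" "ar \<sigma>' 5 = ar \<sigma> 5" "ar \<sigma>' 3 = ar \<sigma> 3" "rg \<sigma>' 6 = rg \<sigma> 6" "ar \<sigma>' 10 = ar \<sigma> 10"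
      using fr by (simp_all add: frame_def a_def)
    have o': "ord \<sigma>' = os @ [a]" using o e by (simp add: ord_def a_def)
    have cm: "c \<in> {1..m}" using f' by (simp add: c_def)
    have Tn: "T c < n" "c \<le> W" "a \<le> W" using edge_lt[OF cm] f' W_ge an by (auto simp: c_def)
    have nx: "ar \<sigma> 3 c = prv H c a" using ad cm f' by (auto simp: adj_def c_def)
    have Xs: "X c - {c} = X (prv H c a)" using prv_step[of c H a] f' by (simp add: X_def c_def)
    have cXc: "c \<in> X c" using f' by (simp add: X_def c_def)
    then have cX: "card (X c) = card (X (prv H c a)) + 1"
      using fX[of c] Xs card_Suc_Diff1[of "X c" c] by simp
    have al: "alive (ar \<sigma> 4) c \<longleftrightarrow> ar \<sigma> 4 (T c) = ar \<sigma> 4 a \<and> rk (ar \<sigma> 4 a) < rk c"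
      using f' cm by (auto simp: alive_def c_def)
    have bnd: "rg \<sigma>' 5 \<le> n" "rg \<sigma>' 7 \<le> m" using sst_bounds[OF s' r] by simp_all
    have codes: "ar \<sigma> 4 v \<le> Suc m" "ar \<sigma> 5 v \<le> Suc m" for v using good_codes[OF g] by auto
    have h12: "ar \<sigma>' 12 a \<le> Suc m"
      using srchD(10)[OF s'[unfolded sst_def], of a] o' by (rule_tac ismax_le) (auto simp: src_def)
    note pv = prv_le[of H c a] prv_valid[of H c a]
    define \<tau> where "\<tau> = srg 10 (T c) \<sigma>'"
    have tau: "rg \<tau> 10 = T c" "rg \<tau> 9 = c" "rg \<tau> 8 = a" "rg \<tau> 5 = rg \<sigma>' 5" "rg \<tau> 2 = rg \<sigma>' 2" "rg \<tau> 7 = rg \<sigma>' 7" "ar \<tau> = ar \<sigma>'"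
      "sst \<tau> U0 r X1 (X c)" "ord \<tau> = os @ [a]" "frame {5, 7, 9, 10} {9, 11, 12, 13} \<sigma> \<tau>" "vis \<tau> = vis \<sigma>'"
      using s' o' fr e by (simp_all add: \<tau>_def c_def)
    define \<tau>' where "\<tau>' = (if ar \<sigma> 4 (T c) = ar \<sigma> 4 a \<and> ar \<sigma>' 9 (T c) \<noteq> rg \<sigma>' 2 then pushed \<tau> else \<tau>)"
    \<comment> \<open>An edge that does not exceed the lower end at its head is neither alive nor a
      source nor a threshold, so removing it from the pending set changes nothing else.\<close>
    have B: "Inv (srg 9 (ar \<sigma> 3 c) \<tau>) v" if "\<not> rk (ar \<sigma> 4 a) < rk c" "30 * card (X (prv H c a)) + 2 + (t - K) \<le> v" for v
    proof -
      have "sst \<tau> U0 r X1 (X c - {c})"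
        unfolding sst_def by (rule srch_X2[OF tau(8)[unfolded sst_def] cXc cm]) (use that(1) f' tau e in \<open>auto simp: c_def src_def key_def alive_def\<close>)
      then show ?thesis unfolding Inv_def Xs nx using pv that(2) tau(10) by (auto simp: nx)
    qed
    have okA: "okk (in_push ;; in_upd) \<tau> v (\<lambda>\<sigma>' u. okk (9 ::= arr 3 (V 9)) \<sigma>' u Inv)"
      if lt: "rk (ar \<sigma> 4 a) < rk c" and v: "30 * card (X (prv H c a)) + 20 + (t - K) \<le> v" for v
    proof -
      have okp: "okk in_push \<tau> (v - 1) (\<lambda>\<sigma>' u. \<sigma>' = \<tau>' \<and> v - 7 \<le> u)"
        using v bnd Tn W_ge by (auto simp: in_push_def vcg tau okk_push e \<tau>'_def)
      have t': "rg \<tau>' 10 = T c" "rg \<tau>' 9 = c" "rg \<tau>' 8 = a" "rg \<tau>' 7 = rg \<sigma>' 7" "ar \<tau>' 4 = ar \<sigma> 4" "ar \<tau>' 5 = ar \<sigma> 5" "ar \<tau>' 12 = ar \<sigma>' 12"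
         "ar \<tau>' 3 = ar \<sigma> 3"
        by (auto simp: \<tau>'_def tau rg_pushed ar_pushed e)
      have s2: "sst \<tau>' U0 r X1 (X c)" "ord \<tau>' = os @ [a]" "alive (ar \<sigma> 4) c \<Longrightarrow> T c \<in> vis \<tau>'"
      proof -
        have p: "sst (pushed \<tau>) U0 r X1 (X c) \<and> ord (pushed \<tau>) = os @ [a] \<and> vis (pushed \<tau>) = insert (T c) (vis \<sigma>')"
          if "ar \<sigma> 4 (T c) = ar \<sigma> 4 a" "ar \<sigma>' 9 (T c) \<noteq> rg \<sigma>' 2"
          using sst_pushed[OF tau(8,9), of c] that lt al tau e f' by (auto simp: c_def)
        show "sst \<tau>' U0 r X1 (X c)" "ord \<tau>' = os @ [a]" unfolding \<tau>'_def using p tau by auto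
        show "alive (ar \<sigma> 4) c \<Longrightarrow> T c \<in> vis \<tau>'"
          unfolding \<tau>'_def using p al tau by (auto simp: vis_def)
      qed
      have frt: "frame {5, 7, 9, 10} {9, 11, 12, 13} \<sigma> (kupd (hupd \<tau>'))"
        using tau(10) by (auto simp: kupd_def hupd_def \<tau>'_def frame_pushed)
      have s3: "sst (kupd (hupd \<tau>')) U0 r X1 (X (prv H c a))"
        using sst_upd(1)[OF s2(1)] s2(2,3) t' cXc cm f' lt Xs by (auto simp: c_def)
      have fin: "okk (9 ::= arr 3 (V 9)) (kupd (hupd \<tau>')) w Inv" if "30 * card (X (prv H c a)) + 3 + (t - K) \<le> w" for w
        using that s3 frt pv Tn by (auto simp: vcg rg_kupd ar_kupd rg_hupd ar_hupd t' Inv_def nx)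
      show ?thesis unfolding ok_Seq
        using v bnd Tn f' codes h12 an
        by (intro conjI ok_mono[OF okp]) (auto intro!: okk_in_upd fin simp: t' c_def)
    qed
    show "3 \<le> u \<and> okk (10 ::= tl_exp (V 9) ;;
      If (wlt_test (arr 4 (V 8)) (V 9)) (in_push ;; in_upd) Skip ;;
      9 ::= arr 3 (V 9)) \<sigma>' (u - 3) Inv"
    proof (cases "rk (ar \<sigma> 4 a) < rk c")
      case True
      then show ?thesis
        using okA[of "u - 7"] Tn f' u[folded c_def] codes e W_ge cX
        by (auto simp: okk evs te_wlt le_diff_pos c_def[symmetric] \<tau>_def[symmetric] tau ok_Seq[of _ _ in_push])
    next
      case False
      then show ?thesis
        using B Tn f' u[folded c_def] codes e W_ge cX
        by (auto simp: vcg c_def[symmetric] \<tau>_def[symmetric] tau nx)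
    qed
  next
    fix \<sigma>' u assume inv: "Inv \<sigma>' u" and b: "\<not> te \<sigma>' (Leq (N 1) (V 9))"
    then have "rg \<sigma>' 9 = 0" by (simp add: vcg)
    then have "X (rg \<sigma>' 9) = {}" by (auto simp: X_def)
    then show "2 \<le> u \<and> Q \<sigma>' (u - 2)" using inv Q[of \<sigma>' "u - 2"] by (auto simp: Inv_def K_def a_def)
  qed
qed


definition popped :: "state \<Rightarrow> state" where
  "popped \<sigma> = (let a = ar \<sigma> 11 (rg \<sigma> 5 - 1) in
     srg 9 (ar \<sigma> 0 a) (sar 12 a 0 (srg 6 (rg \<sigma> 6 + 1) (sar 10 (rg \<sigma> 6) a (srg 8 a (srg 5 (rg \<sigma> 5 - 1) \<sigma>))))))"

lemma okk_pop:
  assumes "rg \<sigma> 5 \<le> n" "rg \<sigma> 6 \<le> n" "ar \<sigma> 11 (rg \<sigma> 5 - 1) < n" "11 \<le> t" "Q (popped \<sigma>) (t - 11)"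
  shows "okk pop_com \<sigma> t Q"
  using assms W_ge by (auto simp: pop_com_def vcg popped_def Let_def ar_sar)

lemma popped_simps:
  "rg (popped \<sigma>) 9 = ar \<sigma> 0 (ar \<sigma> 11 (rg \<sigma> 5 - 1))" "rg (popped \<sigma>) 8 = ar \<sigma> 11 (rg \<sigma> 5 - 1)"
  "k < 32 \<Longrightarrow> k \<noteq> 10 \<Longrightarrow> k \<noteq> 12 \<Longrightarrow> ar (popped \<sigma>) k = ar \<sigma> k"
  "ord (popped \<sigma>) = ord \<sigma> @ [ar \<sigma> 11 (rg \<sigma> 5 - 1)]"
  "frame {5, 6, 7, 8, 9, 10} {9, 10, 11, 12, 13} \<sigma>0 (popped \<sigma>) = frame {5, 6, 7, 8, 9, 10} {9, 10, 11, 12, 13} \<sigma>0 \<sigma>"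
  by (simp_all add: popped_def Let_def ar_sar ord_def Suc_eq_plus1[symmetric] del: Suc_eq_plus1)

lemma stk_popped: "1 \<le> rg \<sigma> 5 \<Longrightarrow> stk \<sigma> = ar \<sigma> 11 (rg \<sigma> 5 - 1) # stk (popped \<sigma>)"
proof -
  assume "1 \<le> rg \<sigma> 5"
  then obtain k where "rg \<sigma> 5 = Suc k" by (cases "rg \<sigma> 5") auto
  then show ?thesis by (simp add: stk_def popped_def Let_def ar_sar)
qed

lemma sst_popped:
  assumes "sst \<sigma> U0 r {} {}" "1 \<le> rg \<sigma> 5"
  shows "sst (popped \<sigma>) U0 r {c \<in> {1..m}. T c = ar \<sigma> 11 (rg \<sigma> 5 - 1)} {c \<in> {1..m}. H c = ar \<sigma> 11 (rg \<sigma> 5 - 1)}"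
proof -
  have 1: "smp (popped \<sigma>) = smp \<sigma>" "vis (popped \<sigma>) = vis \<sigma>" "rg (popped \<sigma>) 7 = rg \<sigma> 7"
    "ar (popped \<sigma>) 12 = (ar \<sigma> 12)(ar \<sigma> 11 (rg \<sigma> 5 - 1) := 0)"
    by (simp_all add: popped_def Let_def smp_def vis_def ar_sar)
  show ?thesis
    using srch_pop[OF assms(1)[unfolded sst_def stk_popped[OF assms(2)]]]
    unfolding sst_def by (simp add: 1 popped_simps)
qed

definition deg :: "nat \<Rightarrow> nat" where
  "deg v = card {c \<in> {1..m}. T c = v} + card {c \<in> {1..m}. H c = v}"

definition searched :: "state \<Rightarrow> nat set \<Rightarrow> nat \<Rightarrow> bool" where
  "searched \<sigma> U0 r \<longleftrightarrow> set (ord \<sigma>) = cc (ar \<sigma> 4) r \<and> distinct (ord \<sigma>) \<and> vis \<sigma> = U0 \<union> cc (ar \<sigma> 4) r \<and>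
     ar \<sigma> 13 ` {1..rg \<sigma> 7} = keys (smp \<sigma>) (ar \<sigma> 4) (ar \<sigma> 5) r \<and>
     rg \<sigma> 7 = card (keys (smp \<sigma>) (ar \<sigma> 4) (ar \<sigma> 5) r) \<and>
     (\<forall>v\<in>cc (ar \<sigma> 4) r. ar \<sigma> 12 v = hh (ar \<sigma> 4) v) \<and>
     (\<forall>col::nat \<Rightarrow> nat. bd col (ord \<sigma>) \<le> 2 * card {c. alive (ar \<sigma> 4) c \<and> T c \<in> cc (ar \<sigma> 4) r \<and> H c \<in> cc (ar \<sigma> 4) r \<and> col (T c) \<noteq> col (H c)})"

lemma finite_cc [simp]: "finite (cc lo r)"
  by (rule finite_subset[OF cc_subset_VV]) (simp add: VV_def)

text \<open>Every vertex of the component is popped once, and its out-list and in-list are scanned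
  once each, which gives the sum of the degrees. The budget sits on the vertices not yet
  popped.\<close>

lemma okk_search:
  assumes g: "good (ar \<sigma> 4) (ar \<sigma> 5)" and ad: "adj \<sigma>" and r: "rg \<sigma> 4 < n"
    and U: "vis \<sigma> \<inter> cc (ar \<sigma> 4) (rg \<sigma> 4) = {}"
    and t: "(\<Sum>v\<in>cc (ar \<sigma> 4) (rg \<sigma> 4). 50 + 30 * deg v) + 20 \<le> t"
    and Q: "\<And>\<sigma>' u. frame {5, 6, 7, 8, 9, 10} {9, 10, 11, 12, 13} \<sigma> \<sigma>' \<Longrightarrow> searched \<sigma>' (vis \<sigma>) (rg \<sigma> 4) \<Longrightarrow>
        t - ((\<Sum>v\<in>cc (ar \<sigma> 4) (rg \<sigma> 4). 50 + 30 * deg v) + 20) \<le> u \<Longrightarrow> Q \<sigma>' u"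
  shows "okk search_com \<sigma> t Q"
proof -
  define r where "r = rg \<sigma> 4"
  define C where "C = cc (ar \<sigma> 4) r"
  define K where "K = (\<Sum>v\<in>C. 50 + 30 * deg v) + 20"
  define Inv where "Inv = (\<lambda>\<sigma>' u. frame {5, 6, 7, 8, 9, 10} {9, 10, 11, 12, 13} \<sigma> \<sigma>' \<and> sst \<sigma>' (vis \<sigma>) r {} {} \<and>
     (\<Sum>v\<in>C - set (ord \<sigma>'). 50 + 30 * deg v) + 2 + (t - K) \<le> u)"
  have rn: "r < n" using assms(3) by (simp add: r_def)
  define \<sigma>0 where "\<sigma>0 = srg 7 0 (srg 6 0 (srg 5 1 (sar 11 0 r (sar 9 r (rg \<sigma> 2) \<sigma>))))"
  have "vis \<sigma>0 = insert r (vis \<sigma>)" by (auto simp: \<sigma>0_def vis_def ar_sar)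
  moreover have "stk \<sigma>0 = [r]" "ord \<sigma>0 = []" by (simp_all add: \<sigma>0_def stk_def ord_def ar_sar One_nat_def)
  ultimately have s0: "sst \<sigma>0 (vis \<sigma>) r {} {}"
    using srch_init[of "vis \<sigma>" "ar \<sigma> 4" r] U unfolding sst_def by (simp add: \<sigma>0_def ar_sar r_def)
  have "okk (While (Leq (N 1) (V 5)) (pop_com ;; out_scan ;; 9 ::= arr 2 (V 8) ;; in_scan)) \<sigma>0 (t - 10) Q"
  proof (rule okk_While[where Inv = Inv])
    have "(\<Sum>v\<in>C - set (ord \<sigma>0). 50 + 30 * deg v) \<le> (\<Sum>v\<in>C. 50 + 30 * deg v)"
      by (intro sum_mono2) (auto simp: C_def)
    then show "Inv \<sigma>0 (t - 10)"
      unfolding Inv_def using s0 t by (auto simp: \<sigma>0_def K_def C_def r_def)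
  next
    fix \<sigma>' u assume inv: "Inv \<sigma>' u" and b: "te \<sigma>' (Leq (N 1) (V 5))"
    have fr: "frame {5, 6, 7, 8, 9, 10} {9, 10, 11, 12, 13} \<sigma> \<sigma>'" and s: "sst \<sigma>' (vis \<sigma>) r {} {}"
      and u: "(\<Sum>v\<in>C - set (ord \<sigma>'). 50 + 30 * deg v) + 2 + (t - K) \<le> u" using inv by (auto simp: Inv_def)
    have k: "1 \<le> rg \<sigma>' 5" using b by (simp add: vcg)
    have e: "ar \<sigma>' 4 = ar \<sigma> 4" "ar \<sigma>' 5 = ar \<sigma> 5" "ar \<sigma>' 0 = ar \<sigma> 0" "ar \<sigma>' 1 = ar \<sigma> 1" "ar \<sigma>' 2 = ar \<sigma> 2" "ar \<sigma>' 3 = ar \<sigma> 3"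
      using fr by (simp_all add: frame_def)
    define a where "a = ar \<sigma>' 11 (rg \<sigma>' 5 - 1)"
    note D = srchD[OF s[unfolded sst_def stk_popped[OF k] a_def[symmetric]]]
    have aC: "a \<in> C" using D(2) by (auto simp: C_def e)
    have an: "a < n" using cc_lt[OF rn] aC by (auto simp: C_def)
    have ao: "a \<notin> set (ord \<sigma>')" using D(1) by auto
    have "(\<Sum>v\<in>C - set (ord \<sigma>'). 50 + 30 * deg v) = (50 + 30 * deg a) + (\<Sum>v\<in>(C - set (ord \<sigma>')) - {a}. 50 + 30 * deg v)"
      using aC ao by (intro sum.remove) (auto simp: C_def)
    moreover have "(C - set (ord \<sigma>')) - {a} = C - set (ord \<sigma>' @ [a])" by auto
    ultimately have sm: "(\<Sum>v\<in>C - set (ord \<sigma>'). 50 + 30 * deg v) = (50 + 30 * deg a) + (\<Sum>v\<in>C - set (ord \<sigma>' @ [a]). 50 + 30 * deg v)"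
      by simp
    have bnd: "rg \<sigma>' 6 + rg \<sigma>' 5 \<le> n" using sst_bounds[OF s rn] by simp
    have sp: "sst (popped \<sigma>') (vis \<sigma>) r {c \<in> {1..m}. T c = a} {c \<in> {1..m}. H c = a}"
      using sst_popped[OF s k] by (simp add: a_def)
    have adj': "adj \<tau>" if "ar \<tau> 0 = ar \<sigma> 0" "ar \<tau> 1 = ar \<sigma> 1" "ar \<tau> 2 = ar \<sigma> 2" "ar \<tau> 3 = ar \<sigma> 3" for \<tau>
      using ad that by (simp add: adj_def)
    have in_sc: "okk in_scan (srg 9 (ar \<sigma> 2 a) \<tau>) v Inv"
      if f: "frame {5, 9, 10} {9, 11} (popped \<sigma>') \<tau>" and st: "sst \<tau> (vis \<sigma>) r {} {c \<in> {1..m}. H c = a}"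
        and v: "30 * card {c \<in> {1..m}. H c = a} + 5 + (\<Sum>v\<in>C - set (ord \<sigma>' @ [a]). 50 + 30 * deg v) + 2 + (t - K) \<le> v" for \<tau> v
    proof (rule okk_in_scan)
      have t4: "ar \<tau> 4 = ar \<sigma> 4" "ar \<tau> 5 = ar \<sigma> 5" "ar \<tau> 0 = ar \<sigma> 0" "ar \<tau> 1 = ar \<sigma> 1" "ar \<tau> 2 = ar \<sigma> 2" "ar \<tau> 3 = ar \<sigma> 3" "rg \<tau> 8 = a"
        using f e by (simp_all add: frame_def popped_simps a_def)
      have "ord \<tau> = ord (popped \<sigma>')" using f by (simp add: ord_def frame_def)
      then have o: "ord \<tau> = ord \<sigma>' @ [a]" by (simp add: popped_simps a_def)
      show "good (ar (srg 9 (ar \<sigma> 2 a) \<tau>) 4) (ar (srg 9 (ar \<sigma> 2 a) \<tau>) 5)" "adj (srg 9 (ar \<sigma> 2 a) \<tau>)"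
        using g t4 adj' by simp_all
      show "ord (srg 9 (ar \<sigma> 2 a) \<tau>) = ord \<sigma>' @ [rg (srg 9 (ar \<sigma> 2 a) \<tau>) 8]" using o t4 by simp
      show "rg (srg 9 (ar \<sigma> 2 a) \<tau>) 9 = prv H (Suc m) (rg (srg 9 (ar \<sigma> 2 a) \<tau>) 8)" using ad an t4 by (simp add: adj_def)
      show "sst (srg 9 (ar \<sigma> 2 a) \<tau>) (vis \<sigma>) r {} {c \<in> {1..m}. H c = rg (srg 9 (ar \<sigma> 2 a) \<tau>) 8}" using st t4 by simp
      show "30 * card {c \<in> {1..m}. H c = rg (srg 9 (ar \<sigma> 2 a) \<tau>) 8} + 5 \<le> v" using v t4 by simp
      fix \<tau>' u' assume f': "frame {5, 7, 9, 10} {9, 11, 12, 13} (srg 9 (ar \<sigma> 2 a) \<tau>) \<tau>'" and s': "sst \<tau>' (vis \<sigma>) r {} {}"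
        and u': "v - (30 * card {c \<in> {1..m}. H c = rg (srg 9 (ar \<sigma> 2 a) \<tau>) 8} + 5) \<le> u'"
      have "ord \<tau>' = ord \<tau>" using f' by (simp add: ord_def frame_def)
      moreover have "frame {5, 6, 7, 8, 9, 10} {9, 10, 11, 12, 13} \<sigma> \<tau>'"
      proof -
        have "frame {5, 6, 7, 8, 9, 10} {9, 10, 11, 12, 13} \<sigma> (popped \<sigma>')" using fr by (simp add: popped_simps)
        then have "frame {5, 6, 7, 8, 9, 10} {9, 10, 11, 12, 13} \<sigma> \<tau>"
          using frame_trans frame_mono[OF f, of "{5, 6, 7, 8, 9, 10}" "{9, 10, 11, 12, 13}"] by blast
        then have "frame {5, 6, 7, 8, 9, 10} {9, 10, 11, 12, 13} \<sigma> (srg 9 (ar \<sigma> 2 a) \<tau>)" by simp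
        then show ?thesis
          using frame_trans frame_mono[OF f', of "{5, 6, 7, 8, 9, 10}" "{9, 10, 11, 12, 13}"] by blast
      qed
      moreover have "(\<Sum>v\<in>C - set (ord \<sigma>' @ [a]). 50 + 30 * deg v) + 2 + (t - K) \<le> u'"
        using u' v t4(7) by simp
      ultimately show "Inv \<tau>' u'" using s' t4 o unfolding Inv_def by (simp only:)
    qed (rule rn)
    have out_sc: "okk out_scan (popped \<sigma>') v (\<lambda>\<sigma>' t'. okk (9 ::= arr 2 (V 8) ;; in_scan) \<sigma>' t' Inv)"
      if v: "30 * deg a + 15 + (\<Sum>v\<in>C - set (ord \<sigma>' @ [a]). 50 + 30 * deg v) + 2 + (t - K) \<le> v" for v
    proof (rule okk_out_scan)
      show "good (ar (popped \<sigma>') 4) (ar (popped \<sigma>') 5)" "adj (popped \<sigma>')"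
        using g e adj' by (simp_all add: popped_simps)
      show "ord (popped \<sigma>') = ord \<sigma>' @ [rg (popped \<sigma>') 8]" by (simp add: popped_simps)
      show "rg (popped \<sigma>') 9 = prv T (Suc m) (rg (popped \<sigma>') 8)" using ad an by (simp add: adj_def popped_simps a_def[symmetric] e)
      show "sst (popped \<sigma>') (vis \<sigma>) r {c \<in> {1..m}. T c = rg (popped \<sigma>') 8} {c \<in> {1..m}. H c = a}"
        using sp by (simp add: popped_simps a_def[symmetric])
      show "25 * card {c \<in> {1..m}. T c = rg (popped \<sigma>') 8} + 5 \<le> v" using v by (simp add: popped_simps a_def[symmetric] deg_def)
      fix \<tau> u' assume f: "frame {5, 9, 10} {9, 11} (popped \<sigma>') \<tau>" and st: "sst \<tau> (vis \<sigma>) r {} {c \<in> {1..m}. H c = a}"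
        and u': "v - (25 * card {c \<in> {1..m}. T c = rg (popped \<sigma>') 8} + 5) \<le> u'"
      have t8: "rg \<tau> 8 = a" "ar \<tau> 2 = ar \<sigma> 2" using f e by (simp_all add: frame_def popped_simps a_def)
      have ub: "30 * card {c \<in> {1..m}. H c = a} + 5 + (\<Sum>v\<in>C - set (ord \<sigma>' @ [a]). 50 + 30 * deg v) + 2 + (t - K) + 3 \<le> u'"
        using u' v deg_def[of a] by (simp add: popped_simps a_def[symmetric])
      have "okk in_scan (srg 9 (ar \<sigma> 2 a) \<tau>) (u' - 2) Inv"
        by (rule in_sc[OF f st]) (use ub in simp)
      then show "okk (9 ::= arr 2 (V 8) ;; in_scan) \<tau> u' Inv"
        using ub an W_ge t8 by (simp add: vcg)
    qed (rule rn)
    show "3 \<le> u \<and> okk (pop_com ;; out_scan ;; 9 ::= arr 2 (V 8) ;; in_scan) \<sigma>' (u - 3) Inv"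
    proof
      show "3 \<le> u" using u sm by simp
      have "okk pop_com \<sigma>' (u - 4) (\<lambda>\<sigma>' t'. okk (out_scan ;; 9 ::= arr 2 (V 8) ;; in_scan) \<sigma>' t' Inv)"
        using u bnd an sm by (intro okk_pop) (auto simp: a_def[symmetric] ok_Seq[of _ _ out_scan] intro: out_sc)
      then show "okk (pop_com ;; out_scan ;; 9 ::= arr 2 (V 8) ;; in_scan) \<sigma>' (u - 3) Inv"
        using u sm by (simp add: ok_Seq[of _ _ pop_com] le_diff_pos)
    qed
  next
    fix \<sigma>' u assume inv: "Inv \<sigma>' u" and b: "\<not> te \<sigma>' (Leq (N 1) (V 5))"
    have fr: "frame {5, 6, 7, 8, 9, 10} {9, 10, 11, 12, 13} \<sigma> \<sigma>'" and s: "sst \<sigma>' (vis \<sigma>) r {} {}"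
      and u: "2 + (t - K) \<le> u" using inv by (auto simp: Inv_def)
    have e: "ar \<sigma>' 4 = ar \<sigma> 4" "ar \<sigma>' 5 = ar \<sigma> 5" using fr by (simp_all add: frame_def)
    have "rg \<sigma>' 5 = 0" using b by (simp add: vcg)
    then have "stk \<sigma>' = []" by (simp add: stk_def)
    note s' = s[unfolded sst_def this]
    have "good (ar \<sigma>' 4) (ar \<sigma>' 5)" using g e by simp
    note D = srch_done[OF this s']
    have "searched \<sigma>' (vis \<sigma>) r" unfolding searched_def using D by blast
    then show "2 \<le> u \<and> Q \<sigma>' (u - 2)"
      using Q[OF fr, of "u - 2"] u by (simp add: r_def K_def C_def)
  qed
  then show ?thesis
    using t rn W_ge by (simp add: search_com_def root_com_def vcg \<sigma>0_def r_def)
qed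

end

section \<open>Bottom-up merge sort by rank\<close>

section \<open>Verification of the sorting\<close>

context inst
begin

definition srt :: "(nat \<Rightarrow> nat) \<Rightarrow> nat \<Rightarrow> nat \<Rightarrow> bool" where
  "srt f a b \<longleftrightarrow> (\<forall>i j. a \<le> i \<and> i \<le> j \<and> j < b \<longrightarrow> rk (f i) \<le> rk (f j))"

text \<open>The state of merging \<open>[a, mid)\<close> and \<open>[mid, e)\<close> of
  \<open>A\<close> into \<open>D\<close>. No output exceeds either front element, and this is what
  keeps the output sorted when the smaller front element is appended.\<close>

definition mrg :: "(nat \<Rightarrow> nat) \<Rightarrow> nat \<Rightarrow> nat \<Rightarrow> nat \<Rightarrow> (nat \<Rightarrow> nat) \<Rightarrow> nat \<Rightarrow> nat \<Rightarrow> nat \<Rightarrow> bool" where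
  "mrg A a mid e D k i j \<longleftrightarrow> a \<le> i \<and> i \<le> mid \<and> mid \<le> j \<and> j \<le> e \<and> k + mid = i + j \<and>
     D ` {a..<k} = A ` {a..<i} \<union> A ` {mid..<j} \<and> srt D a k \<and>
     (\<forall>x. a \<le> x \<and> x < k \<longrightarrow> (i < mid \<longrightarrow> rk (D x) \<le> rk (A i)) \<and> (j < e \<longrightarrow> rk (D x) \<le> rk (A j)))"

lemma mrg_step:
  assumes m: "mrg A a mid e D k i j" and s: "srt A a mid" "srt A mid e" and k: "k < e" and x: "i' + j' = i + j + 1"
    "(i < mid \<and> (j < e \<longrightarrow> rk (A i) \<le> rk (A j)) \<and> i' = i + 1 \<and> x = A i) \<or> (j < e \<and> (i < mid \<longrightarrow> rk (A j) \<le> rk (A i)) \<and> j' = j + 1 \<and> x = A j)"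
  shows "mrg A a mid e (D(k := x)) (k + 1) i' j'"
proof -
  have o: "a \<le> i" "i \<le> mid" "mid \<le> j" "j \<le> e" "k + mid = i + j" and im: "D ` {a..<k} = A ` {a..<i} \<union> A ` {mid..<j}"
    and sr: "srt D a k" and b: "\<And>y. a \<le> y \<Longrightarrow> y < k \<Longrightarrow> i < mid \<Longrightarrow> rk (D y) \<le> rk (A i)"
    "\<And>y. a \<le> y \<Longrightarrow> y < k \<Longrightarrow> j < e \<Longrightarrow> rk (D y) \<le> rk (A j)"
    using m by (auto simp: mrg_def)
  have ak: "a \<le> k" using o by linarith
  have ivl: "{a..<k + 1} = insert k {a..<k}" using ak by auto
  have im2: "(D(k := x)) ` {a..<k} = D ` {a..<k}" by (intro image_cong) auto
  have bx: "rk (D y) \<le> rk x" if "a \<le> y" "y < k" for y using b[OF that] x(2) by auto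
  have sr': "srt (D(k := x)) a (k + 1)"
    unfolding srt_def
  proof (intro allI impI)
    fix p q assume "a \<le> p \<and> p \<le> q \<and> q < k + 1"
    then show "rk ((D(k := x)) p) \<le> rk ((D(k := x)) q)"
      using sr bx[of p] by (cases "q = k"; cases "p = k") (auto simp: srt_def)
  qed
  have top: "rk ((D(k := x)) y) \<le> rk x" if "a \<le> y" "y < k + 1" for y
    using bx[of y] that by (cases "y = k") auto
  have fin: "mrg A a mid e (D(k := x)) (k + 1) i' j'"
    if "a \<le> i'" "i' \<le> mid" "mid \<le> j'" "j' \<le> e" "k + 1 + mid = i' + j'"
      "(D(k := x)) ` {a..<k + 1} = A ` {a..<i'} \<union> A ` {mid..<j'}"
      "i' < mid \<Longrightarrow> rk x \<le> rk (A i')" "j' < e \<Longrightarrow> rk x \<le> rk (A j')"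
    unfolding mrg_def using that sr' by (intro conjI allI impI) (auto simp del: fun_upd_apply intro: order_trans[OF top])
  consider "i < mid" "j < e \<longrightarrow> rk (A i) \<le> rk (A j)" "i' = i + 1" "x = A i" "j' = j"
    | "j < e" "i < mid \<longrightarrow> rk (A j) \<le> rk (A i)" "j' = j + 1" "x = A j" "i' = i"
    using x by auto
  then show ?thesis
  proof cases
    case 1
    have e: "{a..<i + 1} = insert i {a..<i}" using o by auto
    have "(D(k := x)) ` {a..<k + 1} = insert x (A ` {a..<i} \<union> A ` {mid..<j})"
      unfolding ivl image_insert im2 im by (simp only: fun_upd_same)
    also have "\<dots> = A ` {a..<i'} \<union> A ` {mid..<j'}"
      by (simp only: 1(3,4,5) e image_insert Un_insert_left)
    finally have "(D(k := x)) ` {a..<k + 1} = A ` {a..<i'} \<union> A ` {mid..<j'}" .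
    moreover have "rk (A i) \<le> rk (A (i + 1))" if "i + 1 < mid" using s(1) o that by (auto simp: srt_def)
    ultimately show ?thesis using o 1 by (intro fin) auto
  next
    case 2
    have e: "{mid..<j + 1} = insert j {mid..<j}" using o by auto
    have "(D(k := x)) ` {a..<k + 1} = insert x (A ` {a..<i} \<union> A ` {mid..<j})"
      unfolding ivl image_insert im2 im by (simp only: fun_upd_same)
    also have "\<dots> = A ` {a..<i'} \<union> A ` {mid..<j'}"
      by (simp only: 2(3,4,5) e image_insert Un_insert_right)
    finally have "(D(k := x)) ` {a..<k + 1} = A ` {a..<i'} \<union> A ` {mid..<j'}" .
    moreover have "rk (A j) \<le> rk (A (j + 1))" if "j + 1 < e" using s(2) o that by (auto simp: srt_def)
    ultimately show ?thesis using o 2 by (intro fin) auto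
  qed
qed

text \<open>That array 14 is unchanged below \<open>a\<close> is part of the result so that blocks
  merged earlier in the same pass survive.\<close>

lemma okk_merge:
  assumes r: "rg \<sigma> 11 = a" "rg \<sigma> 19 = a" "rg \<sigma> 20 = mid" "rg \<sigma> 21 = mid" "rg \<sigma> 22 = e" "a \<le> mid" "mid \<le> e" "e \<le> Suc m"
    and codes: "\<And>i. a \<le> i \<Longrightarrow> i < e \<Longrightarrow> ar \<sigma> 13 i \<le> Suc m"
    and s: "srt (ar \<sigma> 13) a mid" "srt (ar \<sigma> 13) mid e"
    and t: "12 * (e - a) + 5 \<le> t"
    and Q: "\<And>\<sigma>' u. frame {11, 19, 20} {14} \<sigma> \<sigma>' \<Longrightarrow> (\<And>x. x < a \<Longrightarrow> ar \<sigma>' 14 x = ar \<sigma> 14 x) \<Longrightarrow>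
        ar \<sigma>' 14 ` {a..<e} = ar \<sigma> 13 ` {a..<e} \<Longrightarrow> srt (ar \<sigma>' 14) a e \<Longrightarrow> t - (12 * (e - a) + 5) \<le> u \<Longrightarrow> Q \<sigma>' u"
  shows "okk merge_loop \<sigma> t Q"
proof -
  define K where "K = 12 * (e - a) + 5"
  define A where "A = ar \<sigma> 13"
  define Inv where "Inv = (\<lambda>\<sigma>' u. frame {11, 19, 20} {14} \<sigma> \<sigma>' \<and> (\<forall>x<a. ar \<sigma>' 14 x = ar \<sigma> 14 x) \<and>
     mrg A a mid e (ar \<sigma>' 14) (rg \<sigma>' 11) (rg \<sigma>' 19) (rg \<sigma>' 20) \<and> 12 * (e - rg \<sigma>' 11) + 2 + (t - K) \<le> u)"
  show ?thesis unfolding merge_loop_def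
  proof (rule okk_While[where Inv = Inv])
    show "Inv \<sigma> t" unfolding Inv_def using r t by (auto simp: mrg_def srt_def K_def)
  next
    fix \<sigma>' u assume inv: "Inv \<sigma>' u" and b: "te \<sigma>' (lt_test (V 11) (V 22))"
    have fr: "frame {11, 19, 20} {14} \<sigma> \<sigma>'" and lo: "\<And>x. x < a \<Longrightarrow> ar \<sigma>' 14 x = ar \<sigma> 14 x"
      and mg: "mrg A a mid e (ar \<sigma>' 14) (rg \<sigma>' 11) (rg \<sigma>' 19) (rg \<sigma>' 20)" and u: "12 * (e - rg \<sigma>' 11) + 2 + (t - K) \<le> u"
      using inv by (auto simp: Inv_def)
    have ee: "rg \<sigma>' 21 = mid" "rg \<sigma>' 22 = e" "ar \<sigma>' 13 = A" using fr r by (simp_all add: frame_def A_def)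
    have k: "rg \<sigma>' 11 < e" using b ee by (simp add: vcg)
    have o: "a \<le> rg \<sigma>' 19" "rg \<sigma>' 19 \<le> mid" "mid \<le> rg \<sigma>' 20" "rg \<sigma>' 20 \<le> e" "rg \<sigma>' 11 + mid = rg \<sigma>' 19 + rg \<sigma>' 20"
      using mg by (auto simp: mrg_def)
    have c: "rg \<sigma>' 19 < mid \<Longrightarrow> A (rg \<sigma>' 19) \<le> Suc m" "rg \<sigma>' 20 < e \<Longrightarrow> A (rg \<sigma>' 20) \<le> Suc m"
      using codes o r by (auto simp: A_def)
    have eW: "e \<le> W" using r W_ge by (simp add: W_def)
    have bs: "rg \<sigma>' 19 \<le> W" "rg \<sigma>' 20 \<le> W" "rg \<sigma>' 11 \<le> W" using o k eW r by linarith+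
    have ua: "12 * (e - (rg \<sigma>' 11 + 1)) + 2 + (t - K) + 12 \<le> u" using u k by auto
    have ak: "a \<le> rg \<sigma>' 11" using o by linarith
    have L: "Inv (srg 11 (rg \<sigma>' 11 + 1) (srg 19 (rg \<sigma>' 19 + 1) (sar 14 (rg \<sigma>' 11) (A (rg \<sigma>' 19)) \<sigma>'))) v"
      if "rg \<sigma>' 19 < mid" "rg \<sigma>' 20 < e \<longrightarrow> rk (A (rg \<sigma>' 19)) \<le> rk (A (rg \<sigma>' 20))" "12 * (e - (rg \<sigma>' 11 + 1)) + 2 + (t - K) \<le> v" for v
      unfolding Inv_def using that fr lo ak mrg_step[OF mg s[folded A_def] k, of "rg \<sigma>' 19 + 1" "rg \<sigma>' 20" "A (rg \<sigma>' 19)"]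
      by (simp add: ar_sar)
    have R: "Inv (srg 11 (rg \<sigma>' 11 + 1) (srg 20 (rg \<sigma>' 20 + 1) (sar 14 (rg \<sigma>' 11) (A (rg \<sigma>' 20)) \<sigma>'))) v"
      if "rg \<sigma>' 20 < e" "rg \<sigma>' 19 < mid \<longrightarrow> rk (A (rg \<sigma>' 20)) \<le> rk (A (rg \<sigma>' 19))" "12 * (e - (rg \<sigma>' 11 + 1)) + 2 + (t - K) \<le> v" for v
      unfolding Inv_def using that fr lo ak mrg_step[OF mg s[folded A_def] k, of "rg \<sigma>' 19" "rg \<sigma>' 20 + 1" "A (rg \<sigma>' 20)"]
      by (simp add: ar_sar)
    let ?i = "rg \<sigma>' 19" and ?j = "rg \<sigma>' 20"
    have tst: "te \<sigma>' (Conj (lt_test (V 19) (V 21)) (or_test (Leq (V 22) (V 20)) (wle_test (arr 13 (V 19)) (arr 13 (V 20))))) \<longleftrightarrow>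
        ?i < mid \<and> (?j < e \<longrightarrow> rk (A ?i) \<le> rk (A ?j))"
    proof (cases "?i < mid \<and> ?j < e")
      case True
      then show ?thesis using c ee bs W_ge by (simp add: vcg)
    next
      case False
      then show ?thesis using ee by (auto simp: te_Conj te_lt te_or te_Leq ev_V)
    qed
    have jl: "?j < e" if "\<not> (?i < mid \<and> (?j < e \<longrightarrow> rk (A ?i) \<le> rk (A ?j)))" using that o k by linarith
    show "3 \<le> u \<and> okk (If (Conj (lt_test (V 19) (V 21)) (or_test (Leq (V 22) (V 20)) (wle_test (arr 13 (V 19)) (arr 13 (V 20)))))
        (put 14 (V 11) (arr 13 (V 19)) ;; 19 ::= Plus (V 19) (N 1))
        (put 14 (V 11) (arr 13 (V 20)) ;; 20 ::= Plus (V 20) (N 1)) ;;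
      11 ::= Plus (V 11) (N 1)) \<sigma>' (u - 3) Inv"
    proof (cases "?i < mid \<and> (?j < e \<longrightarrow> rk (A ?i) \<le> rk (A ?j))")
      case True
      then show ?thesis using L ua bs ee W_ge unfolding ok_Seq ok_If tst by (simp add: okk evs le_diff_pos)
    next
      case False
      then show ?thesis using R jl ua bs ee W_ge unfolding ok_Seq ok_If tst by (auto simp: okk evs le_diff_pos)
    qed
  next
    fix \<sigma>' u assume inv: "Inv \<sigma>' u" and b: "\<not> te \<sigma>' (lt_test (V 11) (V 22))"
    have fr: "frame {11, 19, 20} {14} \<sigma> \<sigma>'" and lo: "\<And>x. x < a \<Longrightarrow> ar \<sigma>' 14 x = ar \<sigma> 14 x"
      and mg: "mrg A a mid e (ar \<sigma>' 14) (rg \<sigma>' 11) (rg \<sigma>' 19) (rg \<sigma>' 20)" and u: "2 + (t - K) \<le> u"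
      using inv by (auto simp: Inv_def)
    have "rg \<sigma>' 22 = e" using fr r by (simp add: frame_def)
    then have "e \<le> rg \<sigma>' 11" using b by (simp add: vcg)
    then have x: "rg \<sigma>' 11 = e" "rg \<sigma>' 19 = mid" "rg \<sigma>' 20 = e" using mg by (auto simp: mrg_def)
    have "{a..<e} = {a..<mid} \<union> {mid..<e}" using r by auto
    then have "ar \<sigma>' 14 ` {a..<e} = A ` {a..<e}" using mg x by (simp add: mrg_def image_Un)
    moreover have "srt (ar \<sigma>' 14) a e" using mg x by (simp add: mrg_def)
    ultimately show "2 \<le> u \<and> Q \<sigma>' (u - 2)" using Q[OF fr lo, of "u - 2"] u by (simp add: A_def K_def)
  qed
qed

text \<open>Blocks start at index 1 because index 0 of the threshold array is reserved for the lower
  sentinel. The last block is cut off at \<open>p\<close>.\<close>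

definition blk :: "nat \<Rightarrow> nat \<Rightarrow> (nat \<Rightarrow> nat) \<Rightarrow> bool" where
  "blk wd p A \<longleftrightarrow> (\<forall>b. srt A (1 + wd * b) (min (1 + wd * b + wd) (p + 1)))"

text \<open>A merged block of length \<open>l\<close> costs \<open>12 * l\<close> and at most 30 for
  the set-up; as \<open>l \<ge> 1\<close>, the 45 credits per element cover both.\<close>

lemma okk_pass:
  assumes p: "rg \<sigma> 7 = p" "p \<le> m" "rg \<sigma> 17 = wd" "1 \<le> wd" "wd < p"
    and codes: "\<And>i. 1 \<le> i \<Longrightarrow> i \<le> p \<Longrightarrow> ar \<sigma> 13 i \<le> Suc m"
    and bl: "blk wd p (ar \<sigma> 13)"
    and t: "45 * p + 5 \<le> t"
    and Q: "\<And>\<sigma>' u. frame {11, 18, 19, 20, 21, 22} {14} \<sigma> \<sigma>' \<Longrightarrow>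
        ar \<sigma>' 14 ` {1..p} = ar \<sigma> 13 ` {1..p} \<Longrightarrow> blk (2 * wd) p (ar \<sigma>' 14) \<Longrightarrow> t - (45 * p + 5) \<le> u \<Longrightarrow> Q \<sigma>' u"
  shows "okk pass_com \<sigma> t Q"
proof -
  define K where "K = 45 * p + 5"
  define A where "A = ar \<sigma> 13"
  define Inv where "Inv = (\<lambda>\<sigma>' u. frame {11, 18, 19, 20, 21, 22} {14} \<sigma> \<sigma>' \<and> 1 \<le> rg \<sigma>' 18 \<and> rg \<sigma>' 18 \<le> p + 1 \<and>
     (\<exists>b. rg \<sigma>' 18 = min (1 + 2 * wd * b) (p + 1)) \<and> ar \<sigma>' 14 ` {1..<rg \<sigma>' 18} = A ` {1..<rg \<sigma>' 18} \<and>
     (\<forall>b. srt (ar \<sigma>' 14) (1 + 2 * wd * b) (min (1 + 2 * wd * b + 2 * wd) (rg \<sigma>' 18))) \<and>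
     45 * (p + 1 - rg \<sigma>' 18) + 2 + (t - K) \<le> u)"
  have pW: "p \<le> W" "wd \<le> W" using p W_ge by auto
  have "okk (While (Leq (V 18) (V 7))
     (19 ::= V 18 ;; min_com 21 (Plus (V 18) (V 17)) (Plus (V 7) (N 1)) ;; 20 ::= V 21 ;;
      min_com 22 (Plus (V 18) (Plus (V 17) (V 17))) (Plus (V 7) (N 1)) ;;
      11 ::= V 18 ;; merge_loop ;; 18 ::= V 22)) (srg 18 1 \<sigma>) (t - 2) Q"
  proof (rule okk_While[where Inv = Inv])
    show "Inv (srg 18 1 \<sigma>) (t - 2)" unfolding Inv_def using t p by (auto simp: K_def srt_def intro!: exI[of _ 0])
  next
    fix \<sigma>' u assume inv: "Inv \<sigma>' u" and bt: "te \<sigma>' (Leq (V 18) (V 7))"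
    define a where "a = rg \<sigma>' 18"
    have fr: "frame {11, 18, 19, 20, 21, 22} {14} \<sigma> \<sigma>'" and im: "ar \<sigma>' 14 ` {1..<a} = A ` {1..<a}"
      and sr: "\<And>b. srt (ar \<sigma>' 14) (1 + 2 * wd * b) (min (1 + 2 * wd * b + 2 * wd) a)" and u: "45 * (p + 1 - a) + 2 + (t - K) \<le> u"
      using inv by (auto simp: Inv_def a_def)
    have e: "rg \<sigma>' 7 = p" "rg \<sigma>' 17 = wd" "ar \<sigma>' 13 = A" using fr p by (simp_all add: frame_def A_def)
    have ap: "1 \<le> a" "a \<le> p" using inv bt e by (auto simp: Inv_def vcg a_def)
    obtain b where b: "a = 1 + 2 * wd * b" using inv ap by (auto simp: Inv_def a_def min_def split: if_splits)
    define mid en where "mid = min (a + wd) (p + 1)" and "en = min (a + 2 * wd) (p + 1)"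
    have me: "a \<le> mid" "mid \<le> en" "en \<le> p + 1" "a < en" "en \<le> Suc m" using ap p by (auto simp: mid_def en_def)
    have s1: "srt A a mid" using bl[unfolded blk_def, rule_format, of "2 * b"] b by (simp add: A_def mid_def mult.assoc mult.left_commute)
    have s2: "srt A mid en"
    proof (cases "a + wd \<le> p + 1")
      case True
      have "1 + wd * (2 * b + 1) = a + wd" using b by (simp add: algebra_simps)
      then show ?thesis using bl[unfolded blk_def, rule_format, of "2 * b + 1"] True by (simp add: A_def mid_def en_def mult_2 add.assoc)
    next
      case False
      then show ?thesis by (auto simp: srt_def mid_def en_def)
    qed
    define \<tau> where "\<tau> = srg 11 a (srg 22 en (srg 20 mid (srg 21 mid (srg 19 a \<sigma>'))))"
    have M: "okk merge_loop \<tau> v (\<lambda>\<sigma>' t'. okk (18 ::= V 22) \<sigma>' t' Inv)" if v: "12 * (en - a) + 5 + 1 + 45 * (p + 1 - en) + 2 + (t - K) \<le> v" for v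
    proof (rule okk_merge)
      show "rg \<tau> 11 = a" "rg \<tau> 19 = a" "rg \<tau> 20 = mid" "rg \<tau> 21 = mid" "rg \<tau> 22 = en" by (simp_all add: \<tau>_def)
      show "a \<le> mid" "mid \<le> en" "en \<le> Suc m" by (rule me)+
      show "ar \<tau> 13 i \<le> Suc m" if "a \<le> i" "i < en" for i using codes[of i] that ap me e by (simp add: \<tau>_def A_def)
      show "srt (ar \<tau> 13) a mid" "srt (ar \<tau> 13) mid en" using s1 s2 e by (simp_all add: \<tau>_def)
      show "12 * (en - a) + 5 \<le> v" using v by simp
      fix \<tau>' v' assume f: "frame {11, 19, 20} {14} \<tau> \<tau>'" and lw: "\<And>x. x < a \<Longrightarrow> ar \<tau>' 14 x = ar \<tau> 14 x"
        and im': "ar \<tau>' 14 ` {a..<en} = ar \<tau> 13 ` {a..<en}" and sr': "srt (ar \<tau>' 14) a en" and v': "v - (12 * (en - a) + 5) \<le> v'"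
      have "frame {11, 18, 19, 20, 21, 22} {14} \<sigma> \<tau>" using fr by (simp add: \<tau>_def)
      then have F: "frame {11, 18, 19, 20, 21, 22} {14} \<sigma> \<tau>'"
        using frame_trans frame_mono[OF f, of "{11, 18, 19, 20, 21, 22}" "{14}"] by blast
      have "{1..<en} = {1..<a} \<union> {a..<en}" using ap me by auto
      moreover have "ar \<tau>' 14 ` {1..<a} = ar \<sigma>' 14 ` {1..<a}" using lw by (intro image_cong) (auto simp: \<tau>_def)
      ultimately have I: "ar \<tau>' 14 ` {1..<en} = A ` {1..<en}" using im im' e by (simp add: image_Un \<tau>_def)
      have S: "srt (ar \<tau>' 14) (1 + 2 * wd * b') (min (1 + 2 * wd * b' + 2 * wd) en)" for b'
      proof (cases "b' < b")
        case True
        then have "2 * wd * (b' + 1) \<le> 2 * wd * b" by (intro mult_left_mono) auto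
        then have "1 + 2 * wd * b' + 2 * wd \<le> a" using b by (simp add: algebra_simps)
        then show ?thesis using sr[of b'] lw me unfolding srt_def \<tau>_def by auto
      next
        case False
        show ?thesis
        proof (cases "b' = b")
          case True
          then show ?thesis using sr' b by (simp add: en_def)
        next
          case F': False
          then have "2 * wd * (b + 1) \<le> 2 * wd * b'" using False by (intro mult_left_mono) auto
          then have "a + 2 * wd \<le> 1 + 2 * wd * b'" using b by (simp add: algebra_simps)
          then show ?thesis by (auto simp: srt_def en_def)
        qed
      qed
      have "\<exists>b. en = min (1 + 2 * wd * b) (p + 1)" by (rule exI[of _ "b + 1"]) (simp add: en_def b algebra_simps)
      then have "Inv (srg 18 en \<tau>') (v' - 1)" unfolding Inv_def using F I S v v' me ap by simp
      moreover have "rg \<tau>' 22 = en" using f by (simp add: frame_def \<tau>_def)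
      ultimately show "okk (18 ::= V 22) \<tau>' v' Inv" using v v' by (simp add: vcg)
    qed
    have ub: "12 * (en - a) + 30 + 45 * (p + 1 - en) + 2 + (t - K) \<le> u" using u me ap by simp
    have "okk (min_com 21 (Plus (V 18) (V 17)) (Plus (V 7) (N 1))) \<sigma>1 v R \<longleftrightarrow> 2 \<le> v \<and> R (srg 21 mid \<sigma>1) (v - 2)"
      if "rg \<sigma>1 18 = a" "rg \<sigma>1 17 = wd" "rg \<sigma>1 7 = p" for \<sigma>1 v R
      using that pW ap W_ge by (auto simp: min_com_def vcg mid_def min_def)
    moreover have "okk (min_com 22 (Plus (V 18) (Plus (V 17) (V 17))) (Plus (V 7) (N 1))) \<sigma>1 v R \<longleftrightarrow> 2 \<le> v \<and> R (srg 22 en \<sigma>1) (v - 2)"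
      if "rg \<sigma>1 18 = a" "rg \<sigma>1 17 = wd" "rg \<sigma>1 7 = p" for \<sigma>1 v R
      using that pW ap W_ge by (auto simp: min_com_def vcg en_def min_def mult_2)
    ultimately show "3 \<le> u \<and> okk (19 ::= V 18 ;; min_com 21 (Plus (V 18) (V 17)) (Plus (V 7) (N 1)) ;; 20 ::= V 21 ;;
      min_com 22 (Plus (V 18) (Plus (V 17) (V 17))) (Plus (V 7) (N 1)) ;;
      11 ::= V 18 ;; merge_loop ;; 18 ::= V 22) \<sigma>' (u - 3) Inv"
      using ub e M by (simp add: ok_Seq okk_Assign ev_V le_diff_pos a_def[symmetric] \<tau>_def[symmetric])
  next
    fix \<sigma>' u assume inv: "Inv \<sigma>' u" and bt: "\<not> te \<sigma>' (Leq (V 18) (V 7))"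
    have fr: "frame {11, 18, 19, 20, 21, 22} {14} \<sigma> \<sigma>'" using inv by (simp add: Inv_def)
    then have "rg \<sigma>' 7 = p" using p by (simp add: frame_def)
    then have x: "rg \<sigma>' 18 = p + 1" using inv bt by (auto simp: Inv_def vcg)
    have "{1..<p + 1} = {1..p}" by auto
    then have "ar \<sigma>' 14 ` {1..p} = ar \<sigma> 13 ` {1..p}" using inv x by (simp add: Inv_def A_def)
    moreover have "blk (2 * wd) p (ar \<sigma>' 14)" using inv x by (simp add: Inv_def blk_def)
    moreover have "2 + (t - (45 * p + 5)) \<le> u" using inv by (simp add: Inv_def K_def)
    ultimately show "2 \<le> u \<and> Q \<sigma>' (u - 2)" using Q[OF fr, of "u - 2"] by simp
  qed
  then show ?thesis using t by (simp add: pass_com_def vcg)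
qed

lemma okk_copy:
  assumes p: "rg \<sigma> 7 = p" "p \<le> m" and t: "7 * p + 5 \<le> t"
    and Q: "\<And>\<sigma>' u. frame {11} {13} \<sigma> \<sigma>' \<Longrightarrow> (\<And>i. 1 \<le> i \<Longrightarrow> i \<le> p \<Longrightarrow> ar \<sigma>' 13 i = ar \<sigma> 14 i) \<Longrightarrow> t - (7 * p + 5) \<le> u \<Longrightarrow> Q \<sigma>' u"
  shows "okk copy_com \<sigma> t Q"
proof -
  define Inv where "Inv = (\<lambda>\<sigma>' u. frame {11} {13} \<sigma> \<sigma>' \<and> 1 \<le> rg \<sigma>' 11 \<and> rg \<sigma>' 11 \<le> p + 1 \<and>
     (\<forall>i. 1 \<le> i \<and> i < rg \<sigma>' 11 \<longrightarrow> ar \<sigma>' 13 i = ar \<sigma> 14 i) \<and> 7 * (p + 1 - rg \<sigma>' 11) + 2 + (t - (7 * p + 5)) \<le> u)"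
  have pW: "p \<le> W" using p W_ge by auto
  have "okk (While (Leq (V 11) (V 7)) (put 13 (V 11) (arr 14 (V 11)) ;; 11 ::= Plus (V 11) (N 1))) (srg 11 1 \<sigma>) (t - 2) Q"
  proof (rule okk_While[where Inv = Inv])
    show "Inv (srg 11 1 \<sigma>) (t - 2)" unfolding Inv_def using t by auto
  next
    fix \<sigma>' u assume inv: "Inv \<sigma>' u" and b: "te \<sigma>' (Leq (V 11) (V 7))"
    have fr: "frame {11} {13} \<sigma> \<sigma>'" using inv by (simp add: Inv_def)
    have e: "rg \<sigma>' 7 = p" "ar \<sigma>' 14 = ar \<sigma> 14" using fr p by (simp_all add: frame_def)
    have k: "rg \<sigma>' 11 \<le> p" using b e by (simp add: vcg)
    show "3 \<le> u \<and> okk (put 13 (V 11) (arr 14 (V 11)) ;; 11 ::= Plus (V 11) (N 1)) \<sigma>' (u - 3) Inv"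
      using inv e k pW W_ge by (auto simp: vcg Inv_def ar_sar less_Suc_eq)
  next
    fix \<sigma>' u assume inv: "Inv \<sigma>' u" and b: "\<not> te \<sigma>' (Leq (V 11) (V 7))"
    have fr: "frame {11} {13} \<sigma> \<sigma>'" using inv by (simp add: Inv_def)
    then have "rg \<sigma>' 7 = p" using p by (simp add: frame_def)
    then have "rg \<sigma>' 11 = p + 1" using inv b by (auto simp: Inv_def vcg)
    then show "2 \<le> u \<and> Q \<sigma>' (u - 2)" using Q[OF fr, of "u - 2"] inv by (auto simp: Inv_def)
  qed
  then show ?thesis using t by (simp add: copy_com_def vcg)
qed

text \<open>The block width doubles with every pass, so \<open>p \<le> 2 ^ \<Lambda>\<close> allows
  at most \<open>\<Lambda>\<close> passes, and each pass with its copying is paid for by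
  \<open>70 * p\<close>.\<close>

lemma okk_sort:
  assumes p: "rg \<sigma> 7 \<le> m" "rg \<sigma> 7 \<le> 2 ^ \<Lambda>"
    and codes: "\<And>i. 1 \<le> i \<Longrightarrow> i \<le> rg \<sigma> 7 \<Longrightarrow> ar \<sigma> 13 i \<le> Suc m"
    and t: "70 * rg \<sigma> 7 * \<Lambda> + 5 \<le> t"
    and Q: "\<And>\<sigma>' u. frame {11, 17, 18, 19, 20, 21, 22} {13, 14} \<sigma> \<sigma>' \<Longrightarrow>
        ar \<sigma>' 13 ` {1..rg \<sigma> 7} = ar \<sigma> 13 ` {1..rg \<sigma> 7} \<Longrightarrow> srt (ar \<sigma>' 13) 1 (rg \<sigma> 7 + 1) \<Longrightarrow>
        t - (70 * rg \<sigma> 7 * \<Lambda> + 5) \<le> u \<Longrightarrow> Q \<sigma>' u"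
  shows "okk sort_com \<sigma> t Q"
proof -
  define p where "p = rg \<sigma> 7"
  define K where "K = 70 * p * \<Lambda> + 5"
  define A where "A = ar \<sigma> 13 ` {1..p}"
  have AC: "A \<subseteq> {..Suc m}" using codes by (auto simp: A_def p_def)
  define Inv where "Inv = (\<lambda>\<sigma>' u. frame {11, 17, 18, 19, 20, 21, 22} {13, 14} \<sigma> \<sigma>' \<and> 1 \<le> rg \<sigma>' 17 \<and>
     ar \<sigma>' 13 ` {1..p} = A \<and> blk (rg \<sigma>' 17) p (ar \<sigma>' 13) \<and>
     (\<exists>L. p \<le> rg \<sigma>' 17 * 2 ^ L \<and> 70 * p * L + 2 + (t - K) \<le> u))"
  have pW: "p \<le> W" using p W_ge by (auto simp: p_def)
  have "okk (While (lt_test (V 17) (V 7)) (pass_com ;; copy_com ;; 17 ::= Plus (V 17) (V 17))) (srg 17 1 \<sigma>) (t - 2) Q"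
  proof (rule okk_While[where Inv = Inv])
    have "srt f x (min (x + 1) y)" for f x y
      unfolding srt_def
    proof (intro allI impI)
      fix i j assume "x \<le> i \<and> i \<le> j \<and> j < min (x + 1) y"
      then have "i = j" by simp
      then show "rk (f i) \<le> rk (f j)" by simp
    qed
    then have "blk 1 p (ar \<sigma> 13)" by (simp only: blk_def) blast
    then show "Inv (srg 17 1 \<sigma>) (t - 2)"
      unfolding Inv_def using t p by (auto simp: K_def A_def p_def intro!: exI[of _ \<Lambda>])
  next
    fix \<sigma>' u assume inv: "Inv \<sigma>' u" and b: "te \<sigma>' (lt_test (V 17) (V 7))"
    define wd where "wd = rg \<sigma>' 17"
    have fr: "frame {11, 17, 18, 19, 20, 21, 22} {13, 14} \<sigma> \<sigma>'" and w1: "1 \<le> wd" and im: "ar \<sigma>' 13 ` {1..p} = A"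
      and bl: "blk wd p (ar \<sigma>' 13)" using inv by (auto simp: Inv_def wd_def)
    obtain L where L: "p \<le> wd * 2 ^ L" "70 * p * L + 2 + (t - K) \<le> u" using inv by (auto simp: Inv_def wd_def)
    have e: "rg \<sigma>' 7 = p" using fr by (simp add: frame_def p_def)
    have wp: "wd < p" using b e by (simp add: vcg wd_def)
    obtain L' where L': "L = Suc L'" using L(1) wp by (cases L) auto
    have ub: "60 * p + 10 + 70 * p * L' + 2 + (t - K) \<le> u" using L(2) wp w1 unfolding L' by (simp add: algebra_simps)
    have cd: "ar \<sigma>' 13 i \<le> Suc m" if "1 \<le> i" "i \<le> p" for i using im AC that by (metis atLeastAtMost_iff atMost_iff imageI subset_iff)
    have fin: "okk copy_com \<tau> v (\<lambda>\<sigma>' t'. okk (17 ::= Plus (V 17) (V 17)) \<sigma>' t' Inv)"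
      if f: "frame {11, 18, 19, 20, 21, 22} {14} \<sigma>' \<tau>" and i1: "ar \<tau> 14 ` {1..p} = ar \<sigma>' 13 ` {1..p}"
        and b1: "blk (2 * wd) p (ar \<tau> 14)" and v: "7 * p + 10 + 70 * p * L' + 2 + (t - K) \<le> v" for \<tau> v
    proof (rule okk_copy)
      show "rg \<tau> 7 = p" using f e by (simp add: frame_def)
      show "p \<le> m" using p by (simp add: p_def)
      show "7 * p + 5 \<le> v" using v by simp
      fix \<tau>' v' assume f2: "frame {11} {13} \<tau> \<tau>'" and cp: "\<And>i. 1 \<le> i \<Longrightarrow> i \<le> p \<Longrightarrow> ar \<tau>' 13 i = ar \<tau> 14 i" and v': "v - (7 * p + 5) \<le> v'"
      have w2: "rg \<tau>' 17 = wd" using f f2 by (simp add: frame_def wd_def)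
      have F: "frame {11, 17, 18, 19, 20, 21, 22} {13, 14} \<sigma> \<tau>'"
        using frame_trans[OF fr frame_trans] frame_mono[OF f, of "{11, 17, 18, 19, 20, 21, 22}" "{13, 14}"]
          frame_mono[OF f2, of "{11, 17, 18, 19, 20, 21, 22}" "{13, 14}"] by blast
      have "ar \<tau>' 13 ` {1..p} = ar \<tau> 14 ` {1..p}" using cp by (intro image_cong) auto
      moreover have "blk (2 * wd) p (ar \<tau>' 13)"
        unfolding blk_def
      proof
        fix b show "srt (ar \<tau>' 13) (1 + 2 * wd * b) (min (1 + 2 * wd * b + 2 * wd) (p + 1))"
          using b1[unfolded blk_def, rule_format, of b] cp unfolding srt_def by auto
      qed
      moreover have "p \<le> 2 * wd * 2 ^ L'" using L(1) by (simp add: L')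
      ultimately have "Inv (srg 17 (2 * wd) \<tau>') (v' - 1)"
        unfolding Inv_def using F im i1 v v' w1 by (auto intro!: exI[of _ L'])
      then show "okk (17 ::= Plus (V 17) (V 17)) \<tau>' v' Inv" using v v' w2 wp pW by (simp add: vcg mult_2)
    qed
    have "okk pass_com \<sigma>' (u - 4) (\<lambda>\<sigma>' t'. okk (copy_com ;; 17 ::= Plus (V 17) (V 17)) \<sigma>' t' Inv)"
      by (rule okk_pass[OF e _ wd_def[symmetric] w1 wp cd bl])
        (use ub p w1 wp in \<open>auto simp: ok_Seq[of _ _ copy_com] le_diff_pos p_def[symmetric] intro!: fin\<close>)
    then show "3 \<le> u \<and> okk (pass_com ;; copy_com ;; 17 ::= Plus (V 17) (V 17)) \<sigma>' (u - 3) Inv"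
      using ub by (simp add: ok_Seq[of _ _ pass_com] le_diff_pos)
  next
    fix \<sigma>' u assume inv: "Inv \<sigma>' u" and b: "\<not> te \<sigma>' (lt_test (V 17) (V 7))"
    have fr: "frame {11, 17, 18, 19, 20, 21, 22} {13, 14} \<sigma> \<sigma>'" using inv by (simp add: Inv_def)
    have "p \<le> rg \<sigma>' 17" using b fr by (simp add: vcg frame_def p_def)
    moreover have "srt (ar \<sigma>' 13) 1 (min (1 + rg \<sigma>' 17) (p + 1))" using inv by (auto simp: Inv_def blk_def dest: spec[of _ 0])
    ultimately have "srt (ar \<sigma>' 13) 1 (p + 1)" by (simp add: min_def add.commute split: if_splits)
    then show "2 \<le> u \<and> Q \<sigma>' (u - 2)" using Q[OF fr, of "u - 2"] inv by (auto simp: Inv_def A_def p_def K_def)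
  qed
  then show ?thesis using t by (simp add: sort_com_def vcg)
qed

end

section \<open>Buckets as linked lists, placement of the sources, relaxation and settling\<close>

section \<open>Verification of the bucket search\<close>

text \<open>A linked list threaded through arrays. The number \<open>k\<close> of cells in use is
  kept so that cells allocated later cannot disturb existing lists.\<close>

fun chn :: "(nat \<Rightarrow> nat) \<Rightarrow> (nat \<Rightarrow> nat) \<Rightarrow> nat \<Rightarrow> nat \<Rightarrow> nat list \<Rightarrow> bool" where
  "chn nx it k q [] \<longleftrightarrow> q = 0"
| "chn nx it k q (c # cs) \<longleftrightarrow> 1 \<le> q \<and> q \<le> k \<and> it q = c \<and> chn nx it k (nx q) cs"

lemma chn_mono:
  "chn nx it k q cs \<Longrightarrow> k \<le> k' \<Longrightarrow> (\<And>x. 1 \<le> x \<Longrightarrow> x \<le> k \<Longrightarrow> nx' x = nx x \<and> it' x = it x) \<Longrightarrow> chn nx' it' k' q cs"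
  by (induction cs arbitrary: q) auto

text \<open>The entries whose removal is still to be paid for. Bucket 0 is left out because the
  search stops above it and never removes its entries.\<close>

definition total_len :: "nat \<Rightarrow> (nat \<Rightarrow> nat list) \<Rightarrow> nat" where
  "total_len p \<ll> = (\<Sum>j\<in>{1..p}. length (\<ll> j))"

lemma total_len_insert: "total_len p (\<ll>(g := c # \<ll> g)) \<le> total_len p \<ll> + 1"
proof (cases "g \<in> {1..p}")
  case True
  have "total_len p (\<ll>(g := c # \<ll> g)) = length (c # \<ll> g) + (\<Sum>j\<in>{1..p} - {g}. length (\<ll> j))"
    unfolding total_len_def using True by (subst sum.remove[of _ g]) (auto intro!: sum.cong)
  also have "\<dots> = total_len p \<ll> + 1"
    unfolding total_len_def using True by (subst (2) sum.remove[of _ g]) auto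
  finally show ?thesis by simp
next
  case False
  then have "total_len p (\<ll>(g := c # \<ll> g)) = total_len p \<ll>"
    unfolding total_len_def by (intro sum.cong) auto
  then show ?thesis by simp
qed

lemma total_len_pop: "i \<in> {1..p} \<Longrightarrow> \<ll> i = c # cs \<Longrightarrow> total_len p \<ll> = total_len p (\<ll>(i := cs)) + 1"
proof -
  assume i: "i \<in> {1..p}" "\<ll> i = c # cs"
  have "total_len p (\<ll>(i := cs)) = length cs + (\<Sum>j\<in>{1..p} - {i}. length (\<ll> j))"
    unfolding total_len_def using i by (subst sum.remove[of _ i]) (auto intro!: sum.cong)
  moreover have "total_len p \<ll> = length (c # cs) + (\<Sum>j\<in>{1..p} - {i}. length (\<ll> j))"
    unfolding total_len_def using i by (subst sum.remove[of _ i]) auto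
  ultimately show ?thesis by simp
qed

context inst
begin

definition bkt :: "state \<Rightarrow> (nat \<Rightarrow> nat list) \<Rightarrow> bool" where
  "bkt \<sigma> \<ll> \<longleftrightarrow> (\<forall>j\<ge>1. chn (ar \<sigma> 17) (ar \<sigma> 18) (rg \<sigma> 15) (ar \<sigma> 16 j) (\<ll> j))"

definition inserted :: "state \<Rightarrow> state" where
  "inserted \<sigma> = sar 16 (rg \<sigma> 12) (rg \<sigma> 15 + 1) (sar 17 (rg \<sigma> 15 + 1) (ar \<sigma> 16 (rg \<sigma> 12))
       (sar 18 (rg \<sigma> 15 + 1) (rg \<sigma> 14) (srg 15 (rg \<sigma> 15 + 1) \<sigma>)))"

lemma rg_inserted: "rg (inserted \<sigma>) = (rg \<sigma>)(15 := rg \<sigma> 15 + 1)" by (simp add: inserted_def)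
lemma ar_inserted: "k < 32 \<Longrightarrow> k \<notin> {16, 17, 18} \<Longrightarrow> ar (inserted \<sigma>) k = ar \<sigma> k" by (simp add: inserted_def ar_sar)
lemma frame_inserted: "15 \<in> R \<Longrightarrow> {16, 17, 18} \<subseteq> K \<Longrightarrow> frame R K \<sigma>0 (inserted \<sigma>) \<longleftrightarrow> frame R K \<sigma>0 \<sigma>"
  by (simp add: inserted_def)

lemma bkt_inserted:
  assumes "bkt \<sigma> \<ll>" shows "bkt (inserted \<sigma>) (\<ll>((rg \<sigma> 12) := rg \<sigma> 14 # \<ll> (rg \<sigma> 12)))"
  unfolding bkt_def
proof (intro allI impI)
  fix j :: nat assume j: "1 \<le> j"
  have a: "ar (inserted \<sigma>) 16 = (ar \<sigma> 16)(rg \<sigma> 12 := rg \<sigma> 15 + 1)"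
    "ar (inserted \<sigma>) 17 = (ar \<sigma> 17)(rg \<sigma> 15 + 1 := ar \<sigma> 16 (rg \<sigma> 12))"
    "ar (inserted \<sigma>) 18 = (ar \<sigma> 18)(rg \<sigma> 15 + 1 := rg \<sigma> 14)"
    by (simp_all add: inserted_def ar_sar)
  have old: "chn (ar (inserted \<sigma>) 17) (ar (inserted \<sigma>) 18) (rg \<sigma> 15 + 1) (ar \<sigma> 16 i) (\<ll> i)" if "1 \<le> i" for i
    using assms that unfolding bkt_def by (rule_tac chn_mono[of "ar \<sigma> 17" "ar \<sigma> 18" "rg \<sigma> 15"]) (auto simp: a)
  show "chn (ar (inserted \<sigma>) 17) (ar (inserted \<sigma>) 18) (rg (inserted \<sigma>) 15) (ar (inserted \<sigma>) 16 j)
     ((\<ll>((rg \<sigma> 12) := rg \<sigma> 14 # \<ll> (rg \<sigma> 12))) j)"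
  proof (cases "j = rg \<sigma> 12")
    case True
    then show ?thesis using old[OF j] by (simp add: a(1) rg_inserted) (simp add: a)
  next
    case False
    then show ?thesis using old[OF j] by (simp add: a(1) rg_inserted)
  qed
qed

lemma okk_insert':
  "rg \<sigma> 15 < 2 * W \<Longrightarrow> rg \<sigma> 12 \<le> 2 * W \<Longrightarrow> 7 \<le> t \<Longrightarrow> Q (inserted \<sigma>) (t - 7) \<Longrightarrow> okk insert_com \<sigma> t Q"
  unfolding inserted_def by (rule okk_insert)

lemma okk_guess:
  assumes g: "good (ar \<sigma> 4) (ar \<sigma> 5)" and tb: "tabl (ar \<sigma> 4) (ar \<sigma> 5) S r (rg \<sigma> 7) (ar \<sigma> 13)" and p: "rg \<sigma> 7 \<le> m" "rg \<sigma> 7 + 1 \<le> 2 ^ \<Lambda>"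
    and gg: "rg \<sigma> 12 \<le> rg \<sigma> 7"
    and key: "rg \<sigma> 14 \<le> m" "rk (ar \<sigma> 4 r) \<le> rk (rg \<sigma> 14)" "rk (rg \<sigma> 14) < rk (ar \<sigma> 5 r)"
    and t: "(if ix (rg \<sigma> 7) (ar \<sigma> 13) (rk (rg \<sigma> 14)) = rg \<sigma> 12 then 0 else 1) * (10 * \<Lambda> + 20) + 5 \<le> t"
    and Q: "\<And>\<sigma>' u. frame {12, 13, 21} {} \<sigma> \<sigma>' \<Longrightarrow> rg \<sigma>' 12 = ix (rg \<sigma> 7) (ar \<sigma> 13) (rk (rg \<sigma> 14)) \<Longrightarrow>
       t - ((if ix (rg \<sigma> 7) (ar \<sigma> 13) (rk (rg \<sigma> 14)) = rg \<sigma> 12 then 0 else 1) * (10 * \<Lambda> + 20) + 5) \<le> u \<Longrightarrow> Q \<sigma>' u"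
  shows "okk guess_com \<sigma> t Q"
proof -
  define p where "p = rg \<sigma> 7"
  define j where "j = ix p (ar \<sigma> 13) (rk (rg \<sigma> 14))"
  note tb' = tb[folded p_def]
  have c: "ar \<sigma> 13 i \<le> Suc m" if "i \<le> p + 1" for i by (rule tb_code[OF g tb' that])
  have pW: "p \<le> W" "rg \<sigma> 12 \<le> p" using p gg W_ge by (simp_all add: p_def)
  have t0: "ar \<sigma> 13 0 = ar \<sigma> 4 r" "ar \<sigma> 13 (p + 1) = ar \<sigma> 5 r" by (rule tb_0[OF g tb'], rule tb_top[OF g tb'])
  have tst: "te \<sigma> (Conj (wle_test (arr 13 (V 12)) (V 14)) (wlt_test (V 14) (arr 13 (Plus (V 12) (N 1))))) \<longleftrightarrow> j = rg \<sigma> 12"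
  proof -
    have "te \<sigma> (Conj (wle_test (arr 13 (V 12)) (V 14)) (wlt_test (V 14) (arr 13 (Plus (V 12) (N 1))))) \<longleftrightarrow>
      rk (ar \<sigma> 13 (rg \<sigma> 12)) \<le> rk (rg \<sigma> 14) \<and> rk (rg \<sigma> 14) < rk (ar \<sigma> 13 (rg \<sigma> 12 + 1))"
      using c[of "rg \<sigma> 12"] c[of "rg \<sigma> 12 + 1"] pW key W_ge by (simp add: vcg)
    also have "\<dots> \<longleftrightarrow> j = rg \<sigma> 12"
      using ix_unique[OF g tb' pW(2)] ix_next[OF g tb' key(3)] ix_val[of "ar \<sigma> 13" "rk (rg \<sigma> 14)" p] t0 key(2)
      by (auto simp: j_def)
    finally show ?thesis .
  qed
  show ?thesis
  proof (cases "j = rg \<sigma> 12")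
    case True
    then show ?thesis unfolding guess_com_def ok_If tst using t Q[of \<sigma> "t - 1"] by (simp add: j_def p_def)
  next
    case False
    have "okk locate_com (srg 13 (p + 1) \<sigma>) (t - 3) Q"
    proof (rule okk_locate[where \<Lambda> = \<Lambda>])
      show "ar (srg 13 (p + 1) \<sigma>) 13 i \<le> Suc m" if "i \<le> rg (srg 13 (p + 1) \<sigma>) 13" for i using c that by simp
      show "10 * \<Lambda> + 10 \<le> t - 3" using t False by (simp add: j_def p_def)
      fix \<sigma>' u assume f: "frame {12, 13, 21} {} (srg 13 (p + 1) \<sigma>) \<sigma>'" and l: "rg \<sigma>' 12 < rg (srg 13 (p + 1) \<sigma>) 13"
        "rk (ar (srg 13 (p + 1) \<sigma>) 13 (rg \<sigma>' 12)) \<le> rk (rg (srg 13 (p + 1) \<sigma>) 14)"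
        "rk (rg (srg 13 (p + 1) \<sigma>) 14) < rk (ar (srg 13 (p + 1) \<sigma>) 13 (rg \<sigma>' 12 + 1))" and u: "t - 3 - (10 * \<Lambda> + 10) \<le> u"
      have "rg \<sigma>' 12 = j" using ix_unique[OF g tb', of "rg \<sigma>' 12" "rk (rg \<sigma> 14)"] l by (simp add: j_def)
      moreover have "frame {12, 13, 21} {} \<sigma> \<sigma>'" using f by (auto simp: frame_def)
      ultimately show "Q \<sigma>' u" using Q[of \<sigma>' u] u False by (simp add: j_def p_def)
    qed (use key pW t0 p W_ge in \<open>simp_all add: p_def\<close>)
    then show ?thesis unfolding guess_com_def ok_If tst using False t pW W_ge by (simp add: vcg j_def p_def)
  qed
qed

lemma bkt_frame: "ar \<sigma>' 16 = ar \<sigma> 16 \<Longrightarrow> ar \<sigma>' 17 = ar \<sigma> 17 \<Longrightarrow> ar \<sigma>' 18 = ar \<sigma> 18 \<Longrightarrow> rg \<sigma>' 15 = rg \<sigma> 15 \<Longrightarrow> bkt \<sigma>' \<ll> = bkt \<sigma> \<ll>"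
  by (simp add: bkt_def)

text \<open>A constant per vertex and one binary search per failed guess. Register 12 passes the
  bucket of the last placed source on to the next one, so the searches performed are exactly those
  counted by \<open>fails\<close>.\<close>

lemma okk_place:
  assumes g: "good (ar \<sigma> 4) (ar \<sigma> 5)" and tb: "tabl (ar \<sigma> 4) (ar \<sigma> 5) S r (rg \<sigma> 7) (ar \<sigma> 13)" and p: "rg \<sigma> 7 \<le> m" "rg \<sigma> 7 + 1 \<le> 2 ^ \<Lambda>"
    and o: "distinct (ord \<sigma>)" "set (ord \<sigma>) = cc (ar \<sigma> 4) r" and r: "r < n"
    and h: "\<And>v. v \<in> cc (ar \<sigma> 4) r \<Longrightarrow> ar \<sigma> 12 v = hh (ar \<sigma> 4) v"
    and z: "rg \<sigma> 12 = 0" "rg \<sigma> 15 = 0" "rg \<sigma> 11 = 0" "\<And>j. 1 \<le> j \<Longrightarrow> ar \<sigma> 16 j = 0"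
    and t: "40 * rg \<sigma> 6 + (10 * \<Lambda> + 20) * fails (hh (ar \<sigma> 4)) (\<lambda>v. ix (rg \<sigma> 7) (ar \<sigma> 13) (rk (hh (ar \<sigma> 4) v))) 0 (ord \<sigma>) + 5 \<le> t"
    and Q: "\<And>\<sigma>' \<ll> u. frame {8, 11, 12, 13, 14, 15, 21} {15, 16, 17, 18} \<sigma> \<sigma>' \<Longrightarrow>
       djk (ar \<sigma> 4) r (rg \<sigma> 7) (ar \<sigma> 13) {} (rg \<sigma> 7) (ar \<sigma>' 15) \<ll> \<Longrightarrow> bkt \<sigma>' \<ll> \<Longrightarrow> total_len (rg \<sigma> 7) \<ll> \<le> rg \<sigma> 6 \<Longrightarrow> rg \<sigma>' 15 \<le> rg \<sigma> 6 \<Longrightarrow>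
       (\<And>v. v \<in> cc (ar \<sigma> 4) r \<Longrightarrow> ar \<sigma>' 15 v = 0) \<Longrightarrow> t - (40 * rg \<sigma> 6 + (10 * \<Lambda> + 20) * fails (hh (ar \<sigma> 4)) (\<lambda>v. ix (rg \<sigma> 7) (ar \<sigma> 13) (rk (hh (ar \<sigma> 4) v))) 0 (ord \<sigma>) + 5) \<le> u \<Longrightarrow> Q \<sigma>' u"
  shows "okk place_loop \<sigma> t Q"
proof -
  define lo where "lo = ar \<sigma> 4"
  define Tf where "Tf = ar \<sigma> 13"
  define p where "p = rg \<sigma> 7"
  define c where "c = rg \<sigma> 6"
  define loc where "loc v = ix p Tf (rk (hh lo v))" for v
  define K where "K = 40 * c + (10 * \<Lambda> + 20) * fails (hh lo) loc 0 (ord \<sigma>) + 5"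
  have len: "length (ord \<sigma>) = c" by (simp add: ord_def c_def)
  have nth: "ord \<sigma> ! k = ar \<sigma> 10 k" if "k < c" for k using that by (simp add: ord_def c_def)
  have cn: "c \<le> n"
    using distinct_card[OF o(1)] o(2) len card_cc_le[OF r, of lo] by (simp add: lo_def)
  define Inv where "Inv = (\<lambda>\<sigma>' u. frame {8, 11, 12, 13, 14, 15, 21} {15, 16, 17, 18} \<sigma> \<sigma>' \<and> rg \<sigma>' 11 \<le> c \<and> rg \<sigma>' 12 \<le> p \<and> rg \<sigma>' 15 \<le> rg \<sigma>' 11 \<and>
     (\<forall>v\<in>set (take (rg \<sigma>' 11) (ord \<sigma>)). ar \<sigma>' 15 v = 0) \<and>
     (\<exists>\<ll>. bkt \<sigma>' \<ll> \<and> total_len p \<ll> \<le> rg \<sigma>' 11 \<and>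
        (\<forall>j\<ge>1. \<forall>x\<in>set (\<ll> j). \<exists>u\<in>set (take (rg \<sigma>' 11) (ord \<sigma>)). x = hh lo u \<and> hh lo u \<noteq> 0 \<and> loc u = j) \<and>
        (\<forall>u\<in>set (take (rg \<sigma>' 11) (ord \<sigma>)). hh lo u \<noteq> 0 \<longrightarrow> hh lo u \<in> set (\<ll> (loc u)))) \<and>
     40 * (c - rg \<sigma>' 11) + (10 * \<Lambda> + 20) * fails (hh lo) loc (rg \<sigma>' 12) (drop (rg \<sigma>' 11) (ord \<sigma>)) + 2 + (t - K) \<le> u)"
  show ?thesis unfolding place_loop_def
  proof (rule okk_While[where Inv = Inv])
    have "bkt \<sigma> (\<lambda>_. [])" using z by (simp add: bkt_def)
    moreover have "K \<le> t" using t unfolding K_def c_def lo_def loc_def[abs_def] p_def Tf_def .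
    ultimately show "Inv \<sigma> t"
      unfolding Inv_def using z by (auto simp: K_def total_len_def intro!: exI[of _ "\<lambda>_. []"])
  next
    fix \<sigma>' u assume inv: "Inv \<sigma>' u" and b: "te \<sigma>' (lt_test (V 11) (V 6))"
    define k where "k = rg \<sigma>' 11"
    have fr: "frame {8, 11, 12, 13, 14, 15, 21} {15, 16, 17, 18} \<sigma> \<sigma>'" and i1: "rg \<sigma>' 12 \<le> p" "rg \<sigma>' 15 \<le> k"
      and f0: "\<And>v. v \<in> set (take k (ord \<sigma>)) \<Longrightarrow> ar \<sigma>' 15 v = 0"
      and u: "40 * (c - k) + (10 * \<Lambda> + 20) * fails (hh lo) loc (rg \<sigma>' 12) (drop k (ord \<sigma>)) + 2 + (t - K) \<le> u"
      using inv by (auto simp: Inv_def k_def)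
    obtain \<ll> where L: "bkt \<sigma>' \<ll>" "total_len p \<ll> \<le> k"
       "\<And>j x. 1 \<le> j \<Longrightarrow> x \<in> set (\<ll> j) \<Longrightarrow> \<exists>u\<in>set (take k (ord \<sigma>)). x = hh lo u \<and> hh lo u \<noteq> 0 \<and> loc u = j"
       "\<And>u. u \<in> set (take k (ord \<sigma>)) \<Longrightarrow> hh lo u \<noteq> 0 \<Longrightarrow> hh lo u \<in> set (\<ll> (loc u))"
      using inv unfolding Inv_def k_def[symmetric] by blast
    have e: "rg \<sigma>' 6 = c" "rg \<sigma>' 7 = p" "ar \<sigma>' 10 = ar \<sigma> 10" "ar \<sigma>' 12 = ar \<sigma> 12" "ar \<sigma>' 4 = lo" "ar \<sigma>' 5 = ar \<sigma> 5" "ar \<sigma>' 13 = Tf"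
      using fr by (simp_all add: frame_def c_def p_def lo_def Tf_def)
    have kc: "k < c" using b e by (simp add: vcg k_def)
    define v where "v = ar \<sigma> 10 k"
    have vo: "ord \<sigma> ! k = v" using nth[OF kc] by (simp add: v_def)
    have dr: "drop k (ord \<sigma>) = v # drop (k + 1) (ord \<sigma>)"
      using Cons_nth_drop_Suc[of k "ord \<sigma>"] kc len vo by (simp add: Suc_eq_plus1[symmetric] del: Suc_eq_plus1)
    have tk: "set (take (k + 1) (ord \<sigma>)) = insert v (set (take k (ord \<sigma>)))"
      using take_Suc_conv_app_nth[of k "ord \<sigma>"] kc len vo by (simp add: Suc_eq_plus1[symmetric] del: Suc_eq_plus1)
    have "v \<in> set (ord \<sigma>)" using vo kc len nth_mem by metis
    then have vC: "v \<in> cc lo r" using o(2) by (simp add: lo_def)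
    have vn: "v < n" by (rule cc_lt[OF r vC])
    have hv: "ar \<sigma> 12 v = hh lo v" using h vC by (simp add: lo_def)
    define \<tau> where "\<tau> = srg 11 (k + 1) (srg 14 (hh lo v) (sar 15 v 0 (srg 8 v \<sigma>')))"
    have tau: "rg \<tau> 14 = hh lo v" "rg \<tau> 12 = rg \<sigma>' 12" "rg \<tau> 7 = p" "ar \<tau> 4 = lo" "ar \<tau> 5 = ar \<sigma> 5" "ar \<tau> 13 = Tf" "rg \<tau> 11 = k + 1" "rg \<tau> 15 = rg \<sigma>' 15"
      "ar \<tau> 16 = ar \<sigma>' 16" "ar \<tau> 17 = ar \<sigma>' 17" "ar \<tau> 18 = ar \<sigma>' 18" "ar \<tau> 15 = (ar \<sigma>' 15)(v := 0)"
      using e by (simp_all add: \<tau>_def ar_sar)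
    have frt: "frame {8, 11, 12, 13, 14, 15, 21} {15, 16, 17, 18} \<sigma> \<tau>" using fr by (simp add: \<tau>_def)
    have bt: "bkt \<tau> \<ll>" using L(1) bkt_frame[of \<tau> \<sigma>'] tau by simp
    have z15: "ar \<tau> 15 x = 0" if "x \<in> set (take (k + 1) (ord \<sigma>))" for x using f0 that tk tau by auto
    have skip: "Inv \<tau> x" if "hh lo v = 0" "40 * (c - (k + 1)) + (10 * \<Lambda> + 20) * fails (hh lo) loc (rg \<sigma>' 12) (drop (k + 1) (ord \<sigma>)) + 2 + (t - K) \<le> x" for x
    proof -
      have "\<exists>\<ll>. bkt \<tau> \<ll> \<and> total_len p \<ll> \<le> k + 1 \<and>
        (\<forall>j\<ge>1. \<forall>x\<in>set (\<ll> j). \<exists>u\<in>set (take (k + 1) (ord \<sigma>)). x = hh lo u \<and> hh lo u \<noteq> 0 \<and> loc u = j) \<and>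
        (\<forall>u\<in>set (take (k + 1) (ord \<sigma>)). hh lo u \<noteq> 0 \<longrightarrow> hh lo u \<in> set (\<ll> (loc u)))"
        using bt L(2,3,4) that(1) unfolding tk by (intro exI[of _ \<ll>]) fastforce
      moreover have "\<forall>x\<in>set (take (k + 1) (ord \<sigma>)). ar \<tau> 15 x = 0" using z15 by blast
      ultimately show ?thesis unfolding Inv_def tau(2,7,8) using frt kc i1 that(2) by simp
    qed
    have ins: "okk (guess_com ;; insert_com) \<tau> x Inv"
      if nz: "hh lo v \<noteq> 0" and x: "(if loc v = rg \<sigma>' 12 then 0 else 1) * (10 * \<Lambda> + 20) + 15 + 40 * (c - (k + 1)) + (10 * \<Lambda> + 20) * fails (hh lo) loc (loc v) (drop (k + 1) (ord \<sigma>)) + 2 + (t - K) \<le> x" for x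
    proof -
      note hB = hh_le_B[OF g nz[unfolded lo_def]]
      have hiv: "ar \<sigma> 5 v = ar \<sigma> 5 r" "lo v = lo r" using cc_hi[OF g] cc_lo vC by (auto simp: lo_def)
      have "okk guess_com \<tau> (x - 1) (\<lambda>\<sigma>' t'. okk insert_com \<sigma>' t' Inv)"
      proof (rule okk_guess[where \<Lambda> = \<Lambda> and S = S and r = r])
        show "good (ar \<tau> 4) (ar \<tau> 5)" "tabl (ar \<tau> 4) (ar \<tau> 5) S r (rg \<tau> 7) (ar \<tau> 13)" "rg \<tau> 7 \<le> m" "rg \<tau> 7 + 1 \<le> 2 ^ \<Lambda>" "rg \<tau> 12 \<le> rg \<tau> 7"
          using g tb p i1 unfolding tau by (simp_all add: lo_def p_def Tf_def)
        show "rg \<tau> 14 \<le> m" using hh_le tau by simp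
        show "rk (ar \<tau> 4 r) \<le> rk (rg \<tau> 14)" using hB(2) hiv unfolding tau by (simp add: lo_def)
        show "rk (rg \<tau> 14) < rk (ar \<tau> 5 r)" using hB(1) goodD(4)[OF g hB(5,6)] hiv unfolding tau by (simp add: lo_def)
        show "(if ix (rg \<tau> 7) (ar \<tau> 13) (rk (rg \<tau> 14)) = rg \<tau> 12 then 0 else 1) * (10 * \<Lambda> + 20) + 5 \<le> x - 1"
          unfolding tau loc_def[symmetric] using x by simp
        fix \<rho> y assume f: "frame {12, 13, 21} {} \<tau> \<rho>" and r12: "rg \<rho> 12 = ix (rg \<tau> 7) (ar \<tau> 13) (rk (rg \<tau> 14))"
          and y: "x - 1 - ((if ix (rg \<tau> 7) (ar \<tau> 13) (rk (rg \<tau> 14)) = rg \<tau> 12 then 0 else 1) * (10 * \<Lambda> + 20) + 5) \<le> y"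
        have r12': "rg \<rho> 12 = loc v" using r12 unfolding tau loc_def .
        have y': "7 + 40 * (c - (k + 1)) + (10 * \<Lambda> + 20) * fails (hh lo) loc (loc v) (drop (k + 1) (ord \<sigma>)) + 2 + (t - K) \<le> y"
          using y x unfolding tau loc_def[symmetric] by simp
        have rho: "rg \<rho> 11 = k + 1" "rg \<rho> 14 = hh lo v" "rg \<rho> 15 = rg \<sigma>' 15" "ar \<rho> 15 = ar \<tau> 15"
          using f tau by (simp_all add: frame_def)
        have lp: "loc v \<le> p" unfolding loc_def by (rule ix_le)
        have "bkt \<rho> \<ll>" using bt f bkt_frame[of \<rho> \<tau>] by (simp add: frame_def)
        from bkt_inserted[OF this] have B: "bkt (inserted \<rho>) (\<ll>(loc v := hh lo v # \<ll> (loc v)))" by (simp add: r12' rho)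
        have TL: "total_len p (\<ll>(loc v := hh lo v # \<ll> (loc v))) \<le> k + 1" using total_len_insert[of p \<ll> "loc v" "hh lo v"] L(2) by simp
        have S1: "\<exists>u\<in>set (take (k + 1) (ord \<sigma>)). x = hh lo u \<and> hh lo u \<noteq> 0 \<and> loc u = j"
          if "1 \<le> j" "x \<in> set ((\<ll>(loc v := hh lo v # \<ll> (loc v))) j)" for j x
        proof (cases "j = loc v \<and> x = hh lo v")
          case True
          then show ?thesis unfolding tk using nz by blast
        next
          case False
          then have "x \<in> set (\<ll> j)" using that(2) by (auto split: if_splits)
          then show ?thesis unfolding tk using L(3)[OF that(1)] by blast
        qed
        have S2: "hh lo u \<in> set ((\<ll>(loc v := hh lo v # \<ll> (loc v))) (loc u))" if "u \<in> set (take (k + 1) (ord \<sigma>))" "hh lo u \<noteq> 0" for u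
          using L(4)[of u] that unfolding tk by (cases "u = v") auto
        have F: "frame {8, 11, 12, 13, 14, 15, 21} {15, 16, 17, 18} \<sigma> (inserted \<rho>)"
          using frame_trans[OF frt frame_mono[OF f]] by (simp add: frame_inserted)
        have "Inv (inserted \<rho>) (y - 7)"
          unfolding Inv_def rg_inserted using F B TL S1 S2 kc i1 lp z15 y' by (auto simp: rho r12' ar_inserted)
        then show "okk insert_com \<rho> y Inv"
          using y' rho i1 kc cn lp p W_ge r12' by (intro okk_insert') (auto simp: p_def)
      qed
      then show ?thesis using x by (simp add: ok_Seq)
    qed
    have fl: "fails (hh lo) loc (rg \<sigma>' 12) (drop k (ord \<sigma>)) = (if hh lo v = 0 then fails (hh lo) loc (rg \<sigma>' 12) (drop (k + 1) (ord \<sigma>))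
       else (if loc v = rg \<sigma>' 12 then 0 else 1) + fails (hh lo) loc (loc v) (drop (k + 1) (ord \<sigma>)))" by (simp add: dr)
    have ck: "c - k = (c - (k + 1)) + 1" using kc by simp
    have body: "okk (If (Leq (N 1) (V 14)) (guess_com ;; insert_com) Skip) \<tau> (u - 11) Inv"
    proof (cases "hh lo v = 0")
      case True
      then show ?thesis using skip[of "u - 12"] u unfolding fl ck by (simp add: ok_If te_Leq evs tau)
    next
      case False
      define R where "R = fails (hh lo) loc (loc v) (drop (k + 1) (ord \<sigma>))"
      define b where "b = (if loc v = rg \<sigma>' 12 then 0 else (1::nat))"
      have fl': "fails (hh lo) loc (rg \<sigma>' 12) (drop k (ord \<sigma>)) = b + R" using fl False by (simp add: R_def b_def)
      have "(10 * \<Lambda> + 20) * (b + R) = b * (10 * \<Lambda> + 20) + (10 * \<Lambda> + 20) * R" by (simp add: algebra_simps)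
      then have u': "40 * (c - (k + 1)) + 40 + (b * (10 * \<Lambda> + 20) + (10 * \<Lambda> + 20) * R) + 2 + (t - K) \<le> u"
        using u unfolding fl' ck by simp
      have "okk (guess_com ;; insert_com) \<tau> (u - 12) Inv"
      proof (rule ins[OF False, folded R_def b_def], rule add_le_imp_le_diff)
        show "b * (10 * \<Lambda> + 20) + 15 + 40 * (c - (k + 1)) + (10 * \<Lambda> + 20) * R + 2 + (t - K) + 12 \<le> u"
          using u' by linarith
      qed
      moreover have "te \<tau> (Leq (N 1) (V 14)) \<longleftrightarrow> True" using False by (simp add: te_Leq evs tau Suc_le_eq)
      moreover have "1 \<le> u - 11" using u' by linarith
      moreover have "u - 11 - 1 = u - 12" by simp
      ultimately show ?thesis by (simp only: ok_If if_True simp_thms)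
    qed
    have "40 * 1 \<le> 40 * (c - k)" using kc by (intro mult_le_mono2) simp
    then have u40: "40 \<le> u" using u by linarith
    show "3 \<le> u \<and> okk (8 ::= arr 10 (V 11) ;; put 15 (V 8) (N 0) ;; 14 ::= arr 12 (V 8) ;; 11 ::= Plus (V 11) (N 1) ;;
      If (Leq (N 1) (V 14)) (guess_com ;; insert_com) Skip) \<sigma>' (u - 3) Inv"
      using body u40 kc cn vn e hv W_ge
      by (simp add: ok_Seq[of _ _ "_ ::= _"] ok_Seq[of _ _ "put _ _ _"] okk_Assign okk_put evs ar_sar le_diff_pos k_def[symmetric] v_def[symmetric] \<tau>_def[symmetric])
  next
    fix \<sigma>' u assume inv: "Inv \<sigma>' u" and b: "\<not> te \<sigma>' (lt_test (V 11) (V 6))"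
    have fr: "frame {8, 11, 12, 13, 14, 15, 21} {15, 16, 17, 18} \<sigma> \<sigma>'" using inv by (simp add: Inv_def)
    then have k: "rg \<sigma>' 11 = c" using inv b by (auto simp: Inv_def vcg frame_def c_def)
    have tk: "take c (ord \<sigma>) = ord \<sigma>" using len by simp
    have oC: "set (ord \<sigma>) = cc lo r" using o(2) by (simp add: lo_def)
    have i1: "rg \<sigma>' 15 \<le> c" and f0: "\<And>v. v \<in> cc lo r \<Longrightarrow> ar \<sigma>' 15 v = 0" and u: "2 + (t - K) \<le> u"
      using inv by (auto simp: Inv_def k tk oC)
    have "\<exists>\<ll>. bkt \<sigma>' \<ll> \<and> total_len p \<ll> \<le> c \<and>
        (\<forall>j\<ge>1. \<forall>x\<in>set (\<ll> j). \<exists>u\<in>cc lo r. x = hh lo u \<and> hh lo u \<noteq> 0 \<and> loc u = j) \<and>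
        (\<forall>u\<in>cc lo r. hh lo u \<noteq> 0 \<longrightarrow> hh lo u \<in> set (\<ll> (loc u)))"
      using inv unfolding Inv_def k tk oC by (elim conjE)
    then obtain \<ll> where L: "bkt \<sigma>' \<ll>" "total_len p \<ll> \<le> c"
       "\<And>j x. 1 \<le> j \<Longrightarrow> x \<in> set (\<ll> j) \<Longrightarrow> \<exists>u\<in>cc lo r. x = hh lo u \<and> hh lo u \<noteq> 0 \<and> loc u = j"
       "\<And>u. u \<in> cc lo r \<Longrightarrow> hh lo u \<noteq> 0 \<Longrightarrow> hh lo u \<in> set (\<ll> (loc u))"
      by blast
    note g' = g[folded lo_def] and tb' = tb[folded lo_def p_def Tf_def]
    \<comment> \<open>No vertex is settled yet, so only the entries have to be checked. Each lies in
      the bucket of its own rank, which is at most the bucket of the value at its head.\<close>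
    have "djk lo r p Tf {} p (ar \<sigma>' 15) \<ll>"
    proof (rule djkI[OF g' tb'])
      show "(ar \<sigma>' 15) v \<noteq> 0" if "v \<in> cc lo r" "p < ix p Tf (B v)" for v using that ix_le[of p Tf "B v"] by simp
      show "v \<in> H ` set (\<ll> (ix p Tf (rk (hh lo v))))"
        if "v \<in> cc lo r" "hh lo v \<noteq> 0" "ar \<sigma>' 15 v = 0" "ix p Tf (rk (hh lo v)) \<noteq> 0" for v
        using L(4)[OF that(1,2)] hh_le_B(4)[OF g' that(2)] unfolding loc_def by (metis image_eqI)
      fix j x assume j: "1 \<le> j" "x \<in> set (\<ll> j)"
      then obtain v where v: "v \<in> cc lo r" "x = hh lo v" "hh lo v \<noteq> 0" "loc v = j" using L(3) by blast
      note hB = hh_le_B[OF g' v(3)]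
      have "j \<le> ix p Tf (B v)" using ix_mono[OF hB(1), of p Tf] v(4) by (simp add: loc_def)
      then show "j \<le> p \<and> x \<in> {1..m} \<and> H x \<in> cc lo r \<and> j \<le> ix p Tf (B (H x))"
        using v hB ix_le[of p Tf "rk (hh lo v)"] by (auto simp: loc_def)
    qed (use f0 in auto)
    then show "2 \<le> u \<and> Q \<sigma>' (u - 2)"
      using Q[OF fr, of \<ll> "u - 2", folded lo_def p_def Tf_def c_def, folded loc_def[abs_def], folded K_def] L(1,2) i1 f0 u by (simp add: le_diff_pos)
  qed
qed


lemma okk_cap:
  assumes g: "good (ar \<sigma> 4) (ar \<sigma> 5)" and tb: "tabl (ar \<sigma> 4) (ar \<sigma> 5) S r p (ar \<sigma> 13)" and p: "p \<le> m" "p + 1 \<le> 2 ^ \<Lambda>"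
    and i: "1 \<le> rg \<sigma> 16" "rg \<sigma> 16 \<le> p"
    and key: "rg \<sigma> 14 \<le> m" "rk (ar \<sigma> 4 r) \<le> rk (rg \<sigma> 14)"
    and t: "(if rk (ar \<sigma> 13 (rg \<sigma> 16)) \<le> rk (rg \<sigma> 14) then 0 else 1) * (10 * \<Lambda> + 20) + 5 \<le> t"
    and Q: "\<And>\<sigma>' u. frame {12, 13, 21} {} \<sigma> \<sigma>' \<Longrightarrow> rg \<sigma>' 12 = min (rg \<sigma> 16) (ix p (ar \<sigma> 13) (rk (rg \<sigma> 14))) \<Longrightarrow>
       t - ((if rk (ar \<sigma> 13 (rg \<sigma> 16)) \<le> rk (rg \<sigma> 14) then 0 else 1) * (10 * \<Lambda> + 20) + 5) \<le> u \<Longrightarrow> Q \<sigma>' u"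
  shows "okk cap_com \<sigma> t Q"
proof -
  define i where "i = rg \<sigma> 16"
  have c: "ar \<sigma> 13 j \<le> Suc m" if "j \<le> p + 1" for j by (rule tb_code[OF g tb that])
  have iW: "i \<le> W" "1 \<le> i" "i \<le> p" using i p W_ge by (simp_all add: i_def)
  have t0: "ar \<sigma> 13 0 = ar \<sigma> 4 r" by (rule tb_0[OF g tb])
  have tst: "te \<sigma> (wle_test (arr 13 (V 16)) (V 14)) \<longleftrightarrow> rk (ar \<sigma> 13 i) \<le> rk (rg \<sigma> 14)"
    using c[of i] iW key W_ge by (simp add: vcg i_def)
  show ?thesis
  proof (cases "rk (ar \<sigma> 13 i) \<le> rk (rg \<sigma> 14)")
    case True
    then have "i \<le> ix p (ar \<sigma> 13) (rk (rg \<sigma> 14))" using iW by (intro ix_ge) auto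
    moreover have "frame {12, 13, 21} {} \<sigma> (srg 12 i \<sigma>)" by simp
    ultimately show ?thesis unfolding cap_com_def ok_If tst
      using t True Q[of "srg 12 i \<sigma>" "t - 2"] by (simp add: vcg i_def)
  next
    case False
    have "okk locate_com (srg 13 i \<sigma>) (t - 3) Q"
    proof (rule okk_locate[where \<Lambda> = \<Lambda>])
      show "ar (srg 13 i \<sigma>) 13 j \<le> Suc m" if "j \<le> rg (srg 13 i \<sigma>) 13" for j using c[of j] that iW by simp
      show "10 * \<Lambda> + 10 \<le> t - 3" using t False by (simp add: i_def)
      fix \<sigma>' u assume f: "frame {12, 13, 21} {} (srg 13 i \<sigma>) \<sigma>'" and l: "rg \<sigma>' 12 < rg (srg 13 i \<sigma>) 13"
        "rk (ar (srg 13 i \<sigma>) 13 (rg \<sigma>' 12)) \<le> rk (rg (srg 13 i \<sigma>) 14)"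
        "rk (rg (srg 13 i \<sigma>) 14) < rk (ar (srg 13 i \<sigma>) 13 (rg \<sigma>' 12 + 1))" and u: "t - 3 - (10 * \<Lambda> + 10) \<le> u"
      have "ix p (ar \<sigma> 13) (rk (rg \<sigma> 14)) = rg \<sigma>' 12" using ix_unique[OF g tb, of "rg \<sigma>' 12" "rk (rg \<sigma> 14)"] l iW by simp
      moreover have "rg \<sigma>' 12 < i" using l by simp
      moreover have "frame {12, 13, 21} {} \<sigma> \<sigma>'" using f by (auto simp: frame_def)
      ultimately show "Q \<sigma>' u" using Q[of \<sigma>' u] u False by (simp add: i_def)
    next
      show "rg (srg 13 i \<sigma>) 13 \<le> 2 ^ \<Lambda>" using iW p by simp
    qed (use key iW t0 False W_ge in \<open>simp_all\<close>)
    then show ?thesis unfolding cap_com_def ok_If tst using False t iW W_ge by (simp add: vcg i_def)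
  qed
qed

text \<open>\<open>M\<close> reserves list cells and \<open>K\<close> reserves time for the rest of
  the search. The 60 credits of an out-edge include the 25 with which the inserted entry pays for
  its later removal; binary searches are paid for by the edges in \<open>D1\<close> and
  \<open>D3\<close>.\<close>

lemma okk_relax:
  assumes g: "good lo hi" and tb: "tabl lo hi S r p Tf" and ad: "adj \<sigma>" and p: "p \<le> m" "p + 1 \<le> 2 ^ \<Lambda>"
    and e: "ar \<sigma> 4 = lo" "ar \<sigma> 5 = hi" "ar \<sigma> 13 = Tf" "rg \<sigma> 8 = v" "rg \<sigma> 16 = i" "rg \<sigma> 9 = prv T (Suc m) v"
    and v: "v \<in> cc lo r" "v < n" "ar \<sigma> 15 v = i" and i: "1 \<le> i" "i \<le> p"
    and d: "djk lo r p Tf {c \<in> {1..m}. T c = v} i (ar \<sigma> 15) \<ll>" and b: "bkt \<sigma> \<ll>"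
    and np: "rg \<sigma> 15 + card {c \<in> {1..m}. T c = v} + M \<le> n + m"
    and t: "25 * total_len p \<ll> + 60 * card {c \<in> {1..m}. T c = v} + (10 * \<Lambda> + 20) * card {c \<in> D1 S lo hi \<union> D3 S lo hi. T c = v} + 5 + K \<le> t"
    and Q: "\<And>\<sigma>' \<ll>' u. frame {9, 10, 12, 13, 14, 15, 21} {16, 17, 18} \<sigma> \<sigma>' \<Longrightarrow>
       djk lo r p Tf {} i (ar \<sigma> 15) \<ll>' \<Longrightarrow> bkt \<sigma>' \<ll>' \<Longrightarrow> rg \<sigma>' 15 + M \<le> n + m \<Longrightarrow>
       25 * total_len p \<ll>' + K \<le> u \<Longrightarrow> Q \<sigma>' u"
  shows "okk relax_scan \<sigma> t Q"
proof -
  define X where "X f = {c. 1 \<le> c \<and> c \<le> f \<and> T c = v}" for f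
  define DD where "DD = D1 S lo hi \<union> D3 S lo hi"
  define fin where "fin = ar \<sigma> 15"
  have fX: "finite (X f)" for f by (rule finite_subset[of _ "{..f}"]) (auto simp: X_def)
  have X0: "X (prv T (Suc m) v) = {c \<in> {1..m}. T c = v}" using prv_top[of T v] by (simp add: X_def)
  have DDm: "DD \<subseteq> {1..m}" by (auto simp: DD_def D1_def D3_def alive_def)
  have XD: "card (X (prv T (Suc m) v) \<inter> DD) = card {c \<in> DD. T c = v}"
    unfolding X0 using DDm by (intro arg_cong[where f = card]) blast
  define Inv where "Inv = (\<lambda>\<sigma>' u. frame {9, 10, 12, 13, 14, 15, 21} {16, 17, 18} \<sigma> \<sigma>' \<and> rg \<sigma>' 9 \<le> m \<and> (rg \<sigma>' 9 = 0 \<or> T (rg \<sigma>' 9) = v) \<and>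
     rg \<sigma>' 15 + card (X (rg \<sigma>' 9)) + M \<le> n + m \<and>
     (\<exists>\<ll>. djk lo r p Tf (X (rg \<sigma>' 9)) i fin \<ll> \<and> bkt \<sigma>' \<ll> \<and>
        25 * total_len p \<ll> + 60 * card (X (rg \<sigma>' 9)) + (10 * \<Lambda> + 20) * card (X (rg \<sigma>' 9) \<inter> DD) + 2 + K \<le> u))"
  show ?thesis unfolding relax_scan_def
  proof (rule okk_While[where Inv = Inv])
    show "Inv \<sigma> t"
      unfolding Inv_def e(6) XD unfolding X0
      using d b np t prv_le[of T "Suc m" v] prv_valid[of T "Suc m" v] by (auto simp: fin_def DD_def intro!: exI[of _ \<ll>])
  next
    fix \<sigma>' u assume inv: "Inv \<sigma>' u" and bt: "te \<sigma>' (Leq (N 1) (V 9))"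
    define c where "c = rg \<sigma>' 9"
    have fr: "frame {9, 10, 12, 13, 14, 15, 21} {16, 17, 18} \<sigma> \<sigma>'" and nb: "rg \<sigma>' 15 + card (X c) + M \<le> n + m" using inv by (auto simp: Inv_def c_def)
    obtain \<ll> where L: "djk lo r p Tf (X c) i fin \<ll>" "bkt \<sigma>' \<ll>"
       "25 * total_len p \<ll> + 60 * card (X c) + (10 * \<Lambda> + 20) * card (X c \<inter> DD) + 2 + K \<le> u"
      using inv by (auto simp: Inv_def c_def)
    have c: "1 \<le> c" "c \<le> m" "T c = v" using inv bt by (auto simp: Inv_def vcg c_def)
    have cm: "c \<in> {1..m}" using c by simp
    have e': "rg \<sigma>' 8 = v" "ar \<sigma>' 4 = lo" "ar \<sigma>' 5 = hi" "ar \<sigma>' 1 = ar \<sigma> 1" "ar \<sigma>' 13 = Tf" "ar \<sigma>' 15 = fin" "rg \<sigma>' 16 = i"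
      using fr e by (simp_all add: frame_def fin_def)
    have Hn: "H c < n" "c \<le> W" "v \<le> W" using edge_lt[OF cm] c W_ge v by auto
    have nx: "ar \<sigma> 1 c = prv T c v" using ad cm c by (auto simp: adj_def)
    have Xs: "X c - {c} = X (prv T c v)" using prv_step[of c T v] c by (simp add: X_def)
    have cXc: "c \<in> X c" using c by (simp add: X_def)
    then have cX: "card (X c) = card (X (prv T c v)) + 1"
      using fX[of c] Xs card_Suc_Diff1[of "X c" c] by simp
    have "X c \<inter> DD = (if c \<in> DD then insert c (X (prv T c v) \<inter> DD) else X (prv T c v) \<inter> DD)" using Xs cXc by auto
    moreover have "c \<notin> X (prv T c v)" using Xs by blast
    ultimately have cD: "card (X c \<inter> DD) = (if c \<in> DD then 1 else 0) + card (X (prv T c v) \<inter> DD)" using fX by simp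
    have al: "alive lo c \<longleftrightarrow> lo (H c) = lo v \<and> rk (lo v) < rk c"
      using c cm by (auto simp: alive_def)
    have codes: "lo x \<le> Suc m" for x using goodD(1)[OF g] .
    note pv = prv_le[of T c v] prv_valid[of T c v]
    define \<tau> where "\<tau> = srg 9 (prv T c v) (srg 14 c (srg 10 (H c) \<sigma>'))"
    have tau: "rg \<tau> 10 = H c" "rg \<tau> 9 = prv T c v" "rg \<tau> 14 = c" "rg \<tau> 8 = v" "rg \<tau> 15 = rg \<sigma>' 15" "rg \<tau> 16 = i" "ar \<tau> = ar \<sigma>'"
      using e' by (simp_all add: \<tau>_def)
    have frt: "frame {9, 10, 12, 13, 14, 15, 21} {16, 17, 18} \<sigma> \<tau>" using fr by (simp add: \<tau>_def)
    have bt: "bkt \<tau> \<ll>" using L(2) bkt_frame[of \<tau> \<sigma>'] tau by simp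
    have skip: "Inv \<tau> x" if "alive lo c \<Longrightarrow> fin (H c) \<noteq> 0" "25 * total_len p \<ll> + 60 * card (X (prv T c v)) + (10 * \<Lambda> + 20) * card (X (prv T c v) \<inter> DD) + 2 + K \<le> x" for x
    proof -
      have "djk lo r p Tf (X (prv T c v)) i fin \<ll>" using djk_edge_skip[OF g tb L(1) that(1)] Xs by simp
      then show ?thesis unfolding Inv_def tau using frt pv nb cX that(2) bt by auto
    qed
    have ins: "okk (cap_com ;; insert_com) \<tau> x Inv"
      if a: "alive lo c" "fin (H c) = 0" and x: "(if c \<in> DD then 1 else 0) * (10 * \<Lambda> + 20) + 20 + 25 * (total_len p \<ll> + 1) + 60 * card (X (prv T c v)) + (10 * \<Lambda> + 20) * card (X (prv T c v) \<inter> DD) + 2 + K \<le> x" for x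
    proof -
      have fv: "fin (T c) = i" "T c \<in> cc lo r" using v c by (simp_all add: fin_def)
      have lov: "lo v = lo r" using cc_lo[OF v(1)] .
      \<comment> \<open>By \<open>djk_located\<close>, the comparison that triggers a binary search
        fails only for edges in \<open>DD\<close>, whose credits are released in this round.\<close>
      have dd: "(if rk (Tf i) \<le> rk c then 0 else 1) \<le> (if c \<in> DD then 1 else (0::nat))"
        using djk_located[OF g tb L(1) i(1) a(1) fv(2,1) a(2)] by (auto simp: DD_def not_le)
      then have dd2: "(if rk (Tf i) \<le> rk c then 0 else 1) * (10 * \<Lambda> + 20) \<le> (if c \<in> DD then 1 else 0) * (10 * \<Lambda> + 20)"
        by (rule mult_right_mono) simp
      have "okk cap_com \<tau> (x - 1) (\<lambda>\<sigma>' t'. okk insert_com \<sigma>' t' Inv)"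
      proof (rule okk_cap[where \<Lambda> = \<Lambda> and S = S and r = r and p = p])
        show "good (ar \<tau> 4) (ar \<tau> 5)" "tabl (ar \<tau> 4) (ar \<tau> 5) S r p (ar \<tau> 13)" using g tb tau e' by simp_all
        show "rk (ar \<tau> 4 r) \<le> rk (rg \<tau> 14)" using al a(1) lov tau e' by simp
        show "(if rk (ar \<tau> 13 (rg \<tau> 16)) \<le> rk (rg \<tau> 14) then 0 else 1) * (10 * \<Lambda> + 20) + 5 \<le> x - 1"
          unfolding tau e' using dd2 x by linarith
        fix \<rho> y assume f: "frame {12, 13, 21} {} \<tau> \<rho>" and r12: "rg \<rho> 12 = min (rg \<tau> 16) (ix p (ar \<tau> 13) (rk (rg \<tau> 14)))"
          and y: "x - 1 - ((if rk (ar \<tau> 13 (rg \<tau> 16)) \<le> rk (rg \<tau> 14) then 0 else 1) * (10 * \<Lambda> + 20) + 5) \<le> y"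
        define gg where "gg = min i (ix p Tf (rk c))"
        have r12': "rg \<rho> 12 = gg" using r12 unfolding tau e' gg_def .
        have y': "7 + 25 * (total_len p \<ll> + 1) + 60 * card (X (prv T c v)) + (10 * \<Lambda> + 20) * card (X (prv T c v) \<inter> DD) + 2 + K \<le> y"
          using y x dd2 unfolding tau e' by linarith
        have rho: "rg \<rho> 9 = prv T c v" "rg \<rho> 14 = c" "rg \<rho> 15 = rg \<sigma>' 15"
          using f tau by (simp_all add: frame_def)
        have "bkt \<rho> \<ll>" using bt f bkt_frame[of \<rho> \<tau>] by (simp add: frame_def)
        from bkt_inserted[OF this] have Bk: "bkt (inserted \<rho>) (\<ll>(gg := c # \<ll> gg))" by (simp add: r12' rho)
        have TL: "total_len p (\<ll>(gg := c # \<ll> gg)) \<le> total_len p \<ll> + 1" by (rule total_len_insert)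
        have Dj: "djk lo r p Tf (X (prv T c v)) i fin (\<ll>(gg := c # \<ll> gg))"
          using djk_relax[OF g tb L(1) i(1) a(1) fv(2,1) a(2) gg_def] Xs by simp
        have F: "frame {9, 10, 12, 13, 14, 15, 21} {16, 17, 18} \<sigma> (inserted \<rho>)"
          using frame_trans[OF frt frame_mono[OF f]] by (simp add: frame_inserted)
        have pot: "25 * total_len p (\<ll>(gg := c # \<ll> gg)) + 60 * card (X (prv T c v)) + (10 * \<Lambda> + 20) * card (X (prv T c v) \<inter> DD) + 2 + K \<le> y - 7"
        proof (rule add_le_imp_le_diff)
          have "25 * total_len p (\<ll>(gg := c # \<ll> gg)) + 60 * card (X (prv T c v)) + (10 * \<Lambda> + 20) * card (X (prv T c v) \<inter> DD) + 2 + K + 7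
            \<le> 25 * (total_len p \<ll> + 1) + 60 * card (X (prv T c v)) + (10 * \<Lambda> + 20) * card (X (prv T c v) \<inter> DD) + 2 + K + 7"
            by (intro add_mono mult_le_mono TL order_refl)
          also have "\<dots> \<le> y" using y' by (simp only: ac_simps)
          finally show "25 * total_len p (\<ll>(gg := c # \<ll> gg)) + 60 * card (X (prv T c v)) + (10 * \<Lambda> + 20) * card (X (prv T c v) \<inter> DD) + 2 + K + 7 \<le> y" .
        qed
        have r9: "rg (inserted \<rho>) 9 = prv T c v" "rg (inserted \<rho>) 15 = rg \<sigma>' 15 + 1" by (simp_all add: rg_inserted rho)
        have "Inv (inserted \<rho>) (y - 7)"
          unfolding Inv_def r9 using F Bk Dj pot pv nb cX by auto
        moreover have "rg \<sigma>' 15 < n + m" using nb cX by linarith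
        ultimately show "okk insert_com \<rho> y Inv"
          using y' rho p W_ge r12' i by (intro okk_insert') (auto simp: gg_def W_def)
      qed (use p tau i c in auto)
      then show ?thesis using x by (simp add: ok_Seq)
    qed
    have tst: "te \<tau> (Conj (eq_test (arr 4 (V 10)) (arr 4 (V 8)))
            (Conj (wlt_test (arr 4 (V 8)) (V 14)) (eq_test (arr 15 (V 10)) (N 0)))) \<longleftrightarrow> alive lo c \<and> fin (H c) = 0"
      using Hn W_ge codes c unfolding al by (simp add: vcg tau e')
    have up: "60 + (if c \<in> DD then 1 else 0) * (10 * \<Lambda> + 20) + 25 * total_len p \<ll> + 60 * card (X (prv T c v)) + (10 * \<Lambda> + 20) * card (X (prv T c v) \<inter> DD) + 2 + K \<le> u"
      using L(3) unfolding cX cD by (simp add: algebra_simps split: if_splits)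
    have body: "okk (If (Conj (eq_test (arr 4 (V 10)) (arr 4 (V 8)))
            (Conj (wlt_test (arr 4 (V 8)) (V 14)) (eq_test (arr 15 (V 10)) (N 0))))
        (cap_com ;; insert_com) Skip) \<tau> (u - 9) Inv"
    proof (cases "alive lo c \<and> fin (H c) = 0")
      case True
      have "okk (cap_com ;; insert_com) \<tau> (u - 10) Inv" by (rule ins) (use True up in \<open>auto split: if_splits\<close>)
      then show ?thesis unfolding ok_If tst using True up by (simp add: le_diff_pos)
    next
      case False
      have "Inv \<tau> (u - 10)" by (rule skip) (use False up in \<open>auto split: if_splits\<close>)
      moreover have "1 \<le> u - 9" using up by (simp add: le_diff_pos)
      ultimately show ?thesis unfolding ok_If tst using False by (simp add: if_not_P[OF False])
    qed
    show "3 \<le> u \<and> okk (10 ::= hd_exp (V 9) ;; 14 ::= V 9 ;; 9 ::= arr 1 (V 9) ;;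
      If (Conj (eq_test (arr 4 (V 10)) (arr 4 (V 8)))
            (Conj (wlt_test (arr 4 (V 8)) (V 14)) (eq_test (arr 15 (V 10)) (N 0))))
        (cap_com ;; insert_com) Skip) \<sigma>' (u - 3) Inv"
      using body up c Hn W_ge nx e'
      by (simp add: ok_Seq[of _ _ "_ ::= _"] okk_Assign evs le_diff_pos c_def[symmetric] \<tau>_def[symmetric])
  next
    fix \<sigma>' u assume inv: "Inv \<sigma>' u" and bt: "\<not> te \<sigma>' (Leq (N 1) (V 9))"
    then have "rg \<sigma>' 9 = 0" by (simp add: vcg)
    then have X: "X (rg \<sigma>' 9) = {}" by (auto simp: X_def)
    obtain \<ll> where L: "djk lo r p Tf {} i fin \<ll>" "bkt \<sigma>' \<ll>" "25 * total_len p \<ll> + 2 + K \<le> u"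
      using inv unfolding Inv_def X by auto
    show "2 \<le> u \<and> Q \<sigma>' (u - 2)" using inv L Q[of \<sigma>' \<ll> "u - 2"] unfolding Inv_def X fin_def by auto
  qed
qed

text \<open>Amortized: 12 credits for leaving a bucket, 25 for removing an entry, and for each
  vertex a share spent once, when it is settled. Since the out-edges of a vertex are relaxed only
  then, at most \<open>n + m\<close> list cells are allocated. The buckets from 1 on end up empty,
  ready for the next component.\<close>

lemma okk_settle:
  assumes g: "good (ar \<sigma> 4) (ar \<sigma> 5)" and tb: "tabl (ar \<sigma> 4) (ar \<sigma> 5) S r (rg \<sigma> 7) (ar \<sigma> 13)" and ad: "adj \<sigma>" and p: "rg \<sigma> 7 \<le> m" "rg \<sigma> 7 + 1 \<le> 2 ^ \<Lambda>"
    and r: "r < n" and d: "djk (ar \<sigma> 4) r (rg \<sigma> 7) (ar \<sigma> 13) {} (rg \<sigma> 7) (ar \<sigma> 15) \<ll>" and b: "bkt \<sigma> \<ll>"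
    and z: "\<And>v. v \<in> cc (ar \<sigma> 4) r \<Longrightarrow> ar \<sigma> 15 v = 0"
    and np: "total_len (rg \<sigma> 7) \<ll> \<le> c" "rg \<sigma> 15 \<le> c" "c \<le> n"
    and t: "12 * rg \<sigma> 7 + 25 * c + (\<Sum>v\<in>cc (ar \<sigma> 4) r. 20 + 60 * card {c \<in> {1..m}. T c = v} +
        (10 * \<Lambda> + 20) * card {c \<in> D1 S (ar \<sigma> 4) (ar \<sigma> 5) \<union> D3 S (ar \<sigma> 4) (ar \<sigma> 5). T c = v}) + 5 + K \<le> t"
    and Q: "\<And>\<sigma>' u. frame {8, 9, 10, 12, 13, 14, 15, 16, 21, 23} {15, 16, 17, 18} \<sigma> \<sigma>' \<Longrightarrow>
       (\<And>v. v \<in> cc (ar \<sigma> 4) r \<Longrightarrow> ar \<sigma>' 15 v = ix (rg \<sigma> 7) (ar \<sigma> 13) (B v)) \<Longrightarrow> (\<And>j. 1 \<le> j \<Longrightarrow> ar \<sigma>' 16 j = 0) \<Longrightarrow> K \<le> u \<Longrightarrow> Q \<sigma>' u"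
  shows "okk settle_com \<sigma> t Q"
proof -
  define lo hi Tf p where "lo = ar \<sigma> 4" and "hi = ar \<sigma> 5" and "Tf = ar \<sigma> 13" and "p = rg \<sigma> 7"
  note g' = g[folded lo_def hi_def] and tb' = tb[folded lo_def hi_def Tf_def p_def]
  define C where "C = cc lo r"
  define DD where "DD = D1 S lo hi \<union> D3 S lo hi"
  define wt where "wt v = 20 + 60 * card {c \<in> {1..m}. T c = v} + (10 * \<Lambda> + 20) * card {c \<in> DD. T c = v}" for v
  have fC: "finite C" by (simp add: C_def)
  define U where "U \<sigma>' = {v \<in> C. ar \<sigma>' 15 v = 0}" for \<sigma>'
  have fU: "finite (U \<sigma>')" for \<sigma>' using fC by (simp add: U_def)
  have outm: "(\<Sum>v\<in>A. card {c \<in> {1..m}. T c = v}) \<le> m" if "finite A" for A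
  proof -
    have "(\<Sum>v\<in>A. card {c \<in> {1..m}. T c = v}) = card (\<Union>v\<in>A. {c \<in> {1..m}. T c = v})"
      using that by (intro card_UN_disjoint[symmetric]) auto
    also have "\<dots> \<le> card {1..m}" by (intro card_mono) auto
    finally show ?thesis by simp
  qed
  define Inv where "Inv = (\<lambda>\<sigma>' u. frame {8, 9, 10, 12, 13, 14, 15, 16, 21, 23} {15, 16, 17, 18} \<sigma> \<sigma>' \<and>
     rg \<sigma>' 15 + (\<Sum>v\<in>U \<sigma>'. card {c \<in> {1..m}. T c = v}) \<le> n + m \<and>
     (\<exists>\<ll>. djk lo r p Tf {} (rg \<sigma>' 16) (ar \<sigma>' 15) \<ll> \<and> bkt \<sigma>' \<ll> \<and>
        12 * rg \<sigma>' 16 + 25 * total_len p \<ll> + (\<Sum>v\<in>U \<sigma>'. wt v) + 2 + K \<le> u))"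
  have "okk (While (Leq (N 1) (V 16))
     (If (Leq (arr 16 (V 16)) (N 0)) (16 ::= Monus (V 16) (N 1))
       (23 ::= arr 16 (V 16) ;; put 16 (V 16) (arr 17 (V 23)) ;; 8 ::= hd_exp (arr 18 (V 23)) ;;
        If (Leq (arr 15 (V 8)) (N 0))
          (put 15 (V 8) (V 16) ;; 9 ::= arr 0 (V 8) ;; relax_scan) Skip))) (srg 16 p \<sigma>) (t - 2) Q"
  proof (rule okk_While[where Inv = Inv])
    have U0: "U (srg 16 p \<sigma>) = C" using z by (auto simp: U_def C_def lo_def)
    have "total_len p \<ll> \<le> c" using np by (simp add: p_def)
    then have "12 * p + 25 * total_len p \<ll> + (\<Sum>v\<in>C. wt v) + 2 + K \<le> t - 2"
      using t unfolding p_def[symmetric] lo_def[symmetric] hi_def[symmetric] C_def[symmetric] DD_def[symmetric] wt_def[symmetric] by linarith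
    moreover have "bkt (srg 16 p \<sigma>) \<ll>" using b bkt_frame[of "srg 16 p \<sigma>" \<sigma>] by simp
    ultimately show "Inv (srg 16 p \<sigma>) (t - 2)"
      unfolding Inv_def U0 using d np outm[OF fC] by (auto simp: lo_def p_def Tf_def intro!: exI[of _ \<ll>])
  next
    fix \<sigma>' u assume inv: "Inv \<sigma>' u" and bt: "te \<sigma>' (Leq (N 1) (V 16))"
    define i where "i = rg \<sigma>' 16"
    have fr: "frame {8, 9, 10, 12, 13, 14, 15, 16, 21, 23} {15, 16, 17, 18} \<sigma> \<sigma>'"
      and nb: "rg \<sigma>' 15 + (\<Sum>v\<in>U \<sigma>'. card {c \<in> {1..m}. T c = v}) \<le> n + m" using inv by (auto simp: Inv_def)
    obtain \<ll> where L: "djk lo r p Tf {} i (ar \<sigma>' 15) \<ll>" "bkt \<sigma>' \<ll>"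
       "12 * i + 25 * total_len p \<ll> + (\<Sum>v\<in>U \<sigma>'. wt v) + 2 + K \<le> u"
      using inv by (auto simp: Inv_def i_def)
    note D = djkD[OF g' tb' L(1)]
    have i1: "1 \<le> i" using bt by (simp add: vcg i_def)
    have iW: "i \<le> W" using D(1) p W_ge by (simp add: p_def)
    have e: "ar \<sigma>' 4 = lo" "ar \<sigma>' 5 = hi" "ar \<sigma>' 13 = Tf" "ar \<sigma>' 0 = ar \<sigma> 0" "ar \<sigma>' 1 = ar \<sigma> 1" "ar \<sigma>' 2 = ar \<sigma> 2" "ar \<sigma>' 3 = ar \<sigma> 3"
      using fr by (simp_all add: frame_def lo_def hi_def Tf_def)
    have ch: "chn (ar \<sigma>' 17) (ar \<sigma>' 18) (rg \<sigma>' 15) (ar \<sigma>' 16 i) (\<ll> i)" using L(2) i1 by (simp add: bkt_def)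
    show "3 \<le> u \<and> okk (If (Leq (arr 16 (V 16)) (N 0)) (16 ::= Monus (V 16) (N 1))
       (23 ::= arr 16 (V 16) ;; put 16 (V 16) (arr 17 (V 23)) ;; 8 ::= hd_exp (arr 18 (V 23)) ;;
        If (Leq (arr 15 (V 8)) (N 0))
          (put 15 (V 8) (V 16) ;; 9 ::= arr 0 (V 8) ;; relax_scan) Skip)) \<sigma>' (u - 3) Inv"
    proof (cases "\<ll> i")
      case Nil
      then have z16: "ar \<sigma>' 16 i = 0" using ch by simp
      have "djk lo r p Tf {} (i - 1) (ar \<sigma>' 15) \<ll>" by (rule djk_dec[OF g' tb' L(1) i1 Nil])
      moreover have "bkt (srg 16 (i - 1) \<sigma>') \<ll>" using L(2) bkt_frame[of "srg 16 (i - 1) \<sigma>'" \<sigma>'] by simp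
      moreover have "12 * i = 12 * (i - 1) + 12" using i1 by simp
      ultimately have "Inv (srg 16 (i - 1) \<sigma>') (u - 5)"
        unfolding Inv_def using fr nb L(3) by (auto simp: U_def intro!: exI[of _ \<ll>])
      then show ?thesis using L(3) i1 z16 iW W_ge by (simp add: vcg i_def[symmetric])
    next
      case (Cons x cs)
      define q where "q = ar \<sigma>' 16 i"
      have q: "1 \<le> q" "q \<le> rg \<sigma>' 15" "ar \<sigma>' 18 q = x" "chn (ar \<sigma>' 17) (ar \<sigma>' 18) (rg \<sigma>' 15) (ar \<sigma>' 17 q) cs"
        using ch by (simp_all add: Cons q_def)
      have xs: "x \<in> {1..m}" "H x \<in> cc lo r" using D(6)[OF i1, of x] by (simp_all add: Cons)
      define v where "v = H x"
      have vC: "v \<in> C" "v < n" using xs cc_lt[OF r] by (auto simp: v_def C_def)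
      have qW: "q \<le> 2 * W" using q nb by (simp add: W_def)
      have ip: "i \<in> {1..p}" using i1 D(1) by simp
      have tl: "total_len p \<ll> = total_len p (\<ll>(i := cs)) + 1" by (rule total_len_pop[of i p \<ll> x cs, OF ip Cons])
      define \<tau> where "\<tau> = srg 8 v (sar 16 i (ar \<sigma>' 17 q) (srg 23 q \<sigma>'))"
      have tau: "rg \<tau> 16 = i" "rg \<tau> 8 = v" "rg \<tau> 15 = rg \<sigma>' 15" "ar \<tau> 15 = ar \<sigma>' 15" "ar \<tau> 4 = lo" "ar \<tau> 5 = hi" "ar \<tau> 13 = Tf" "ar \<tau> 0 = ar \<sigma> 0"
         "ar \<tau> 1 = ar \<sigma> 1" "ar \<tau> 2 = ar \<sigma> 2" "ar \<tau> 3 = ar \<sigma> 3"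
        using e by (simp_all add: \<tau>_def ar_sar i_def)
      have frt: "frame {8, 9, 10, 12, 13, 14, 15, 16, 21, 23} {15, 16, 17, 18} \<sigma> \<tau>" using fr by (simp add: \<tau>_def)
      have bt: "bkt \<tau> (\<ll>(i := cs))"
        unfolding bkt_def
      proof (intro allI impI)
        fix j :: nat assume j: "1 \<le> j"
        show "chn (ar \<tau> 17) (ar \<tau> 18) (rg \<tau> 15) (ar \<tau> 16 j) ((\<ll>(i := cs)) j)"
          using L(2) j q by (cases "j = i") (simp_all add: bkt_def \<tau>_def ar_sar)
      qed
      have up: "25 + (12 * i + 25 * total_len p (\<ll>(i := cs)) + (\<Sum>v\<in>U \<sigma>'. wt v) + 2 + K) \<le> u" using L(3) tl by simp
      have body: "okk (If (Leq (arr 15 (V 8)) (N 0)) (put 15 (V 8) (V 16) ;; 9 ::= arr 0 (V 8) ;; relax_scan) Skip) \<tau> (u - 10) Inv"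
      proof (cases "ar \<sigma>' 15 v = 0")
        case False
        have "djk lo r p Tf {} i (ar \<sigma>' 15) (\<ll>(i := cs))" by (rule djk_skip[OF g' tb' L(1) i1 Cons]) (use False in \<open>simp add: v_def\<close>)
        then have "Inv \<tau> (u - 11)"
          unfolding Inv_def using frt bt nb up by (auto simp: tau U_def intro!: exI[of _ "\<ll>(i := cs)"])
        then show ?thesis using False up vC W_ge by (simp add: vcg tau)
      next
        case True
        note DS = djk_settle[OF g' tb' L(1) i1 Cons True[unfolded v_def], folded v_def]
        define \<rho> where "\<rho> = srg 9 (prv T (Suc m) v) (sar 15 v i \<tau>)"
        have rho: "ar \<rho> 4 = lo" "ar \<rho> 5 = hi" "ar \<rho> 13 = Tf" "rg \<rho> 8 = v" "rg \<rho> 16 = i" "rg \<rho> 9 = prv T (Suc m) v" "ar \<rho> 15 = (ar \<sigma>' 15)(v := i)"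
          "rg \<rho> 15 = rg \<sigma>' 15" "ar \<rho> 0 = ar \<sigma> 0" "ar \<rho> 1 = ar \<sigma> 1" "ar \<rho> 2 = ar \<sigma> 2" "ar \<rho> 3 = ar \<sigma> 3"
          by (simp_all add: \<rho>_def tau ar_sar)
        have frr: "frame {8, 9, 10, 12, 13, 14, 15, 16, 21, 23} {15, 16, 17, 18} \<sigma> \<rho>" using frt by (simp add: \<rho>_def)
        have bR: "bkt \<rho> (\<ll>(i := cs))" using bt bkt_frame[of \<rho> \<tau>] by (simp add: \<rho>_def ar_sar)
        have vU: "v \<in> U \<sigma>'" using vC True by (simp add: U_def)
        define U' where "U' = U \<sigma>' - {v}"
        have s1: "(\<Sum>v\<in>U \<sigma>'. wt v) = wt v + (\<Sum>v\<in>U'. wt v)" unfolding U'_def by (rule sum.remove[OF fU vU])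
        have s2: "(\<Sum>v\<in>U \<sigma>'. card {c \<in> {1..m}. T c = v}) = card {c \<in> {1..m}. T c = v} + (\<Sum>v\<in>U'. card {c \<in> {1..m}. T c = v})"
          unfolding U'_def by (rule sum.remove[OF fU vU])
        have rl: "okk relax_scan \<rho> y Inv"
          if y: "25 * total_len p (\<ll>(i := cs)) + 60 * card {c \<in> {1..m}. T c = v} + (10 * \<Lambda> + 20) * card {c \<in> DD. T c = v} + 5 + (12 * i + (\<Sum>v\<in>U'. wt v) + 2 + K) \<le> y" for y
        proof (rule okk_relax[OF g' tb' _ p[folded p_def] rho(1-6) _ _ _ i1 D(1) _ bR _ y[unfolded DD_def]])
          show "adj \<rho>" using ad by (simp add: adj_def rho)
          show "v \<in> cc lo r" "v < n" using vC by (simp_all add: C_def)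
          show "ar \<rho> 15 v = i" by (simp add: rho)
          show "djk lo r p Tf {c \<in> {1..m}. T c = v} i (ar \<rho> 15) (\<ll>(i := cs))" using DS(1) by (simp add: rho)
          show "rg \<rho> 15 + card {c \<in> {1..m}. T c = v} + (\<Sum>v\<in>U'. card {c \<in> {1..m}. T c = v}) \<le> n + m" using nb s2 rho by simp
          fix \<sigma>2 \<ll>' w' assume f: "frame {9, 10, 12, 13, 14, 15, 21} {16, 17, 18} \<rho> \<sigma>2" and dj: "djk lo r p Tf {} i (ar \<rho> 15) \<ll>'"
            and bk: "bkt \<sigma>2 \<ll>'" and nb': "rg \<sigma>2 15 + (\<Sum>v\<in>U'. card {c \<in> {1..m}. T c = v}) \<le> n + m"
            and w': "25 * total_len p \<ll>' + (12 * i + (\<Sum>v\<in>U'. wt v) + 2 + K) \<le> w'"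
          have "frame {8, 9, 10, 12, 13, 14, 15, 16, 21, 23} {15, 16, 17, 18} \<sigma> \<sigma>2"
            using frame_trans[OF frr frame_mono[OF f]] by simp
          moreover have r2: "ar \<sigma>2 15 = ar \<rho> 15" "rg \<sigma>2 16 = i" using f rho by (simp_all add: frame_def)
          moreover have "U \<sigma>2 = U'" using i1 by (auto simp: U_def U'_def r2 rho)
          ultimately show "Inv \<sigma>2 w'" unfolding Inv_def using dj bk nb' w' by (auto intro!: exI[of _ \<ll>'])
        qed
        have "okk relax_scan \<rho> (u - 15) Inv" by (rule rl) (use up s1 in \<open>simp add: wt_def\<close>)
        moreover have "ar \<sigma> 0 v = prv T (Suc m) v" using ad vC by (simp add: adj_def)
        ultimately show ?thesis using True up vC W_ge iW
          by (simp add: ok_If te_Leq ok_Seq[of _ _ "_ ::= _"] ok_Seq[of _ _ "put _ _ _"] okk_Assign okk_put evs tau ar_sar le_diff_pos \<rho>_def[symmetric])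
      qed
      have "te \<sigma>' (Leq (arr 16 (V 16)) (N 0)) \<longleftrightarrow> False" using q(1) iW W_ge by (simp add: vcg i_def[symmetric] q_def[symmetric])
      then show ?thesis using body up q qW iW xs W_ge
        by (simp add: ok_If[of _ _ "Leq (arr 16 (V 16)) (N 0)"] ok_Seq[of _ _ "_ ::= _"] ok_Seq[of _ _ "put _ _ _"] okk_Assign okk_put evs ar_sar le_diff_pos
            i_def[symmetric] q_def[symmetric] v_def[symmetric] \<tau>_def[symmetric])
    qed
  next
    fix \<sigma>' u assume inv: "Inv \<sigma>' u" and bt: "\<not> te \<sigma>' (Leq (N 1) (V 16))"
    have i0: "rg \<sigma>' 16 = 0" using bt by (simp add: vcg)
    have fr: "frame {8, 9, 10, 12, 13, 14, 15, 16, 21, 23} {15, 16, 17, 18} \<sigma> \<sigma>'" using inv by (simp add: Inv_def)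
    obtain \<ll> where L: "djk lo r p Tf {} 0 (ar \<sigma>' 15) \<ll>" "bkt \<sigma>' \<ll>" "2 + K \<le> u"
      using inv by (auto simp: Inv_def i0)
    have 1: "ar \<sigma>' 15 v = ix p Tf (B v)" if "v \<in> cc lo r" for v by (rule djk_done[OF g' tb' L(1) that])
    have 2: "ar \<sigma>' 16 j = 0" if "1 \<le> j" for j
    proof -
      have "\<ll> j = []" using djkD(6)[OF g' tb' L(1) that] that by (cases "\<ll> j") fastforce+
      then show ?thesis using L(2) that by (auto simp: bkt_def)
    qed
    show "2 \<le> u \<and> Q \<sigma>' (u - 2)"
      using Q[OF fr, of "u - 2"] 1 2 L(3) by (simp add: lo_def Tf_def p_def)
  qed
  then show ?thesis using t by (simp add: settle_com_def vcg p_def)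
qed

end

section \<open>The cost of a component, and the sweep over all components\<close>

section \<open>One level\<close>

context inst
begin

lemma okk_write:
  assumes o: "distinct (ord \<sigma>)" "set (ord \<sigma>) = C" "C \<subseteq> {..<n}" and p: "p \<le> m" "\<And>v. v \<in> C \<Longrightarrow> ar \<sigma> 15 v \<le> p"
    and t: "12 * rg \<sigma> 6 + 10 \<le> t"
    and Q: "\<And>\<sigma>' u. frame {8, 11} {6, 7} \<sigma> \<sigma>' \<Longrightarrow> ar \<sigma>' 6 = (\<lambda>v. if v \<in> C then ar \<sigma> 13 (ar \<sigma> 15 v) else ar \<sigma> 6 v) \<Longrightarrow>
       ar \<sigma>' 7 = (\<lambda>v. if v \<in> C then ar \<sigma> 13 (ar \<sigma> 15 v + 1) else ar \<sigma> 7 v) \<Longrightarrow> t - (12 * rg \<sigma> 6 + 10) \<le> u \<Longrightarrow> Q \<sigma>' u"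
  shows "okk write_com \<sigma> t Q"
proof -
  define c where "c = rg \<sigma> 6"
  have len: "length (ord \<sigma>) = c" by (simp add: ord_def c_def)
  have nth: "ord \<sigma> ! k = ar \<sigma> 10 k" if "k < c" for k using that by (simp add: ord_def c_def)
  have cn: "c \<le> n"
    using card_mono[OF _ o(3)] distinct_card[OF o(1)] o(2) len by simp
  define Inv where "Inv = (\<lambda>\<sigma>' u. frame {8, 11} {6, 7} \<sigma> \<sigma>' \<and> rg \<sigma>' 11 \<le> c \<and>
     ar \<sigma>' 6 = (\<lambda>v. if v \<in> set (take (rg \<sigma>' 11) (ord \<sigma>)) then ar \<sigma> 13 (ar \<sigma> 15 v) else ar \<sigma> 6 v) \<and>
     ar \<sigma>' 7 = (\<lambda>v. if v \<in> set (take (rg \<sigma>' 11) (ord \<sigma>)) then ar \<sigma> 13 (ar \<sigma> 15 v + 1) else ar \<sigma> 7 v) \<and>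
     12 * (c - rg \<sigma>' 11) + 2 + (t - (12 * c + 10)) \<le> u)"
  have "okk (While (lt_test (V 11) (V 6))
     (8 ::= arr 10 (V 11) ;; put 6 (V 8) (arr 13 (arr 15 (V 8))) ;;
      put 7 (V 8) (arr 13 (Plus (arr 15 (V 8)) (N 1))) ;; 11 ::= Plus (V 11) (N 1))) (srg 11 0 \<sigma>) (t - 2) Q"
  proof (rule okk_While[where Inv = Inv])
    show "Inv (srg 11 0 \<sigma>) (t - 2)" using t by (simp add: Inv_def c_def) linarith
  next
    fix \<sigma>' u assume inv: "Inv \<sigma>' u" and b: "te \<sigma>' (lt_test (V 11) (V 6))"
    define k where "k = rg \<sigma>' 11"
    have fr: "frame {8, 11} {6, 7} \<sigma> \<sigma>'" and u: "12 * (c - k) + 2 + (t - (12 * c + 10)) \<le> u"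
      and a6: "ar \<sigma>' 6 = (\<lambda>v. if v \<in> set (take k (ord \<sigma>)) then ar \<sigma> 13 (ar \<sigma> 15 v) else ar \<sigma> 6 v)"
      and a7: "ar \<sigma>' 7 = (\<lambda>v. if v \<in> set (take k (ord \<sigma>)) then ar \<sigma> 13 (ar \<sigma> 15 v + 1) else ar \<sigma> 7 v)"
      using inv by (simp_all add: Inv_def k_def)
    have e: "rg \<sigma>' 6 = c" "ar \<sigma>' 10 = ar \<sigma> 10" "ar \<sigma>' 13 = ar \<sigma> 13" "ar \<sigma>' 15 = ar \<sigma> 15"
      using fr by (simp_all add: frame_def c_def)
    have kc: "k < c" using b e by (simp add: vcg k_def)
    define v where "v = ar \<sigma> 10 k"
    have vo: "ord \<sigma> ! k = v" using nth[OF kc] by (simp add: v_def)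
    have tk: "set (take (k + 1) (ord \<sigma>)) = insert v (set (take k (ord \<sigma>)))"
      using take_Suc_conv_app_nth[of k "ord \<sigma>"] kc len vo by (simp add: Suc_eq_plus1[symmetric] del: Suc_eq_plus1)
    have "v \<in> set (ord \<sigma>)" using vo kc len nth_mem by metis
    then have vC: "v \<in> C" using o(2) by simp
    have vn: "v < n" using vC o(3) by auto
    have fp: "ar \<sigma> 15 v \<le> p" by (rule p(2)[OF vC])
    define \<tau> where "\<tau> = srg 11 (k + 1) (sar 7 v (ar \<sigma> 13 (ar \<sigma> 15 v + 1)) (sar 6 v (ar \<sigma> 13 (ar \<sigma> 15 v)) (srg 8 v \<sigma>')))"
    have tau: "rg \<tau> 11 = k + 1" "ar \<tau> 6 = (ar \<sigma>' 6)(v := ar \<sigma> 13 (ar \<sigma> 15 v))" "ar \<tau> 7 = (ar \<sigma>' 7)(v := ar \<sigma> 13 (ar \<sigma> 15 v + 1))"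
      by (simp_all add: \<tau>_def ar_sar)
    have "frame {8, 11} {6, 7} \<sigma> \<tau>" using fr by (simp add: \<tau>_def)
    moreover have "c - k = c - (k + 1) + 1" using kc by simp
    ultimately have "Inv \<tau> (u - 10)" unfolding Inv_def tau tk a6 a7 using kc u by (auto simp: fun_eq_iff)
    moreover have u10: "10 \<le> u" using u kc by linarith
    ultimately show "3 \<le> u \<and> okk (8 ::= arr 10 (V 11) ;; put 6 (V 8) (arr 13 (arr 15 (V 8))) ;;
      put 7 (V 8) (arr 13 (Plus (arr 15 (V 8)) (N 1))) ;; 11 ::= Plus (V 11) (N 1)) \<sigma>' (u - 3) Inv"
      using u10 kc cn vn e fp p W_ge by (simp add: okk evs ar_sar le_diff_pos k_def[symmetric] v_def[symmetric] \<tau>_def[symmetric])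
  next
    fix \<sigma>' u assume inv: "Inv \<sigma>' u" and b: "\<not> te \<sigma>' (lt_test (V 11) (V 6))"
    have "frame {8, 11} {6, 7} \<sigma> \<sigma>'" using inv by (simp add: Inv_def)
    then have k: "rg \<sigma>' 11 = c" using inv b by (auto simp: Inv_def vcg frame_def c_def)
    show "2 \<le> u \<and> Q \<sigma>' (u - 2)"
      using inv len o(2) unfolding Inv_def k by (auto intro!: Q simp: c_def)
  qed
  then show ?thesis using t by (simp add: write_com_def vcg)
qed

text \<open>The share of a vertex in the cost of its component. Sorting is charged to sampled edges
  and binary searches to dying ones. Edges in \<open>D3\<close> occur twice, because the placement
  of sources charges them at the head and relaxation at the tail.\<close>

definition wt :: "nat \<Rightarrow> nat set \<Rightarrow> (nat \<Rightarrow> nat) \<Rightarrow> (nat \<Rightarrow> nat) \<Rightarrow> nat \<Rightarrow> nat" where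
  "wt \<Lambda> S lo hi v = 300 + 100 * deg v + (80 * \<Lambda> + 40) * card {c \<in> {1..m} \<inter> S. H c = v} +
     (30 * \<Lambda> + 60) * (card {c \<in> D1 S lo hi. T c = v} + card {c \<in> D3 S lo hi. H c = v} + card {c \<in> D3 S lo hi. T c = v})"

lemma card_fibres: "finite A \<Longrightarrow> finite X \<Longrightarrow> card {c \<in> X. f c \<in> A} = (\<Sum>v\<in>A. card {c \<in> X. f c = v})"
proof -
  assume "finite A" "finite X"
  then have "(\<Sum>v\<in>A. card {c \<in> X. f c = v}) = card (\<Union>v\<in>A. {c \<in> X. f c = v})"
    by (intro card_UN_disjoint[symmetric]) auto
  also have "(\<Union>v\<in>A. {c \<in> X. f c = v}) = {c \<in> X. f c \<in> A}" by auto
  finally show ?thesis ..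
qed

lemma finite_D [simp]: "finite (D1 S lo hi)" "finite (D3 S lo hi)"
  by (rule finite_subset[of _ "{1..m}"]; auto simp: D1_def D3_def alive_def)+

text \<open>The coefficient \<open>80 * \<Lambda> + 40\<close> of a sampled edge consists of
  \<open>70 * \<Lambda>\<close> for sorting, \<open>10 * \<Lambda> + 20\<close> for one binary
  search from the summand \<open>p\<close> in the bound on \<open>F\<close>, and 20 for its
  bucket.\<close>

lemma comp_cost:
  assumes C: "finite C" "C \<noteq> {}" and p: "p \<le> card {c \<in> {1..m} \<inter> S. H c \<in> C}"
    and F: "F \<le> p + 2 * card {c \<in> D1 S lo hi. T c \<in> C} + 2 * card {c \<in> D3 S lo hi. H c \<in> C}"
  shows "((\<Sum>v\<in>C. 50 + 30 * deg v) + 20) + (70 * p * \<Lambda> + 5) + (40 * card C + (10 * \<Lambda> + 20) * F + 5) +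
    (12 * p + 25 * card C + (\<Sum>v\<in>C. 20 + 60 * card {c \<in> {1..m}. T c = v} +
        (10 * \<Lambda> + 20) * card {c \<in> D1 S lo hi \<union> D3 S lo hi. T c = v}) + 5) + (12 * card C + 10) + 50 \<le> (\<Sum>v\<in>C. wt \<Lambda> S lo hi v)"
proof -
  define x y1 y3 z d where "x = card {c \<in> {1..m} \<inter> S. H c \<in> C}" and "y1 = card {c \<in> D1 S lo hi. T c \<in> C}"
    and "y3 = card {c \<in> D3 S lo hi. H c \<in> C}" and "z = card {c \<in> D3 S lo hi. T c \<in> C}" and "d = (\<Sum>v\<in>C. deg v)"
  have x: "x = (\<Sum>v\<in>C. card {c \<in> {1..m} \<inter> S. H c = v})" and y1: "y1 = (\<Sum>v\<in>C. card {c \<in> D1 S lo hi. T c = v})"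
    and y3: "y3 = (\<Sum>v\<in>C. card {c \<in> D3 S lo hi. H c = v})" and z: "z = (\<Sum>v\<in>C. card {c \<in> D3 S lo hi. T c = v})"
    unfolding x_def y1_def y3_def z_def by (intro card_fibres C(1); simp)+
  have "(\<Sum>v\<in>C. 20 + 60 * card {c \<in> {1..m}. T c = v} + (10 * \<Lambda> + 20) * card {c \<in> D1 S lo hi \<union> D3 S lo hi. T c = v})
    \<le> (\<Sum>v\<in>C. 20 + 60 * deg v + (10 * \<Lambda> + 20) * (card {c \<in> D1 S lo hi. T c = v} + card {c \<in> D3 S lo hi. T c = v}))"
  proof (intro sum_mono add_mono mult_le_mono order_refl)
    fix v show "card {c \<in> D1 S lo hi \<union> D3 S lo hi. T c = v} \<le> card {c \<in> D1 S lo hi. T c = v} + card {c \<in> D3 S lo hi. T c = v}"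
      using card_Un_le[of "{c \<in> D1 S lo hi. T c = v}" "{c \<in> D3 S lo hi. T c = v}"]
      by (simp add: Collect_disj_eq[symmetric] conj_disj_distribR)
  qed (simp add: deg_def)
  also have "\<dots> = 20 * card C + 60 * d + (10 * \<Lambda> + 20) * (y1 + z)"
    by (simp add: sum.distrib d_def y1 z flip: sum_distrib_left)
  finally have 1: "(\<Sum>v\<in>C. 20 + 60 * card {c \<in> {1..m}. T c = v} + (10 * \<Lambda> + 20) * card {c \<in> D1 S lo hi \<union> D3 S lo hi. T c = v})
    \<le> 20 * card C + 60 * d + (10 * \<Lambda> + 20) * (y1 + z)" .
  have 2: "(\<Sum>v\<in>C. 50 + 30 * deg v) = 50 * card C + 30 * d" by (simp add: sum.distrib d_def flip: sum_distrib_left)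
  have 3: "(\<Sum>v\<in>C. wt \<Lambda> S lo hi v) = 300 * card C + 100 * d + (80 * \<Lambda> + 40) * x + (30 * \<Lambda> + 60) * (y1 + y3 + z)"
    by (simp add: wt_def sum.distrib d_def x y1 y3 z flip: sum_distrib_left)
  have c1: "1 \<le> card C" using C by (metis One_nat_def Suc_leI card_gt_0_iff)
  have px: "p \<le> x" using p by (simp add: x_def)
  have 4: "(10 * \<Lambda> + 20) * F \<le> (10 * \<Lambda> + 20) * (x + 2 * y1 + 2 * y3)"
    using F px by (intro mult_left_mono) (auto simp: y1_def y3_def)
  have 5: "70 * p * \<Lambda> \<le> 70 * x * \<Lambda>" using px by simp
  have e: "(10 * \<Lambda> + 20) * (x + 2 * y1 + 2 * y3) + 70 * x * \<Lambda> + 20 * x + (10 * \<Lambda> + 20) * (y1 + z) + (20 * \<Lambda> + 40) * z + (10 * \<Lambda> + 20) * y3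
      = (80 * \<Lambda> + 40) * x + (30 * \<Lambda> + 60) * (y1 + y3 + z)"
    by (simp add: algebra_simps)
  show ?thesis unfolding 2 3 using 1 4 5 e c1 px by linarith
qed

text \<open>Only unvisited vertices are charged. The command can therefore be called for both ends
  of every edge, at constant cost whenever the component has been dealt with before.\<close>

lemma okk_comp:
  assumes g: "good (ar \<sigma> 4) (ar \<sigma> 5)" and ad: "adj \<sigma>" and r: "rg \<sigma> 4 \<in> VV"
    and U: "cc (ar \<sigma> 4) (rg \<sigma> 4) \<subseteq> vis \<sigma> \<or> vis \<sigma> \<inter> cc (ar \<sigma> 4) (rg \<sigma> 4) = {}"
    and sz: "card (keys (smp \<sigma>) (ar \<sigma> 4) (ar \<sigma> 5) (rg \<sigma> 4)) + 1 \<le> 2 ^ \<Lambda>"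
    and z: "\<And>j. 1 \<le> j \<Longrightarrow> ar \<sigma> 16 j = 0"
    and t: "(\<Sum>v\<in>cc (ar \<sigma> 4) (rg \<sigma> 4) - vis \<sigma>. wt \<Lambda> (smp \<sigma>) (ar \<sigma> 4) (ar \<sigma> 5) v) + 2 + K \<le> t"
    and Q: "\<And>\<sigma>' u. frame {5..23} {6, 7, 9, 10, 11, 12, 13, 14, 15, 16, 17, 18} \<sigma> \<sigma>' \<Longrightarrow> (\<And>j. 1 \<le> j \<Longrightarrow> ar \<sigma>' 16 j = 0) \<Longrightarrow>
       vis \<sigma>' = vis \<sigma> \<union> cc (ar \<sigma> 4) (rg \<sigma> 4) \<Longrightarrow>
       ar \<sigma>' 6 = (\<lambda>v. if v \<in> cc (ar \<sigma> 4) (rg \<sigma> 4) - vis \<sigma> then nlo (smp \<sigma>) (ar \<sigma> 4) (ar \<sigma> 5) v else ar \<sigma> 6 v) \<Longrightarrow>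
       ar \<sigma>' 7 = (\<lambda>v. if v \<in> cc (ar \<sigma> 4) (rg \<sigma> 4) - vis \<sigma> then nhi (smp \<sigma>) (ar \<sigma> 4) (ar \<sigma> 5) v else ar \<sigma> 7 v) \<Longrightarrow>
       K \<le> u \<Longrightarrow> Q \<sigma>' u"
  shows "okk comp_com \<sigma> t Q"
proof -
  define lo hi S r C where "lo = ar \<sigma> 4" and "hi = ar \<sigma> 5" and "S = smp \<sigma>" and "r = rg \<sigma> 4" and "C = cc lo r"
  have rn: "r < n" using VV_lt[OF r] by (simp add: r_def)
  note defs = lo_def[symmetric] hi_def[symmetric] S_def[symmetric] r_def[symmetric] C_def[symmetric]
  note g' = g[unfolded defs] and z' = z and U' = U[unfolded defs] and t' = t[unfolded defs] and sz' = sz[unfolded defs]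
  note Q' = Q[unfolded defs]
  have tst: "te \<sigma> (eq_test (arr 9 (V 4)) (V 2)) \<longleftrightarrow> r \<in> vis \<sigma>"
    using rn W_ge by (simp add: vcg r_def vis_def)
  have rC: "r \<in> C" by (simp add: C_def)
  have fC: "finite C" by (simp add: C_def)
  have Cn: "v < n" if "v \<in> C" for v using cc_lt[OF rn] that by (simp add: C_def)
  have CV: "v \<in> VV" if "v \<in> C" for v using cc_subset_VV[of lo r] that r by (auto simp: C_def r_def)
  show ?thesis
  proof (cases "r \<in> vis \<sigma>")
    case True
    then have CU: "C \<subseteq> vis \<sigma>" using U' rC by auto
    then have Cv: "C - vis \<sigma> = {}" by blast
    have "Q \<sigma> (t - 1)" by (rule Q'[unfolded Cv]) (use z' CU t' in auto)
    then show ?thesis unfolding comp_com_def ok_If tst using True t' by (simp add: ok_Skip)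
  next
    case False
    then have CU: "vis \<sigma> \<inter> C = {}" using U' rC by auto
    then have Cv: "C - vis \<sigma> = C" by blast
    define p where "p = card (keys S lo hi r)"
    define F where "F = p + 2 * card {c \<in> D1 S lo hi. T c \<in> C} + 2 * card {c \<in> D3 S lo hi. H c \<in> C}"
    define c1 where "c1 = (\<Sum>v\<in>C. 50 + 30 * deg v) + 20"
    define c2 where "c2 = 70 * p * \<Lambda> + 5"
    define c3 where "c3 = 40 * card C + (10 * \<Lambda> + 20) * F + 5"
    define c4 where "c4 = 12 * p + 25 * card C + (\<Sum>v\<in>C. 20 + 60 * card {c \<in> {1..m}. T c = v} +
        (10 * \<Lambda> + 20) * card {c \<in> D1 S lo hi \<union> D3 S lo hi. T c = v}) + 5"
    define c5 where "c5 = 12 * card C + 10"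
    have "p \<le> card {c \<in> {1..m} \<inter> S. H c \<in> C}"
      unfolding p_def by (intro card_mono) (auto simp: keys_def C_def)
    then have cost: "c1 + c2 + c3 + c4 + c5 + 50 + 2 + K \<le> t"
      using comp_cost[OF fC _ _ order_refl, where p = p and S = S and lo = lo and hi = hi and \<Lambda> = \<Lambda>] rC t' unfolding Cv c1_def c2_def c3_def c4_def c5_def F_def by fastforce
    have "card (keys S lo hi r) \<le> card {1..m}" by (intro card_mono) (auto simp: keys_def)
    then have pm: "p \<le> m" by (simp add: p_def)
    have p2: "p + 1 \<le> 2 ^ \<Lambda>" using sz' by (simp add: p_def)
    have "okk search_com \<sigma> (t - 2) (\<lambda>\<sigma>' u. okk (sort_com ;; ends_com ;; place_loop ;; settle_com ;; write_com) \<sigma>' (u) Q)"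
    proof (rule okk_search[OF g ad])
      show "rg \<sigma> 4 < n" using rn by (simp add: r_def)
      show "vis \<sigma> \<inter> cc (ar \<sigma> 4) (rg \<sigma> 4) = {}" using CU unfolding defs .
      show "(\<Sum>v\<in>cc (ar \<sigma> 4) (rg \<sigma> 4). 50 + 30 * deg v) + 20 \<le> t - 2" unfolding defs using cost by (simp add: c1_def)
      fix \<sigma>1 u1 assume f1: "frame {5, 6, 7, 8, 9, 10} {9, 10, 11, 12, 13} \<sigma> \<sigma>1" and s1: "searched \<sigma>1 (vis \<sigma>) (rg \<sigma> 4)"
        and u1: "t - 2 - ((\<Sum>v\<in>cc (ar \<sigma> 4) (rg \<sigma> 4). 50 + 30 * deg v) + 20) \<le> u1"
      have u1': "c2 + c3 + c4 + c5 + 48 + 2 + K \<le> u1" using u1 cost unfolding defs c1_def by simp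
      have a1: "ar \<sigma>1 4 = lo" "ar \<sigma>1 5 = hi" "ar \<sigma>1 16 = ar \<sigma> 16" "rg \<sigma>1 4 = r" "smp \<sigma>1 = S" "adj \<sigma>1"
        using f1 ad by (simp_all add: frame_def lo_def hi_def r_def S_def smp_def adj_def)
      note s1' = s1[unfolded searched_def a1 defs, folded p_def]
      have o1: "set (ord \<sigma>1) = C" "distinct (ord \<sigma>1)" "vis \<sigma>1 = vis \<sigma> \<union> C" "ar \<sigma>1 13 ` {1..p} = keys S lo hi r" "rg \<sigma>1 7 = p"
         "\<And>v. v \<in> C \<Longrightarrow> ar \<sigma>1 12 v = hh lo v"
        "\<And>col::nat \<Rightarrow> nat. bd col (ord \<sigma>1) \<le> 2 * card {c. alive lo c \<and> T c \<in> C \<and> H c \<in> C \<and> col (T c) \<noteq> col (H c)}"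
        using s1' by auto
      have cC: "rg \<sigma>1 6 = card C" using distinct_card[OF o1(2)] o1(1) by (simp add: ord_def)
      have "okk sort_com \<sigma>1 (u1 - 1) (\<lambda>\<sigma>' u. okk (ends_com ;; place_loop ;; settle_com ;; write_com) \<sigma>' u Q)"
      proof (rule okk_sort[where \<Lambda> = \<Lambda>])
        show "rg \<sigma>1 7 \<le> m" "rg \<sigma>1 7 \<le> 2 ^ \<Lambda>" using o1 pm p2 by simp_all
        show "ar \<sigma>1 13 i \<le> Suc m" if "1 \<le> i" "i \<le> rg \<sigma>1 7" for i
        proof -
          have "ar \<sigma>1 13 i \<in> ar \<sigma>1 13 ` {1..p}" using that o1 by auto
          then show ?thesis unfolding o1(4) by (simp add: keys_def)
        qed
        show "70 * rg \<sigma>1 7 * \<Lambda> + 5 \<le> u1 - 1" using u1' unfolding o1(5) c2_def by simp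
        fix \<sigma>2 u2 assume f2: "frame {11, 17, 18, 19, 20, 21, 22} {13, 14} \<sigma>1 \<sigma>2"
          and im: "ar \<sigma>2 13 ` {1..rg \<sigma>1 7} = ar \<sigma>1 13 ` {1..rg \<sigma>1 7}" and sr: "srt (ar \<sigma>2 13) 1 (rg \<sigma>1 7 + 1)"
          and u2: "u1 - 1 - (70 * rg \<sigma>1 7 * \<Lambda> + 5) \<le> u2"
        have u2': "c3 + c4 + c5 + 47 + 2 + K \<le> u2" using u2 u1' unfolding o1(5) c2_def by simp
        have a2: "ar \<sigma>2 4 = lo" "ar \<sigma>2 5 = hi" "ar \<sigma>2 16 = ar \<sigma> 16" "rg \<sigma>2 4 = r" "smp \<sigma>2 = S" "adj \<sigma>2" "rg \<sigma>2 7 = p" "ord \<sigma>2 = ord \<sigma>1"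
           "ar \<sigma>2 12 = ar \<sigma>1 12" "rg \<sigma>2 6 = card C"
          using f2 a1 o1 cC by (simp_all add: frame_def smp_def adj_def ord_def)
        define \<sigma>3 where "\<sigma>3 = srg 11 0 (srg 15 0 (srg 12 0 (sar 13 (p + 1) (hi r) (sar 13 0 (lo r) \<sigma>2))))"
        have a3: "ar \<sigma>3 4 = lo" "ar \<sigma>3 5 = hi" "ar \<sigma>3 16 = ar \<sigma> 16" "rg \<sigma>3 7 = p" "ord \<sigma>3 = ord \<sigma>1"
           "ar \<sigma>3 12 = ar \<sigma>1 12" "rg \<sigma>3 6 = card C" "ar \<sigma>3 13 = (ar \<sigma>2 13)(0 := lo r, p + 1 := hi r)" "rg \<sigma>3 12 = 0" "rg \<sigma>3 15 = 0" "rg \<sigma>3 11 = 0"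
          using a2 by (simp_all add: \<sigma>3_def ar_sar ord_def)
        have f3: "frame {5..23} {6, 7, 9, 10, 11, 12, 13, 14, 15, 16, 17, 18} \<sigma> \<sigma>3"
          unfolding \<sigma>3_def using frame_trans[OF frame_mono[OF f1] frame_mono[OF f2], of "{5..23}" "{6, 7, 9, 10, 11, 12, 13, 14, 15, 16, 17, 18}"] by simp
        define Tf where "Tf = ar \<sigma>3 13"
        have tb: "tabl lo hi S r p Tf"
        proof (rule tablI[OF g'])
          have "Tf ` {1..p} = ar \<sigma>2 13 ` {1..p}" by (intro image_cong) (auto simp: Tf_def a3)
          then show "Tf ` {1..p} = keys S lo hi r" using im o1(4,5) by simp
          show "Tf 0 = lo r" "Tf (p + 1) = hi r" by (simp_all add: Tf_def a3)
          show "rk (lo r) \<le> rk (hi r)" by (rule good_lh[OF g' CV[OF rC]])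
          show "rk (Tf i) \<le> rk (Tf j)" if "1 \<le> i" "i \<le> j" "j \<le> p" for i j
            using sr that by (simp add: Tf_def a3 srt_def o1(5))
        qed
        have fl: "fails (hh lo) (\<lambda>v. ix p Tf (rk (hh lo v))) 0 (ord \<sigma>1) \<le> F"
          unfolding F_def C_def by (rule fails_le[OF g' tb o1(2) o1(1)[unfolded C_def] o1(7)[unfolded C_def]])
        have fl': "(10 * \<Lambda> + 20) * fails (hh lo) (\<lambda>v. ix p Tf (rk (hh lo v))) 0 (ord \<sigma>1) \<le> (10 * \<Lambda> + 20) * F"
          by (rule mult_left_mono[OF fl]) simp
        have "okk place_loop \<sigma>3 (u2 - 11) (\<lambda>\<sigma>' u. okk (settle_com ;; write_com) \<sigma>' u Q)"
        proof (rule okk_place[where \<sigma> = \<sigma>3 and S = S and r = r and \<Lambda> = \<Lambda>, unfolded a3(1-7,9-11), folded Tf_def C_def])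
          show "good lo hi" "tabl lo hi S r p Tf" "p \<le> m" "p + 1 \<le> 2 ^ \<Lambda>" by (fact g' tb pm p2)+
          show "distinct (ord \<sigma>1)" "set (ord \<sigma>1) = C" "r < n" by (fact o1 rn)+
          show "ar \<sigma>1 12 v = hh lo v" if "v \<in> C" for v using o1(6) that .
          show "ar \<sigma> 16 j = 0" if "1 \<le> j" for j using z that .
          show "40 * card C + (10 * \<Lambda> + 20) * fails (hh lo) (\<lambda>v. ix p Tf (rk (hh lo v))) 0 (ord \<sigma>1) + 5 \<le> u2 - 11"
            using fl' u2' unfolding c3_def by linarith
          fix \<sigma>4 \<ll> u3 assume f4: "frame {8, 11, 12, 13, 14, 15, 21} {15, 16, 17, 18} \<sigma>3 \<sigma>4" and d4: "djk lo r p Tf {} p (ar \<sigma>4 15) \<ll>"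
            and b4: "bkt \<sigma>4 \<ll>" and l4: "total_len p \<ll> \<le> card C" "rg \<sigma>4 15 \<le> card C" and z4: "\<And>v. v \<in> C \<Longrightarrow> ar \<sigma>4 15 v = 0"
            and u3: "u2 - 11 - (40 * card C + (10 * \<Lambda> + 20) * fails (hh lo) (\<lambda>v. ix p Tf (rk (hh lo v))) 0 (ord \<sigma>1) + 5) \<le> u3"
          have u3': "c4 + c5 + 36 + 2 + K \<le> u3" using u3 u2' fl' unfolding c3_def by linarith
          have a4: "ar \<sigma>4 4 = lo" "ar \<sigma>4 5 = hi" "rg \<sigma>4 7 = p" "ord \<sigma>4 = ord \<sigma>1" "rg \<sigma>4 6 = card C" "ar \<sigma>4 13 = Tf"
            using f4 a3 by (simp_all add: frame_def ord_def Tf_def)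
          have f4': "frame {5..23} {6, 7, 9, 10, 11, 12, 13, 14, 15, 16, 17, 18} \<sigma> \<sigma>4"
            by (rule frame_trans[OF f3 frame_mono[OF f4]]) auto
          have "okk settle_com \<sigma>4 (u3 - 1) (\<lambda>\<sigma>' u. okk write_com \<sigma>' u Q)"
          proof (rule okk_settle[where \<sigma> = \<sigma>4 and S = S and r = r and \<Lambda> = \<Lambda> and c = "card C" and K = "c5 + 30 + 2 + K", unfolded a4, folded C_def])
            show "good lo hi" "tabl lo hi S r p Tf" "p \<le> m" "p + 1 \<le> 2 ^ \<Lambda>" "r < n" by (fact g' tb pm p2 rn)+
            show "adj \<sigma>4" using f4' ad by (simp add: adj_def frame_def)
            show "djk lo r p Tf {} p (ar \<sigma>4 15) \<ll>" "bkt \<sigma>4 \<ll>" "total_len p \<ll> \<le> card C" "rg \<sigma>4 15 \<le> card C" by (fact d4 b4 l4)+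
            show "ar \<sigma>4 15 v = 0" if "v \<in> C" for v using z4 that .
            show "card C \<le> n" using card_cc_le[OF rn] by (simp add: C_def)
            show "12 * p + 25 * card C + (\<Sum>v\<in>C. 20 + 60 * card {c \<in> {1..m}. T c = v} +
                (10 * \<Lambda> + 20) * card {c \<in> D1 S lo hi \<union> D3 S lo hi. T c = v}) + 5 + (c5 + 30 + 2 + K) \<le> u3 - 1"
              using u3' unfolding c4_def by simp
            fix \<sigma>5 u4 assume f5: "frame {8, 9, 10, 12, 13, 14, 15, 16, 21, 23} {15, 16, 17, 18} \<sigma>4 \<sigma>5"
              and fn: "\<And>v. v \<in> C \<Longrightarrow> ar \<sigma>5 15 v = ix p Tf (B v)" and z5: "\<And>j. 1 \<le> j \<Longrightarrow> ar \<sigma>5 16 j = 0" and u4: "c5 + 30 + 2 + K \<le> u4"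
            have a5: "ord \<sigma>5 = ord \<sigma>1" "rg \<sigma>5 6 = card C" "ar \<sigma>5 13 = Tf" "ar \<sigma>5 9 = ar \<sigma>1 9" "rg \<sigma>5 2 = rg \<sigma> 2" "ar \<sigma>5 6 = ar \<sigma> 6" "ar \<sigma>5 7 = ar \<sigma> 7"
              using f5 f4 f1 f2 a4 by (simp_all add: frame_def ord_def Tf_def \<sigma>3_def ar_sar)
            have f5': "frame {5..23} {6, 7, 9, 10, 11, 12, 13, 14, 15, 16, 17, 18} \<sigma> \<sigma>5"
              by (rule frame_trans[OF f4' frame_mono[OF f5]]) auto
            show "okk write_com \<sigma>5 u4 Q"
            proof (rule okk_write[where C = C and p = p])
              show "distinct (ord \<sigma>5)" "set (ord \<sigma>5) = C" using o1 a5 by simp_all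
              show "C \<subseteq> {..<n}" using Cn by auto
              show "p \<le> m" by (rule pm)
              show "ar \<sigma>5 15 v \<le> p" if "v \<in> C" for v using fn[OF that] ix_le[of p Tf "B v"] by simp
              show "12 * rg \<sigma>5 6 + 10 \<le> u4" using u4 a5 by (simp add: c5_def)
              fix \<sigma>6 u5 assume f6: "frame {8, 11} {6, 7} \<sigma>5 \<sigma>6"
                and w6: "ar \<sigma>6 6 = (\<lambda>v. if v \<in> C then ar \<sigma>5 13 (ar \<sigma>5 15 v) else ar \<sigma>5 6 v)"
                and w7: "ar \<sigma>6 7 = (\<lambda>v. if v \<in> C then ar \<sigma>5 13 (ar \<sigma>5 15 v + 1) else ar \<sigma>5 7 v)"
                and u5: "u4 - (12 * rg \<sigma>5 6 + 10) \<le> u5"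
              show "Q \<sigma>6 u5"
              proof (rule Q'[unfolded Cv])
                show "frame {5..23} {6, 7, 9, 10, 11, 12, 13, 14, 15, 16, 17, 18} \<sigma> \<sigma>6"
                  by (rule frame_trans[OF f5' frame_mono[OF f6]]) auto
                show "ar \<sigma>6 16 j = 0" if "1 \<le> j" for j using z5[OF that] f6 by (simp add: frame_def)
                have "vis \<sigma>6 = vis \<sigma>1" using f6 a5 f1 by (simp add: vis_def frame_def)
                then show "vis \<sigma>6 = vis \<sigma> \<union> C" using o1 by simp
                show "ar \<sigma>6 6 = (\<lambda>v. if v \<in> C then nlo S lo hi v else ar \<sigma> 6 v)"
                  using w6 fn nlo_ix[OF g' tb] by (auto simp: a5 C_def fun_eq_iff)
                show "ar \<sigma>6 7 = (\<lambda>v. if v \<in> C then nhi S lo hi v else ar \<sigma> 7 v)"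
                  using w7 fn nhi_ix[OF g' tb] CV by (auto simp: a5 C_def fun_eq_iff)
                show "K \<le> u5" using u5 u4 a5 by (simp add: c5_def)
              qed
            qed
          qed
          then show "okk (settle_com ;; write_com) \<sigma>4 u3 Q" using u3' by (simp add: ok_Seq)
        qed simp_all
        moreover have "p + 1 \<le> W" "r \<le> W" using pm rn by (simp_all add: W_def)
        ultimately have "okk (ends_com ;; place_loop ;; settle_com ;; write_com) \<sigma>2 u2 Q"
          using u2' a2 W_ge unfolding ends_com_def
          by (simp add: okk evs ar_sar le_diff_pos ok_Seq[of _ _ place_loop] del: ok_Seq[of _ _ settle_com]) (simp add: \<sigma>3_def)
        then show "okk (ends_com ;; place_loop ;; settle_com ;; write_com) \<sigma>2 u2 Q" .
      qed
      then show "okk (sort_com ;; ends_com ;; place_loop ;; settle_com ;; write_com) \<sigma>1 u1 Q" using u1' by (simp add: ok_Seq)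
    qed
    then show ?thesis unfolding comp_com_def ok_If tst using False cost by (simp add: ok_Seq[of _ _ search_com])
  qed
qed

end

text \<open>All passes over vertices run over the ends of edges. Vertices without edges cost no
  time, which keeps the bound free of a term in \<open>n\<close>.\<close>

definition edge_loop :: "com \<Rightarrow> com" where
  "edge_loop c = 3 ::= N 1 ;; While (Leq (V 3) NumEdges) (c ;; 3 ::= Plus (V 3) (N 1))"

text \<open>New ends replace the old ones only after all components are finished, since the searches
  recognize alive edges by the old ones. Clearing the visit stamps lets every level use the stamp
  1.\<close>

definition take_com :: com where
  "take_com = put 4 (V 4) (arr 6 (V 4)) ;; put 5 (V 4) (arr 7 (V 4)) ;; put 9 (V 4) (N 0)"

definition refine_com :: com where
  "refine_com = 2 ::= N 1 ;;
     edge_loop (4 ::= tl_exp (V 3) ;; comp_com ;; 4 ::= hd_exp (V 3) ;; comp_com) ;;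
     edge_loop (4 ::= tl_exp (V 3) ;; take_com ;; 4 ::= hd_exp (V 3) ;; take_com)"

context inst
begin

lemma okk_edge_loop:
  assumes "2 \<le> t" "P 1 (srg 3 1 \<sigma>) (t - 2)"
    and b: "\<And>k \<sigma> u. P k \<sigma> u \<Longrightarrow> 1 \<le> k \<Longrightarrow> k \<le> m \<Longrightarrow> rg \<sigma> 3 = k \<Longrightarrow>
        4 \<le> u \<and> okk c \<sigma> (u - 4) (\<lambda>\<sigma>' u'. rg \<sigma>' 3 = k \<and> 1 \<le> u' \<and> P (k + 1) (srg 3 (k + 1) \<sigma>') (u' - 1))"
    and e: "\<And>\<sigma> u. P (m + 1) \<sigma> u \<Longrightarrow> 2 \<le> u \<and> Q \<sigma> (u - 2)"
  shows "okk (edge_loop c) \<sigma> t Q"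
proof -
  have "okk (While (Leq (V 3) NumEdges) (c ;; 3 ::= Plus (V 3) (N 1))) (srg 3 1 \<sigma>) (t - 2) Q"
  proof (rule okk_While[where Inv = "\<lambda>\<sigma> u. 1 \<le> rg \<sigma> 3 \<and> rg \<sigma> 3 \<le> m + 1 \<and> P (rg \<sigma> 3) \<sigma> u"])
    fix \<sigma> u assume inv: "1 \<le> rg \<sigma> 3 \<and> rg \<sigma> 3 \<le> m + 1 \<and> P (rg \<sigma> 3) \<sigma> u" and "te \<sigma> (Leq (V 3) NumEdges)"
    then have k: "1 \<le> rg \<sigma> 3" "rg \<sigma> 3 \<le> m" "P (rg \<sigma> 3) \<sigma> u" by (auto simp: te_Leq evs)
    define k where "k = rg \<sigma> 3"
    note K = k[folded k_def]
    have "4 \<le> u" and o: "okk c \<sigma> (u - 4) (\<lambda>\<sigma>' u'. rg \<sigma>' 3 = k \<and> 1 \<le> u' \<and> P (k + 1) (srg 3 (k + 1) \<sigma>') (u' - 1))"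
      using b[OF K(3) K(1) K(2)] k_def by auto
    have "okk c \<sigma> (u - 4) (\<lambda>\<sigma>' t'. okk (3 ::= Plus (V 3) (N 1)) \<sigma>' t' (\<lambda>\<sigma> u. 1 \<le> rg \<sigma> 3 \<and> rg \<sigma> 3 \<le> m + 1 \<and> P (rg \<sigma> 3) \<sigma> u))"
      by (rule ok_mono[OF o order_refl]) (use K W_ge in \<open>auto simp: okk_Assign evs\<close>)
    then show "3 \<le> u \<and> okk (c ;; 3 ::= Plus (V 3) (N 1)) \<sigma> (u - 3) (\<lambda>\<sigma> u. 1 \<le> rg \<sigma> 3 \<and> rg \<sigma> 3 \<le> m + 1 \<and> P (rg \<sigma> 3) \<sigma> u)"
      using \<open>4 \<le> u\<close> by (simp add: ok_Seq le_diff_pos)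
  next
    fix \<sigma> u assume inv: "1 \<le> rg \<sigma> 3 \<and> rg \<sigma> 3 \<le> m + 1 \<and> P (rg \<sigma> 3) \<sigma> u" and "\<not> te \<sigma> (Leq (V 3) NumEdges)"
    then have "rg \<sigma> 3 = m + 1" by (auto simp: te_Leq evs)
    then show "2 \<le> u \<and> Q \<sigma> (u - 2)" using inv e by metis
  qed (use assms in simp)
  then show ?thesis using assms(1) by (simp add: edge_loop_def okk evs le_diff_pos)
qed

definition ends :: "nat \<Rightarrow> nat set" where "ends k = T ` {1..<k} \<union> H ` {1..<k}"

lemma ends_1: "ends 1 = {}" by (simp add: ends_def)

lemma ends_Suc: "1 \<le> k \<Longrightarrow> ends (k + 1) = insert (H k) (insert (T k) (ends k))"
proof -
  assume "1 \<le> k"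
  then have "{1..<k + 1} = insert k {1..<k}" by auto
  then show ?thesis by (auto simp: ends_def)
qed

lemma ends_top: "ends (m + 1) = VV"
proof -
  have "{1..<m + 1} = {1..m}" by auto
  then show ?thesis by (simp add: ends_def VV_def)
qed

text \<open>Components are visited completely or not at all; this is why the stamp of the root alone
  decides whether a component can be skipped.\<close>

definition lvl :: "state \<Rightarrow> state \<Rightarrow> bool" where
  "lvl \<sigma> \<sigma>' \<longleftrightarrow> frame {2..23} {6, 7, 9, 10, 11, 12, 13, 14, 15, 16, 17, 18} \<sigma> \<sigma>' \<and> (\<forall>j\<ge>1. ar \<sigma>' 16 j = 0) \<and>
     (\<forall>v\<in>VV. cc (ar \<sigma> 4) v \<subseteq> vis \<sigma>' \<or> vis \<sigma>' \<inter> cc (ar \<sigma> 4) v = {}) \<and>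
     (\<forall>v\<in>vis \<sigma>' \<inter> VV. ar \<sigma>' 6 v = nlo (smp \<sigma>) (ar \<sigma> 4) (ar \<sigma> 5) v \<and> ar \<sigma>' 7 v = nhi (smp \<sigma>) (ar \<sigma> 4) (ar \<sigma> 5) v)"

lemma lvl_srg [simp]: "r \<in> {3, 4} \<Longrightarrow> lvl \<sigma> (srg r v \<sigma>') = lvl \<sigma> \<sigma>'"
  unfolding lvl_def by (elim insertE; simp)

lemma cc_VV: "v \<in> VV \<Longrightarrow> cc lo v \<subseteq> VV"
  using cc_subset_VV[of lo v] by auto

lemma finite_VV [simp]: "finite VV" by (simp add: VV_def)

lemma okk_comp_lvl:
  assumes g: "good (ar \<sigma> 4) (ar \<sigma> 5)" and ad: "adj \<sigma>"
    and sz: "\<And>v. v \<in> VV \<Longrightarrow> card (keys (smp \<sigma>) (ar \<sigma> 4) (ar \<sigma> 5) v) + 1 \<le> 2 ^ \<Lambda>"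
    and l: "lvl \<sigma> \<sigma>'" and r: "rg \<sigma>' 4 \<in> VV"
    and t: "(\<Sum>v\<in>VV - vis \<sigma>'. wt \<Lambda> (smp \<sigma>) (ar \<sigma> 4) (ar \<sigma> 5) v) + 2 + K \<le> t"
    and Q: "\<And>\<sigma>'' u. lvl \<sigma> \<sigma>'' \<Longrightarrow> rg \<sigma>'' 3 = rg \<sigma>' 3 \<Longrightarrow> vis \<sigma>' \<subseteq> vis \<sigma>'' \<Longrightarrow> rg \<sigma>' 4 \<in> vis \<sigma>'' \<Longrightarrow>
       (\<Sum>v\<in>VV - vis \<sigma>''. wt \<Lambda> (smp \<sigma>) (ar \<sigma> 4) (ar \<sigma> 5) v) + K \<le> u \<Longrightarrow> Q \<sigma>'' u"
  shows "okk comp_com \<sigma>' t Q"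
proof -
  define C where "C = cc (ar \<sigma> 4) (rg \<sigma>' 4)"
  define f where "f = wt \<Lambda> (smp \<sigma>) (ar \<sigma> 4) (ar \<sigma> 5)"
  have fr: "frame {2..23} {6, 7, 9, 10, 11, 12, 13, 14, 15, 16, 17, 18} \<sigma> \<sigma>'" using l by (simp add: lvl_def)
  have e: "ar \<sigma>' 4 = ar \<sigma> 4" "ar \<sigma>' 5 = ar \<sigma> 5" "smp \<sigma>' = smp \<sigma>" "adj \<sigma>'"
    using fr ad by (simp_all add: frame_def smp_def adj_def)
  have CV: "C \<subseteq> VV" unfolding C_def by (rule cc_VV[OF r])
  have "VV - vis \<sigma>' = (C - vis \<sigma>') \<union> (VV - (vis \<sigma>' \<union> C))" using CV by auto
  then have sm: "(\<Sum>v\<in>VV - vis \<sigma>'. f v) = (\<Sum>v\<in>C - vis \<sigma>'. f v) + (\<Sum>v\<in>VV - (vis \<sigma>' \<union> C). f v)"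
    using CV finite_subset[OF CV] by (subst sum.union_disjoint[symmetric]) auto
  show ?thesis
  proof (rule okk_comp[where \<Lambda> = \<Lambda> and K = "(\<Sum>v\<in>VV - (vis \<sigma>' \<union> C). f v) + K" and \<sigma> = \<sigma>', unfolded e, folded C_def f_def])
    show "C \<subseteq> vis \<sigma>' \<or> vis \<sigma>' \<inter> C = {}" using l r by (simp add: lvl_def C_def)
    show "(\<Sum>v\<in>C - vis \<sigma>'. f v) + 2 + ((\<Sum>v\<in>VV - (vis \<sigma>' \<union> C). f v) + K) \<le> t" using t sm unfolding f_def by simp
    fix \<sigma>'' u assume f: "frame {5..23} {6, 7, 9, 10, 11, 12, 13, 14, 15, 16, 17, 18} \<sigma>' \<sigma>''" and z: "\<And>j. 1 \<le> j \<Longrightarrow> ar \<sigma>'' 16 j = 0"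
      and v: "vis \<sigma>'' = vis \<sigma>' \<union> C"
      and a6: "ar \<sigma>'' 6 = (\<lambda>v. if v \<in> C - vis \<sigma>' then nlo (smp \<sigma>) (ar \<sigma> 4) (ar \<sigma> 5) v else ar \<sigma>' 6 v)"
      and a7: "ar \<sigma>'' 7 = (\<lambda>v. if v \<in> C - vis \<sigma>' then nhi (smp \<sigma>) (ar \<sigma> 4) (ar \<sigma> 5) v else ar \<sigma>' 7 v)"
      and u: "(\<Sum>v\<in>VV - (vis \<sigma>' \<union> C). f v) + K \<le> u"
    show "Q \<sigma>'' u"
    proof (rule Q)
      have "frame {2..23} {6, 7, 9, 10, 11, 12, 13, 14, 15, 16, 17, 18} \<sigma> \<sigma>''"
        by (rule frame_trans[OF fr frame_mono[OF f]]) auto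
      moreover have "cc (ar \<sigma> 4) v \<subseteq> vis \<sigma>'' \<or> vis \<sigma>'' \<inter> cc (ar \<sigma> 4) v = {}" if "v \<in> VV" for v
      proof (cases "cc (ar \<sigma> 4) v \<inter> C = {}")
        case True
        then show ?thesis using l that unfolding v lvl_def by blast
      next
        case False
        then obtain x where "x \<in> cc (ar \<sigma> 4) v" "x \<in> C" by auto
        then have "cc (ar \<sigma> 4) v = C" using cc_eq unfolding C_def by metis
        then show ?thesis unfolding v by blast
      qed
      ultimately show "lvl \<sigma> \<sigma>''" using l z unfolding lvl_def a6 a7 v by auto
      show "rg \<sigma>'' 3 = rg \<sigma>' 3" using f by (simp add: frame_def)
      show "vis \<sigma>' \<subseteq> vis \<sigma>''" "rg \<sigma>' 4 \<in> vis \<sigma>''" by (auto simp: v C_def)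
      show "(\<Sum>v\<in>VV - vis \<sigma>''. wt \<Lambda> (smp \<sigma>) (ar \<sigma> 4) (ar \<sigma> 5) v) + K \<le> u" using u unfolding v f_def .
    qed
  next
    show "ar \<sigma>' 16 j = 0" if "1 \<le> j" for j using l that by (simp add: lvl_def)
  qed (fact g r e sz[OF r])+
qed

definition cpd :: "state \<Rightarrow> nat set \<Rightarrow> state \<Rightarrow> bool" where
  "cpd \<sigma> X \<sigma>' \<longleftrightarrow> frame {3, 4} {4, 5, 9} \<sigma> \<sigma>' \<and> ar \<sigma>' 4 = (\<lambda>v. if v \<in> X then ar \<sigma> 6 v else ar \<sigma> 4 v) \<and>
     ar \<sigma>' 5 = (\<lambda>v. if v \<in> X then ar \<sigma> 7 v else ar \<sigma> 5 v) \<and> ar \<sigma>' 9 = (\<lambda>v. if v \<in> X then 0 else ar \<sigma> 9 v)"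

lemma cpd_srg [simp]: "r \<in> {3, 4} \<Longrightarrow> cpd \<sigma> X (srg r v \<sigma>') = cpd \<sigma> X \<sigma>'"
  by (auto simp: cpd_def)

definition taken :: "state \<Rightarrow> state" where
  "taken \<sigma> = (let v = rg \<sigma> 4 in sar 9 v 0 (sar 5 v (ar \<sigma> 7 v) (sar 4 v (ar \<sigma> 6 v) \<sigma>)))"

lemma rg_taken [simp]: "rg (taken \<sigma>) = rg \<sigma>" by (simp add: taken_def Let_def)

lemma okk_take: "rg \<sigma> 4 < n \<Longrightarrow> okk take_com \<sigma> t Q \<longleftrightarrow> 5 \<le> t \<and> Q (taken \<sigma>) (t - 5)"
  using W_ge by (auto simp: take_com_def taken_def Let_def okk evs ar_sar le_diff_pos)

lemma cpd_taken: "cpd \<sigma> X \<sigma>' \<Longrightarrow> cpd \<sigma> (insert (rg \<sigma>' 4) X) (taken \<sigma>')"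
proof -
  assume c: "cpd \<sigma> X \<sigma>'"
  then have e: "ar \<sigma>' 6 = ar \<sigma> 6" "ar \<sigma>' 7 = ar \<sigma> 7" by (simp_all add: cpd_def frame_def)
  show ?thesis using c unfolding cpd_def by (auto simp: taken_def Let_def ar_sar e fun_eq_iff)
qed

lemma wt_VV:
  "(\<Sum>v\<in>VV. wt \<Lambda> S lo hi v) \<le> 800 * m + (80 * \<Lambda> + 40) * card (S \<inter> {1..m}) +
     (60 * \<Lambda> + 120) * (card (D1 S lo hi) + card (D3 S lo hi))"
proof -
  have fib: "(\<Sum>v\<in>VV. card {c \<in> X. f c = v}) \<le> card X" if "finite X" for X :: "nat set" and f
    using card_fibres[of VV X f] that card_mono[OF that, of "{c \<in> X. f c \<in> VV}"] by simp
  have "card VV \<le> card (T ` {1..m}) + card (H ` {1..m})" unfolding VV_def by (rule card_Un_le)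
  also have "\<dots> \<le> m + m" using card_image_le[of "{1..m}"] by (intro add_mono) (simp_all add: order_trans[OF card_image_le])
  finally have V: "card VV \<le> 2 * m" by simp
  have d: "(\<Sum>v\<in>VV. deg v) \<le> m + m"
    unfolding deg_def sum.distrib using fib[of "{1..m}" T] fib[of "{1..m}" H] by simp
  define x a b c where "x = (\<Sum>v\<in>VV. card {c \<in> {1..m} \<inter> S. H c = v})" and "a = (\<Sum>v\<in>VV. card {c \<in> D1 S lo hi. T c = v})"
    and "b = (\<Sum>v\<in>VV. card {c \<in> D3 S lo hi. H c = v})" and "c = (\<Sum>v\<in>VV. card {c \<in> D3 S lo hi. T c = v})"
  have x: "x \<le> card (S \<inter> {1..m})" using fib[of "{1..m} \<inter> S" H] by (simp add: x_def Int_commute)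
  have abc: "a \<le> card (D1 S lo hi)" "b \<le> card (D3 S lo hi)" "c \<le> card (D3 S lo hi)"
    unfolding a_def b_def c_def by (intro fib; simp)+
  have "(\<Sum>v\<in>VV. wt \<Lambda> S lo hi v) = 300 * card VV + 100 * (\<Sum>v\<in>VV. deg v) + (80 * \<Lambda> + 40) * x + (30 * \<Lambda> + 60) * (a + b + c)"
    by (simp add: wt_def sum.distrib x_def a_def b_def c_def flip: sum_distrib_left)
  also have "\<dots> \<le> 300 * (2 * m) + 100 * (m + m) + (80 * \<Lambda> + 40) * card (S \<inter> {1..m}) + (30 * \<Lambda> + 60) * (2 * (card (D1 S lo hi) + card (D3 S lo hi)))"
    by (intro add_mono mult_le_mono2 V d x order_trans[OF add_mono[OF add_mono[OF abc(1) abc(2)] abc(3)]]) simp_all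
  also have "\<dots> = 800 * m + (80 * \<Lambda> + 40) * card (S \<inter> {1..m}) + (60 * \<Lambda> + 120) * (card (D1 S lo hi) + card (D3 S lo hi))"
    by (simp add: algebra_simps)
  finally show ?thesis .
qed

lemma okk_refine:
  assumes g: "good (ar \<sigma> 4) (ar \<sigma> 5)" and ad: "adj \<sigma>"
    and sz: "\<And>v. v \<in> VV \<Longrightarrow> card (keys (smp \<sigma>) (ar \<sigma> 4) (ar \<sigma> 5) v) + 1 \<le> 2 ^ \<Lambda>"
    and z: "\<And>j. 1 \<le> j \<Longrightarrow> ar \<sigma> 16 j = 0" "\<And>v. v \<in> VV \<Longrightarrow> ar \<sigma> 9 v = 0"
    and t: "(\<Sum>v\<in>VV. wt \<Lambda> (smp \<sigma>) (ar \<sigma> 4) (ar \<sigma> 5) v) + 60 * m + 20 + K \<le> t"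
    and Q: "\<And>\<sigma>' u. frame {2..23} {4, 5, 6, 7, 9, 10, 11, 12, 13, 14, 15, 16, 17, 18} \<sigma> \<sigma>' \<Longrightarrow>
       refined (smp \<sigma>) (ar \<sigma> 4) (ar \<sigma> 5) (ar \<sigma>' 4) (ar \<sigma>' 5) \<Longrightarrow> (\<And>j. 1 \<le> j \<Longrightarrow> ar \<sigma>' 16 j = 0) \<Longrightarrow>
       (\<And>v. v \<in> VV \<Longrightarrow> ar \<sigma>' 9 v = 0) \<Longrightarrow> K \<le> u \<Longrightarrow> Q \<sigma>' u"
  shows "okk refine_com \<sigma> t Q"
proof -
  define f where "f = wt \<Lambda> (smp \<sigma>) (ar \<sigma> 4) (ar \<sigma> 5)"
  have ed: "T k \<in> VV" "H k \<in> VV" "T k < n" "H k < n" if "1 \<le> k" "k \<le> m" for k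
    using VV_edge[of k] edge_lt[of k] that by auto
  define \<tau> where "\<tau> = srg 2 1 \<sigma>"
  have v0: "vis \<tau> \<inter> VV = {}" using z(2) by (auto simp: vis_def \<tau>_def)
  have "vis \<tau> \<inter> cc (ar \<sigma> 4) v = {}" if "v \<in> VV" for v using cc_VV[OF that, of "ar \<sigma> 4"] v0 by blast
  then have l0: "lvl \<sigma> \<tau>" using z(1) v0 unfolding lvl_def by (simp add: \<tau>_def)
  define P where "P = (\<lambda>k \<sigma>' u. lvl \<sigma> \<sigma>' \<and> ends k \<subseteq> vis \<sigma>' \<and> 20 * (m + 1 - k) + (\<Sum>v\<in>VV - vis \<sigma>'. f v) + 30 * m + 7 + K \<le> u)"
  have "okk (edge_loop (4 ::= tl_exp (V 3) ;; comp_com ;; 4 ::= hd_exp (V 3) ;; comp_com)) \<tau> (t - 3)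
     (\<lambda>\<sigma>' u. okk (edge_loop (4 ::= tl_exp (V 3) ;; take_com ;; 4 ::= hd_exp (V 3) ;; take_com)) \<sigma>' u Q)"
  proof (rule okk_edge_loop[where P = P])
    have "(\<Sum>v\<in>VV - vis \<tau>. f v) \<le> (\<Sum>v\<in>VV. f v)" by (intro sum_mono2) auto
    then show "P 1 (srg 3 1 \<tau>) (t - 3 - 2)" using t l0 ends_1 unfolding P_def f_def by simp
    show "2 \<le> t - 3" using t by simp
  next
    fix k \<sigma>' u assume P: "P k \<sigma>' u" and k: "1 \<le> k" "k \<le> m" "rg \<sigma>' 3 = k"
    have l: "lvl \<sigma> \<sigma>'" and en: "ends k \<subseteq> vis \<sigma>'" and u: "20 * (m + 1 - k) + (\<Sum>v\<in>VV - vis \<sigma>'. f v) + 30 * m + 7 + K \<le> u"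
      using P by (auto simp: P_def)
    define X where "X = 20 * (m + 1 - (k + 1)) + 30 * m + 7 + K"
    have u': "(\<Sum>v\<in>VV - vis \<sigma>'. f v) + 20 + X \<le> u" using u k unfolding X_def by linarith
    have "okk comp_com (srg 4 (T k) \<sigma>') (u - 7)
       (\<lambda>\<sigma>' u. okk (4 ::= hd_exp (V 3) ;; comp_com) \<sigma>' u (\<lambda>\<sigma>' u'. rg \<sigma>' 3 = k \<and> 1 \<le> u' \<and> P (k + 1) (srg 3 (k + 1) \<sigma>') (u' - 1)))"
    proof (rule okk_comp_lvl[OF g ad sz, where K = "X + 8", folded f_def])
      show "lvl \<sigma> (srg 4 (T k) \<sigma>')" using l by simp
      show "rg (srg 4 (T k) \<sigma>') 4 \<in> VV" using ed k by simp
      show "(\<Sum>v\<in>VV - vis (srg 4 (T k) \<sigma>'). f v) + 2 + (X + 8) \<le> u - 7" using u' by simp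
      fix \<sigma>1 u1 assume l1: "lvl \<sigma> \<sigma>1" and r1: "rg \<sigma>1 3 = rg (srg 4 (T k) \<sigma>') 3" and v1: "vis (srg 4 (T k) \<sigma>') \<subseteq> vis \<sigma>1"
        "rg (srg 4 (T k) \<sigma>') 4 \<in> vis \<sigma>1" and u1: "(\<Sum>v\<in>VV - vis \<sigma>1. f v) + (X + 8) \<le> u1"
      have "okk comp_com (srg 4 (H k) \<sigma>1) (u1 - 2) (\<lambda>\<sigma>' u'. rg \<sigma>' 3 = k \<and> 1 \<le> u' \<and> P (k + 1) (srg 3 (k + 1) \<sigma>') (u' - 1))"
      proof (rule okk_comp_lvl[OF g ad sz, where K = "X + 1", folded f_def])
        show "lvl \<sigma> (srg 4 (H k) \<sigma>1)" using l1 by simp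
        show "rg (srg 4 (H k) \<sigma>1) 4 \<in> VV" using ed k by simp
        show "(\<Sum>v\<in>VV - vis (srg 4 (H k) \<sigma>1). f v) + 2 + (X + 1) \<le> u1 - 2" using u1 by simp
        fix \<sigma>2 u2 assume l2: "lvl \<sigma> \<sigma>2" and r2: "rg \<sigma>2 3 = rg (srg 4 (H k) \<sigma>1) 3" and v2: "vis (srg 4 (H k) \<sigma>1) \<subseteq> vis \<sigma>2"
          "rg (srg 4 (H k) \<sigma>1) 4 \<in> vis \<sigma>2" and u2: "(\<Sum>v\<in>VV - vis \<sigma>2. f v) + (X + 1) \<le> u2"
        have "ends (k + 1) \<subseteq> vis \<sigma>2" using en v1 v2 unfolding ends_Suc[OF k(1)] by auto
        then show "rg \<sigma>2 3 = k \<and> 1 \<le> u2 \<and> P (k + 1) (srg 3 (k + 1) \<sigma>2) (u2 - 1)"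
          using l2 r1 r2 u2 k unfolding P_def X_def by simp
      qed
      moreover have "rg \<sigma>1 3 = k" using r1 k by simp
      ultimately show "okk (4 ::= hd_exp (V 3) ;; comp_com) \<sigma>1 u1 (\<lambda>\<sigma>' u'. rg \<sigma>' 3 = k \<and> 1 \<le> u' \<and> P (k + 1) (srg 3 (k + 1) \<sigma>') (u' - 1))"
        using u1 k by (simp add: ok_Seq okk_Assign evs le_diff_pos)
    qed
    then show "4 \<le> u \<and> okk (4 ::= tl_exp (V 3) ;; comp_com ;; 4 ::= hd_exp (V 3) ;; comp_com) \<sigma>' (u - 4)
        (\<lambda>\<sigma>' u'. rg \<sigma>' 3 = k \<and> 1 \<le> u' \<and> P (k + 1) (srg 3 (k + 1) \<sigma>') (u' - 1))"
      using u' k by (simp add: ok_Seq[of _ _ "_ ::= _"] ok_Seq[of _ _ comp_com] okk_Assign evs le_diff_pos)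
  next
    fix \<sigma>1 u assume "P (m + 1) \<sigma>1 u"
    then have l: "lvl \<sigma> \<sigma>1" and vis: "VV \<subseteq> vis \<sigma>1" and u: "30 * m + 7 + K \<le> u" by (auto simp: P_def ends_top)
    define P' where "P' = (\<lambda>k \<sigma>' u. cpd \<sigma>1 (ends k) \<sigma>' \<and> 20 * (m + 1 - k) + 2 + K \<le> u)"
    have "okk (edge_loop (4 ::= tl_exp (V 3) ;; take_com ;; 4 ::= hd_exp (V 3) ;; take_com)) \<sigma>1 (u - 2) Q"
    proof (rule okk_edge_loop[where P = P'])
      show "2 \<le> u - 2" using u by simp
      have "cpd \<sigma>1 {} \<sigma>1" by (simp add: cpd_def)
      then show "P' 1 (srg 3 1 \<sigma>1) (u - 2 - 2)" using u ends_1 by (simp add: P'_def le_diff_pos)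
    next
      fix k \<sigma>' u assume P: "P' k \<sigma>' u" and k: "1 \<le> k" "k \<le> m" "rg \<sigma>' 3 = k"
      have c: "cpd \<sigma>1 (ends k) \<sigma>'" and u: "20 * (m + 1 - k) + 2 + K \<le> u" using P by (auto simp: P'_def)
      have u': "20 + (20 * (m + 1 - (k + 1)) + 2 + K) \<le> u" using u k by linarith
      define \<rho> where "\<rho> = taken (srg 4 (H k) (taken (srg 4 (T k) \<sigma>')))"
      have "cpd \<sigma>1 (insert (T k) (ends k)) (taken (srg 4 (T k) \<sigma>'))" using cpd_taken[of \<sigma>1 "ends k" "srg 4 (T k) \<sigma>'"] c by simp
      then have "cpd \<sigma>1 (ends (k + 1)) \<rho>"
        using cpd_taken[of \<sigma>1 "insert (T k) (ends k)" "srg 4 (H k) (taken (srg 4 (T k) \<sigma>'))"] unfolding ends_Suc[OF k(1)] \<rho>_def by simp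
      moreover have "rg \<rho> 3 = k" using k by (simp add: \<rho>_def)
      ultimately show "4 \<le> u \<and> okk (4 ::= tl_exp (V 3) ;; take_com ;; 4 ::= hd_exp (V 3) ;; take_com) \<sigma>' (u - 4)
        (\<lambda>\<sigma>' u'. rg \<sigma>' 3 = k \<and> 1 \<le> u' \<and> P' (k + 1) (srg 3 (k + 1) \<sigma>') (u' - 1))"
        using u' k ed[of k] by (simp add: ok_Seq okk_Assign okk_take evs le_diff_pos P'_def \<rho>_def[symmetric])
    next
      fix \<sigma>' u assume "P' (m + 1) \<sigma>' u"
      then have c: "cpd \<sigma>1 VV \<sigma>'" and u: "2 + K \<le> u" by (auto simp: P'_def ends_top)
      have f1: "frame {2..23} {6, 7, 9, 10, 11, 12, 13, 14, 15, 16, 17, 18} \<sigma> \<sigma>1" using l by (simp add: lvl_def)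
      have f2: "frame {3, 4} {4, 5, 9} \<sigma>1 \<sigma>'" using c by (simp add: cpd_def)
      have "Q \<sigma>' (u - 2)"
      proof (rule Q)
        show "frame {2..23} {4, 5, 6, 7, 9, 10, 11, 12, 13, 14, 15, 16, 17, 18} \<sigma> \<sigma>'"
          using frame_trans[OF frame_mono[OF f1] frame_mono[OF f2], of "{2..23}" "{4, 5, 6, 7, 9, 10, 11, 12, 13, 14, 15, 16, 17, 18}"] by auto
        have "ar \<sigma>1 4 = ar \<sigma> 4" "ar \<sigma>1 5 = ar \<sigma> 5" using f1 by (simp_all add: frame_def)
        then show "refined (smp \<sigma>) (ar \<sigma> 4) (ar \<sigma> 5) (ar \<sigma>' 4) (ar \<sigma>' 5)"
          using c l vis unfolding refined_def cpd_def lvl_def by auto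
        show "ar \<sigma>' 16 j = 0" if "1 \<le> j" for j using that l f2 by (simp add: lvl_def frame_def)
        show "ar \<sigma>' 9 v = 0" if "v \<in> VV" for v using that c by (simp add: cpd_def)
        show "K \<le> u - 2" using u by simp
      qed
      then show "2 \<le> u \<and> Q \<sigma>' (u - 2)" using u by simp
    qed
    then show "2 \<le> u \<and> okk (edge_loop (4 ::= tl_exp (V 3) ;; take_com ;; 4 ::= hd_exp (V 3) ;; take_com)) \<sigma>1 (u - 2) Q" using u by simp
  qed
  then show ?thesis using t by (simp add: refine_com_def ok_Seq[of _ _ "_ ::= _"] ok_Seq[of _ _ "edge_loop _"] okk_Assign evs le_diff_pos \<tau>_def)
qed

end

section \<open>Ranks against real capacities: correctness of an output code\<close>

section \<open>Bottleneck capacities and ranks\<close>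

context inst
begin

lemma cas_append:
  "pre_digraph.cas (with_proj G) u (p @ [e]) v \<longleftrightarrow> pre_digraph.cas (with_proj G) u p (fst e) \<and> snd e = v"
  by (induction p arbitrary: u) (auto simp: pre_digraph.cas.simps)

lemma edge_code: "e \<in> parcs G \<Longrightarrow> \<exists>d\<in>{1..m}. es ! (d - 1) = e"
proof -
  assume "e \<in> parcs G"
  then have "e \<in> set es" using inst by (simp add: ssbp_instance_def)
  then obtain i where "i < m" "es ! i = e" by (auto simp: in_set_conv_nth m_def)
  then show ?thesis by (intro bexI[of _ "i + 1"]) auto
qed

lemma code_edge: "d \<in> {1..m} \<Longrightarrow> es ! (d - 1) \<in> parcs G"
proof -
  assume d: "d \<in> {1..m}"
  then have "es ! (d - 1) \<in> set es" by (intro nth_mem) (auto simp: m_def)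
  then show ?thesis using inst by (simp add: ssbp_instance_def)
qed

lemma walk_reach:
  assumes "pre_digraph.cas (with_proj G) u p v" "set p \<subseteq> parcs G" "\<And>d. d \<in> {1..m} \<Longrightarrow> es ! (d - 1) \<in> set p \<Longrightarrow> t \<le> rk d"
  shows "(u, v) \<in> {(T c, H c) | c. c \<in> {1..m} \<and> t \<le> rk c}\<^sup>*"
  using assms
proof (induction p arbitrary: u)
  case Nil
  then show ?case by (simp add: pre_digraph.cas.simps)
next
  case (Cons e p)
  have e: "fst e = u" "pre_digraph.cas (with_proj G) (snd e) p v" using Cons.prems(1) by (auto simp: pre_digraph.cas.simps)
  obtain d where d: "d \<in> {1..m}" "es ! (d - 1) = e" using edge_code[of e] Cons.prems(2) by (metis list.set_intros(1) subsetD)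
  have "t \<le> rk d" using Cons.prems(3)[OF d(1)] d(2) by simp
  then have "(u, snd e) \<in> {(T c, H c) | c. c \<in> {1..m} \<and> t \<le> rk c}" using d e by (auto simp: T_def H_def intro!: exI[of _ d])
  moreover have "(snd e, v) \<in> {(T c, H c) | c. c \<in> {1..m} \<and> t \<le> rk c}\<^sup>*"
    by (rule Cons.IH[OF e(2)]) (use Cons.prems in auto)
  ultimately show ?case by (rule converse_rtrancl_into_rtrancl)
qed

lemma reach_walk:
  assumes "(s, v) \<in> {(T c, H c) | c. c \<in> {1..m} \<and> t \<le> rk c}\<^sup>*"
  shows "\<exists>p. pre_digraph.cas (with_proj G) s p v \<and> set p \<subseteq> parcs G \<and> (\<forall>e\<in>set p. \<exists>d\<in>{1..m}. es ! (d - 1) = e \<and> t \<le> rk d)"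
  using assms
proof (induction rule: rtrancl_induct)
  case base
  show ?case by (intro exI[of _ "[]"]) (simp add: pre_digraph.cas.simps)
next
  case (step y z)
  then obtain p c where p: "pre_digraph.cas (with_proj G) s p y" "set p \<subseteq> parcs G" "\<forall>e\<in>set p. \<exists>d\<in>{1..m}. es ! (d - 1) = e \<and> t \<le> rk d"
    and c: "c \<in> {1..m}" "t \<le> rk c" "y = T c" "z = H c" by auto
  show ?case
    by (rule exI[of _ "p @ [es ! (c - 1)]"]) (use p c code_edge in \<open>auto simp: cas_append T_def H_def\<close>)
qed

lemma awalk_iff: "pre_digraph.awalk (with_proj G) s p v \<longleftrightarrow> set p \<subseteq> parcs G \<and> pre_digraph.cas (with_proj G) s p v"
  using inst by (auto simp: pre_digraph.awalk_def ssbp_instance_def)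

lemma weight_mono: "c \<in> {1..m} \<Longrightarrow> d \<in> {1..m} \<Longrightarrow> rk c \<le> rk d \<Longrightarrow> w (es ! (c - 1)) \<le> w (es ! (d - 1))"
  by (subst (asm) rk_mono_iff) (auto simp: ele_def)

text \<open>A path of edges of rank at least \<open>B v\<close> gives one inequality. Conversely, a
  path whose edges all exceed \<open>B v\<close> in rank would contradict the maximality of
  \<open>B v\<close>, so every path has an edge no heavier than \<open>c\<close>. For the source,
  the empty path has capacity infinity.\<close>

lemma output_bottleneck:
  assumes c: "c \<le> Suc m" "rk c = B v"
  shows "output_value es w c = bottleneck G w s v"
proof (cases "v = s")
  case True
  have "rk c = rk (Suc m)" using c True by simp
  then have "c = Suc m" using rk_eq_iff[OF c(1), of "Suc m"] by simp
  then have o: "output_value es w c = \<infinity>" by (simp add: output_value_def m_def)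
  have "[] \<in> {p. pre_digraph.awalk (with_proj G) s p v}" using True by (simp add: awalk_iff pre_digraph.cas.simps)
  then have "capacity w [] \<le> bottleneck G w s v" unfolding bottleneck_def by (rule SUP_upper)
  then show ?thesis using o by (simp add: capacity_def top_ereal_def)
next
  case False
  have B: "B v < Suc m" using B_top[of v] B_le[of v] False by fastforce
  have cm: "c \<le> m"
  proof (rule ccontr)
    assume "\<not> c \<le> m"
    then have "c = Suc m" using c by simp
    then show False using c B by simp
  qed
  show ?thesis
  proof (rule antisym)
    show "output_value es w c \<le> bottleneck G w s v"
    proof (cases "c = 0")
      case True
      then show ?thesis by (simp add: output_value_def)
    next
      case c0: False
      then have ci: "c \<in> {1..m}" using cm by simp
      then have "reach (rk c) v" using le_B_iff[of "rk c" v] rk_bounds[OF ci] c by simp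
      then obtain p where p: "pre_digraph.cas (with_proj G) s p v" "set p \<subseteq> parcs G" "\<forall>e\<in>set p. \<exists>d\<in>{1..m}. es ! (d - 1) = e \<and> rk c \<le> rk d"
        using reach_walk unfolding reach_def by blast
      have "ereal (w (es ! (c - 1))) \<le> capacity w p"
        unfolding capacity_def using p(3) weight_mono[OF ci] by (intro INF_greatest) fastforce
      also have "\<dots> \<le> bottleneck G w s v" unfolding bottleneck_def using p by (intro SUP_upper) (simp add: awalk_iff)
      finally show ?thesis using ci by (simp add: output_value_def m_def)
    qed
    show "bottleneck G w s v \<le> output_value es w c"
      unfolding bottleneck_def
    proof (rule SUP_least)
      fix p assume "p \<in> {p. pre_digraph.awalk (with_proj G) s p v}"
      then have p: "pre_digraph.cas (with_proj G) s p v" "set p \<subseteq> parcs G" by (simp_all add: awalk_iff)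
      have "\<exists>d\<in>{1..m}. es ! (d - 1) \<in> set p \<and> \<not> B v + 1 \<le> rk d"
      proof (rule ccontr)
        assume "\<not> ?thesis"
        then have "reach (B v + 1) v" unfolding reach_def by (intro walk_reach[OF p]) blast
        then show False using le_B_iff[of "B v + 1" v] B by simp
      qed
      then obtain d where d: "d \<in> {1..m}" "es ! (d - 1) \<in> set p" "rk d \<le> rk c" using c by auto
      have c0: "c \<noteq> 0" using rk_bounds[OF d(1)] d(3) by (intro notI) simp
      then have ci: "c \<in> {1..m}" using cm by simp
      have "capacity w p \<le> ereal (w (es ! (d - 1)))" unfolding capacity_def using d(2) by (intro INF_lower)
      also have "\<dots> \<le> ereal (w (es ! (c - 1)))" using weight_mono[OF d(1) ci d(3)] by simp
      finally show "capacity w p \<le> output_value es w c" using ci by (simp add: output_value_def m_def)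
    qed
  qed
qed

end

section \<open>Independent samples: expectations, two tail bounds, and failure probabilities of
  random draws\<close>

section \<open>Sampling\<close>

text \<open>\<open>expd q c k F S\<close> is the expectation of \<open>F\<close> over the set that arises from \<open>S\<close> by adding
  each of \<open>c, \<dots>, c + k - 1\<close> independently with probability \<open>1 / q\<close>.\<close>
fun expd :: "nat \<Rightarrow> nat \<Rightarrow> nat \<Rightarrow> (nat set \<Rightarrow> real) \<Rightarrow> nat set \<Rightarrow> real" where
  "expd q c 0 F S = F S"
| "expd q c (Suc k) F S = (expd q (c + 1) k F (insert c S) + (real q - 1) * expd q (c + 1) k F S) / real q"

lemma expd_mono:
  assumes "1 \<le> q" "\<And>S. F S \<le> F' S" shows "expd q c k F S \<le> expd q c k F' S"
proof (induction k arbitrary: c S)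
  case (Suc k)
  show ?case unfolding expd.simps
    using assms(1) Suc.IH[of "c + 1" "insert c S"] Suc.IH[of "c + 1" S] by (intro divide_right_mono add_mono mult_left_mono) auto
qed (simp add: assms)

lemma expd_add: "expd q c k (\<lambda>S. F S + F' S) S = expd q c k F S + expd q c k F' S"
  by (induction k arbitrary: c S) (auto simp: add_divide_distrib diff_divide_distrib algebra_simps)

lemma expd_0: "expd q c k (\<lambda>S. 0) S = 0"
  by (induction k arbitrary: c S) auto

lemma expd_sum: "finite A \<Longrightarrow> expd q c k (\<lambda>S. \<Sum>i\<in>A. F i S) S = (\<Sum>i\<in>A. expd q c k (F i) S)"
proof (induction A rule: finite_induct)
  case empty
  show ?case by (simp add: expd_0)
qed (simp add: expd_add)

lemma expd_scale: "expd q c k (\<lambda>S. a * F S) S = a * expd q c k F S"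
  by (induction k arbitrary: c S) (auto simp: algebra_simps add_divide_distrib)

lemma expd_nonneg:
  assumes "1 \<le> q" "\<And>S. 0 \<le> F S" shows "0 \<le> expd q c k F S"
  using assms by (induction k arbitrary: c S) auto

lemma interval_Suc: "{c..<c + Suc k} = insert c {c + 1..<c + 1 + k}"
  by auto

text \<open>Every element of \<open>A\<close> that is still to be drawn is missed with probability
  \<open>1 - 1 / q\<close>, independently of the others.\<close>

lemma expd_hit:
  assumes q: "1 \<le> q" and A: "finite A"
  shows "expd q c k (\<lambda>S. of_bool (S \<inter> A = {})) S \<le> of_bool (S \<inter> A = {}) * (1 - 1 / real q) ^ card (A \<inter> {c..<c + k})"
proof (induction k arbitrary: c S)
  case (Suc k)
  have e: "A \<inter> {c..<c + Suc k} = (if c \<in> A then insert c (A \<inter> {c + 1..<c + 1 + k}) else A \<inter> {c + 1..<c + 1 + k})"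
    unfolding interval_Suc by auto
  have ce: "card (A \<inter> {c..<c + Suc k}) = (if c \<in> A then 1 else 0) + card (A \<inter> {c + 1..<c + 1 + k})"
    unfolding e using A by simp
  define X where "X = (1 - 1 / real q) ^ card (A \<inter> {c + 1..<c + 1 + k})"
  have X0: "0 \<le> X" unfolding X_def using q by (intro zero_le_power) (simp add: field_simps)
  have q1: "0 \<le> real q - 1" using q by simp
  have "expd q c (Suc k) (\<lambda>S. of_bool (S \<inter> A = {})) S \<le>
     (of_bool (insert c S \<inter> A = {}) * X + (real q - 1) * (of_bool (S \<inter> A = {}) * X)) / real q"
    unfolding expd.simps X_def by (intro divide_right_mono add_mono mult_left_mono Suc.IH q1) simp_all
  also have "\<dots> \<le> of_bool (S \<inter> A = {}) * ((1 - 1 / real q) ^ (if c \<in> A then 1 else 0) * X)"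
    using q X0 by (auto simp: field_simps)
  finally show ?case unfolding ce power_add X_def by simp
qed simp

text \<open>The exponential moment for base 2 factorizes, with \<open>1 + 1 / q\<close> for each
  element of \<open>A\<close> still to be drawn. As \<open>S\<close> avoids the remaining codes,
  every insertion really adds an element.\<close>

lemma expd_pow2:
  assumes q: "1 \<le> q" and A: "finite A" and S: "finite S" "S \<inter> {c..<c + k} = {}"
  shows "expd q c k (\<lambda>S. 2 ^ card (S \<inter> A)) S = 2 ^ card (S \<inter> A) * (1 + 1 / real q) ^ card (A \<inter> {c..<c + k})"
  using S
proof (induction k arbitrary: c S)
  case (Suc k)
  have e: "A \<inter> {c..<c + Suc k} = (if c \<in> A then insert c (A \<inter> {c + 1..<c + 1 + k}) else A \<inter> {c + 1..<c + 1 + k})"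
    unfolding interval_Suc by auto
  have ce: "card (A \<inter> {c..<c + Suc k}) = (if c \<in> A then 1 else 0) + card (A \<inter> {c + 1..<c + 1 + k})"
    unfolding e using A by simp
  define X where "X = (1 + 1 / real q) ^ card (A \<inter> {c + 1..<c + 1 + k})"
  have d: "S \<inter> {c + 1..<c + 1 + k} = {}" "insert c S \<inter> {c + 1..<c + 1 + k} = {}" "c \<notin> S" using Suc.prems(2) by auto
  have "insert c S \<inter> A = (if c \<in> A then insert c (S \<inter> A) else S \<inter> A)" by auto
  then have ci: "card (insert c S \<inter> A) = (if c \<in> A then 1 else 0) + card (S \<inter> A)" using Suc.prems(1) d(3) by simp
  have "expd q c (Suc k) (\<lambda>S. 2 ^ card (S \<inter> A)) S =
     (2 ^ card (insert c S \<inter> A) * X + (real q - 1) * (2 ^ card (S \<inter> A) * X)) / real q"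
    unfolding expd.simps X_def using Suc.IH[of S "c + 1"] Suc.IH[of "insert c S" "c + 1"] Suc.prems(1) d by simp
  also have "\<dots> = 2 ^ card (S \<inter> A) * ((1 + 1 / real q) ^ (if c \<in> A then 1 else 0) * X)"
    unfolding ci using q by (auto simp: field_simps power_add)
  finally show ?case unfolding ce power_add X_def by simp
qed simp

lemma expd_one: "expd 1 c k (\<lambda>S. of_bool (\<not> {c0..<c + k} \<subseteq> S)) S = of_bool (\<not> {c0..<c} \<subseteq> S)" if "c0 \<le> c"
  using that
proof (induction k arbitrary: c S)
  case (Suc k)
  have "{c0..<c + 1} \<subseteq> insert c S \<longleftrightarrow> {c0..<c} \<subseteq> S"
  proof -
    have "{c0..<c + 1} = insert c {c0..<c}" using Suc.prems by auto
    then show ?thesis by auto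
  qed
  moreover have eq: "c + Suc k = c + 1 + k" by simp
  ultimately show ?case unfolding expd.simps eq using Suc.IH[of "c + 1" "insert c S"] Suc.prems by simp
qed simp

lemma exp_le_2_powr: "0 \<le> x \<Longrightarrow> exp x \<le> 2 powr (2 * x)" for x :: real
proof -
  assume x: "0 \<le> x"
  have "exp (1 / 2 :: real) \<le> 1 + 1 / 2 + (1 / 2)\<^sup>2" by (rule exp_bound) auto
  also have "\<dots> \<le> (2 :: real)" by (simp add: power2_eq_square)
  finally have "1 / 2 \<le> ln (2 :: real)" by (subst ln_ge_iff) auto
  then have "x * 1 \<le> x * (2 * ln 2)" by (intro mult_left_mono x) simp
  then show ?thesis by (simp add: powr_def algebra_simps)
qed

text \<open>A Chernoff bound: Markov's inequality for \<open>2 ^ card (S \<inter> A)\<close>. The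
  factor 2 at the mean comes from the crude estimate
  \<open>exp x \<le> 2 powr (2 * x)\<close>.\<close>

lemma markov_count:
  assumes q: "1 \<le> q" and A: "A \<subseteq> {1..m}" and a: "2 * real (card A) / real q + real D \<le> real a"
  shows "expd q 1 m (\<lambda>S. of_bool (a \<le> card (S \<inter> A))) {} \<le> 2 powr (- real D)"
proof -
  have fA: "finite A" using A finite_subset by blast
  have "(1 + 1 / real q) ^ card A \<le> exp (1 / real q) ^ card A" by (intro power_mono exp_ge_add_one_self) auto
  also have "\<dots> = exp (real (card A) / real q)" by (simp add: exp_of_nat_mult[symmetric])
  also have "\<dots> \<le> 2 powr (2 * (real (card A) / real q))" by (rule exp_le_2_powr) simp
  finally have b: "(1 + 1 / real q) ^ card A \<le> 2 powr (2 * (real (card A) / real q))" .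
  have "expd q 1 m (\<lambda>S. of_bool (a \<le> card (S \<inter> A))) {} \<le> expd q 1 m (\<lambda>S. (1 / 2 ^ a) * 2 ^ card (S \<inter> A)) {}"
    by (rule expd_mono[OF q]) (auto simp: field_simps intro!: power_increasing)
  also have "\<dots> = (1 / 2 ^ a) * (1 + 1 / real q) ^ card (A \<inter> {1..<1 + m})"
    unfolding expd_scale using expd_pow2[OF q fA, of "{}" 1 m] by simp
  also have "A \<inter> {1..<1 + m} = A" using A by auto
  also have "1 / 2 ^ a * (1 + 1 / real q) ^ card A \<le> 1 / 2 ^ a * 2 powr (2 * (real (card A) / real q))" by (rule mult_left_mono[OF b]) simp
  also have "\<dots> = 2 powr (2 * real (card A) / real q - real a)"
    by (simp add: powr_diff powr_realpow)
  also have "\<dots> \<le> 2 powr (- real D)" using a by (intro powr_mono) auto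
  finally show ?thesis .
qed

text \<open>At least \<open>D * q\<close> independent misses have probability at most
  \<open>exp (- D)\<close>; this is weakened to base 2 to match the other tail bound.\<close>

lemma hit_bound:
  assumes q: "1 \<le> q" and A: "A \<subseteq> {1..m}" and a: "D * q \<le> card A"
  shows "expd q 1 m (\<lambda>S. of_bool (S \<inter> A = {})) {} \<le> 2 powr (- real D)"
proof -
  have fA: "finite A" using A finite_subset by blast
  have "expd q 1 m (\<lambda>S. of_bool (S \<inter> A = {})) {} \<le> (1 - 1 / real q) ^ card (A \<inter> {1..<1 + m})"
    using expd_hit[OF q fA, of 1 m "{}"] by simp
  also have "A \<inter> {1..<1 + m} = A" using A by auto
  also have "(1 - 1 / real q) ^ card A \<le> exp (- (1 / real q)) ^ card A"
    using exp_ge_add_one_self[of "- (1 / real q)"] q by (intro power_mono) (auto simp: field_simps)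
  also have "\<dots> = exp (- (real (card A) / real q))" by (simp add: exp_of_nat_mult[symmetric])
  also have "\<dots> \<le> exp (- real D)"
  proof -
    have "real D * real q \<le> real (card A)" using a by (simp flip: of_nat_mult)
    then show ?thesis using q by (simp add: field_simps)
  qed
  also have "\<dots> \<le> 2 powr (- real D)" using ln_2_less_1 by (simp add: powr_def mult_left_le)
  finally show ?thesis .
qed

text \<open>The failure bound is averaged over the drawn value, so different outcomes may carry
  different bounds. The command has the shape of a loop body that begins with a draw, followed by
  the loop; the two extra steps are the draw and the removal of its \<open>Skip\<close>.\<close>

lemma tri_Random:
  assumes "q = max 1 (eval_exp \<kappa> I \<sigma> a)" "\<And>k. k < q \<Longrightarrow> tri \<kappa> I (Seq c d) (\<sigma>\<lparr>regs := (regs \<sigma>)(r := k)\<rparr>) t (\<epsilon> k) Q"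
  shows "tri \<kappa> I (Seq (Seq (Random r a) c) d) \<sigma> (t + 2) ((\<Sum>k<q. \<epsilon> k) / of_nat q) Q"
proof -
  have q: "1 \<le> q" using assms(1) by simp
  have "steps \<kappa> I (t + 2) (Seq (Seq (Random r a) c) d, \<sigma>) =
     bind_pmf (pmf_of_set {..<q}) (\<lambda>k. steps \<kappa> I t (Seq c d, \<sigma>\<lparr>regs := (regs \<sigma>)(r := k)\<rparr>))"
    unfolding assms(1) by (simp add: numeral_2_eq_2 map_pmf_def bind_assoc_pmf bind_return_pmf)
  then have "emeasure (steps \<kappa> I (t + 2) (Seq (Seq (Random r a) c) d, \<sigma>)) (failing Q) =
     (\<integral>\<^sup>+k. emeasure (steps \<kappa> I t (Seq c d, \<sigma>\<lparr>regs := (regs \<sigma>)(r := k)\<rparr>)) (failing Q) \<partial>pmf_of_set {..<q})"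
    by (simp only: emeasure_bind_pmf)
  also have "\<dots> = (\<Sum>k<q. emeasure (steps \<kappa> I t (Seq c d, \<sigma>\<lparr>regs := (regs \<sigma>)(r := k)\<rparr>)) (failing Q)) / of_nat q"
    using q by (subst nn_integral_pmf_of_set) (auto simp: lessThan_empty_iff)
  also have "\<dots> \<le> (\<Sum>k<q. \<epsilon> k) / of_nat q"
    using assms(2) unfolding tri_def by (intro divide_right_mono_ennreal sum_mono) auto
  finally show ?thesis unfolding tri_def .
qed

lemma tri_1: "tri \<kappa> I c \<sigma> t 1 Q"
  by (simp add: tri_def emeasure_pmf_le_1)

lemma steps_halted: "fst y = Skip \<Longrightarrow> y \<in> set_pmf (steps \<kappa> I k x) \<Longrightarrow> y \<in> set_pmf (steps \<kappa> I (k + j) x)"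
  unfolding steps_add by (cases y) force

text \<open>A halted configuration stays in the support for ever, so it can be inspected after
  \<open>t\<close> further steps, when failing has probability 0.\<close>

lemma tri_0_sure:
  assumes "tri \<kappa> I c \<sigma> t 0 Q"
  shows "\<And>k x. x \<in> set_pmf (steps \<kappa> I k (c, \<sigma>)) \<Longrightarrow> halted x \<Longrightarrow> Q (snd x)"
    and "\<And>k. t \<le> k \<Longrightarrow> measure_pmf.prob (steps \<kappa> I k (c, \<sigma>)) {x. halted x} = 1"
proof -
  have z: "emeasure (steps \<kappa> I k (c, \<sigma>)) (failing Q) = 0" if "t \<le> k" for k
    using failing_antimono_steps[of \<kappa> I t "k - t" "(c, \<sigma>)" Q] assms that by (simp add: tri_def)
  have nf: "x \<notin> failing Q" if "t \<le> k" "x \<in> set_pmf (steps \<kappa> I k (c, \<sigma>))" for k x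
    using z[OF that(1)] that(2) by (auto simp: measure_pmf.emeasure_eq_measure measure_pmf_zero_iff)
  show "Q (snd x)" if x: "x \<in> set_pmf (steps \<kappa> I k (c, \<sigma>))" and h: "halted x" for k x
  proof -
    have "x \<in> set_pmf (steps \<kappa> I (k + t) (c, \<sigma>))" using steps_halted h x by (simp add: halted_def)
    then show ?thesis using nf[of "k + t" x] by (simp add: failing_def)
  qed
  show "measure_pmf.prob (steps \<kappa> I k (c, \<sigma>)) {x. halted x} = 1" if "t \<le> k" for k
    using nf[OF that] by (subst measure_pmf.prob_eq_1) (auto simp: AE_measure_pmf_iff failing_def halted_def)
qed

lemma tri_prob:
  assumes "tri \<kappa> I c \<sigma> t (ennreal e) Q" "t \<le> k" "0 \<le> e"
  shows "1 - e \<le> measure_pmf.prob (steps \<kappa> I k (c, \<sigma>)) {x. halted x}"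
proof -
  let ?p = "steps \<kappa> I k (c, \<sigma>)"
  have "emeasure ?p (failing Q) \<le> ennreal e"
    using failing_antimono_steps[of \<kappa> I t "k - t" "(c, \<sigma>)" Q] assms by (simp add: tri_def)
  then have e: "measure_pmf.prob ?p (failing Q) \<le> e" using assms(3) by (simp add: measure_pmf.emeasure_eq_measure)
  have "UNIV - failing Q \<subseteq> {x. halted x}" by (auto simp: failing_def halted_def)
  then have "measure_pmf.prob ?p (UNIV - failing Q) \<le> measure_pmf.prob ?p {x. halted x}"
    by (intro measure_pmf.finite_measure_mono) auto
  moreover have "measure_pmf.prob ?p (UNIV - failing Q) = 1 - measure_pmf.prob ?p (failing Q)"
    using measure_pmf.prob_compl[of "failing Q" ?p] by simp
  ultimately show ?thesis using e by simp
qed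

section \<open>Random tapes and the loop over the sampling rates\<close>

section \<open>All levels\<close>

text \<open>An entry is uniform below the value \<open>q\<close> of register 1, so it is 0 with
  probability \<open>1 / q\<close>. For \<open>q = 1\<close> all entries are 0, which makes the
  sample complete.\<close>

definition draw_loop :: com where
  "draw_loop = While (Leq (V 3) NumEdges)
     (Random 10 (V 1) ;; put 8 (V 3) (V 10) ;; 3 ::= Plus (V 3) (N 1))"

definition tape_com :: com where "tape_com = 3 ::= N 1 ;; draw_loop"

definition levels_com :: com where
  "levels_com = tape_com ;; While (Leq (N 1) (V 1)) (refine_com ;; 1 ::= Quot (V 1) (V 0) ;; tape_com)"

context inst
begin

abbreviation trp :: "com \<Rightarrow> state \<Rightarrow> nat \<Rightarrow> ennreal \<Rightarrow> (state \<Rightarrow> bool) \<Rightarrow> bool" where "trp \<equiv> tri 10 I"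

text \<open>The codes below register 3 are drawn already, and \<open>expd\<close> averages over the
  rest; its recursion is one round of the loop seen through \<open>tri_Random\<close>. The predicate
  \<open>bad\<close> is arbitrary, so that the failure event can be chosen by the caller.\<close>

lemma tri_draw:
  assumes "q = max 1 (rg \<sigma> 1)" "k + rg \<sigma> 3 = m + 1" "1 \<le> rg \<sigma> 3"
  shows "trp draw_loop \<sigma> (12 * k + 2) (ennreal (expd q (rg \<sigma> 3) k (\<lambda>S. of_bool (bad S)) (smp \<sigma> \<inter> {1..<rg \<sigma> 3})))
    (\<lambda>\<sigma>'. frame {3, 10} {8} \<sigma> \<sigma>' \<and> \<not> bad (smp \<sigma>' \<inter> {1..m}))"
  using assms
proof (induction k arbitrary: \<sigma>)
  case 0
  have r3: "rg \<sigma> 3 = m + 1" using 0 by simp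
  have i: "{1..<rg \<sigma> 3} = {1..m}" unfolding r3 by auto
  show ?case
  proof (cases "bad (smp \<sigma> \<inter> {1..m})")
    case True
    then show ?thesis unfolding i by (simp add: tri_1)
  next
    case False
    have "\<not> te \<sigma> (Leq (V 3) NumEdges)" using r3 by (simp add: te_Leq evs)
    moreover have "12 * 0 + 2 = (2 :: nat)" by simp
    ultimately show ?thesis unfolding draw_loop_def using False by (simp only: tri_While_false frame_refl simp_thms)
  qed
next
  case (Suc k)
  define c where "c = rg \<sigma> 3"
  define S where "S = smp \<sigma> \<inter> {1..<c}"
  define Q where "Q = (\<lambda>\<sigma>'. frame {3, 10} {8} \<sigma> \<sigma>' \<and> \<not> bad (smp \<sigma>' \<inter> {1..m}))"
  define F where "F = (\<lambda>S. expd q (c + 1) k (\<lambda>S. of_bool (bad S)) S)"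
  have c: "1 \<le> c" "c \<le> m" "k + (c + 1) = m + 1" using Suc.prems by (simp_all add: c_def)
  have q1: "1 \<le> q" using Suc.prems by simp
  have F0: "0 \<le> F S" for S unfolding F_def by (rule expd_nonneg[OF q1]) simp
  have b: "trp (Seq (put 8 (V 3) (V 10) ;; 3 ::= Plus (V 3) (N 1)) draw_loop) (\<sigma>\<lparr>regs := (rg \<sigma>)(10 := j)\<rparr>) (12 * k + 6)
      (ennreal (if j = 0 then F (insert c S) else F S)) Q" for j
  proof -
    define \<tau> where "\<tau> = srg 3 (c + 1) (sar 8 c j (srg 10 j \<sigma>))"
    have "okk (put 8 (V 3) (V 10) ;; 3 ::= Plus (V 3) (N 1)) (srg 10 j \<sigma>) 3 (\<lambda>\<sigma>' _. \<sigma>' = \<tau>)"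
      using c W_ge by (simp add: okk evs \<tau>_def c_def)
    then have 1: "trp (put 8 (V 3) (V 10) ;; 3 ::= Plus (V 3) (N 1)) (srg 10 j \<sigma>) 3 0 (\<lambda>\<sigma>'. \<sigma>' = \<tau>)"
      by (rule ok_imp_tri)
    have IH: "trp draw_loop \<tau> (12 * k + 2) (ennreal (expd q (rg \<tau> 3) k (\<lambda>S. of_bool (bad S)) (smp \<tau> \<inter> {1..<rg \<tau> 3})))
      (\<lambda>\<sigma>'. frame {3, 10} {8} \<tau> \<sigma>' \<and> \<not> bad (smp \<sigma>' \<inter> {1..m}))"
      by (rule Suc.IH) (use Suc.prems c in \<open>simp_all add: \<tau>_def\<close>)
    have r3: "rg \<tau> 3 = c + 1" by (simp add: \<tau>_def)
    have sm: "smp \<tau> \<inter> {1..<c + 1} = (if j = 0 then insert c S else S)"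
      using c by (auto simp: \<tau>_def smp_def S_def ar_sar)
    have frt: "frame {3, 10} {8} \<sigma> \<tau>" by (simp add: \<tau>_def)
    have 2: "trp draw_loop \<tau> (12 * k + 2) (ennreal (if j = 0 then F (insert c S) else F S)) Q"
    proof (rule tri_mono[OF IH order_refl])
      show "ennreal (expd q (rg \<tau> 3) k (\<lambda>S. of_bool (bad S)) (smp \<tau> \<inter> {1..<rg \<tau> 3})) \<le> ennreal (if j = 0 then F (insert c S) else F S)"
        unfolding r3 sm F_def by simp
      show "Q \<sigma>'" if "frame {3, 10} {8} \<tau> \<sigma>' \<and> \<not> bad (smp \<sigma>' \<inter> {1..m})" for \<sigma>'
        using that frame_trans[OF frt] by (auto simp: Q_def)
    qed
    have "trp (Seq (put 8 (V 3) (V 10) ;; 3 ::= Plus (V 3) (N 1)) draw_loop) (srg 10 j \<sigma>) (3 + (12 * k + 2) + 1)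
      (0 + ennreal (if j = 0 then F (insert c S) else F S)) Q"
      by (rule tri_Seq[OF 1]) (simp only: 2)
    then show ?thesis by (simp add: srg_def add.commute)
  qed
  have w1: "trp (Seq (Random 10 (V 1) ;; put 8 (V 3) (V 10) ;; 3 ::= Plus (V 3) (N 1)) draw_loop) \<sigma> (12 * k + 6 + 2)
     ((\<Sum>j<q. ennreal (if j = 0 then F (insert c S) else F S)) / of_nat q) Q"
    by (rule tri_Random) (use Suc.prems b in \<open>simp_all add: evs\<close>)
  have E: "(\<Sum>j<q. ennreal (if j = 0 then F (insert c S) else F S)) / of_nat q =
     ennreal ((F (insert c S) + (real q - 1) * F S) / real q)"
  proof -
    obtain q' where q': "q = Suc q'" using q1 by (cases q) auto
    have A: "(\<Sum>j<q. if j = 0 then F (insert c S) else F S) = F (insert c S) + (real q - 1) * F S"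
      unfolding q' by (subst sum.lessThan_Suc_shift) simp
    have B: "(\<Sum>j<q. ennreal (if j = 0 then F (insert c S) else F S)) = ennreal (\<Sum>j<q. if j = 0 then F (insert c S) else F S)"
      by (rule sum_ennreal) (simp add: F0)
    have C: "(of_nat q :: ennreal) = ennreal (real q)" by (simp add: ennreal_of_nat_eq_real_of_nat)
    have nn: "0 \<le> F (insert c S) + (real q - 1) * F S" using F0 q1 by simp
    show ?thesis unfolding B A C by (rule divide_ennreal) (use nn q1 in auto)
  qed
  have "trp (Seq (Random 10 (V 1) ;; put 8 (V 3) (V 10) ;; 3 ::= Plus (V 3) (N 1)) draw_loop) \<sigma> (12 * k + 8)
     (ennreal (expd q c (Suc k) (\<lambda>S. of_bool (bad S)) S)) Q" by (rule tri_mono[OF w1[unfolded E]]) (simp_all add: F_def)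
  moreover have "te \<sigma> (Leq (V 3) NumEdges)" using c by (simp add: te_Leq evs c_def)
  ultimately have "trp draw_loop \<sigma> (12 * k + 8 + 2) (ennreal (expd q c (Suc k) (\<lambda>S. of_bool (bad S)) S)) Q"
    unfolding draw_loop_def by (intro tri_While_true)
  then show ?case unfolding Q_def S_def c_def by (rule tri_mono) auto
qed

lemma tri_tape:
  "trp tape_com \<sigma> (12 * m + 10) (ennreal (expd (max 1 (rg \<sigma> 1)) 1 m (\<lambda>S. of_bool (bad S)) {}))
    (\<lambda>\<sigma>'. frame {3, 10} {8} \<sigma> \<sigma>' \<and> \<not> bad (smp \<sigma>' \<inter> {1..m}))"
proof -
  have 1: "trp (3 ::= N 1) \<sigma> 1 0 (\<lambda>\<sigma>'. \<sigma>' = srg 3 1 \<sigma>)" by (rule ok_imp_tri) (simp add: okk evs)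
  have "trp tape_com \<sigma> (1 + (12 * m + 2) + 1) (0 + ennreal (expd (max 1 (rg \<sigma> 1)) 1 m (\<lambda>S. of_bool (bad S)) {}))
    (\<lambda>\<sigma>'. frame {3, 10} {8} \<sigma> \<sigma>' \<and> \<not> bad (smp \<sigma>' \<inter> {1..m}))"
    unfolding tape_com_def
  proof (rule tri_Seq[OF 1])
    fix \<sigma>' assume e: "\<sigma>' = srg 3 1 \<sigma>"
    have "trp draw_loop \<sigma>' (12 * m + 2) (ennreal (expd (max 1 (rg \<sigma> 1)) (rg \<sigma>' 3) m (\<lambda>S. of_bool (bad S)) (smp \<sigma>' \<inter> {1..<rg \<sigma>' 3})))
      (\<lambda>\<sigma>''. frame {3, 10} {8} \<sigma>' \<sigma>'' \<and> \<not> bad (smp \<sigma>'' \<inter> {1..m}))"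
      by (rule tri_draw) (simp_all add: e)
    then show "trp draw_loop \<sigma>' (12 * m + 2) (ennreal (expd (max 1 (rg \<sigma> 1)) 1 m (\<lambda>S. of_bool (bad S)) {}))
      (\<lambda>\<sigma>'. frame {3, 10} {8} \<sigma> \<sigma>' \<and> \<not> bad (smp \<sigma>' \<inter> {1..m}))"
      by (rule tri_mono) (auto simp: e frame_def)
  qed
  then show ?thesis by (rule tri_mono) auto
qed

definition LI :: "nat \<Rightarrow> state \<Rightarrow> bool" where
  "LI D \<sigma> \<longleftrightarrow> good (ar \<sigma> 4) (ar \<sigma> 5) \<and> adj \<sigma> \<and> (\<forall>j\<ge>1. ar \<sigma> 16 j = 0) \<and> (\<forall>v\<in>VV. ar \<sigma> 9 v = 0) \<and> rg \<sigma> 0 = D"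

definition fin :: "state \<Rightarrow> state \<Rightarrow> bool" where
  "fin \<sigma> \<sigma>' \<longleftrightarrow> (\<forall>v. ar \<sigma>' 4 v \<le> Suc m) \<and> (\<forall>v\<in>VV. rk (ar \<sigma>' 4 v) = B v) \<and> (\<forall>t<n. mem \<sigma>' t = mem \<sigma> t)"

text \<open>\<open>smp\<close> is a set of arbitrary cell indices with entry 0, not only of edge
  codes. Thresholds see just its part in \<open>{1..m}\<close>, and only that part can be
  counted.\<close>

lemma restr: "keys (S \<inter> {1..m}) lo hi = keys S lo hi" "refined (S \<inter> {1..m}) lo hi = refined S lo hi"
proof -
  show k: "keys (S \<inter> {1..m}) lo hi = keys S lo hi" by (auto simp: keys_def fun_eq_iff)
  show "refined (S \<inter> {1..m}) lo hi = refined S lo hi"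
    by (intro ext) (simp add: refined_def nlo_def nhi_def k)
qed

text \<open>The refined ends as functions of the sample. They are fixed before the next tape is
  drawn, so the failure event of that tape may depend on them.\<close>

definition nl :: "nat set \<Rightarrow> (nat \<Rightarrow> nat) \<Rightarrow> (nat \<Rightarrow> nat) \<Rightarrow> nat \<Rightarrow> nat" where
  "nl S lo hi v = (if v \<in> VV then nlo S lo hi v else lo v)"

definition nh :: "nat set \<Rightarrow> (nat \<Rightarrow> nat) \<Rightarrow> (nat \<Rightarrow> nat) \<Rightarrow> nat \<Rightarrow> nat" where
  "nh S lo hi v = (if v \<in> VV then nhi S lo hi v else hi v)"

lemma refined_iff: "refined S lo hi lo' hi' \<longleftrightarrow> lo' = nl S lo hi \<and> hi' = nh S lo hi"
  by (auto simp: refined_def nl_def nh_def fun_eq_iff)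

text \<open>The tape of the next level is drawn at the end of a round, hence \<open>bad\<close>
  speaks of the next sample while the time bound speaks of the current one. The cost of dying edges
  is expressed as a drop of \<open>Psi\<close>, so that it telescopes over the rounds.\<close>

lemma tri_body:
  assumes li: "LI D \<sigma>" and kb: "\<And>v. v \<in> VV \<Longrightarrow> card (keys (smp \<sigma>) (ar \<sigma> 4) (ar \<sigma> 5) v) + 1 \<le> 2 ^ \<Lambda>"
    and lo': "lo' = nl (smp \<sigma>) (ar \<sigma> 4) (ar \<sigma> 5)" "hi' = nh (smp \<sigma>) (ar \<sigma> 4) (ar \<sigma> 5)" and q: "q = rg \<sigma> 1 div D"
    and e: "expd (max 1 q) 1 m (\<lambda>S. of_bool (bad S)) {} \<le> e"
  shows "trp (refine_com ;; 1 ::= Quot (V 1) (V 0) ;; tape_com) \<sigma>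
    (900 * m + 90 + (80 * \<Lambda> + 40) * card (smp \<sigma> \<inter> {1..m}) + (60 * \<Lambda> + 120) * (Psi (ar \<sigma> 4) - Psi lo')) (ennreal e)
    (\<lambda>\<sigma>'. LI D \<sigma>' \<and> ar \<sigma>' 4 = lo' \<and> ar \<sigma>' 5 = hi' \<and> rg \<sigma>' 1 = q \<and> \<not> bad (smp \<sigma>' \<inter> {1..m}) \<and> (\<forall>t<n. mem \<sigma>' t = mem \<sigma> t))"
proof -
  define lo hi S where "lo = ar \<sigma> 4" and "hi = ar \<sigma> 5" and "S = smp \<sigma>"
  have g: "good lo hi" and ad: "adj \<sigma>" and z: "\<And>j. 1 \<le> j \<Longrightarrow> ar \<sigma> 16 j = 0" "\<And>v. v \<in> VV \<Longrightarrow> ar \<sigma> 9 v = 0" and r0: "rg \<sigma> 0 = D"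
    using li by (auto simp: LI_def lo_def hi_def)
  have rf: "refined S lo hi lo' hi'" by (simp add: refined_iff lo' lo_def hi_def S_def)
  define c0 where "c0 = (\<Sum>v\<in>VV. wt \<Lambda> S lo hi v) + 60 * m + 20"
  have "card (D1 S lo hi) + card (D3 S lo hi) \<le> Psi lo - Psi lo'" using Psi_refined[OF g rf] by linarith
  then have "(60 * \<Lambda> + 120) * (card (D1 S lo hi) + card (D3 S lo hi)) \<le> (60 * \<Lambda> + 120) * (Psi lo - Psi lo')" by (rule mult_le_mono2)
  then have c0: "c0 \<le> 860 * m + 20 + (80 * \<Lambda> + 40) * card (S \<inter> {1..m}) + (60 * \<Lambda> + 120) * (Psi lo - Psi lo')"
    using wt_VV[of \<Lambda> S lo hi] unfolding c0_def by linarith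
  define P1 where "P1 = (\<lambda>\<sigma>'. frame {2..23} {4, 5, 6, 7, 9, 10, 11, 12, 13, 14, 15, 16, 17, 18} \<sigma> \<sigma>' \<and> refined S lo hi (ar \<sigma>' 4) (ar \<sigma>' 5) \<and>
     (\<forall>j\<ge>1. ar \<sigma>' 16 j = 0) \<and> (\<forall>v\<in>VV. ar \<sigma>' 9 v = 0))"
  have "okk refine_com \<sigma> c0 (\<lambda>\<sigma>' _. P1 \<sigma>')"
    by (rule okk_refine[where \<Lambda> = \<Lambda> and K = 0]) (use g ad kb z in \<open>auto simp: lo_def hi_def S_def c0_def P1_def\<close>)
  then have 1: "trp refine_com \<sigma> c0 0 P1" by (rule ok_imp_tri)
  have 2: "trp (1 ::= Quot (V 1) (V 0)) \<sigma>1 1 0 (\<lambda>\<sigma>'. \<sigma>' = srg 1 (rg \<sigma>1 1 div rg \<sigma>1 0) \<sigma>1)" for \<sigma>1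
    by (rule ok_imp_tri) (simp add: okk_Assign evs)
  define Q where "Q = (\<lambda>\<sigma>'. LI D \<sigma>' \<and> ar \<sigma>' 4 = lo' \<and> ar \<sigma>' 5 = hi' \<and> rg \<sigma>' 1 = q \<and> \<not> bad (smp \<sigma>' \<inter> {1..m}) \<and> (\<forall>t<n. mem \<sigma>' t = mem \<sigma> t))"
  have 3: "trp (1 ::= Quot (V 1) (V 0) ;; tape_com) \<sigma>1 (1 + (12 * m + 10) + 1) (0 + ennreal e) Q" if p: "P1 \<sigma>1" for \<sigma>1
  proof (rule tri_Seq[OF 2])
    fix \<sigma>2 assume s2: "\<sigma>2 = srg 1 (rg \<sigma>1 1 div rg \<sigma>1 0) \<sigma>1"
    have f1: "frame {2..23} {4, 5, 6, 7, 9, 10, 11, 12, 13, 14, 15, 16, 17, 18} \<sigma> \<sigma>1" using p by (simp add: P1_def)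
    then have r: "rg \<sigma>1 1 = rg \<sigma> 1" "rg \<sigma>1 0 = D" using r0 by (simp_all add: frame_def)
    have lh: "ar \<sigma>1 4 = lo'" "ar \<sigma>1 5 = hi'" using p by (simp_all add: P1_def refined_iff lo' lo_def hi_def S_def)
    have g': "good lo' hi'" by (rule good_refined[OF g rf])
    have ad1: "adj \<sigma>1" using f1 ad by (simp add: adj_def frame_def)
    have mm: "mem \<sigma>1 t = mem \<sigma> t" if "t < n" for t using f1 that by (simp add: frame_def)
    have z1: "\<forall>j\<ge>1. ar \<sigma>1 16 j = 0" "\<forall>v\<in>VV. ar \<sigma>1 9 v = 0" using p by (auto simp: P1_def)
    have q2: "rg \<sigma>2 1 = q" by (simp add: s2 r q)
    have imp: "Q \<sigma>'" if "frame {3, 10} {8} \<sigma>2 \<sigma>' \<and> \<not> bad (smp \<sigma>' \<inter> {1..m})" for \<sigma>'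
    proof -
      have f: "frame {3, 10} {8} \<sigma>2 \<sigma>'" and nb: "\<not> bad (smp \<sigma>' \<inter> {1..m})" using that by auto
      have a: "ar \<sigma>' k = ar \<sigma>1 k" if "k < 32" "k \<noteq> 8" for k using f that by (simp add: frame_def s2)
      have "LI D \<sigma>'" unfolding LI_def adj_def using a g' lh z1 ad1[unfolded adj_def] f r by (simp add: frame_def s2)
      moreover have "rg \<sigma>' 1 = q" using f q2 by (simp add: frame_def)
      moreover have "mem \<sigma>' t = mem \<sigma> t" if "t < n" for t using f mm that by (simp add: frame_def s2)
      ultimately show ?thesis unfolding Q_def using nb a lh by simp
    qed
    show "trp tape_com \<sigma>2 (12 * m + 10) (ennreal e) Q"
      by (rule tri_mono[OF tri_tape[of \<sigma>2 bad]]) (use e q2 imp in \<open>auto intro!: ennreal_leI\<close>)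
  qed
  have "trp (refine_com ;; 1 ::= Quot (V 1) (V 0) ;; tape_com) \<sigma> (c0 + (1 + (12 * m + 10) + 1) + 1) (0 + (0 + ennreal e)) Q"
    by (rule tri_Seq[OF 1 3])
  then show ?thesis unfolding Q_def
    by (rule tri_mono) (use c0 in \<open>auto simp: lo_def S_def\<close>)
qed

text \<open>Abstract in the invariant \<open>iv\<close>, the failure events \<open>bb\<close>, the
  sample sizes \<open>sz\<close> and the error bounds \<open>\<epsilon>\<close>, so that it serves
  both the analysis that never fails and the fast one. Level \<open>i\<close> samples at rate
  \<open>1 / D ^ i\<close>; at level 0 all edges are sampled and \<open>nlo_complete\<close> yields
  exact values.\<close>

lemma tri_levels_loop:
  assumes D: "2 \<le> D"
    and A1: "\<And>i lo hi S v. good lo hi \<Longrightarrow> iv i lo hi \<Longrightarrow> \<not> bb i lo hi S \<Longrightarrow> S \<subseteq> {1..m} \<Longrightarrow> v \<in> VV \<Longrightarrow> card (keys S lo hi v) + 1 \<le> 2 ^ \<Lambda>"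
    and A2: "\<And>i lo hi S. good lo hi \<Longrightarrow> iv i lo hi \<Longrightarrow> \<not> bb i lo hi S \<Longrightarrow> S \<subseteq> {1..m} \<Longrightarrow> card S \<le> sz i"
    and A3: "\<And>i lo hi lo' hi' S. good lo hi \<Longrightarrow> iv (Suc i) lo hi \<Longrightarrow> \<not> bb (Suc i) lo hi S \<Longrightarrow> refined S lo hi lo' hi' \<Longrightarrow> iv i lo' hi'"
    and A4: "\<And>i lo hi. good lo hi \<Longrightarrow> iv i lo hi \<Longrightarrow> expd (D ^ i) 1 m (\<lambda>S. of_bool (bb i lo hi S)) {} \<le> \<epsilon> i" "\<And>i. 0 \<le> \<epsilon> i"
    and A5: "\<And>lo hi S. \<not> bb 0 lo hi S \<Longrightarrow> {1..m} \<subseteq> S"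
    and s: "LI D \<sigma>" "rg \<sigma> 1 = D ^ i" "iv i (ar \<sigma> 4) (ar \<sigma> 5)" "\<not> bb i (ar \<sigma> 4) (ar \<sigma> 5) (smp \<sigma> \<inter> {1..m})"
  shows "trp (While (Leq (N 1) (V 1)) (refine_com ;; 1 ::= Quot (V 1) (V 0) ;; tape_com)) \<sigma>
    ((i + 1) * (900 * m + 100) + (80 * \<Lambda> + 40) * (\<Sum>j\<le>i. sz j) + (60 * \<Lambda> + 120) * Psi (ar \<sigma> 4) + 10)
    (ennreal (\<Sum>j<i. \<epsilon> j)) (fin \<sigma>)"
  using s
proof (induction i arbitrary: \<sigma>)
  case (0 \<sigma>)
  define lo' hi' where "lo' = nl (smp \<sigma>) (ar \<sigma> 4) (ar \<sigma> 5)" and "hi' = nh (smp \<sigma>) (ar \<sigma> 4) (ar \<sigma> 5)"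
  have g: "good (ar \<sigma> 4) (ar \<sigma> 5)" using 0 by (simp add: LI_def)
  note kb = A1[OF g 0(3,4) Int_lower2, unfolded restr] and sb = A2[OF g 0(3,4) Int_lower2]
  have "1 div D = 0" using D by simp
  then have q: "0 = rg \<sigma> 1 div D" using 0(2) by simp
  \<comment> \<open>The round of level 0 sets register 1 to 0, which ends the loop, and draws one
    more tape; its failure event is empty.\<close>
  note b = tri_body[OF 0(1) kb lo'_def hi'_def q, where bad = "\<lambda>_. False" and e = 0]
  have S: "{1..m} \<subseteq> smp \<sigma>" using A5[OF 0(4)] by auto
  define t0 where "t0 = 900 * m + 90 + (80 * \<Lambda> + 40) * card (smp \<sigma> \<inter> {1..m}) + (60 * \<Lambda> + 120) * (Psi (ar \<sigma> 4) - Psi lo')"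
  have "trp (Seq (refine_com ;; 1 ::= Quot (V 1) (V 0) ;; tape_com) (While (Leq (N 1) (V 1)) (refine_com ;; 1 ::= Quot (V 1) (V 0) ;; tape_com))) \<sigma>
      (t0 + 2 + 1) (ennreal 0 + 0) (fin \<sigma>)"
  proof (rule tri_Seq[OF b[folded t0_def]])
    fix \<sigma>' assume a: "LI D \<sigma>' \<and> ar \<sigma>' 4 = lo' \<and> ar \<sigma>' 5 = hi' \<and> rg \<sigma>' 1 = 0 \<and> \<not> False \<and> (\<forall>t<n. mem \<sigma>' t = mem \<sigma> t)"
    have "\<not> te \<sigma>' (Leq (N 1) (V 1))" using a by (simp add: te_Leq evs)
    moreover have "good (ar \<sigma>' 4) (ar \<sigma>' 5)" using a unfolding LI_def by blast
    then have "ar \<sigma>' 4 v \<le> Suc m" for v by (rule goodD(1))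
    moreover have "rk (ar \<sigma>' 4 v) = B v" if "v \<in> VV" for v using a nlo_complete[OF g S that] that by (simp add: lo'_def nl_def)
    ultimately have "\<not> te \<sigma>' (Leq (N 1) (V 1))" "fin \<sigma> \<sigma>'" unfolding fin_def using a by blast+
    then show "trp (While (Leq (N 1) (V 1)) (refine_com ;; 1 ::= Quot (V 1) (V 0) ;; tape_com)) \<sigma>' 2 0 (fin \<sigma>)"
      by (rule tri_While_false)
  qed (simp_all add: expd_0)
  moreover have "te \<sigma> (Leq (N 1) (V 1))" using 0(2) by (simp add: te_Leq evs)
  ultimately have w: "trp (While (Leq (N 1) (V 1)) (refine_com ;; 1 ::= Quot (V 1) (V 0) ;; tape_com)) \<sigma> (t0 + 2 + 1 + 2) (ennreal 0 + 0) (fin \<sigma>)"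
    by (intro tri_While_true)
  have s0: "(\<Sum>j\<le>0. sz j) = sz 0" by simp
  have "(80 * \<Lambda> + 40) * card (smp \<sigma> \<inter> {1..m}) \<le> (80 * \<Lambda> + 40) * sz 0" by (rule mult_le_mono2[OF sb])
  moreover have "(60 * \<Lambda> + 120) * (Psi (ar \<sigma> 4) - Psi lo') \<le> (60 * \<Lambda> + 120) * Psi (ar \<sigma> 4)" by (rule mult_le_mono2) simp
  ultimately have t: "t0 + 2 + 1 + 2 \<le> (0 + 1) * (900 * m + 100) + (80 * \<Lambda> + 40) * (\<Sum>j\<le>0. sz j) + (60 * \<Lambda> + 120) * Psi (ar \<sigma> 4) + 10"
    unfolding t0_def s0 mult_1 add_0 by linarith
  show ?case by (rule tri_mono[OF w t]) simp_all
next
  case (Suc i \<sigma>)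
  define lo' hi' where "lo' = nl (smp \<sigma>) (ar \<sigma> 4) (ar \<sigma> 5)" and "hi' = nh (smp \<sigma>) (ar \<sigma> 4) (ar \<sigma> 5)"
  have g: "good (ar \<sigma> 4) (ar \<sigma> 5)" using Suc.prems by (simp add: LI_def)
  have rf: "refined (smp \<sigma>) (ar \<sigma> 4) (ar \<sigma> 5) lo' hi'" by (simp add: refined_iff lo'_def hi'_def)
  have g': "good lo' hi'" by (rule good_refined[OF g rf])
  have rf2: "refined (smp \<sigma> \<inter> {1..m}) (ar \<sigma> 4) (ar \<sigma> 5) lo' hi'" using rf by (simp add: restr)
  have iv: "iv i lo' hi'" by (rule A3[OF g Suc.prems(3,4) rf2])
  note kb = A1[OF g Suc.prems(3,4) Int_lower2, unfolded restr] and sb = A2[OF g Suc.prems(3,4) Int_lower2]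
  have q: "D ^ i = rg \<sigma> 1 div D" using Suc.prems(2) D by simp
  have "1 \<le> D ^ i" using D by simp
  then have "expd (max 1 (D ^ i)) 1 m (\<lambda>S. of_bool (bb i lo' hi' S)) {} \<le> \<epsilon> i" using A4(1)[OF g' iv] by (simp add: max_absorb2)
  note b = tri_body[OF Suc.prems(1) kb lo'_def hi'_def q this]
  define t0 where "t0 = 900 * m + 90 + (80 * \<Lambda> + 40) * card (smp \<sigma> \<inter> {1..m}) + (60 * \<Lambda> + 120) * (Psi (ar \<sigma> 4) - Psi lo')"
  define t1 where "t1 = (i + 1) * (900 * m + 100) + (80 * \<Lambda> + 40) * (\<Sum>j\<le>i. sz j) + (60 * \<Lambda> + 120) * Psi lo' + 10"
  have "trp (Seq (refine_com ;; 1 ::= Quot (V 1) (V 0) ;; tape_com) (While (Leq (N 1) (V 1)) (refine_com ;; 1 ::= Quot (V 1) (V 0) ;; tape_com))) \<sigma>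
      (t0 + t1 + 1) (ennreal (\<epsilon> i) + ennreal (\<Sum>j<i. \<epsilon> j)) (fin \<sigma>)"
  proof (rule tri_Seq[OF b[folded t0_def]])
    fix \<sigma>' assume a: "LI D \<sigma>' \<and> ar \<sigma>' 4 = lo' \<and> ar \<sigma>' 5 = hi' \<and> rg \<sigma>' 1 = D ^ i \<and> \<not> bb i lo' hi' (smp \<sigma>' \<inter> {1..m}) \<and> (\<forall>t<n. mem \<sigma>' t = mem \<sigma> t)"
    have "trp (While (Leq (N 1) (V 1)) (refine_com ;; 1 ::= Quot (V 1) (V 0) ;; tape_com)) \<sigma>' t1 (ennreal (\<Sum>j<i. \<epsilon> j)) (fin \<sigma>')"
      using Suc.IH[of \<sigma>'] a iv unfolding t1_def by simp
    then show "trp (While (Leq (N 1) (V 1)) (refine_com ;; 1 ::= Quot (V 1) (V 0) ;; tape_com)) \<sigma>' t1 (ennreal (\<Sum>j<i. \<epsilon> j)) (fin \<sigma>)"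
      by (rule tri_mono) (use a in \<open>auto simp: fin_def\<close>)
  qed
  moreover have "1 \<le> D ^ Suc i" by (rule one_le_power) (use D in simp)
  then have "te \<sigma> (Leq (N 1) (V 1))" using Suc.prems(2) by (simp add: te_Leq evs del: power_Suc)
  ultimately have w: "trp (While (Leq (N 1) (V 1)) (refine_com ;; 1 ::= Quot (V 1) (V 0) ;; tape_com)) \<sigma> (t0 + t1 + 1 + 2) (ennreal (\<epsilon> i) + ennreal (\<Sum>j<i. \<epsilon> j)) (fin \<sigma>)"
    by (intro tri_While_true)
  have ps: "Psi lo' \<le> Psi (ar \<sigma> 4)" using Psi_refined[OF g rf] by linarith
  have "(80 * \<Lambda> + 40) * card (smp \<sigma> \<inter> {1..m}) \<le> (80 * \<Lambda> + 40) * sz (Suc i)" by (rule mult_le_mono2[OF sb])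
  moreover have "(60 * \<Lambda> + 120) * (Psi (ar \<sigma> 4) - Psi lo') + (60 * \<Lambda> + 120) * Psi lo' = (60 * \<Lambda> + 120) * Psi (ar \<sigma> 4)"
    unfolding distrib_left[symmetric] using ps by simp
  moreover have "(80 * \<Lambda> + 40) * (\<Sum>j\<le>Suc i. sz j) = (80 * \<Lambda> + 40) * (\<Sum>j\<le>i. sz j) + (80 * \<Lambda> + 40) * sz (Suc i)"
    by (simp add: distrib_left)
  moreover have "(Suc i + 1) * (900 * m + 100) = (i + 1) * (900 * m + 100) + (900 * m + 100)" by simp
  ultimately have t: "t0 + t1 + 1 + 2 \<le> (Suc i + 1) * (900 * m + 100) + (80 * \<Lambda> + 40) * (\<Sum>j\<le>Suc i. sz j) + (60 * \<Lambda> + 120) * Psi (ar \<sigma> 4) + 10"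
    unfolding t0_def t1_def by linarith
  have "ennreal (\<epsilon> i) + ennreal (\<Sum>j<i. \<epsilon> j) = ennreal (\<Sum>j<Suc i. \<epsilon> j)"
    using A4(2) by (subst ennreal_plus[symmetric]) (auto intro: sum_nonneg simp: add.commute)
  then show ?case by (intro tri_mono[OF w t]) auto
qed

lemma tri_levels:
  assumes D: "2 \<le> D"
    and A1: "\<And>i lo hi S v. good lo hi \<Longrightarrow> iv i lo hi \<Longrightarrow> \<not> bb i lo hi S \<Longrightarrow> S \<subseteq> {1..m} \<Longrightarrow> v \<in> VV \<Longrightarrow> card (keys S lo hi v) + 1 \<le> 2 ^ \<Lambda>"
    and A2: "\<And>i lo hi S. good lo hi \<Longrightarrow> iv i lo hi \<Longrightarrow> \<not> bb i lo hi S \<Longrightarrow> S \<subseteq> {1..m} \<Longrightarrow> card S \<le> sz i"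
    and A3: "\<And>i lo hi lo' hi' S. good lo hi \<Longrightarrow> iv (Suc i) lo hi \<Longrightarrow> \<not> bb (Suc i) lo hi S \<Longrightarrow> refined S lo hi lo' hi' \<Longrightarrow> iv i lo' hi'"
    and A4: "\<And>i lo hi. good lo hi \<Longrightarrow> iv i lo hi \<Longrightarrow> expd (D ^ i) 1 m (\<lambda>S. of_bool (bb i lo hi S)) {} \<le> \<epsilon> i" "\<And>i. 0 \<le> \<epsilon> i"
    and A5: "\<And>lo hi S. \<not> bb 0 lo hi S \<Longrightarrow> {1..m} \<subseteq> S"
    and s: "LI D \<sigma>" "rg \<sigma> 1 = D ^ i" "iv i (ar \<sigma> 4) (ar \<sigma> 5)"
  shows "trp levels_com \<sigma> ((i + 1) * (900 * m + 100) + (80 * \<Lambda> + 40) * (\<Sum>j\<le>i. sz j) + (60 * \<Lambda> + 120) * (2 * m) + 12 * m + 30)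
    (ennreal (\<Sum>j\<le>i. \<epsilon> j)) (fin \<sigma>)"
proof -
  define t1 where "t1 = (i + 1) * (900 * m + 100) + (80 * \<Lambda> + 40) * (\<Sum>j\<le>i. sz j) + (60 * \<Lambda> + 120) * Psi (ar \<sigma> 4) + 10"
  have g: "good (ar \<sigma> 4) (ar \<sigma> 5)" using s by (simp add: LI_def)
  have w: "trp levels_com \<sigma> ((12 * m + 10) + t1 + 1) (ennreal (expd (max 1 (rg \<sigma> 1)) 1 m (\<lambda>S. of_bool (bb i (ar \<sigma> 4) (ar \<sigma> 5) S)) {}) + ennreal (\<Sum>j<i. \<epsilon> j)) (fin \<sigma>)"
    unfolding levels_com_def
  proof (rule tri_Seq[OF tri_tape])
    fix \<sigma>' assume a: "frame {3, 10} {8} \<sigma> \<sigma>' \<and> \<not> bb i (ar \<sigma> 4) (ar \<sigma> 5) (smp \<sigma>' \<inter> {1..m})"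
    then have e: "ar \<sigma>' 4 = ar \<sigma> 4" "ar \<sigma>' 5 = ar \<sigma> 5" "rg \<sigma>' 1 = rg \<sigma> 1" by (simp_all add: frame_def)
    have li: "LI D \<sigma>'" using s(1) a by (simp add: LI_def adj_def frame_def)
    show "trp (While (Leq (N 1) (V 1)) (refine_com ;; 1 ::= Quot (V 1) (V 0) ;; tape_com)) \<sigma>' t1 (ennreal (\<Sum>j<i. \<epsilon> j)) (fin \<sigma>)"
      unfolding t1_def
      by (rule tri_mono[OF tri_levels_loop[where iv = iv and bb = bb and sz = sz and \<epsilon> = \<epsilon> and \<sigma> = \<sigma>' and i = i, OF D A1 A2 A3 A4 A5 li]])
        (use a e s in \<open>auto simp: fin_def frame_def\<close>)
  qed
  have "1 \<le> D ^ i" using D by simp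
  then have e1: "ennreal (expd (max 1 (rg \<sigma> 1)) 1 m (\<lambda>S. of_bool (bb i (ar \<sigma> 4) (ar \<sigma> 5) S)) {}) + ennreal (\<Sum>j<i. \<epsilon> j) \<le> ennreal (\<epsilon> i) + ennreal (\<Sum>j<i. \<epsilon> j)"
    using A4(1)[OF g s(3)] s(2) by (intro add_right_mono ennreal_leI) (simp add: max_absorb2)
  have e2: "ennreal (\<epsilon> i) + ennreal (\<Sum>j<i. \<epsilon> j) = ennreal (\<Sum>j\<le>i. \<epsilon> j)"
    using A4(2) by (subst ennreal_plus[symmetric]) (auto intro: sum_nonneg simp: add.commute lessThan_Suc_atMost[symmetric])
  have "(60 * \<Lambda> + 120) * Psi (ar \<sigma> 4) \<le> (60 * \<Lambda> + 120) * (2 * m)" by (rule mult_le_mono2[OF Psi_le])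
  then have t: "(12 * m + 10) + t1 + 1 \<le> (i + 1) * (900 * m + 100) + (80 * \<Lambda> + 40) * (\<Sum>j\<le>i. sz j) + (60 * \<Lambda> + 120) * (2 * m) + 12 * m + 30"
    unfolding t1_def by linarith
  show ?thesis by (rule tri_mono[OF w t]) (use e1 e2 in auto)
qed

end

section \<open>Parameters without logarithms, initial intervals, and the output pass\<close>

section \<open>Set-up and output\<close>

text \<open>Registers 8, 9 and 0 hold \<open>2 ^ (k\<^sup>2)\<close>, \<open>2 ^ (2 k + 1)\<close> and \<open>2 ^ k\<close>, so that \<open>D = 2 ^ k\<close> for
  the least \<open>k\<close> with \<open>n \<le> 2 ^ (k\<^sup>2)\<close> is found without computing a logarithm or a root.\<close>
definition params_com :: com where
  "params_com = 8 ::= N 2 ;; 9 ::= N 8 ;; 0 ::= N 2 ;;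
     While (lt_test (V 8) NumVerts) (8 ::= Times (V 8) (V 9) ;; 9 ::= Times (V 9) (N 4) ;; 0 ::= Times (V 0) (N 2)) ;;
     1 ::= N 1 ;;
     While (Leq (Times (V 1) (Times (V 0) (V 0))) NumEdges) (1 ::= Times (V 1) (V 0))"

text \<open>Prepending the edges in ascending order yields the descending chains described by
  \<open>prv\<close>. The lower ends start as 0, the initial content of the memory; upper ends are
  set at edge ends and at the source only.\<close>

definition adj_com :: com where
  "adj_com = edge_loop
      (8 ::= tl_exp (V 3) ;; put 1 (V 3) (arr 0 (V 8)) ;; put 0 (V 8) (V 3) ;; put 5 (V 8) (Plus NumEdges (N 1)) ;;
       8 ::= hd_exp (V 3) ;; put 3 (V 3) (arr 2 (V 8)) ;; put 2 (V 8) (V 3) ;; put 5 (V 8) (Plus NumEdges (N 1))) ;;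
     put 4 Src (Plus NumEdges (N 1)) ;; put 5 Src (Plus NumEdges (N 1))"

text \<open>Vertices other than \<open>s\<close> without edges keep the initial 0, which stands for
  minus infinity.\<close>

definition output_com :: com where
  "output_com = edge_loop (4 ::= tl_exp (V 3) ;; Store (V 4) (arr 4 (V 4)) ;; 4 ::= hd_exp (V 3) ;; Store (V 4) (arr 4 (V 4))) ;;
     Store Src (Plus NumEdges (N 1))"

context inst
begin

definition sout :: "nat \<Rightarrow> nat \<Rightarrow> state \<Rightarrow> state" where
  "sout t v \<sigma> = \<sigma>\<lparr>mem := (mem \<sigma>)(t := v)\<rparr>"

lemma sout_simps [simp]:
  "rg (sout t v \<sigma>) = rg \<sigma>" "mem (sout t v \<sigma>) = (mem \<sigma>)(t := v)" "t < n \<Longrightarrow> ar (sout t v \<sigma>) = ar \<sigma>"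
  by (auto simp: sout_def ar_def fun_eq_iff)

lemma okk_Store: "okk (Store a e) \<sigma> t Q \<longleftrightarrow> 1 \<le> t \<and> Q (sout (ev \<sigma> a) (ev \<sigma> e) \<sigma>) (t - 1)"
  by (simp add: ok_Store sout_def)

lemma okk_output:
  assumes a: "\<And>v. ar \<sigma> 4 v \<le> Suc m" "\<And>v. v \<in> VV \<Longrightarrow> rk (ar \<sigma> 4 v) = B v" and z: "\<And>t. t < n \<Longrightarrow> mem \<sigma> t = 0"
  shows "okk output_com \<sigma> (20 * m + 20) (\<lambda>\<sigma>' _. ssbp_output_correct G es w s \<sigma>')"
proof -
  define A where "A = ar \<sigma> 4"
  define P where "P = (\<lambda>k \<sigma>' u. ar \<sigma>' 4 = A \<and> (\<forall>t<n. mem \<sigma>' t = (if t \<in> ends k then A t else 0)) \<and> 20 * (m + 1 - k) + 10 \<le> u)"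
  define Q where "Q = (\<lambda>\<sigma>' (u :: nat). ssbp_output_correct G es w s \<sigma>')"
  have "okk (edge_loop (4 ::= tl_exp (V 3) ;; Store (V 4) (arr 4 (V 4)) ;; 4 ::= hd_exp (V 3) ;; Store (V 4) (arr 4 (V 4)))) \<sigma> (20 * m + 19)
     (\<lambda>\<sigma>' u. okk (Store Src (Plus NumEdges (N 1))) \<sigma>' u Q)"
  proof (rule okk_edge_loop[where P = P])
    show "P 1 (srg 3 1 \<sigma>) (20 * m + 19 - 2)" using z ends_1 by (simp add: P_def A_def)
  next
    fix k \<sigma>' u assume P: "P k \<sigma>' u" and k: "1 \<le> k" "k \<le> m" "rg \<sigma>' 3 = k"
    have ed: "T k < n" "H k < n" using edge_lt[of k] k by auto
    have e: "ar \<sigma>' 4 = A" "\<And>t. t < n \<Longrightarrow> mem \<sigma>' t = (if t \<in> ends k then A t else 0)" and u: "20 * (m + 1 - k) + 10 \<le> u" using P by (auto simp: P_def)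
    have u': "20 + (20 * (m + 1 - (k + 1)) + 10) \<le> u" using u k by linarith
    have u2: "30 \<le> u" using u' by linarith
    define \<rho> where "\<rho> = sout (H k) (A (H k)) (srg 4 (H k) (sout (T k) (A (T k)) (srg 4 (T k) \<sigma>')))"
    have r: "rg \<rho> 3 = k" "ar \<rho> 4 = A" using k e ed by (simp_all add: \<rho>_def)
    have "mem \<rho> t = (if t \<in> ends (k + 1) then A t else 0)" if "t < n" for t
      unfolding ends_Suc[OF k(1)] using e that by (simp add: \<rho>_def)
    then have "P (k + 1) (srg 3 (k + 1) \<rho>) (u - 12)" using u' r unfolding P_def by simp
    then show "4 \<le> u \<and> okk (4 ::= tl_exp (V 3) ;; Store (V 4) (arr 4 (V 4)) ;; 4 ::= hd_exp (V 3) ;; Store (V 4) (arr 4 (V 4))) \<sigma>' (u - 4)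
        (\<lambda>\<sigma>' u'. rg \<sigma>' 3 = k \<and> 1 \<le> u' \<and> P (k + 1) (srg 3 (k + 1) \<sigma>') (u' - 1))"
      using u2 k ed e r W_ge by (simp add: okk okk_Store evs le_diff_pos \<rho>_def[symmetric])
  next
    fix \<sigma>' u assume "P (m + 1) \<sigma>' u"
    then have e: "\<And>t. t < n \<Longrightarrow> mem \<sigma>' t = (if t \<in> VV then A t else 0)" and u: "10 \<le> u" by (auto simp: P_def ends_top)
    have "output_value es w (mem (sout s (m + 1) \<sigma>') t) = bottleneck G w s t" if "t < n" for t
    proof (rule output_bottleneck)
      show "mem (sout s (m + 1) \<sigma>') t \<le> Suc m" using e[OF that] a(1) by (simp add: A_def)
      show "rk (mem (sout s (m + 1) \<sigma>') t) = B t" using e[OF that] a(2)[of t] B_notin_VV[of t] by (simp add: A_def Suc_eq_plus1[symmetric] del: Suc_eq_plus1)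
    qed
    then have "Q (sout s (m + 1) \<sigma>') (u - 3)"
      using inst unfolding Q_def ssbp_output_correct_def n_def ssbp_instance_def by blast
    moreover have "ev \<sigma>' (Plus NumEdges (N 1)) = m + 1" using W_ge by (simp add: evs)
    ultimately show "2 \<le> u \<and> okk (Store Src (Plus NumEdges (N 1))) \<sigma>' (u - 2) Q"
      using u by (simp add: okk_Store ev_Src le_diff_pos)
  qed simp
  moreover have e: "20 * m + 20 - 1 = 20 * m + 19" by simp
  ultimately show ?thesis unfolding output_com_def ok_Seq[of _ _ "edge_loop _"] Q_def e by simp
qed

lemma prv_1: "prv F 1 v = 0"
proof -
  have "{d \<in> {1..m}. d < 1 \<and> F d = v} = {}" by auto
  then show ?thesis unfolding prv_def by (simp only: Max_singleton)
qed

lemma prv_Suc: "1 \<le> k \<Longrightarrow> k \<le> m \<Longrightarrow> prv F (k + 1) v = (if F k = v then k else prv F k v)"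
proof (cases "F k = v")
  case True
  assume k: "1 \<le> k" "k \<le> m"
  have "Max (insert 0 {d \<in> {1..m}. d < k + 1 \<and> F d = v}) = k" using True k by (intro Max_eqI) auto
  then show ?thesis unfolding prv_def using True by simp
next
  case False
  have "d < k + 1 \<and> F d = v \<longleftrightarrow> d < k \<and> F d = v" for d using False by (cases "d = k") auto
  then have "{d \<in> {1..m}. d < k + 1 \<and> F d = v} = {d \<in> {1..m}. d < k \<and> F d = v}" by simp
  then show ?thesis unfolding prv_def using False by simp
qed

text \<open>An edge out of \<open>s\<close> falls under disjointness, as the lower end
  \<open>Suc m\<close> of \<open>s\<close> is no less than any upper end. Edges into
  \<open>s\<close> do not exceed the lower end there, and all other edges start with equal
  intervals.\<close>

lemma good_init: "good ((\<lambda>_. 0)(s := Suc m)) (\<lambda>v. if v = s \<or> v \<in> VV then Suc m else 0)"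
proof -
  have "B v < Suc m" if "v \<noteq> s" for v using B_top[of v] B_le[of v] that by fastforce
  then show ?thesis unfolding good_def using VV_edge by auto
qed

lemma okk_adj:
  assumes z: "\<And>k i. k < 32 \<Longrightarrow> ar \<sigma> k i = 0"
  shows "okk adj_com \<sigma> (30 * m + 20) (\<lambda>\<sigma>' _. frame {3, 8} {0, 1, 2, 3, 4, 5} \<sigma> \<sigma>' \<and> adj \<sigma>' \<and> ar \<sigma>' 4 = (\<lambda>_. 0)(s := Suc m) \<and>
     ar \<sigma>' 5 = (\<lambda>v. if v = s \<or> v \<in> VV then Suc m else 0))"
proof -
  define P where "P = (\<lambda>k \<sigma>' u. frame {3, 8} {0, 1, 2, 3, 4, 5} \<sigma> \<sigma>' \<and> ar \<sigma>' 4 = (\<lambda>_. 0) \<and> ar \<sigma>' 5 = (\<lambda>v. if v \<in> ends k then Suc m else 0) \<and>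
    (\<forall>v. ar \<sigma>' 0 v = prv T k v \<and> ar \<sigma>' 2 v = prv H k v) \<and>
    (\<forall>c. 1 \<le> c \<and> c < k \<longrightarrow> ar \<sigma>' 1 c = prv T c (T c) \<and> ar \<sigma>' 3 c = prv H c (H c)) \<and> 30 * (m + 1 - k) + 10 \<le> u)"
  define Q where "Q = (\<lambda>\<sigma>' (u :: nat). frame {3, 8} {0, 1, 2, 3, 4, 5} \<sigma> \<sigma>' \<and> adj \<sigma>' \<and> ar \<sigma>' 4 = (\<lambda>_. 0)(s := Suc m) \<and>
     ar \<sigma>' 5 = (\<lambda>v. if v = s \<or> v \<in> VV then Suc m else 0))"
  have "okk (edge_loop (8 ::= tl_exp (V 3) ;; put 1 (V 3) (arr 0 (V 8)) ;; put 0 (V 8) (V 3) ;; put 5 (V 8) (Plus NumEdges (N 1)) ;;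
       8 ::= hd_exp (V 3) ;; put 3 (V 3) (arr 2 (V 8)) ;; put 2 (V 8) (V 3) ;; put 5 (V 8) (Plus NumEdges (N 1)))) \<sigma> (30 * m + 19)
     (\<lambda>\<sigma>' u. okk (put 4 Src (Plus NumEdges (N 1)) ;; put 5 Src (Plus NumEdges (N 1))) \<sigma>' u Q)"
  proof (rule okk_edge_loop[where P = P])
    show "P 1 (srg 3 1 \<sigma>) (30 * m + 19 - 2)" using z ends_1 prv_1 by (auto simp: P_def fun_eq_iff)
  next
    fix k \<sigma>' u assume P: "P k \<sigma>' u" and k: "1 \<le> k" "k \<le> m" "rg \<sigma>' 3 = k"
    have ed: "T k < n" "H k < n" using edge_lt[of k] k by auto
    have fr: "frame {3, 8} {0, 1, 2, 3, 4, 5} \<sigma> \<sigma>'" and e: "ar \<sigma>' 4 = (\<lambda>_. 0)" "ar \<sigma>' 5 = (\<lambda>v. if v \<in> ends k then Suc m else 0)"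
      "\<And>v. ar \<sigma>' 0 v = prv T k v" "\<And>v. ar \<sigma>' 2 v = prv H k v"
      "\<And>c. 1 \<le> c \<Longrightarrow> c < k \<Longrightarrow> ar \<sigma>' 1 c = prv T c (T c)" "\<And>c. 1 \<le> c \<Longrightarrow> c < k \<Longrightarrow> ar \<sigma>' 3 c = prv H c (H c)"
      and u: "30 * (m + 1 - k) + 10 \<le> u" using P by (auto simp: P_def)
    have u': "30 + (30 * (m + 1 - (k + 1)) + 10) \<le> u" using u k by linarith
    have u2: "40 \<le> u" using u' by linarith
    define \<rho> where "\<rho> = sar 5 (H k) (m + 1) (sar 2 (H k) k (sar 3 k (prv H k (H k)) (srg 8 (H k)
        (sar 5 (T k) (m + 1) (sar 0 (T k) k (sar 1 k (prv T k (T k)) (srg 8 (T k) \<sigma>')))))))"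
    have r: "rg \<rho> 3 = k" "frame {3, 8} {0, 1, 2, 3, 4, 5} \<sigma> \<rho>" using k fr by (simp_all add: \<rho>_def)
    have ar: "ar \<rho> 4 = (\<lambda>_. 0)" "ar \<rho> 5 = (ar \<sigma>' 5)(T k := m + 1, H k := m + 1)" "ar \<rho> 0 = (ar \<sigma>' 0)(T k := k)" "ar \<rho> 2 = (ar \<sigma>' 2)(H k := k)"
      "ar \<rho> 1 = (ar \<sigma>' 1)(k := prv T k (T k))" "ar \<rho> 3 = (ar \<sigma>' 3)(k := prv H k (H k))"
      by (simp_all add: \<rho>_def ar_sar e(1))
    have "P (k + 1) (srg 3 (k + 1) \<rho>) (u - 20)"
      unfolding P_def ar_srg ar ends_Suc[OF k(1)] prv_Suc[OF k(1,2)] using u' r e by (auto simp: less_Suc_eq)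
    then show "4 \<le> u \<and> okk (8 ::= tl_exp (V 3) ;; put 1 (V 3) (arr 0 (V 8)) ;; put 0 (V 8) (V 3) ;; put 5 (V 8) (Plus NumEdges (N 1)) ;;
       8 ::= hd_exp (V 3) ;; put 3 (V 3) (arr 2 (V 8)) ;; put 2 (V 8) (V 3) ;; put 5 (V 8) (Plus NumEdges (N 1))) \<sigma>' (u - 4)
        (\<lambda>\<sigma>' u'. rg \<sigma>' 3 = k \<and> 1 \<le> u' \<and> P (k + 1) (srg 3 (k + 1) \<sigma>') (u' - 1))"
      using u2 k ed e r W_ge by (simp add: okk evs ar_sar le_diff_pos \<rho>_def[symmetric, simplified])
  next
    fix \<sigma>' u assume P: "P (m + 1) \<sigma>' u"
    have u: "10 \<le> u" using P by (simp add: P_def)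
    have "Q (sar 5 s (m + 1) (sar 4 s (m + 1) \<sigma>')) (u - 5)"
      using P unfolding P_def Q_def ends_top adj_def by (auto simp: ar_sar fun_eq_iff Suc_eq_plus1[symmetric] simp del: Suc_eq_plus1)
    then show "2 \<le> u \<and> okk (put 4 Src (Plus NumEdges (N 1)) ;; put 5 Src (Plus NumEdges (N 1))) \<sigma>' (u - 2) Q"
      using u s_lt W_ge by (simp add: okk evs le_diff_pos)
  qed simp
  moreover have e: "30 * m + 20 - 1 = 30 * m + 19" by simp
  ultimately show ?thesis unfolding adj_com_def ok_Seq[of _ _ "edge_loop _"] Q_def e by simp
qed

definition rr :: nat where "rr = (LEAST r. 1 \<le> r \<and> n \<le> 2 ^ (r * r))"
definition DD :: nat where "DD = 2 ^ rr"
text \<open>The start level: a window has at most \<open>m\<close> edges, so the size bound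
  \<open>DD ^ (i + 2)\<close> holds at \<open>i = RR\<close> before any sampling.\<close>

definition RR :: nat where "RR = (LEAST R. m < DD ^ (R + 2))"

lemma rr_props: "1 \<le> rr" "n \<le> 2 ^ (rr * rr)"
proof -
  have "n \<le> 2 ^ n" by (rule less_imp_le[OF less_exp])
  also have "\<dots> \<le> 2 ^ (n * n)" by (rule power_increasing) (simp_all add: le_square)
  finally have "1 \<le> n \<and> n \<le> 2 ^ (n * n)" using W_ge by simp
  then have "1 \<le> rr \<and> n \<le> 2 ^ (rr * rr)" unfolding rr_def by (rule LeastI)
  then show "1 \<le> rr" "n \<le> 2 ^ (rr * rr)" by auto
qed

lemma rr_le: "1 \<le> r \<Longrightarrow> n \<le> 2 ^ (r * r) \<Longrightarrow> rr \<le> r"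
  unfolding rr_def by (intro Least_le) simp

lemma rr_min: "rr = 1 \<or> 2 ^ ((rr - 1) * (rr - 1)) < n"
proof (rule ccontr)
  assume "\<not> ?thesis"
  then have "rr \<noteq> 1" "n \<le> 2 ^ ((rr - 1) * (rr - 1))" by auto
  then have "rr \<le> rr - 1" using rr_props(1) by (intro rr_le) auto
  then show False using rr_props(1) by simp
qed

lemma DD_ge: "2 \<le> DD"
  using power_increasing[OF rr_props(1), of "2 :: nat"] by (simp add: DD_def)

lemma RR_props: "m < DD ^ (RR + 2)"
proof -
  have "m < 2 ^ m" by (rule less_exp)
  also have "\<dots> \<le> DD ^ m" by (rule power_mono[OF DD_ge]) simp
  also have "\<dots> \<le> DD ^ (m + 2)" using DD_ge by (intro power_increasing) auto
  finally show ?thesis unfolding RR_def by (rule LeastI)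
qed

lemma RR_le: "m < DD ^ (R + 2) \<Longrightarrow> RR \<le> R"
  unfolding RR_def by (rule Least_le)

lemma RR_min: "k < RR \<Longrightarrow> DD ^ (k + 2) \<le> m"
  using RR_le[of k] by (meson not_less)

text \<open>Controls wrap-around: the factors multiplied while the parameters are computed are
  bounded by small powers of \<open>W\<close>, for which the word bound \<open>W ^ 10\<close> leaves
  ample room.\<close>

lemma pw: "a \<le> W ^ i \<Longrightarrow> b \<le> W ^ j \<Longrightarrow> i + j < 10 \<Longrightarrow> a * b < W ^ 10"
proof -
  assume a: "a \<le> W ^ i" "b \<le> W ^ j" "i + j < 10"
  then have "a * b \<le> W ^ (i + j)" by (simp add: power_add mult_mono)
  also have "\<dots> < W ^ 10" using a W_ge by (intro power_strict_increasing) auto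
  finally show ?thesis .
qed

lemma pw_const: "2 \<le> W ^ 1" "4 \<le> W ^ 2"
  using W_ge power_mono[of 2 W 2] by auto

text \<open>Minimality of \<open>rr\<close> gives \<open>2 ^ ((rr - 1) * (rr - 1)) < n\<close>, and
  squaring this suffices because \<open>rr \<le> 2 * (rr - 1) * (rr - 1)\<close> from
  \<open>rr = 2\<close> on.\<close>

lemma DD_le: "DD \<le> W ^ 2"
proof (cases "rr = 1")
  case True
  then show ?thesis using W_ge pw_const by (simp add: DD_def)
next
  case False
  then obtain j where j: "rr = j + 2" using rr_props(1) by (metis One_nat_def Suc_leI add.commute add_2_eq_Suc le_neq_implies_less less_imp_Suc_add plus_1_eq_Suc add_Suc_right)
  have e: "rr - 1 = j + 1" using j by simp
  have "2 ^ ((j + 1) * (j + 1)) \<le> n" using rr_min[unfolded e] False by (metis less_imp_le)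
  then have "(2 ^ ((j + 1) * (j + 1)))\<^sup>2 \<le> W ^ 2" using W_ge by (intro power_mono) auto
  moreover have "DD \<le> (2 ^ ((j + 1) * (j + 1)))\<^sup>2" unfolding DD_def j power_mult[symmetric] by (rule power_increasing) (simp_all add: algebra_simps)
  ultimately show ?thesis by (metis order_trans)
qed

lemma okk_params:
  "okk params_com \<sigma> (14 * rr + 10 * RR + 40) (\<lambda>\<sigma>' _. frame {0, 1, 8, 9} {} \<sigma> \<sigma>' \<and> rg \<sigma>' 0 = DD \<and> rg \<sigma>' 1 = DD ^ RR)"
proof -
  define Q where "Q = (\<lambda>\<sigma>' (u :: nat). frame {0, 1, 8, 9} {} \<sigma> \<sigma>' \<and> rg \<sigma>' 0 = DD \<and> rg \<sigma>' 1 = DD ^ RR)"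
  define I1 where "I1 = (\<lambda>\<sigma>' u. \<exists>k. 1 \<le> k \<and> k \<le> rr \<and> frame {0, 1, 8, 9} {} \<sigma> \<sigma>' \<and> rg \<sigma>' 8 = 2 ^ (k * k) \<and> rg \<sigma>' 9 = 2 ^ (2 * k + 1) \<and>
     rg \<sigma>' 0 = 2 ^ k \<and> 14 * (rr - k) + 10 * RR + 20 \<le> u)"
  define I2 where "I2 = (\<lambda>\<sigma>' u. \<exists>k. k \<le> RR \<and> frame {0, 1, 8, 9} {} \<sigma> \<sigma>' \<and> rg \<sigma>' 1 = DD ^ k \<and> rg \<sigma>' 0 = DD \<and> 10 * (RR - k) + 5 \<le> u)"
  have D2: "DD * DD \<le> W ^ 4" using mult_mono[OF DD_le DD_le] by (simp add: power_add[symmetric])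
  have l2: "okk (While (Leq (Times (V 1) (Times (V 0) (V 0))) NumEdges) (1 ::= Times (V 1) (V 0))) \<tau> u Q" if "I2 \<tau> u" for \<tau> u
  proof (rule okk_While[where Inv = I2, OF that])
    fix \<sigma>' u assume "I2 \<sigma>' u"
    then obtain k where k: "k \<le> RR" "frame {0, 1, 8, 9} {} \<sigma> \<sigma>'" "rg \<sigma>' 1 = DD ^ k" "rg \<sigma>' 0 = DD" "10 * (RR - k) + 5 \<le> u"
      unfolding I2_def by blast
    have kW: "DD ^ k \<le> W ^ 1"
    proof (cases k)
      case 0
      then show ?thesis using W_ge by simp
    next
      case (Suc j)
      have "DD ^ k \<le> DD ^ (j + 2)" using DD_ge Suc by (intro power_increasing) auto
      also have "\<dots> \<le> m" using RR_min[of j] k(1) Suc by simp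
      finally show ?thesis using W_ge by simp
    qed
    have t: "te \<sigma>' (Leq (Times (V 1) (Times (V 0) (V 0))) NumEdges) \<longleftrightarrow> DD ^ (k + 2) \<le> m"
      using pw[OF kW D2] pw[OF DD_le DD_le] k by (simp add: te_Leq evs power_add power2_eq_square mult_ac)
    {
      assume "te \<sigma>' (Leq (Times (V 1) (Times (V 0) (V 0))) NumEdges)"
      then have "k \<noteq> RR" using t RR_props by auto
      then have kR: "k < RR" using k by simp
      then have "RR - k = RR - (k + 1) + 1" by simp
      then have "10 * (RR - (k + 1)) + 15 \<le> u" using k(5) by linarith
      then have "I2 (srg 1 (DD ^ k * DD) \<sigma>') (u - 4)" unfolding I2_def using k kR by (intro exI[of _ "k + 1"]) (simp add: power_add le_diff_pos)
      then show "3 \<le> u \<and> okk (1 ::= Times (V 1) (V 0)) \<sigma>' (u - 3) I2"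
        using pw[OF kW DD_le] k by (simp add: okk_Assign evs le_diff_pos)
    }
    {
      assume "\<not> te \<sigma>' (Leq (Times (V 1) (Times (V 0) (V 0))) NumEdges)"
      then have "RR \<le> k" using t by (intro RR_le) simp
      then show "2 \<le> u \<and> Q \<sigma>' (u - 2)" using k by (simp add: Q_def)
    }
  qed
  define \<tau> where "\<tau> = srg 0 2 (srg 9 8 (srg 8 2 \<sigma>))"
  define X where "X = 14 * rr + 10 * RR + 33"
  have "okk (While (lt_test (V 8) NumVerts) (8 ::= Times (V 8) (V 9) ;; 9 ::= Times (V 9) (N 4) ;; 0 ::= Times (V 0) (N 2))) \<tau> X
    (\<lambda>\<sigma>' u. okk (1 ::= N 1 ;; While (Leq (Times (V 1) (Times (V 0) (V 0))) NumEdges) (1 ::= Times (V 1) (V 0))) \<sigma>' u Q)"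
  proof (rule okk_While[where Inv = I1])
    show "I1 \<tau> X" unfolding I1_def X_def using rr_props by (intro exI[of _ 1]) (simp add: \<tau>_def)
  next
    fix \<sigma>' u assume "I1 \<sigma>' u"
    then obtain k where k: "1 \<le> k" "k \<le> rr" "frame {0, 1, 8, 9} {} \<sigma> \<sigma>'" "rg \<sigma>' 8 = 2 ^ (k * k)" "rg \<sigma>' 9 = 2 ^ (2 * k + 1)"
       "rg \<sigma>' 0 = 2 ^ k" "14 * (rr - k) + 10 * RR + 20 \<le> u" unfolding I1_def by blast
    have t: "te \<sigma>' (lt_test (V 8) NumVerts) \<longleftrightarrow> 2 ^ (k * k) < n" by (simp add: te_lt evs k)
    {
      assume "te \<sigma>' (lt_test (V 8) NumVerts)"
      then have l: "2 ^ (k * k) < n" using t by simp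
      then have "k \<noteq> rr" using rr_props(2) by auto
      then have kr: "k < rr" using k by simp
      have b1: "2 ^ (k * k) \<le> W ^ 1" using l W_ge by simp
      \<comment> \<open>Bounds the multiplier in register 9 by the cube of
        \<open>2 ^ (k * k)\<close>, which is below \<open>n\<close> as long as the loop
        runs.\<close>
      have "2 * k + 1 \<le> k * k * 3" using k(1) mult_le_mono1[OF k(1), of k] by linarith
      then have "(2::nat) ^ (2 * k + 1) \<le> 2 ^ (k * k * 3)" by (rule power_increasing) simp
      also have "\<dots> \<le> W ^ 3" unfolding power_mult[of _ "k * k"] by (rule power_mono) (use b1 in auto)
      finally have b2: "2 ^ (2 * k + 1) \<le> W ^ 3" .
      have "(2::nat) ^ k \<le> 2 ^ (k * k)" by (rule power_increasing) (simp_all add: le_square)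
      then have b3: "2 ^ k \<le> W ^ 1" using b1 by linarith
      have rk: "rr - k = rr - (k + 1) + 1" using kr by simp
      have u: "14 * (rr - (k + 1)) + 10 * RR + 34 \<le> u" using k(7) rk by linarith
      define \<rho> where "\<rho> = srg 0 (2 ^ k * 2) (srg 9 (2 ^ (2 * k + 1) * 4) (srg 8 (2 ^ (k * k) * 2 ^ (2 * k + 1)) \<sigma>'))"
      have p4: "(2 :: nat) ^ (2 * Suc 0) = 4" by simp
      have sq: "(k + 1) * (k + 1) = k * k + (2 * k + 1)" by (simp add: algebra_simps)
      have "I1 \<rho> (u - 8)" unfolding I1_def
        by (rule exI[of _ "k + 1"]) (use k kr u in \<open>simp add: \<rho>_def sq power_add p4 le_diff_pos del: mult_Suc mult_Suc_right\<close>)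
      then show "3 \<le> u \<and> okk (8 ::= Times (V 8) (V 9) ;; 9 ::= Times (V 9) (N 4) ;; 0 ::= Times (V 0) (N 2)) \<sigma>' (u - 3) I1"
        using pw[OF b1 b2] pw[OF b2 pw_const(2)] pw[OF b3 pw_const(1)] k(4-6) u
        by (simp add: okk evs le_diff_pos \<rho>_def)
    }
    {
      assume "\<not> te \<sigma>' (lt_test (V 8) NumVerts)"
      then have "rr \<le> k" using t k by (intro rr_le) auto
      then have "I2 (srg 1 1 \<sigma>') (u - 4)" unfolding I2_def using k by (intro exI[of _ 0]) (simp add: DD_def)
      then show "2 \<le> u \<and> okk (1 ::= N 1 ;; While (Leq (Times (V 1) (Times (V 0) (V 0))) NumEdges) (1 ::= Times (V 1) (V 0))) \<sigma>' (u - 2) Q"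
        using l2 k by (simp add: ok_Seq okk_Assign evs le_diff_pos)
    }
  qed
  moreover have e: "14 * rr + 10 * RR + 40 = X + 7" by (simp add: X_def)
  ultimately show ?thesis unfolding params_com_def Q_def[symmetric] e
    by (simp add: ok_Seq[of _ _ "_ ::= _"] ok_Seq[of _ _ "While _ _"] okk_Assign evs \<tau>_def)
qed

end

section \<open>Failure events, the total running time, and the theorem\<close>

section \<open>The algorithm\<close>

definition ssbp_com :: com where
  "ssbp_com = params_com ;; adj_com ;; levels_com ;; output_com"

lemma expd_union:
  assumes q: "1 \<le> q" and X: "finite X" and b: "\<And>x. x \<in> X \<Longrightarrow> expd q c k (\<lambda>S. of_bool (P x S)) S \<le> \<delta>"
  shows "expd q c k (\<lambda>S. of_bool (\<exists>x\<in>X. P x S)) S \<le> real (card X) * \<delta>"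
proof -
  have "of_bool (\<exists>x\<in>X. P x S) \<le> (\<Sum>x\<in>X. of_bool (P x S) :: real)" for S
  proof (cases "\<exists>x\<in>X. P x S")
    case True
    then obtain x where x: "x \<in> X" "P x S" by blast
    have "(of_bool (P x S) :: real) \<le> (\<Sum>x\<in>X. of_bool (P x S))" using X x by (intro member_le_sum) auto
    then show ?thesis using True x by simp
  qed (simp add: sum_nonneg)
  then have "expd q c k (\<lambda>S. of_bool (\<exists>x\<in>X. P x S)) S \<le> expd q c k (\<lambda>S. \<Sum>x\<in>X. of_bool (P x S)) S"
    by (rule expd_mono[OF q])
  also have "\<dots> = (\<Sum>x\<in>X. expd q c k (\<lambda>S. of_bool (P x S)) S)" by (rule expd_sum[OF X])
  also have "\<dots> \<le> real (card X) * \<delta>" by (rule sum_bounded_above[OF b])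
  finally show ?thesis .
qed

lemma expd_or:
  assumes "1 \<le> q"
  shows "expd q c k (\<lambda>S. of_bool (P S \<or> P' S)) S \<le> expd q c k (\<lambda>S. of_bool (P S)) S + expd q c k (\<lambda>S. of_bool (P' S)) S"
  unfolding expd_add[symmetric] by (rule expd_mono[OF assms]) auto

context inst
begin

definition start :: state where "start = \<lparr>regs = (\<lambda>_. 0), mem = (\<lambda>_. 0)\<rparr>"

lemma tri_ssbp:
  assumes l: "\<And>\<sigma>. LI DD \<sigma> \<Longrightarrow> rg \<sigma> 1 = DD ^ RR \<Longrightarrow> trp levels_com \<sigma> tlv e (fin \<sigma>)"
  shows "trp ssbp_com start (14 * rr + 10 * RR + 50 * m + tlv + 90) e (ssbp_output_correct G es w s)"
proof -
  have 1: "trp params_com start (14 * rr + 10 * RR + 40) 0 (\<lambda>\<sigma>'. frame {0, 1, 8, 9} {} start \<sigma>' \<and> rg \<sigma>' 0 = DD \<and> rg \<sigma>' 1 = DD ^ RR)"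
    by (rule ok_imp_tri[OF okk_params])
  have "trp ssbp_com start ((14 * rr + 10 * RR + 40) + ((30 * m + 20) + (tlv + (20 * m + 20) + 1) + 1) + 1) (0 + (0 + (e + 0))) (ssbp_output_correct G es w s)"
    unfolding ssbp_com_def
  proof (rule tri_Seq[OF 1])
    fix \<sigma>1 assume a: "frame {0, 1, 8, 9} {} start \<sigma>1 \<and> rg \<sigma>1 0 = DD \<and> rg \<sigma>1 1 = DD ^ RR"
    then have z1: "ar \<sigma>1 k i = 0" if "k < 32" for k i using that by (simp add: frame_def start_def ar_def)
    have m1: "mem \<sigma>1 t = 0" if "t < n" for t using a that by (simp add: frame_def start_def)
    show "trp (adj_com ;; levels_com ;; output_com) \<sigma>1 ((30 * m + 20) + (tlv + (20 * m + 20) + 1) + 1) (0 + (e + 0)) (ssbp_output_correct G es w s)"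
    proof (rule tri_Seq[OF ok_imp_tri[OF okk_adj[OF z1]]])
      fix \<sigma>2 assume b: "frame {3, 8} {0, 1, 2, 3, 4, 5} \<sigma>1 \<sigma>2 \<and> adj \<sigma>2 \<and> ar \<sigma>2 4 = (\<lambda>_. 0)(s := Suc m) \<and>
         ar \<sigma>2 5 = (\<lambda>v. if v = s \<or> v \<in> VV then Suc m else 0)"
      then have z2: "ar \<sigma>2 16 = ar \<sigma>1 16" "ar \<sigma>2 9 = ar \<sigma>1 9" "rg \<sigma>2 0 = DD" "rg \<sigma>2 1 = DD ^ RR" using a by (simp_all add: frame_def)
      have m2: "mem \<sigma>2 t = 0" if "t < n" for t using b m1 that by (simp add: frame_def)
      have li: "LI DD \<sigma>2" unfolding LI_def using b z1 z2 good_init by simp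
      show "trp (levels_com ;; output_com) \<sigma>2 (tlv + (20 * m + 20) + 1) (e + 0) (ssbp_output_correct G es w s)"
      proof (rule tri_Seq[OF l[OF li z2(4)]])
        fix \<sigma>3 assume "fin \<sigma>2 \<sigma>3"
        then show "trp output_com \<sigma>3 (20 * m + 20) 0 (ssbp_output_correct G es w s)"
          by (intro ok_imp_tri okk_output) (auto simp: fin_def m2)
      qed
    qed simp_all
  qed
  then show ?thesis by (rule tri_mono) auto
qed

lemma expd_full: "expd 1 1 m (\<lambda>S. of_bool (\<not> {1..m} \<subseteq> S)) {} = 0"
proof -
  have e: "{1..m} = {1..<1 + m}" by auto
  show ?thesis unfolding e using expd_one[of 1 1 m "{}"] by simp
qed

lemma card_keys_win: "keys S lo hi v \<subseteq> S \<inter> win lo v (rk (lo v)) (rk (hi v))"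
  by (auto simp: keys_def win_def)

lemma finite_win [simp]: "finite (win lo v a b)" and win_sub: "win lo v a b \<subseteq> {1..m}"
proof -
  show s: "win lo v a b \<subseteq> {1..m}" by (auto simp: win_def)
  show "finite (win lo v a b)" by (rule finite_subset[OF s]) simp
qed

text \<open>The only failure event is incompleteness of the sample at level 0, which is impossible
  at rate 1. The coarse bound of \<open>m\<close> on thresholds and samples then gives a time within
  which every run halts with a correct output.\<close>

lemma tri_ssbp_sure: "\<exists>t. trp ssbp_com start t 0 (ssbp_output_correct G es w s)"
proof -
  have D: "2 \<le> DD" by (rule DD_ge)
  have p2: "m + 1 \<le> 2 ^ (m + 1)" by (rule less_imp_le[OF less_exp])
  have k: "card (keys S lo hi v) + 1 \<le> 2 ^ (m + 1)" for S lo hi v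
  proof -
    have "keys S lo hi v \<subseteq> {1..m}" by (auto simp: keys_def)
    then have "card (keys S lo hi v) \<le> m" using card_mono[of "{1..m}" "keys S lo hi v"] by simp
    then show ?thesis using p2 by linarith
  qed
  have "\<exists>tlv. \<forall>\<sigma>. LI DD \<sigma> \<longrightarrow> rg \<sigma> 1 = DD ^ RR \<longrightarrow> trp levels_com \<sigma> tlv 0 (fin \<sigma>)"
  proof (intro exI allI impI)
    fix \<sigma> assume s: "LI DD \<sigma>" "rg \<sigma> 1 = DD ^ RR"
    have "trp levels_com \<sigma> ((RR + 1) * (900 * m + 100) + (80 * (m + 1) + 40) * (\<Sum>j\<le>RR. m) + (60 * (m + 1) + 120) * (2 * m) + 12 * m + 30)
      (ennreal (\<Sum>j\<le>RR. 0)) (fin \<sigma>)"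
    proof (rule tri_levels[where iv = "\<lambda>_ _ _. True" and bb = "\<lambda>i _ _ S. i = 0 \<and> \<not> {1..m} \<subseteq> S" and D = DD])
      show "card S \<le> m" if "S \<subseteq> {1..m}" for S using card_mono[OF _ that] by simp
      show "expd (DD ^ i) 1 m (\<lambda>S. of_bool (i = 0 \<and> \<not> {1..m} \<subseteq> S)) {} \<le> 0" for i
        using expd_full by (cases "i = 0") (simp_all add: expd_0)
    qed (use D k s in auto)
    then show "trp levels_com \<sigma> ((RR + 1) * (900 * m + 100) + (80 * (m + 1) + 40) * (\<Sum>j\<le>RR. m) + (60 * (m + 1) + 120) * (2 * m) + 12 * m + 30) 0 (fin \<sigma>)"
      by simp
  qed
  then obtain tlv where "\<And>\<sigma>. LI DD \<sigma> \<Longrightarrow> rg \<sigma> 1 = DD ^ RR \<Longrightarrow> trp levels_com \<sigma> tlv 0 (fin \<sigma>)" by blast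
  then show ?thesis using tri_ssbp by blast
qed

text \<open>A sample above level 0 is bad if it misses a large window, so that some next interval
  could stay too long; if it is too large for the sorting budget; or if it gives some component too
  many thresholds for short binary searches.\<close>

definition bad :: "nat \<Rightarrow> (nat \<Rightarrow> nat) \<Rightarrow> (nat \<Rightarrow> nat) \<Rightarrow> nat set \<Rightarrow> bool" where
  "bad i lo hi S \<longleftrightarrow> (if i = 0 then \<not> {1..m} \<subseteq> S else
     (\<exists>x\<in>VV \<times> {..Suc m} \<times> {..Suc m}. DD * DD ^ i < card (win lo (fst x) (fst (snd x)) (snd (snd x))) \<and> S \<inter> win lo (fst x) (fst (snd x)) (snd (snd x)) = {}) \<or>
     2 * m div DD ^ i + DD + 1 \<le> card (S \<inter> {1..m}) \<or>
     (\<exists>v\<in>VV. 3 * (DD * DD) \<le> card (S \<inter> win lo v (rk (lo v)) (rk (hi v)))))"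

text \<open>The number of events in the union bound: windows given by a vertex and two ends among
  \<open>m + 2\<close> ranks, one event for the size of the sample, and one for each vertex.\<close>

definition EE :: real where "EE = real n * real (m + 2) ^ 2 + (1 + real n)"

text \<open>With \<open>q = DD ^ i\<close>, a component has at most \<open>DD * DD * q\<close>
  candidates and hence \<open>DD * DD\<close> expected thresholds. The limit
  \<open>3 * (DD * DD)\<close> leaves the room for twice the mean plus \<open>DD\<close> that
  \<open>markov_count\<close> asks for, and windows of more than \<open>DD * q\<close> edges are
  handled by \<open>hit_bound\<close>.\<close>

lemma expd_bad:
  assumes "sz_le lo hi (DD ^ (i + 2))"
  shows "expd (DD ^ i) 1 m (\<lambda>S. of_bool (bad i lo hi S)) {} \<le> EE * 2 powr (- real DD)"
proof (cases "i = 0")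
  case True
  then show ?thesis using expd_full by (simp add: bad_def EE_def)
next
  case False
  define q where "q = DD ^ i"
  define \<delta> where "\<delta> = 2 powr (- real DD)"
  have q1: "1 \<le> q" using DD_ge by (simp add: q_def)
  have d0: "0 \<le> \<delta>" by (simp add: \<delta>_def)
  have "VV \<subseteq> {..<n}" using VV_lt by auto
  then have "card VV \<le> n" using card_mono[of "{..<n}" VV] by simp
  then have V: "real (card VV) \<le> real n" by simp
  have 1: "expd q 1 m (\<lambda>S. of_bool (\<exists>x\<in>VV \<times> {..Suc m} \<times> {..Suc m}. DD * q < card (win lo (fst x) (fst (snd x)) (snd (snd x))) \<and>
       S \<inter> win lo (fst x) (fst (snd x)) (snd (snd x)) = {})) {} \<le> real (card (VV \<times> {..Suc m} \<times> {..Suc m})) * \<delta>"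
  proof (rule expd_union[OF q1])
    fix x
    define A where "A = win lo (fst x) (fst (snd x)) (snd (snd x))"
    show "expd q 1 m (\<lambda>S. of_bool (DD * q < card (win lo (fst x) (fst (snd x)) (snd (snd x))) \<and> S \<inter> win lo (fst x) (fst (snd x)) (snd (snd x)) = {})) {} \<le> \<delta>"
      unfolding A_def[symmetric]
    proof (cases "DD * q < card A")
      case True
      then show "expd q 1 m (\<lambda>S. of_bool (DD * q < card A \<and> S \<inter> A = {})) {} \<le> \<delta>"
        using hit_bound[OF q1 win_sub[of lo "fst x" "fst (snd x)" "snd (snd x)", folded A_def], of DD] by (simp add: \<delta>_def)
    qed (simp add: expd_0 d0)
  qed simp
  have "real (2 * m) / real q \<le> real (2 * m div q) + 1"
  proof -
    have "2 * m < (2 * m div q + 1) * q" using q1 dividend_less_times_div[of q "2 * m"] by (simp add: algebra_simps)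
    then have "real (2 * m) \<le> real ((2 * m div q + 1) * q)" by (simp only: of_nat_le_iff)
    then show ?thesis using q1 by (simp add: divide_le_eq)
  qed
  then have 2: "expd q 1 m (\<lambda>S. of_bool (2 * m div q + DD + 1 \<le> card (S \<inter> {1..m}))) {} \<le> \<delta>"
    unfolding \<delta>_def by (intro markov_count[OF q1]) simp_all
  have 3: "expd q 1 m (\<lambda>S. of_bool (\<exists>v\<in>VV. 3 * (DD * DD) \<le> card (S \<inter> win lo v (rk (lo v)) (rk (hi v))))) {} \<le> real (card VV) * \<delta>"
  proof (rule expd_union[OF q1])
    fix v assume v: "v \<in> VV"
    have "card (win lo v (rk (lo v)) (rk (hi v))) \<le> DD * DD * q" using assms v by (simp add: sz_le_def q_def power_add power2_eq_square mult_ac)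
    then have "real (card (win lo v (rk (lo v)) (rk (hi v)))) \<le> real DD * real DD * real q" by (simp only: of_nat_mult[symmetric] of_nat_le_iff)
    then have "real (card (win lo v (rk (lo v)) (rk (hi v)))) / real q \<le> real DD * real DD" using q1 by (simp add: divide_le_eq)
    moreover have "real DD * 1 \<le> real DD * real DD" using DD_ge by (intro mult_left_mono) auto
    ultimately show "expd q 1 m (\<lambda>S. of_bool (3 * (DD * DD) \<le> card (S \<inter> win lo v (rk (lo v)) (rk (hi v))))) {} \<le> \<delta>"
      unfolding \<delta>_def by (intro markov_count[OF q1 win_sub]) simp
  qed simp
  have "expd q 1 m (\<lambda>S. of_bool (bad i lo hi S)) {} \<le> real (card (VV \<times> {..Suc m} \<times> {..Suc m})) * \<delta> + (\<delta> + real (card VV) * \<delta>)"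
    using False order_trans[OF expd_or[OF q1] add_mono[OF 1 order_trans[OF expd_or[OF q1] add_mono[OF 2 3]]]]
    unfolding bad_def q_def[symmetric] by simp
  also have "\<dots> = (real (card VV) * real (m + 2) ^ 2 + (1 + real (card VV))) * \<delta>"
    by (simp add: card_cartesian_product power2_eq_square algebra_simps)
  also have "\<dots> \<le> EE * \<delta>" unfolding EE_def by (intro mult_right_mono add_mono V order_refl d0) simp_all
  finally show ?thesis by (simp add: q_def \<delta>_def)
qed

text \<open>The edges are distinct pairs of vertices, so there are no parallel edges; this keeps
  \<open>log m\<close> within a constant factor of \<open>log n\<close>.\<close>

lemma m_le: "m \<le> n * n"
proof -
  have "set es \<subseteq> {..<n} \<times> {..<n}"
  proof
    fix e assume "e \<in> set es"
    then obtain i where "i < m" "es ! i = e" by (auto simp: in_set_conv_nth m_def)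
    then show "e \<in> {..<n} \<times> {..<n}" using edge_lt[of "i + 1"] by (cases e) (auto simp: T_def H_def)
  qed
  then have "card (set es) \<le> card ({..<n} \<times> {..<n})" by (intro card_mono) auto
  moreover have "card (set es) = m" using inst unfolding ssbp_instance_def m_def by (metis distinct_card)
  ultimately show ?thesis by (simp add: card_cartesian_product)
qed

text \<open>For \<open>RR > 0\<close>, minimality of \<open>RR\<close> gives
  \<open>DD ^ (RR + 1) \<le> m \<le> n * n \<le> 2 ^ (2 * rr * rr)\<close>, and
  \<open>DD = 2 ^ rr\<close> allows the exponents to be compared.\<close>

lemma RR_le_rr: "RR + 1 \<le> 2 * rr"
proof (cases RR)
  case 0
  then show ?thesis using rr_props by simp
next
  case (Suc k)
  have e: "RR + 1 = k + 2" using Suc by simp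
  have "2 ^ (rr * (RR + 1)) = DD ^ (k + 2)" unfolding e DD_def by (simp only: power_mult)
  also have "\<dots> \<le> m" by (rule RR_min) (simp add: Suc)
  also have "\<dots> \<le> n * n" by (rule m_le)
  also have "\<dots> \<le> 2 ^ (rr * rr) * 2 ^ (rr * rr)" using rr_props(2) by (intro mult_mono) auto
  also have "\<dots> = 2 ^ (rr * (2 * rr))" by (simp add: power_add[symmetric] mult_2_right)
  finally have "rr * (RR + 1) \<le> rr * (2 * rr)" by (rule power_le_imp_le_exp[rotated]) simp
  then show ?thesis using rr_props(1) by simp
qed

definition szf :: "nat \<Rightarrow> nat" where "szf i = (if i = 0 then m else 2 * m div DD ^ i + DD)"

text \<open>The expected sizes decay geometrically and the deviations \<open>DD\<close> add up to at
  most \<open>RR * DD \<le> m\<close>. Hence sorting at all levels together costs no more, up to a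
  constant, than sorting \<open>m\<close> edges in small groups once.\<close>

lemma szf_sum: "(\<Sum>j\<le>RR. szf j) \<le> 4 * m"
proof -
  \<comment> \<open>The extra last term carries the geometric series through the induction, because
    every level at least halves it.\<close>
  have "(\<Sum>j\<le>R. szf j) + 2 * m div DD ^ R \<le> 3 * m + R * DD" for R
  proof (induction R)
    case 0
    show ?case by (simp add: szf_def)
  next
    case (Suc R)
    have "2 * m div DD ^ Suc R = (2 * m div DD ^ R) div DD" by (simp only: power_Suc2 div_mult2_eq)
    also have "\<dots> \<le> (2 * m div DD ^ R) div 2" by (rule div_le_mono2) (use DD_ge in auto)
    finally have "2 * (2 * m div DD ^ Suc R) \<le> 2 * m div DD ^ R" by linarith
    then show ?case using Suc.IH by (simp add: szf_def)
  qed
  from this[of RR] have "(\<Sum>j\<le>RR. szf j) \<le> 3 * m + RR * DD" by linarith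
  moreover have "RR * DD \<le> m"
  proof (cases RR)
    case (Suc k)
    have "RR < 2 ^ RR" by (rule less_exp)
    also have "\<dots> \<le> DD ^ RR" by (rule power_mono[OF DD_ge]) simp
    finally have "RR * DD \<le> DD ^ RR * DD" by simp
    also have "\<dots> = DD ^ (k + 2)" by (simp add: Suc)
    also have "\<dots> \<le> m" by (rule RR_min) (simp add: Suc)
    finally show ?thesis .
  qed simp
  ultimately show ?thesis by linarith
qed

lemma EE_nonneg: "0 \<le> EE" by (simp add: EE_def)

text \<open>\<open>\<Lambda>\<close> is chosen so that \<open>2 ^ \<Lambda> = 4 * (DD * DD)\<close>
  exceeds the number of thresholds of a component. There are \<open>RR + 1 \<le> 2 * rr\<close>
  levels, which gives both the factor in the failure bound and the term for the passes over all
  edges.\<close>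

lemma tri_ssbp_fast:
  assumes m1: "1 \<le> m"
  shows "trp ssbp_com start (5000 * (m * rr)) (ennreal (2 * real rr * (EE * 2 powr (- real DD)))) (ssbp_output_correct G es w s)"
proof -
  define \<Lambda> where "\<Lambda> = 2 * rr + 2"
  have L: "2 ^ \<Lambda> = 4 * (DD * DD)" by (simp add: \<Lambda>_def DD_def power_add mult_2)
  have DDp: "1 \<le> DD * DD" using mult_mono[of 1 DD 1 DD] DD_ge by simp
  define e where "e = EE * 2 powr (- real DD)"
  have e0: "0 \<le> e" using EE_nonneg by (simp add: e_def)
  define tlv where "tlv = (RR + 1) * (900 * m + 100) + (80 * \<Lambda> + 40) * (\<Sum>j\<le>RR. szf j) + (60 * \<Lambda> + 120) * (2 * m) + 12 * m + 30"
  have lev: "trp levels_com \<sigma> tlv (ennreal (\<Sum>j\<le>RR. e)) (fin \<sigma>)" if s: "LI DD \<sigma>" "rg \<sigma> 1 = DD ^ RR" for \<sigma>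
    unfolding tlv_def
  proof (rule tri_levels[where iv = "\<lambda>i lo hi. sz_le lo hi (DD ^ (i + 2))" and bb = bad and D = DD])
    fix i lo hi S v assume iv: "sz_le lo hi (DD ^ (i + 2))" and nb: "\<not> bad i lo hi S" and v: "v \<in> VV"
    have "card (keys S lo hi v) < 3 * (DD * DD)"
    proof (cases "i = 0")
      \<comment> \<open>At level 0 every edge is sampled, but by then the size invariant bounds the
        windows themselves by \<open>DD * DD\<close>.\<close>
      case True
      have "card (keys S lo hi v) \<le> card (win lo v (rk (lo v)) (rk (hi v)))" using card_keys_win[of S lo hi v] by (intro card_mono) auto
      also have "\<dots> \<le> DD * DD" using iv v True by (simp add: sz_le_def power2_eq_square)
      finally show ?thesis using DDp by linarith
    next
      case False
      have "card (keys S lo hi v) \<le> card (S \<inter> win lo v (rk (lo v)) (rk (hi v)))" using card_keys_win[of S lo hi v] by (intro card_mono) auto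
      also have "\<dots> < 3 * (DD * DD)" using nb False v unfolding bad_def by (metis not_le)
      finally show ?thesis .
    qed
    then show "card (keys S lo hi v) + 1 \<le> 2 ^ \<Lambda>" unfolding L by linarith
  next
    fix i lo hi S assume nb: "\<not> bad i lo hi S" and S: "S \<subseteq> {1..m}"
    have "S \<inter> {1..m} = S" using S by auto
    moreover have "card S \<le> m" using card_mono[OF _ S] by simp
    ultimately show "card S \<le> szf i" using nb unfolding bad_def szf_def by (auto simp: not_le)
  next
    fix i lo hi lo' hi' S assume g: "good lo hi" and nb: "\<not> bad (Suc i) lo hi S" and r: "refined S lo hi lo' hi'"
    show "sz_le lo' hi' (DD ^ (i + 2))"
    proof (rule sz_refined[OF g r])
      fix v a b assume "v \<in> VV" "a \<le> Suc m" "b \<le> Suc m" and c: "DD ^ (i + 2) < card (win lo v a b)"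
      then have "(v, a, b) \<in> VV \<times> {..Suc m} \<times> {..Suc m}" by simp
      moreover have "DD * DD ^ Suc i < card (win lo v a b)" using c by simp
      ultimately have "S \<inter> win lo v a b \<noteq> {}" using nb unfolding bad_def by (auto simp del: power_Suc)
      then show "win lo v a b \<inter> S \<noteq> {}" by (simp add: Int_commute)
    qed
  next
    show "expd (DD ^ i) 1 m (\<lambda>S. of_bool (bad i lo hi S)) {} \<le> e" if "sz_le lo hi (DD ^ (i + 2))" for i lo hi
      unfolding e_def by (rule expd_bad[OF that])
  next
    show "{1..m} \<subseteq> S" if "\<not> bad 0 lo hi S" for lo hi S using that by (simp add: bad_def)
  next
    have "card (win lo v a b) \<le> DD ^ (RR + 2)" for lo v a b
      using card_mono[OF _ win_sub[of lo v a b]] RR_props by simp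
    then show "sz_le (ar \<sigma> 4) (ar \<sigma> 5) (DD ^ (RR + 2))" by (simp add: sz_le_def)
  qed (use DD_ge e0 s in auto)
  have e: "ennreal (\<Sum>j\<le>RR. e) \<le> ennreal (2 * real rr * e)"
  proof (rule ennreal_leI)
    have "real (RR + 1) \<le> real (2 * rr)" using RR_le_rr by (simp only: of_nat_le_iff)
    then have "real (RR + 1) * e \<le> real (2 * rr) * e" by (rule mult_right_mono[OF _ e0])
    then show "(\<Sum>j\<le>RR. e) \<le> 2 * real rr * e" by (simp add: add.commute)
  qed
  have mr: "m \<le> m * rr" "rr \<le> m * rr" "1 \<le> m * rr" using m1 rr_props(1) mult_mono[OF m1 rr_props(1)] by auto
  have "(RR + 1) * (900 * m + 100) \<le> (2 * rr) * (1000 * m)" using RR_le_rr m1 by (intro mult_mono) auto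
  moreover have "(80 * \<Lambda> + 40) * (\<Sum>j\<le>RR. szf j) \<le> (80 * \<Lambda> + 40) * (4 * m)" by (rule mult_le_mono2[OF szf_sum])
  moreover have "(80 * \<Lambda> + 40) * (4 * m) = 640 * (m * rr) + 800 * m" "(60 * \<Lambda> + 120) * (2 * m) = 240 * (m * rr) + 480 * m"
    by (simp_all add: \<Lambda>_def algebra_simps)
  moreover have "(2 * rr) * (1000 * m) = 2000 * (m * rr)" by simp
  ultimately have "14 * rr + 10 * RR + 50 * m + tlv + 90 \<le> 5000 * (m * rr)"
    using mr RR_le_rr unfolding tlv_def by linarith
  then show ?thesis using tri_mono[OF tri_ssbp[OF lev] _ e] unfolding e_def by blast
qed

lemma rr_log:
  assumes n2: "2 \<le> n"
  shows "sqrt (log 2 (real n)) \<le> real rr" "real rr \<le> 2 * sqrt (log 2 (real n))"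
proof -
  define l where "l = log 2 (real n)"
  have l1: "1 \<le> l" using n2 by (simp add: l_def le_log_iff)
  have "real n \<le> 2 powr (real rr * real rr)"
    using rr_props(2) by (simp add: powr_realpow[symmetric] flip: of_nat_mult) (metis of_nat_le_iff of_nat_numeral of_nat_power powr_realpow zero_less_numeral)
  then have "l \<le> real rr * real rr" using n2 by (simp add: l_def log_le_iff)
  then show "sqrt (log 2 (real n)) \<le> real rr" unfolding l_def[symmetric] by (intro real_le_lsqrt) (auto simp: power2_eq_square)
  have s1: "1 \<le> sqrt l" using l1 by simp
  show "real rr \<le> 2 * sqrt (log 2 (real n))" unfolding l_def[symmetric]
  proof (cases "rr = 1")
    case True
    then have "real rr = 1" by simp
    then show "real rr \<le> 2 * sqrt l" using s1 by linarith
  next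
    case False
    then have "2 ^ ((rr - 1) * (rr - 1)) < n" using rr_min by simp
    then have "real (2 ^ ((rr - 1) * (rr - 1))) \<le> real n" by linarith
    then have "2 powr (real ((rr - 1) * (rr - 1))) \<le> real n" unfolding powr_realpow[OF zero_less_numeral] by simp
    then have "real ((rr - 1) * (rr - 1)) \<le> l" using n2 by (simp add: l_def le_log_iff)
    then have "real (rr - 1) \<le> sqrt l" by (intro real_le_rsqrt) (simp add: power2_eq_square)
    moreover have "real rr = real (rr - 1) + 1" using rr_props(1) by simp
    ultimately show "real rr \<le> 2 * sqrt l" using s1 by linarith
  qed
qed

text \<open>The 10 in the exponent pays for the polynomial factor: \<open>rr \<le> n\<close>,
  \<open>EE \<le> 5 * n ^ 5\<close> by \<open>m \<le> n * n\<close>, and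
  \<open>10 \<le> n ^ 4\<close>. The factor \<open>2 powr (- DD)\<close> becomes a power of
  \<open>n\<close> on division by \<open>log 2 n\<close>, using that \<open>DD\<close> is at least
  \<open>2 powr sqrt (log 2 n)\<close>.\<close>

lemma failure_bound:
  assumes n2: "2 \<le> n"
  shows "2 * real rr * (EE * 2 powr (- real DD)) \<le> real n powr (- (2 powr sqrt (log 2 (real n)) / log 2 (real n) - 10))"
proof -
  define x where "x = real n"
  have x2: "2 \<le> x" using n2 by (simp add: x_def)
  have "n \<le> 2 ^ n" by (rule less_imp_le[OF less_exp])
  also have "\<dots> \<le> 2 ^ (n * n)" by (rule power_increasing) (simp_all add: le_square)
  finally have "rr \<le> n" using n2 by (intro rr_le) auto
  then have r: "real rr \<le> x" by (simp add: x_def)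
  have p: "1 \<le> x ^ k" for k using x2 by (intro one_le_power) auto
  have s5: "x ^ 5 = x * x ^ 4" using power_Suc[of x 4] by simp
  have s6: "x ^ 6 = x * x ^ 5" using power_Suc[of x 5] by simp
  have x4: "4 \<le> x\<^sup>2" "16 \<le> x ^ 4" using power_mono[of 2 x 2] power_mono[of 2 x 4] x2 by auto
  have "real m \<le> real (n * n)" using m_le by (simp only: of_nat_le_iff)
  then have "real (m + 2) \<le> 2 * x\<^sup>2" using x4 by (simp add: x_def power2_eq_square)
  then have "real (m + 2) ^ 2 \<le> (2 * x\<^sup>2) ^ 2" by (intro power_mono) auto
  also have "\<dots> = 4 * x ^ 4" by (simp add: power_mult_distrib flip: power_mult)
  finally have "x * real (m + 2) ^ 2 \<le> x * (4 * x ^ 4)" using x2 by (intro mult_left_mono) auto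
  also have "\<dots> = 4 * x ^ 5" by (simp add: s5)
  finally have E1: "x * real (m + 2) ^ 2 \<le> 4 * x ^ 5" .
  have "1 + x \<le> 2 * x" using x2 by simp
  also have "\<dots> \<le> 16 * x" using x2 by simp
  also have "\<dots> \<le> x ^ 4 * x" using x4 x2 by (intro mult_right_mono) auto
  also have "\<dots> = x ^ 5" by (simp add: s5)
  finally have "EE \<le> 5 * x ^ 5" using E1 unfolding EE_def x_def[symmetric] by linarith
  then have "2 * real rr * EE \<le> (2 * x) * (5 * x ^ 5)" using r x2 EE_nonneg by (intro mult_mono) auto
  also have "\<dots> = 10 * x ^ 6" by (simp add: s6)
  also have "\<dots> \<le> x ^ 4 * x ^ 6" using x4 x2 by (intro mult_right_mono) auto
  also have "\<dots> = x powr 10" using x2 by (simp add: powr_numeral flip: power_add)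
  finally have A: "2 * real rr * EE \<le> x powr 10" .
  have "1 \<le> log 2 x" using x2 by (simp add: le_log_iff)
  then have l1: "log 2 x \<noteq> 0" by linarith
  have "2 powr sqrt (log 2 x) \<le> 2 powr real rr" using rr_log(1)[OF n2] by (simp add: x_def)
  also have "\<dots> = real DD" by (simp add: DD_def powr_realpow)
  finally have "2 powr (- real DD) \<le> 2 powr (- (2 powr sqrt (log 2 x)))" by simp
  also have "\<dots> = (2 powr log 2 x) powr (- (2 powr sqrt (log 2 x) / log 2 x))"
    unfolding powr_powr using l1 by simp
  also have "2 powr log 2 x = x" using x2 by simp
  finally have "2 * real rr * EE * 2 powr (- real DD) \<le> x powr 10 * x powr (- (2 powr sqrt (log 2 x) / log 2 x))"
    using A EE_nonneg by (intro mult_mono) auto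
  also have "\<dots> = x powr (- (2 powr sqrt (log 2 x) / log 2 x - 10))" by (simp add: powr_add[symmetric])
  finally show ?thesis by (simp add: x_def mult.assoc)
qed

lemma ssbp_com_sure:
  "(\<lambda>k. prob_halted ssbp_com 10 (ssbp_input G es w s) k) \<longlonglongrightarrow> 1 \<and>
     (\<forall>k. \<forall>x\<in>set_pmf (run ssbp_com 10 (ssbp_input G es w s) k). halted x \<longrightarrow> ssbp_output_correct G es w s (snd x))"
proof -
  obtain t where t: "tri 10 I ssbp_com start t 0 (ssbp_output_correct G es w s)" using tri_ssbp_sure by blast
  have "prob_halted ssbp_com 10 (ssbp_input G es w s) k = 1" if "t \<le> k" for k
    using tri_0_sure(2)[OF t that] by (simp add: prob_halted_def run_def I_def start_def)
  then have "(\<lambda>k. prob_halted ssbp_com 10 (ssbp_input G es w s) k) \<longlonglongrightarrow> 1"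
    by (intro tendsto_eventually) (auto simp: eventually_sequentially)
  then show ?thesis using tri_0_sure(1)[OF t] by (auto simp: run_def I_def start_def)
qed

text \<open>The constant 10000 is 5000 times the factor 2 between \<open>rr\<close> and
  \<open>sqrt (log 2 n)\<close>.\<close>

lemma ssbp_com_fast:
  assumes "2 \<le> n" "1 \<le> m"
  shows "1 - real n powr (- (2 powr sqrt (log 2 (real n)) / log 2 (real n) - 10)) \<le>
    prob_halted ssbp_com 10 (ssbp_input G es w s) (nat \<lfloor>10000 * real m * sqrt (log 2 (real n))\<rfloor>)"
proof -
  have "real (5000 * (m * rr)) = 5000 * real m * real rr" by simp
  also have "\<dots> \<le> 5000 * real m * (2 * sqrt (log 2 (real n)))" using rr_log(2)[OF assms(1)] by (intro mult_left_mono) auto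
  finally have "5000 * (m * rr) \<le> nat \<lfloor>10000 * real m * sqrt (log 2 (real n))\<rfloor>" by (intro le_nat_floor) simp
  from tri_prob[OF tri_ssbp_fast[OF assms(2)] this]
  have "1 - 2 * real rr * (EE * 2 powr (- real DD)) \<le> prob_halted ssbp_com 10 (ssbp_input G es w s) (nat \<lfloor>10000 * real m * sqrt (log 2 (real n))\<rfloor>)"
    using EE_nonneg by (simp add: prob_halted_def run_def I_def start_def)
  then show ?thesis using failure_bound[OF assms(1)] by linarith
qed

end

theorem theorem3:
  shows "\<exists>(prog :: com) (\<kappa> :: nat) (C :: real) (f :: nat \<Rightarrow> real).
    \<kappa> \<ge> 1 \<and> C > 0 \<and> filterlim f at_top sequentially \<and>
    solves_ssbp prog \<kappa> \<and>
    (\<forall>(G :: nat pair_pre_digraph) es (w :: nat \<times> nat \<Rightarrow> real) s n m.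
       ssbp_instance G es s \<and> n = card (pverts G) \<and> m = card (parcs G) \<and> n \<ge> 2 \<and> m \<ge> 1 \<longrightarrow>
       prob_halted prog \<kappa> (ssbp_input G es w s) (nat \<lfloor>C * real m * sqrt (log 2 (real n))\<rfloor>)
         \<ge> 1 - real n powr (- f n))"
proof (intro exI conjI)
  show "(10 :: nat) \<ge> 1" "(10000 :: real) > 0" by simp_all
  \<comment> \<open>With \<open>l = log 2 n\<close>, the function \<open>2 powr sqrt l\<close>
    outgrows \<open>l\<close>, so the exponent is unbounded; this is the superpolynomially small
    failure probability.\<close>
  show "filterlim (\<lambda>n. 2 powr sqrt (log 2 (real n)) / log 2 (real n) - 10) at_top sequentially"
    by real_asymp
  show "solves_ssbp ssbp_com 10"
    unfolding solves_ssbp_def using inst.ssbp_com_sure[OF inst.intro] by blast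
  show "\<forall>(G :: nat pair_pre_digraph) es (w :: nat \<times> nat \<Rightarrow> real) s n m.
       ssbp_instance G es s \<and> n = card (pverts G) \<and> m = card (parcs G) \<and> n \<ge> 2 \<and> m \<ge> 1 \<longrightarrow>
       prob_halted ssbp_com 10 (ssbp_input G es w s) (nat \<lfloor>10000 * real m * sqrt (log 2 (real n))\<rfloor>)
         \<ge> 1 - real n powr (- (2 powr sqrt (log 2 (real n)) / log 2 (real n) - 10))"
  proof (intro allI impI, elim conjE)
    fix G :: "nat pair_pre_digraph" and es and w :: "nat \<times> nat \<Rightarrow> real" and s n m
    assume i: "ssbp_instance G es s" and nm: "n = card (pverts G)" "m = card (parcs G)" "n \<ge> 2" "m \<ge> 1"
    interpret inst G es w s by (rule inst.intro[OF i])
    have "length es = card (parcs G)" using i unfolding ssbp_instance_def by (metis distinct_card)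
    then show "prob_halted ssbp_com 10 (ssbp_input G es w s) (nat \<lfloor>10000 * real m * sqrt (log 2 (real n))\<rfloor>)
         \<ge> 1 - real n powr (- (2 powr sqrt (log 2 (real n)) / log 2 (real n) - 10))"
      using ssbp_com_fast nm by (simp add: n_def m_def)
  qed
qed

end
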